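(* Let $\Bbbk$ be a unital commutative ring in which $2$ and $3$ are units, and let $f\colon(L,d,\lambda)\to(L',d',\lambda')$ be a weak morphism of weak Lie 3-algebras over $\Bbbk$. The following components define a morphism of (semi-strict) Lie 3-algebras $\bar f\colon(L,d,\bar\lambda)\to(L',d',\bar\lambda')$ between the skew-symmetrizations: $$\bar f_1=f_1,\qquad\bar f_2=\tfrac12\sum_{\sigma\in\mathbb{S}_2}(-1)^{|\sigma|}f_2^\sigma,$$ $$\bar f_3=\tfrac16\sum_{\sigma\in\mathbb{S}_3}(-1)^{|\sigma|}f_3^\sigma-\tfrac1{24}\sum_{\sigma\in\mathbb{S}_3}(-1)^{|\sigma|}\big(f_{2;1}\circ_1\lambda_2+f_{2;1}\circ_2\lambda_2-\lambda'_{2;1}\circ(f_2,f_1)-\lambda'_{2;1}\circ(f_1,f_2)\big)^\sigma.$$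
   Context: Conventions. Complexes are complexes of $\Bbbk$-modules with differential of degree $-1$; the Koszul sign rule is used. A 3-term complex is $(L,d)=L_0\xleftarrow{d}L_1\xleftarrow{d}L_2$, concentrated in degrees $0,1,2$. A map $L^{\otimes n}\to L'[k]$ means a $\Bbbk$-linear map raising degree by $k$. For a multilinear map $\mu$: $\mu^\sigma(v_1,\dots,v_n)=\varepsilon\,\mu(v_{\sigma^{-1}(1)},\dots,v_{\sigma^{-1}(n)})$ with $\varepsilon$ the Koszul sign ($(123)$ means $1\mapsto2\mapsto3\mapsto1$); $\partial(\mu)=d\circ\mu-(-1)^{|\mu|}\mu\circ d_{L^{\otimes n}}$; $(\mu\circ_i\nu)(v_1,\dots,v_{n+k-1})=(-1)^{|\nu|(|v_1|+\dots+|v_{i-1}|)}\mu(v_1,\dots,v_{i-1},\nu(v_i,\dots,v_{i+k-1}),v_{i+k},\dots)$ for $\nu$ of arity $k$; $\mu\circ(\nu_1,\dots,\nu_m)=\mu\circ(\nu_1\otimes\dots\otimes\nu_m)$ and $\mu\circ(\nu_1,\dots,\nu_m)^\sigma=(\mu\circ(\nu_1,\dots,\nu_m))^\sigma$. Leibniz 3-algebra. A 3-term complex $(L,d)$ with maps $\lambda_2\colon L^{\otimes2}\to L$, $\lambda_3\colon L^{\otimes3}\to L[1]$, $\lambda_4\colon L^{\otimes4}\to L[2]$ such that $\partial(\lambda_2)=0$; $\partial(\lambda_3)=\lambda_2\circ_2\lambda_2-\lambda_2\circ_1\lambda_2-(\lambda_2\circ_2\lambda_2)^{(12)}$; $\partial(\lambda_4)=\lambda_2\circ_1\lambda_3+\lambda_2\circ_2\lambda_3-(\lambda_2\circ_2\lambda_3)^{(12)}+(\lambda_2\circ_2\lambda_3)^{(123)}-\lambda_3\circ_1\lambda_2+\lambda_3\circ_2\lambda_2-(\lambda_3\circ_2\lambda_2)^{(12)}-\lambda_3\circ_3\lambda_2+(\lambda_3\circ_3\lambda_2)^{(23)}-(\lambda_3\circ_3\lambda_2)^{(132)}$;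 $0=\lambda_2\circ_1\lambda_4-\lambda_2\circ_2\lambda_4+(\lambda_2\circ_2\lambda_4)^{(12)}-(\lambda_2\circ_2\lambda_4)^{(123)}+(\lambda_2\circ_2\lambda_4)^{(1234)}+\lambda_3\circ_1\lambda_3+\lambda_3\circ_2\lambda_3-(\lambda_3\circ_2\lambda_3)^{(12)}+(\lambda_3\circ_2\lambda_3)^{(123)}+\lambda_3\circ_3\lambda_3-(\lambda_3\circ_3\lambda_3)^{(23)}+(\lambda_3\circ_3\lambda_3)^{(132)}+(\lambda_3\circ_3\lambda_3)^{(234)}-(\lambda_3\circ_3\lambda_3)^{(1342)}+(\lambda_3\circ_3\lambda_3)^{(13)(24)}+\lambda_4\circ_1\lambda_2-\lambda_4\circ_2\lambda_2+(\lambda_4\circ_2\lambda_2)^{(12)}+\lambda_4\circ_3\lambda_2-(\lambda_4\circ_3\lambda_2)^{(23)}+(\lambda_4\circ_3\lambda_2)^{(132)}-\lambda_4\circ_4\lambda_2+(\lambda_4\circ_4\lambda_2)^{(34)}-(\lambda_4\circ_4\lambda_2)^{(243)}+(\lambda_4\circ_4\lambda_2)^{(1432)}$. Weak Lie 3-algebra $(L,d,\lambda)$. A Leibniz 3-algebra together with maps $\lambda_{2;1}\colon L^{\otimes2}\to L[1]$, $\lambda_{2;1,1}\colon L^{\otimes2}\to L[2]$, $\lambda_{3;1},\lambda_{3;2}\colon L^{\otimes3}\to L[2]$ such that $\partial(\lambda_{2;1})=\lambda_2+\lambda_2^{(12)}$; $\partial(\lambda_{2;1,1})=\lambda_{2;1}-\lambda_{2;1}^{(12)}$;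 $\partial(\lambda_{3;1})=\lambda_3+\lambda_3^{(12)}+\lambda_2\circ_1\lambda_{2;1}$; $\partial(\lambda_{3;2})=\lambda_3+\lambda_3^{(23)}-\lambda_2\circ_2\lambda_{2;1}+\lambda_{2;1}\circ_1\lambda_2+(\lambda_{2;1}\circ_2\lambda_2)^{(12)}$; $\lambda_{2;1,1}+\lambda_{2;1,1}^{(12)}=0$; $\lambda_{3;1}-\lambda_{3;1}^{(12)}=\lambda_2\circ_1\lambda_{2;1,1}$; $\lambda_{3;1}-\lambda_{3;2}^{(12)}+\lambda_{3;1}^{(132)}-\lambda_{3;2}+\lambda_{3;1}^{(23)}-\lambda_{3;2}^{(123)}=\lambda_{2;1}\circ_2\lambda_{2;1}+\lambda_{2;1}\circ_1\lambda_{2;1}+(\lambda_{2;1}\circ_2\lambda_{2;1})^{(12)}+(\lambda_{2;1,1}\circ_2\lambda_2)^{(132)}$; $\lambda_{3;2}-\lambda_{3;2}^{(23)}=-\lambda_2\circ_2\lambda_{2;1,1}+\lambda_{2;1,1}\circ_1\lambda_2+(\lambda_{2;1,1}\circ_2\lambda_2)^{(12)}$; $\lambda_4+\lambda_4^{(12)}=\lambda_2\circ_1\lambda_{3;1}-\lambda_{3;1}\circ_3\lambda_2+(\lambda_2\circ_2\lambda_{3;1})^{(123)}+\lambda_3\circ_1\lambda_{2;1}$; $\lambda_4+\lambda_4^{(23)}=\lambda_2\circ_1\lambda_{3;2}-\lambda_3\circ_2\lambda_{2;1}+\lambda_2\circ_2\lambda_{3;1}-\lambda_{3;1}\circ_1\lambda_2-(\lambda_{3;1}\circ_2\lambda_2)^{(12)}-(\lambda_{3;1}\circ_3\lambda_2)^{(132)}$;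 $\lambda_4+\lambda_4^{(34)}=\lambda_{2;1}\circ_1\lambda_3-\lambda_{3;2}\circ_1\lambda_2+\lambda_{3;2}\circ_2\lambda_2-(\lambda_{3;2}\circ_2\lambda_2)^{(12)}+\lambda_3\circ_3\lambda_{2;1}+(\lambda_{3;2}\circ_3\lambda_2)^{(23)}-(\lambda_{3;2}\circ_3\lambda_2)^{(132)}+\lambda_2\circ_2\lambda_{3;2}-(\lambda_2\circ_2\lambda_{3;2})^{(12)}+(\lambda_{2;1}\circ_2\lambda_3)^{(123)}$. Weak morphism of weak Lie 3-algebras $f\colon(L,d,\lambda)\to(L',d',\lambda')$. Maps $f_1\colon L\to L'$, $f_2\colon L^{\otimes2}\to L'[1]$, $f_{2;1}\colon L^{\otimes2}\to L'[2]$, $f_3\colon L^{\otimes3}\to L'[2]$ satisfying the following; $(f_1,f_2,f_3)$ satisfying the first four is a morphism of Leibniz 3-algebras: $\partial(f_1)=0$; $\partial(f_2)=f_1\circ\lambda_2-\lambda_2'\circ(f_1,f_1)$; $\partial(f_3)=f_1\circ\lambda_3-f_2\circ_2\lambda_2+f_2\circ_1\lambda_2+(f_2\circ_2\lambda_2)^{(12)}-\lambda_3'\circ(f_1,f_1,f_1)-\lambda_2'\circ(f_1,f_2)+\lambda_2'\circ(f_2,f_1)+\lambda_2'\circ(f_1,f_2)^{(12)}$; $f_1\circ\lambda_4-\lambda_4'\circ(f_1,f_1,f_1,f_1)=f_2\circ_1\lambda_3+f_2\circ_2\lambda_3-(f_2\circ_2\lambda_3)^{(12)}+(f_2\circ_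2\lambda_3)^{(123)}-f_3\circ_1\lambda_2+f_3\circ_2\lambda_2-(f_3\circ_2\lambda_2)^{(12)}-f_3\circ_3\lambda_2+(f_3\circ_3\lambda_2)^{(23)}-(f_3\circ_3\lambda_2)^{(132)}+\lambda_2'\circ(f_3,f_1)+\lambda_2'\circ(f_1,f_3)-\lambda_2'\circ(f_1,f_3)^{(12)}+\lambda_2'\circ(f_1,f_3)^{(123)}-\lambda_2'\circ(f_2,f_2)+\lambda_2'\circ(f_2,f_2)^{(23)}-\lambda_2'\circ(f_2,f_2)^{(132)}+\lambda_3'\circ(f_2,f_1,f_1)-\lambda_3'\circ(f_1,f_2,f_1)+\lambda_3'\circ(f_1,f_2,f_1)^{(12)}+\lambda_3'\circ(f_1,f_1,f_2)-\lambda_3'\circ(f_1,f_1,f_2)^{(23)}+\lambda_3'\circ(f_1,f_1,f_2)^{(132)}$; $\partial(f_{2;1})=-f_2-f_2^{(12)}+f_1\circ\lambda_{2;1}-\lambda_{2;1}'\circ(f_1,f_1)$; $f_1\circ\lambda_{2;1,1}-\lambda_{2;1,1}'\circ(f_1,f_1)=f_{2;1}-f_{2;1}^{(12)}$; $f_1\circ\lambda_{3;1}-\lambda_{3;1}'\circ(f_1,f_1,f_1)=f_3+f_3^{(12)}+f_2\circ_1\lambda_{2;1}+\lambda_2'\circ(f_{2;1},f_1)$; $f_1\circ\lambda_{3;2}-\lambda_{3;2}'\circ(f_1,f_1,f_1)=f_3+f_3^{(23)}-f_2\circ_2\lambda_{2;1}+f_{2;1}\circ_1\lambda_2+(f_{2;1}\circ_2\lambda_2)^{(12)}-\lambda_2'\circ(f_1,f_{2;1})-\lambda_{2;1}'\circ(f_2,f_1)-\lambda_{2;1}'\circ(f_1,f_2)^{(12)}$.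 Lie 3-algebras. A (semi-strict) Lie 3-algebra (3-term $L_\infty$-algebra) is a Leibniz 3-algebra whose structure maps are skew-symmetric, $\bar\lambda_n^\sigma=(-1)^{|\sigma|}\bar\lambda_n$. A morphism of Lie 3-algebras is a morphism of the Leibniz 3-algebras all of whose components are skew-symmetric. Skew-symmetrization. The skew-symmetrization of a weak Lie 3-algebra $(L,d,\lambda)$ is the Lie 3-algebra $(L,d,\bar\lambda)$ with $\bar\lambda_2=\frac12\sum_{\sigma\in\mathbb{S}_2}(-1)^{|\sigma|}\lambda_2^\sigma$; $\bar\lambda_3=\frac16\sum_{\sigma\in\mathbb{S}_3}(-1)^{|\sigma|}\lambda_3^\sigma-\frac1{24}\sum_{\sigma\in\mathbb{S}_3}(-1)^{|\sigma|}(\lambda_{2;1}\circ_1\lambda_2+\lambda_{2;1}\circ_2\lambda_2)^\sigma$; $\bar\lambda_4=\frac1{24}\sum_{\sigma\in\mathbb{S}_4}(-1)^{|\sigma|}\lambda_4^\sigma+\frac1{48}\sum_{\sigma\in\mathbb{S}_4}(-1)^{|\sigma|}(\lambda_{2;1}\circ_1\lambda_3-\lambda_{3;1}\circ_1\lambda_2+\lambda_{3;2}\circ_2\lambda_2-\lambda_{2;1}\circ_2\lambda_3-\lambda_{3;1}\circ_2\lambda_2+\lambda_{3;2}\circ_3\lambda_2)^\sigma$. *)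

theory Defs
  imports Complex_Main "HOL-Combinatorics.Cycles"
begin

section \<open>Multilinear maps of graded modules\<close>

text \<open>
  A homogeneous element is a pair (degree, vector); the tag makes the Koszul signs meaningful also
  for the vector 0. A map \<open>L\<^sup>\<otimes>\<^sup>n \<rightarrow> L'[k]\<close> is given by its values on lists of homogeneous
  elements, i.e. by a family of multilinear maps
  \<open>L p\<^sub>1 \<times> \<dots> \<times> L p\<^sub>n \<rightarrow> L' (p\<^sub>1 + \<dots> + p\<^sub>n + k)\<close>,
  together with \<open>n\<close> and \<open>k\<close>. Its values outside the homogeneous lists of length \<open>n\<close> are irrelevant.
\<close>

datatype ('v, 'w) gmap = GMap (arity: nat) (gdeg: int) (app: "(int \<times> 'v) list \<Rightarrow> 'w")

definition sgn_pow :: "int \<Rightarrow> 'w \<Rightarrow> 'w::ab_group_add" \<comment> \<open>multiplication by \<open>(-1)\<^sup>k\<close>\<close>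
  where "sgn_pow k w = (if even k then w else - w)"

definition tdeg :: "(int \<times> 'v) list \<Rightarrow> int"
  where "tdeg vs = sum_list (map fst vs)"

definition value_of :: "('v, 'w) gmap \<Rightarrow> (int \<times> 'v) list \<Rightarrow> int \<times> 'w"
  where "value_of \<mu> vs = (gdeg \<mu> + tdeg vs, app \<mu> vs)"

text \<open>
  Addition, subtraction and negation are only used for maps of equal arity and degree.
\<close>

instantiation gmap :: (type, plus) plus
begin
definition "\<mu> + \<nu> = GMap (arity \<mu>) (gdeg \<mu>) (\<lambda>vs. app \<mu> vs + app \<nu> vs)"
instance ..
end

instantiation gmap :: (type, minus) minus
begin
definition "\<mu> - \<nu> = GMap (arity \<mu>) (gdeg \<mu>) (\<lambda>vs. app \<mu> vs - app \<nu> vs)"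
instance ..
end

instantiation gmap :: (type, uminus) uminus
begin
definition "- \<mu> = GMap (arity \<mu>) (gdeg \<mu>) (\<lambda>vs. - app \<mu> vs)"
instance ..
end

definition zero_map :: "nat \<Rightarrow> int \<Rightarrow> ('v, 'w::zero) gmap"
  where "zero_map n k = GMap n k (\<lambda>vs. 0)"

definition circ :: "('v, 'w::ab_group_add) gmap \<Rightarrow> nat \<Rightarrow> ('v, 'v) gmap \<Rightarrow> ('v, 'w) gmap"
    ("_ \<circ>\<^bsub>_\<^esub> _" [85, 0, 86] 85)
  where "\<mu> \<circ>\<^bsub>i\<^esub> \<nu> = GMap (arity \<mu> + arity \<nu> - 1) (gdeg \<mu> + gdeg \<nu>)
    (\<lambda>vs. sgn_pow (gdeg \<nu> * tdeg (take (i - 1) vs))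
       (app \<mu> (take (i - 1) vs
          @ [value_of \<nu> (take (arity \<nu>) (drop (i - 1) vs))]
          @ drop (i - 1 + arity \<nu>) vs)))"

fun block_values :: "('v, 'w) gmap list \<Rightarrow> (int \<times> 'v) list \<Rightarrow> (int \<times> 'w) list" where
  "block_values [] vs = []"
| "block_values (\<nu> # \<nu>s) vs =
     value_of \<nu> (take (arity \<nu>) vs) # block_values \<nu>s (drop (arity \<nu>) vs)"

text \<open>
  Exponent of the sign in \<open>(\<nu>\<^sub>1 \<otimes> \<dots> \<otimes> \<nu>\<^sub>m) (w\<^sub>1 \<otimes> \<dots> \<otimes> w\<^sub>m) = \<plusminus> \<nu>\<^sub>1 w\<^sub>1 \<otimes> \<dots> \<otimes> \<nu>\<^sub>m w\<^sub>m\<close>: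
  each block \<open>w\<^sub>j\<close> is passed by all \<open>\<nu>\<^sub>i\<close> with \<open>i > j\<close>.
\<close>

fun tensor_exponent :: "('v, 'w) gmap list \<Rightarrow> (int \<times> 'v) list \<Rightarrow> int" where
  "tensor_exponent [] vs = 0"
| "tensor_exponent (\<nu> # \<nu>s) vs =
     sum_list (map gdeg \<nu>s) * tdeg (take (arity \<nu>) vs) + tensor_exponent \<nu>s (drop (arity \<nu>) vs)"

definition tensor_comp :: "('w, 'u::ab_group_add) gmap \<Rightarrow> ('v, 'w) gmap list \<Rightarrow> ('v, 'u) gmap"
    (infixl "\<circ>\<^sub>\<otimes>" 85)
  where "\<mu> \<circ>\<^sub>\<otimes> \<nu>s = GMap (sum_list (map arity \<nu>s)) (gdeg \<mu> + sum_list (map gdeg \<nu>s))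
    (\<lambda>vs. sgn_pow (tensor_exponent \<nu>s vs) (app \<mu> (block_values \<nu>s vs)))"

text \<open>
  Permutations act on the positions \<open>1, \<dots>, n\<close>, whereas list indices start at 0. The Koszul sign of
  \<open>v\<^sub>1, \<dots>, v\<^sub>n \<mapsto> v\<^bsub>\<sigma>\<^sup>-\<^sup>1(1)\<^esub>, \<dots>, v\<^bsub>\<sigma>\<^sup>-\<^sup>1(n)\<^esub>\<close> collects the pairs \<open>i < j\<close> with \<open>\<sigma> i > \<sigma> j\<close>, whose entries
  are interchanged.
\<close>

definition koszul_exponent :: "(nat \<Rightarrow> nat) \<Rightarrow> (int \<times> 'v) list \<Rightarrow> int"
  where "koszul_exponent \<sigma> vs =
    (\<Sum>(i, j) \<in> {(i, j). 1 \<le> i \<and> i < j \<and> j \<le> length vs \<and> \<sigma> i > \<sigma> j}.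
       fst (vs ! (i - 1)) * fst (vs ! (j - 1)))"

definition perm_act :: "('v, 'w::ab_group_add) gmap \<Rightarrow> (nat \<Rightarrow> nat) \<Rightarrow> ('v, 'w) gmap"
    ("_\<^bsup>_\<^esup>" [1000, 0] 1000)
  where "\<mu>\<^bsup>\<sigma>\<^esup> = GMap (arity \<mu>) (gdeg \<mu>)
    (\<lambda>vs. sgn_pow (koszul_exponent \<sigma> vs)
       (app \<mu> (map (\<lambda>i. vs ! (inv \<sigma> i - 1)) [1..<Suc (length vs)])))"

abbreviation cyc :: "nat list \<Rightarrow> nat \<Rightarrow> nat"
  where "cyc \<equiv> cycle_of_list"

lemma "cyc [1, 2, 3] 1 = 2" "cyc [1, 2, 3] 2 = 3" "cyc [1, 2, 3] 3 = 1"
  by (simp_all add: transpose_def)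

definition skew_sum :: "('v, 'w::ab_group_add) gmap \<Rightarrow> ('v, 'w) gmap"
  where "skew_sum \<mu> = GMap (arity \<mu>) (gdeg \<mu>)
    (\<lambda>vs. \<Sum>\<sigma> | \<sigma> permutes {1..arity \<mu>}.
       if evenperm \<sigma> then app (\<mu>\<^bsup>\<sigma>\<^esup>) vs else - app (\<mu>\<^bsup>\<sigma>\<^esup>) vs)"

text \<open>The inverse of a unit; unspecified for non-units.\<close>

definition unit_inv :: "'k::comm_ring_1 \<Rightarrow> 'k"
  where "unit_inv c = (THE b. c * b = 1)"


section \<open>Complexes\<close>

text \<open>
  The homogeneous components of a complex are submodules of one ambient module with scalar
  multiplication \<open>scal\<close>. No relation between components of different degree is required, so the
  complex is their external direct sum.
\<close>

record ('k, 'v) cplx =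
  scal :: "'k \<Rightarrow> 'v \<Rightarrow> 'v"
  comp :: "int \<Rightarrow> 'v set"
  diff :: "('v, 'v) gmap"

definition homogeneous :: "('k, 'v, 'a) cplx_scheme \<Rightarrow> (int \<times> 'v) list \<Rightarrow> bool"
  where "homogeneous L vs \<longleftrightarrow> (\<forall>(p, v) \<in> set vs. v \<in> comp L p)"

definition map_eq :: "('k, 'v, 'a) cplx_scheme \<Rightarrow> ('v, 'w) gmap \<Rightarrow> ('v, 'w) gmap \<Rightarrow> bool"
  where "map_eq L \<mu> \<nu> \<longleftrightarrow> arity \<mu> = arity \<nu> \<and> gdeg \<mu> = gdeg \<nu> \<and>
    (\<forall>vs. length vs = arity \<mu> \<longrightarrow> homogeneous L vs \<longrightarrow> app \<mu> vs = app \<nu> vs)"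

definition graded_map :: "('k, 'v::plus, 'a) cplx_scheme \<Rightarrow> ('k, 'w::plus, 'b) cplx_scheme \<Rightarrow>
    nat \<Rightarrow> int \<Rightarrow> ('v, 'w) gmap \<Rightarrow> bool"
  where "graded_map L L' n k \<mu> \<longleftrightarrow> arity \<mu> = n \<and> gdeg \<mu> = k \<and>
    (\<forall>vs. length vs = n \<longrightarrow> homogeneous L vs \<longrightarrow> app \<mu> vs \<in> comp L' (tdeg vs + k)) \<and>
    (\<forall>us ws p x y. length us + 1 + length ws = n \<longrightarrow> homogeneous L us \<longrightarrow> homogeneous L ws \<longrightarrow>
       x \<in> comp L p \<longrightarrow> y \<in> comp L p \<longrightarrow>
       app \<mu> (us @ (p, x + y) # ws) = app \<mu> (us @ (p, x) # ws) + app \<mu> (us @ (p, y) # ws)) \<and>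
    (\<forall>us ws p c x. length us + 1 + length ws = n \<longrightarrow> homogeneous L us \<longrightarrow> homogeneous L ws \<longrightarrow>
       x \<in> comp L p \<longrightarrow>
       app \<mu> (us @ (p, scal L c x) # ws) = scal L' c (app \<mu> (us @ (p, x) # ws)))"

definition smult_map :: "('k, 'w, 'b) cplx_scheme \<Rightarrow> 'k \<Rightarrow> ('v, 'w) gmap \<Rightarrow> ('v, 'w) gmap"
  where "smult_map L' c \<mu> = GMap (arity \<mu>) (gdeg \<mu>) (\<lambda>vs. scal L' c (app \<mu> vs))"

definition three_term_complex :: "('k::comm_ring_1, 'v::ab_group_add, 'a) cplx_scheme \<Rightarrow> bool"
  where "three_term_complex L \<longleftrightarrow>
    module (scal L) \<and> (\<forall>p. module.subspace (scal L) (comp L p)) \<and>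
    (\<forall>p. p \<notin> {0, 1, 2} \<longrightarrow> comp L p = {0}) \<and>
    graded_map L L 1 (-1) (diff L) \<and> map_eq L (diff L \<circ>\<^bsub>1\<^esub> diff L) (zero_map 1 (-2))"

text \<open>\<open>\<partial> \<mu> = d \<circ> \<mu> - (-1)\<^sup>|\<^sup>\<mu>\<^sup>| \<mu> \<circ> d\<close>, the differential of the source being
  \<open>\<Sum>\<^sub>i id \<otimes> \<dots> \<otimes> d \<otimes> \<dots> \<otimes> id\<close>.\<close>

definition bdry :: "('k, 'v, 'a) cplx_scheme \<Rightarrow> ('k, 'w::ab_group_add, 'b) cplx_scheme \<Rightarrow>
    ('v, 'w) gmap \<Rightarrow> ('v, 'w) gmap"
  where "bdry L L' \<mu> = GMap (arity \<mu>) (gdeg \<mu> - 1)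
    (\<lambda>vs. app (diff L' \<circ>\<^sub>\<otimes> [\<mu>]) vs
       - sgn_pow (gdeg \<mu>) (\<Sum>i = 1..arity \<mu>. app (\<mu> \<circ>\<^bsub>i\<^esub> diff L) vs))"


section \<open>Leibniz, Lie and weak Lie 3-algebras\<close>

record ('k, 'v) leibniz3 = "('k, 'v) cplx" +
  lam2 :: "('v, 'v) gmap"
  lam3 :: "('v, 'v) gmap"
  lam4 :: "('v, 'v) gmap"

record ('k, 'v) weak_lie3 = "('k, 'v) leibniz3" +
  lam21 :: "('v, 'v) gmap"
  lam211 :: "('v, 'v) gmap"
  lam31 :: "('v, 'v) gmap"
  lam32 :: "('v, 'v) gmap"

definition leibniz3_algebra :: "('k::comm_ring_1, 'v::ab_group_add, 'a) leibniz3_scheme \<Rightarrow> bool"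
  where "leibniz3_algebra L \<longleftrightarrow>
    (let l2 = lam2 L; l3 = lam3 L; l4 = lam4 L in
     three_term_complex L \<and>
     graded_map L L 2 0 l2 \<and> graded_map L L 3 1 l3 \<and> graded_map L L 4 2 l4 \<and>
     map_eq L (bdry L L l2) (zero_map 2 (-1)) \<and>
     map_eq L (bdry L L l3)
       (l2 \<circ>\<^bsub>2\<^esub> l2 - l2 \<circ>\<^bsub>1\<^esub> l2 - (l2 \<circ>\<^bsub>2\<^esub> l2)\<^bsup>cyc [1,2]\<^esup>) \<and>
     map_eq L (bdry L L l4)
       (l2 \<circ>\<^bsub>1\<^esub> l3 + l2 \<circ>\<^bsub>2\<^esub> l3 - (l2 \<circ>\<^bsub>2\<^esub> l3)\<^bsup>cyc [1,2]\<^esup> + (l2 \<circ>\<^bsub>2\<^esub> l3)\<^bsup>cyc [1,2,3]\<^esup>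
        - l3 \<circ>\<^bsub>1\<^esub> l2 + l3 \<circ>\<^bsub>2\<^esub> l2 - (l3 \<circ>\<^bsub>2\<^esub> l2)\<^bsup>cyc [1,2]\<^esup>
        - l3 \<circ>\<^bsub>3\<^esub> l2 + (l3 \<circ>\<^bsub>3\<^esub> l2)\<^bsup>cyc [2,3]\<^esup> - (l3 \<circ>\<^bsub>3\<^esub> l2)\<^bsup>cyc [1,3,2]\<^esup>) \<and>
     map_eq L (zero_map 5 2)
       (l2 \<circ>\<^bsub>1\<^esub> l4 - l2 \<circ>\<^bsub>2\<^esub> l4 + (l2 \<circ>\<^bsub>2\<^esub> l4)\<^bsup>cyc [1,2]\<^esup> - (l2 \<circ>\<^bsub>2\<^esub> l4)\<^bsup>cyc [1,2,3]\<^esup> + (l2 \<circ>\<^bsub>2\<^esub> l4)\<^bsup>cyc [1,2,3,4]\<^esup>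
        + l3 \<circ>\<^bsub>1\<^esub> l3 + l3 \<circ>\<^bsub>2\<^esub> l3 - (l3 \<circ>\<^bsub>2\<^esub> l3)\<^bsup>cyc [1,2]\<^esup> + (l3 \<circ>\<^bsub>2\<^esub> l3)\<^bsup>cyc [1,2,3]\<^esup>
        + l3 \<circ>\<^bsub>3\<^esub> l3 - (l3 \<circ>\<^bsub>3\<^esub> l3)\<^bsup>cyc [2,3]\<^esup> + (l3 \<circ>\<^bsub>3\<^esub> l3)\<^bsup>cyc [1,3,2]\<^esup>
        + (l3 \<circ>\<^bsub>3\<^esub> l3)\<^bsup>cyc [2,3,4]\<^esup> - (l3 \<circ>\<^bsub>3\<^esub> l3)\<^bsup>cyc [1,3,4,2]\<^esup> + (l3 \<circ>\<^bsub>3\<^esub> l3)\<^bsup>cyc [1,3] \<circ> cyc [2,4]\<^esup>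
        + l4 \<circ>\<^bsub>1\<^esub> l2 - l4 \<circ>\<^bsub>2\<^esub> l2 + (l4 \<circ>\<^bsub>2\<^esub> l2)\<^bsup>cyc [1,2]\<^esup>
        + l4 \<circ>\<^bsub>3\<^esub> l2 - (l4 \<circ>\<^bsub>3\<^esub> l2)\<^bsup>cyc [2,3]\<^esup> + (l4 \<circ>\<^bsub>3\<^esub> l2)\<^bsup>cyc [1,3,2]\<^esup>
        - l4 \<circ>\<^bsub>4\<^esub> l2 + (l4 \<circ>\<^bsub>4\<^esub> l2)\<^bsup>cyc [3,4]\<^esup> - (l4 \<circ>\<^bsub>4\<^esub> l2)\<^bsup>cyc [2,4,3]\<^esup> + (l4 \<circ>\<^bsub>4\<^esub> l2)\<^bsup>cyc [1,4,3,2]\<^esup>))"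

definition weak_lie3_algebra :: "('k::comm_ring_1, 'v::ab_group_add, 'a) weak_lie3_scheme \<Rightarrow> bool"
  where "weak_lie3_algebra L \<longleftrightarrow>
    (let l2 = lam2 L; l3 = lam3 L; l4 = lam4 L;
         l21 = lam21 L; l211 = lam211 L; l31 = lam31 L; l32 = lam32 L in
     leibniz3_algebra L \<and>
     graded_map L L 2 1 l21 \<and> graded_map L L 2 2 l211 \<and>
     graded_map L L 3 2 l31 \<and> graded_map L L 3 2 l32 \<and>
     map_eq L (bdry L L l21) (l2 + l2\<^bsup>cyc [1,2]\<^esup>) \<and>
     map_eq L (bdry L L l211) (l21 - l21\<^bsup>cyc [1,2]\<^esup>) \<and>
     map_eq L (bdry L L l31) (l3 + l3\<^bsup>cyc [1,2]\<^esup> + l2 \<circ>\<^bsub>1\<^esub> l21) \<and>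
     map_eq L (bdry L L l32)
       (l3 + l3\<^bsup>cyc [2,3]\<^esup> - l2 \<circ>\<^bsub>2\<^esub> l21 + l21 \<circ>\<^bsub>1\<^esub> l2 + (l21 \<circ>\<^bsub>2\<^esub> l2)\<^bsup>cyc [1,2]\<^esup>) \<and>
     map_eq L (l211 + l211\<^bsup>cyc [1,2]\<^esup>) (zero_map 2 2) \<and>
     map_eq L (l31 - l31\<^bsup>cyc [1,2]\<^esup>) (l2 \<circ>\<^bsub>1\<^esub> l211) \<and>
     map_eq L (l31 - l32\<^bsup>cyc [1,2]\<^esup> + l31\<^bsup>cyc [1,3,2]\<^esup> - l32 + l31\<^bsup>cyc [2,3]\<^esup> - l32\<^bsup>cyc [1,2,3]\<^esup>)
       (l21 \<circ>\<^bsub>2\<^esub> l21 + l21 \<circ>\<^bsub>1\<^esub> l21 + (l21 \<circ>\<^bsub>2\<^esub> l21)\<^bsup>cyc [1,2]\<^esup> + (l211 \<circ>\<^bsub>2\<^esub> l2)\<^bsup>cyc [1,3,2]\<^esup>) \<and>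
     map_eq L (l32 - l32\<^bsup>cyc [2,3]\<^esup>)
       (- l2 \<circ>\<^bsub>2\<^esub> l211 + l211 \<circ>\<^bsub>1\<^esub> l2 + (l211 \<circ>\<^bsub>2\<^esub> l2)\<^bsup>cyc [1,2]\<^esup>) \<and>
     map_eq L (l4 + l4\<^bsup>cyc [1,2]\<^esup>)
       (l2 \<circ>\<^bsub>1\<^esub> l31 - l31 \<circ>\<^bsub>3\<^esub> l2 + (l2 \<circ>\<^bsub>2\<^esub> l31)\<^bsup>cyc [1,2,3]\<^esup> + l3 \<circ>\<^bsub>1\<^esub> l21) \<and>
     map_eq L (l4 + l4\<^bsup>cyc [2,3]\<^esup>)
       (l2 \<circ>\<^bsub>1\<^esub> l32 - l3 \<circ>\<^bsub>2\<^esub> l21 + l2 \<circ>\<^bsub>2\<^esub> l31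
        - l31 \<circ>\<^bsub>1\<^esub> l2 - (l31 \<circ>\<^bsub>2\<^esub> l2)\<^bsup>cyc [1,2]\<^esup> - (l31 \<circ>\<^bsub>3\<^esub> l2)\<^bsup>cyc [1,3,2]\<^esup>) \<and>
     map_eq L (l4 + l4\<^bsup>cyc [3,4]\<^esup>)
       (l21 \<circ>\<^bsub>1\<^esub> l3 - l32 \<circ>\<^bsub>1\<^esub> l2 + l32 \<circ>\<^bsub>2\<^esub> l2 - (l32 \<circ>\<^bsub>2\<^esub> l2)\<^bsup>cyc [1,2]\<^esup>
        + l3 \<circ>\<^bsub>3\<^esub> l21 + (l32 \<circ>\<^bsub>3\<^esub> l2)\<^bsup>cyc [2,3]\<^esup> - (l32 \<circ>\<^bsub>3\<^esub> l2)\<^bsup>cyc [1,3,2]\<^esup>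
        + l2 \<circ>\<^bsub>2\<^esub> l32 - (l2 \<circ>\<^bsub>2\<^esub> l32)\<^bsup>cyc [1,2]\<^esup> + (l21 \<circ>\<^bsub>2\<^esub> l3)\<^bsup>cyc [1,2,3]\<^esup>))"

definition skew_symmetric :: "('k, 'v, 'a) cplx_scheme \<Rightarrow> ('v, 'w::ab_group_add) gmap \<Rightarrow> bool"
  where "skew_symmetric L \<mu> \<longleftrightarrow>
    (\<forall>\<sigma>. \<sigma> permutes {1..arity \<mu>} \<longrightarrow> map_eq L (\<mu>\<^bsup>\<sigma>\<^esup>) (if evenperm \<sigma> then \<mu> else - \<mu>))"

definition lie3_algebra :: "('k::comm_ring_1, 'v::ab_group_add, 'a) leibniz3_scheme \<Rightarrow> bool"
  where "lie3_algebra L \<longleftrightarrow> leibniz3_algebra L \<and>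
    skew_symmetric L (lam2 L) \<and> skew_symmetric L (lam3 L) \<and> skew_symmetric L (lam4 L)"

definition skew_symmetrization ::
    "('k::comm_ring_1, 'v::ab_group_add, 'a) weak_lie3_scheme \<Rightarrow> ('k, 'v) leibniz3"
  where "skew_symmetrization L =
    (let l2 = lam2 L; l3 = lam3 L; l4 = lam4 L; l21 = lam21 L; l31 = lam31 L; l32 = lam32 L in
     \<lparr>scal = scal L, comp = comp L, diff = diff L,
      lam2 = smult_map L (unit_inv 2) (skew_sum l2),
      lam3 = smult_map L (unit_inv 6) (skew_sum l3)
        - smult_map L (unit_inv 24) (skew_sum (l21 \<circ>\<^bsub>1\<^esub> l2 + l21 \<circ>\<^bsub>2\<^esub> l2)),
      lam4 = smult_map L (unit_inv 24) (skew_sum l4)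
        + smult_map L (unit_inv 48) (skew_sum
            (l21 \<circ>\<^bsub>1\<^esub> l3 - l31 \<circ>\<^bsub>1\<^esub> l2 + l32 \<circ>\<^bsub>2\<^esub> l2
             - l21 \<circ>\<^bsub>2\<^esub> l3 - l31 \<circ>\<^bsub>2\<^esub> l2 + l32 \<circ>\<^bsub>3\<^esub> l2))\<rparr>)"


section \<open>Morphisms\<close>

definition leibniz3_morphism ::
    "('k::comm_ring_1, 'v::ab_group_add, 'a) leibniz3_scheme \<Rightarrow>
     ('k, 'w::ab_group_add, 'b) leibniz3_scheme \<Rightarrow>
     ('v, 'w) gmap \<Rightarrow> ('v, 'w) gmap \<Rightarrow> ('v, 'w) gmap \<Rightarrow> bool"
  where "leibniz3_morphism L L' f1 f2 f3 \<longleftrightarrow>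
    (let l2 = lam2 L; l3 = lam3 L; l4 = lam4 L; l2' = lam2 L'; l3' = lam3 L'; l4' = lam4 L' in
     leibniz3_algebra L \<and> leibniz3_algebra L' \<and>
     graded_map L L' 1 0 f1 \<and> graded_map L L' 2 1 f2 \<and> graded_map L L' 3 2 f3 \<and>
     map_eq L (bdry L L' f1) (zero_map 1 (-1)) \<and>
     map_eq L (bdry L L' f2) (f1 \<circ>\<^bsub>1\<^esub> l2 - l2' \<circ>\<^sub>\<otimes> [f1, f1]) \<and>
     map_eq L (bdry L L' f3)
       (f1 \<circ>\<^bsub>1\<^esub> l3 - f2 \<circ>\<^bsub>2\<^esub> l2 + f2 \<circ>\<^bsub>1\<^esub> l2 + (f2 \<circ>\<^bsub>2\<^esub> l2)\<^bsup>cyc [1,2]\<^esup>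
        - l3' \<circ>\<^sub>\<otimes> [f1, f1, f1] - l2' \<circ>\<^sub>\<otimes> [f1, f2] + l2' \<circ>\<^sub>\<otimes> [f2, f1]
        + (l2' \<circ>\<^sub>\<otimes> [f1, f2])\<^bsup>cyc [1,2]\<^esup>) \<and>
     map_eq L (f1 \<circ>\<^bsub>1\<^esub> l4 - l4' \<circ>\<^sub>\<otimes> [f1, f1, f1, f1])
       (f2 \<circ>\<^bsub>1\<^esub> l3 + f2 \<circ>\<^bsub>2\<^esub> l3 - (f2 \<circ>\<^bsub>2\<^esub> l3)\<^bsup>cyc [1,2]\<^esup> + (f2 \<circ>\<^bsub>2\<^esub> l3)\<^bsup>cyc [1,2,3]\<^esup>
        - f3 \<circ>\<^bsub>1\<^esub> l2 + f3 \<circ>\<^bsub>2\<^esub> l2 - (f3 \<circ>\<^bsub>2\<^esub> l2)\<^bsup>cyc [1,2]\<^esup>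
        - f3 \<circ>\<^bsub>3\<^esub> l2 + (f3 \<circ>\<^bsub>3\<^esub> l2)\<^bsup>cyc [2,3]\<^esup> - (f3 \<circ>\<^bsub>3\<^esub> l2)\<^bsup>cyc [1,3,2]\<^esup>
        + l2' \<circ>\<^sub>\<otimes> [f3, f1] + l2' \<circ>\<^sub>\<otimes> [f1, f3] - (l2' \<circ>\<^sub>\<otimes> [f1, f3])\<^bsup>cyc [1,2]\<^esup> + (l2' \<circ>\<^sub>\<otimes> [f1, f3])\<^bsup>cyc [1,2,3]\<^esup>
        - l2' \<circ>\<^sub>\<otimes> [f2, f2] + (l2' \<circ>\<^sub>\<otimes> [f2, f2])\<^bsup>cyc [2,3]\<^esup> - (l2' \<circ>\<^sub>\<otimes> [f2, f2])\<^bsup>cyc [1,3,2]\<^esup>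
        + l3' \<circ>\<^sub>\<otimes> [f2, f1, f1] - l3' \<circ>\<^sub>\<otimes> [f1, f2, f1] + (l3' \<circ>\<^sub>\<otimes> [f1, f2, f1])\<^bsup>cyc [1,2]\<^esup>
        + l3' \<circ>\<^sub>\<otimes> [f1, f1, f2] - (l3' \<circ>\<^sub>\<otimes> [f1, f1, f2])\<^bsup>cyc [2,3]\<^esup> + (l3' \<circ>\<^sub>\<otimes> [f1, f1, f2])\<^bsup>cyc [1,3,2]\<^esup>))"

definition weak_lie3_morphism ::
    "('k::comm_ring_1, 'v::ab_group_add, 'a) weak_lie3_scheme \<Rightarrow>
     ('k, 'w::ab_group_add, 'b) weak_lie3_scheme \<Rightarrow>
     ('v, 'w) gmap \<Rightarrow> ('v, 'w) gmap \<Rightarrow> ('v, 'w) gmap \<Rightarrow> ('v, 'w) gmap \<Rightarrow> bool"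
  where "weak_lie3_morphism L L' f1 f2 f21 f3 \<longleftrightarrow>
    (let l2 = lam2 L; l21 = lam21 L; l211 = lam211 L; l31 = lam31 L; l32 = lam32 L;
         l2' = lam2 L'; l21' = lam21 L'; l211' = lam211 L'; l31' = lam31 L'; l32' = lam32 L' in
     weak_lie3_algebra L \<and> weak_lie3_algebra L' \<and>
     leibniz3_morphism L L' f1 f2 f3 \<and> graded_map L L' 2 2 f21 \<and>
     map_eq L (bdry L L' f21) (- f2 - f2\<^bsup>cyc [1,2]\<^esup> + f1 \<circ>\<^bsub>1\<^esub> l21 - l21' \<circ>\<^sub>\<otimes> [f1, f1]) \<and>
     map_eq L (f1 \<circ>\<^bsub>1\<^esub> l211 - l211' \<circ>\<^sub>\<otimes> [f1, f1]) (f21 - f21\<^bsup>cyc [1,2]\<^esup>) \<and>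
     map_eq L (f1 \<circ>\<^bsub>1\<^esub> l31 - l31' \<circ>\<^sub>\<otimes> [f1, f1, f1])
       (f3 + f3\<^bsup>cyc [1,2]\<^esup> + f2 \<circ>\<^bsub>1\<^esub> l21 + l2' \<circ>\<^sub>\<otimes> [f21, f1]) \<and>
     map_eq L (f1 \<circ>\<^bsub>1\<^esub> l32 - l32' \<circ>\<^sub>\<otimes> [f1, f1, f1])
       (f3 + f3\<^bsup>cyc [2,3]\<^esup> - f2 \<circ>\<^bsub>2\<^esub> l21 + f21 \<circ>\<^bsub>1\<^esub> l2 + (f21 \<circ>\<^bsub>2\<^esub> l2)\<^bsup>cyc [1,2]\<^esup>
        - l2' \<circ>\<^sub>\<otimes> [f1, f21] - l21' \<circ>\<^sub>\<otimes> [f2, f1] - (l21' \<circ>\<^sub>\<otimes> [f1, f2])\<^bsup>cyc [1,2]\<^esup>))"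

definition lie3_morphism ::
    "('k::comm_ring_1, 'v::ab_group_add, 'a) leibniz3_scheme \<Rightarrow>
     ('k, 'w::ab_group_add, 'b) leibniz3_scheme \<Rightarrow>
     ('v, 'w) gmap \<Rightarrow> ('v, 'w) gmap \<Rightarrow> ('v, 'w) gmap \<Rightarrow> bool"
  where "lie3_morphism L L' f1 f2 f3 \<longleftrightarrow>
    lie3_algebra L \<and> lie3_algebra L' \<and> leibniz3_morphism L L' f1 f2 f3 \<and>
    skew_symmetric L f1 \<and> skew_symmetric L f2 \<and> skew_symmetric L f3"

end

theory Submission
  imports Defs
begin

text \<open>
  Put \<open>g\<^sub>2 = 1/2 \<lambda>\<^sub>2\<^sub>;\<^sub>1\<close>. For a suitable combination \<open>g\<^sub>3\<close> of \<open>\<lambda>\<^sub>3\<^sub>;\<^sub>1\<close>, \<open>\<lambda>\<^sub>3\<^sub>;\<^sub>2\<close>, \<open>\<lambda>\<^sub>2\<^sub>;\<^sub>1 \<circ> \<lambda>\<^sub>2\<^sub>;\<^sub>1\<close> and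
  \<open>\<lambda>\<^sub>2\<^sub>;\<^sub>1\<^sub>,\<^sub>1 \<circ> \<lambda>\<^sub>2\<close> the triple \<open>(id, g\<^sub>2, g\<^sub>3)\<close> satisfies the equations of a morphism of Leibniz 3-algebras from \<open>\<lambda>\<close> to
  its skew-symmetrization. Since its linear part is the identity, the Leibniz 3-algebra equations are transported along it,
  which avoids any division by 5 in the five-ary identity. The four-ary operation is determined by this isomorphism;
  the identities of \<open>\<lambda>\<^sub>4\<close> show that it is alternating, so it equals its own antisymmetrization, which
  evaluates to the stated formula.

  For a weak morphism \<open>f\<close> the composite of \<open>(f\<^sub>1, f\<^sub>2, f\<^sub>3)\<close> with these isomorphisms is changed by the homotopy
  \<open>u = 1/2 f\<^sub>2\<^sub>;\<^sub>1\<close>; the result has exactly the components of the skew-symmetrized morphism.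

  All identities are verified by writing the difference of both sides as an integral combination of
  hypotheses and of values \<open>d x\<close> with \<open>x\<close> of degree 3, which vanish in a 3-term complex.
\<close>

subsection \<open>Multilinear maps and permutations\<close>

text \<open>Origin of \<open>g2\<close> and \<open>g3\<close>: together with \<open>h\<close>, half
  of \<open>lam211\<close>, they are components of a weak morphism with linear part id into the
  skew-symmetrization, the latter regarded as a weak Lie 3-algebra with all symmetry operations
  zero. For \<open>g2\<close> the choice is evident, as the boundary of \<open>lam21\<close> is
  twice the symmetric part of \<open>lam2\<close>. The weak-morphism equations for
  \<open>lam31\<close> and \<open>lam32\<close> and the boundary equation are then a linear system
  for \<open>g3\<close>; the same equations turn the symmetry axioms of \<open>lam4\<close> into
  alternation. The stated four-ary formula does not contain \<open>g3\<close>, so it is compared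
  with the transported bracket only after antisymmetrization. There each kind of summand becomes a
  single unknown and the comparison is linear algebra. Truncation acts in two ways. An identity of
  degree 2 is checked on arguments of degree 0 only. And for x of degree 3 the expansion of d x by
  the boundary equations is a nontrivial relation between values of degree 2, although x is zero.
  Denominators are cleared by factors 2, 12, 24 or 48 before identities are compared.\<close>

lemma sgn_pow_even: "even k \<Longrightarrow> sgn_pow k w = w"
  and sgn_pow_odd: "odd k \<Longrightarrow> sgn_pow k w = - w"
  by (simp_all add: sgn_pow_def)

lemma gmap_simps [simp]:
  fixes \<mu> \<nu> :: "('v, 'w::ab_group_add) gmap" and \<rho> :: "('v, 'v) gmap" and \<rho>s :: "('u, 'v) gmap list"
  shows "arity (\<mu> + \<nu>) = arity \<mu>" "gdeg (\<mu> + \<nu>) = gdeg \<mu>" "app (\<mu> + \<nu>) vs = app \<mu> vs + app \<nu> vs"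
    "arity (\<mu> - \<nu>) = arity \<mu>" "gdeg (\<mu> - \<nu>) = gdeg \<mu>" "app (\<mu> - \<nu>) vs = app \<mu> vs - app \<nu> vs"
    "arity (- \<mu>) = arity \<mu>" "gdeg (- \<mu>) = gdeg \<mu>" "app (- \<mu>) vs = - app \<mu> vs"
    "arity (smult_map L c \<mu>) = arity \<mu>" "gdeg (smult_map L c \<mu>) = gdeg \<mu>"
    "app (smult_map L c \<mu>) vs = scal L c (app \<mu> vs)"
    "arity (\<mu>\<^bsup>\<sigma>\<^esup>) = arity \<mu>" "gdeg (\<mu>\<^bsup>\<sigma>\<^esup>) = gdeg \<mu>"
    "arity (skew_sum \<mu>) = arity \<mu>" "gdeg (skew_sum \<mu>) = gdeg \<mu>"
    "arity (\<mu> \<circ>\<^bsub>i\<^esub> \<rho>) = arity \<mu> + arity \<rho> - 1" "gdeg (\<mu> \<circ>\<^bsub>i\<^esub> \<rho>) = gdeg \<mu> + gdeg \<rho>"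
    "arity (\<mu> \<circ>\<^sub>\<otimes> \<rho>s) = sum_list (map arity \<rho>s)"
    "gdeg (\<mu> \<circ>\<^sub>\<otimes> \<rho>s) = gdeg \<mu> + sum_list (map gdeg \<rho>s)"
  by (simp_all add: plus_gmap_def minus_gmap_def uminus_gmap_def smult_map_def
      perm_act_def skew_sum_def circ_def tensor_comp_def)

lemma zero_map_simps [simp]: "arity (zero_map n k) = n" "gdeg (zero_map n k) = k" "app (zero_map n k) vs = 0"
  by (simp_all add: zero_map_def)

lemma bdry_simps [simp]: "arity (bdry L L' \<mu>) = arity \<mu>" "gdeg (bdry L L' \<mu>) = gdeg \<mu> - 1"
  by (simp_all add: bdry_def)

lemma app_circ: "app (\<mu> \<circ>\<^bsub>i\<^esub> \<nu>) vs = sgn_pow (gdeg \<nu> * tdeg (take (i - 1) vs))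
       (app \<mu> (take (i - 1) vs @ [value_of \<nu> (take (arity \<nu>) (drop (i - 1) vs))]
          @ drop (i - 1 + arity \<nu>) vs))"
  by (simp add: circ_def)

lemma app_tensor: "app (\<mu> \<circ>\<^sub>\<otimes> \<nu>s) vs = sgn_pow (tensor_exponent \<nu>s vs) (app \<mu> (block_values \<nu>s vs))"
  by (simp add: tensor_comp_def)

lemma app_perm: "app (\<mu>\<^bsup>\<sigma>\<^esup>) vs = sgn_pow (koszul_exponent \<sigma> vs)
       (app \<mu> (map (\<lambda>i. vs ! (inv \<sigma> i - 1)) [1..<Suc (length vs)]))"
  by (simp add: perm_act_def)

lemma tdeg_simps [simp]: "tdeg [] = 0" "tdeg (x # xs) = fst x + tdeg xs" "tdeg (xs @ ys) = tdeg xs + tdeg ys"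
  by (simp_all add: tdeg_def)

text \<open>A cycle unfolds as \<open>transpose i j\<close> after \<open>cyc (j # cs)\<close>, so
  its inverse peels off one transposition at a time. Bijectivity of the shorter cycle is supplied
  here, which keeps the evaluation rule unconditional.\<close>

lemma inv_cyc: "inv (cyc (i # j # cs)) = inv (cyc (j # cs)) \<circ> transpose i j"
  using permutation_bijective[OF permutation_of_cycle[of "j # cs"]]
  by (simp add: o_inv_distrib)

lemma inv_cyc_single [simp]: "inv (cyc [i]) = id"
  by simp

text \<open>The set of inversions in the definition does not evaluate by rewriting; nested sums over
  index lists do, once the arguments form an explicit list.\<close>

lemma koszul_exponent_list: "koszul_exponent \<sigma> vs =
    (\<Sum>j\<leftarrow>[1..<Suc (length vs)]. \<Sum>i\<leftarrow>[1..<j].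
      if \<sigma> i > \<sigma> j then fst (vs ! (i - 1)) * fst (vs ! (j - 1)) else 0)"
proof -
  \<comment> \<open>The larger index becomes the outer one, so that the pairs form a
    \<open>Sigma\<close> set whose inner range depends on the outer index.\<close>
  have "{(i, j). 1 \<le> i \<and> i < j \<and> j \<le> length vs \<and> \<sigma> i > \<sigma> j} =
      prod.swap ` {z \<in> Sigma {1..<Suc (length vs)} (\<lambda>j. {1..<j}). \<sigma> (snd z) > \<sigma> (fst z)}"
    by (auto simp: image_iff)
  then have "koszul_exponent \<sigma> vs =
      (\<Sum>z \<in> {z \<in> Sigma {1..<Suc (length vs)} (\<lambda>j. {1..<j}). \<sigma> (snd z) > \<sigma> (fst z)}.
        fst (vs ! (snd z - 1)) * fst (vs ! (fst z - 1)))"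
    unfolding koszul_exponent_def by (simp add: sum.reindex case_prod_beta)
  also have "\<dots> = (\<Sum>z \<in> Sigma {1..<Suc (length vs)} (\<lambda>j. {1..<j}).
      if \<sigma> (snd z) > \<sigma> (fst z) then fst (vs ! (snd z - 1)) * fst (vs ! (fst z - 1)) else 0)"
    by (rule sum.inter_filter) simp
  also have "\<dots> = (\<Sum>j\<in>{1..<Suc (length vs)}. \<Sum>i\<in>{1..<j}.
      if \<sigma> i > \<sigma> j then fst (vs ! (i - 1)) * fst (vs ! (j - 1)) else 0)"
    by (subst sum.Sigma) (auto simp: case_prod_beta)
  finally show ?thesis
    by (simp only: interv_sum_list_conv_sum_set_nat set_upt)
qed

text \<open>Running from 0 to a literal length lets the index list unfold; the shift by one
  reconciles positions 1, ..., n with list indices.\<close>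

lemma permuted_list: "length vs = n \<Longrightarrow>
    map (\<lambda>i. vs ! (inv \<sigma> i - 1)) [1..<Suc (length vs)] = map (\<lambda>i. vs ! (inv \<sigma> (Suc i) - 1)) [0..<n]"
  by (intro nth_equalityI) (auto simp del: upt_Suc)

lemmas perm_eval = app_perm permuted_list koszul_exponent_list upt_rec_numeral upt_rec numeral_eq_Suc
  inv_cyc inv_transpose_eq transpose_def o_inv_distrib

lemma app_perm2: "app (\<mu>\<^bsup>cyc [1,2]\<^esup>) [x, y] = sgn_pow (fst x * fst y) (app \<mu> [y, x])"
  by (simp add: perm_eval)

lemma app_perm3:
  "app (\<mu>\<^bsup>cyc [1,2]\<^esup>) [x, y, z] = sgn_pow (fst x * fst y) (app \<mu> [y, x, z])"
  "app (\<mu>\<^bsup>cyc [2,3]\<^esup>) [x, y, z] = sgn_pow (fst y * fst z) (app \<mu> [x, z, y])"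
  "app (\<mu>\<^bsup>cyc [1,2,3]\<^esup>) [x, y, z] = sgn_pow (fst x * fst z + fst y * fst z) (app \<mu> [z, x, y])"
  "app (\<mu>\<^bsup>cyc [1,3,2]\<^esup>) [x, y, z] = sgn_pow (fst x * fst y + fst x * fst z) (app \<mu> [y, z, x])"
  by (simp_all add: perm_eval)

lemma app_perm4:
  "app (\<mu>\<^bsup>cyc [1,2]\<^esup>) [x, y, z, w] = sgn_pow (fst x * fst y) (app \<mu> [y, x, z, w])"
  "app (\<mu>\<^bsup>cyc [2,3]\<^esup>) [x, y, z, w] = sgn_pow (fst y * fst z) (app \<mu> [x, z, y, w])"
  "app (\<mu>\<^bsup>cyc [3,4]\<^esup>) [x, y, z, w] = sgn_pow (fst z * fst w) (app \<mu> [x, y, w, z])"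
  "app (\<mu>\<^bsup>cyc [1,2,3]\<^esup>) [x, y, z, w] = sgn_pow (fst x * fst z + fst y * fst z) (app \<mu> [z, x, y, w])"
  "app (\<mu>\<^bsup>cyc [1,3,2]\<^esup>) [x, y, z, w] = sgn_pow (fst x * fst y + fst x * fst z) (app \<mu> [y, z, x, w])"
  by (simp_all add: perm_eval)

lemma koszul_exponent_degree_0:
  assumes "\<forall>x \<in> set vs. fst x = 0"
  shows "koszul_exponent \<sigma> vs = 0"
proof -
  have "fst (vs ! (i - 1)) = 0" if "1 \<le> i" "i \<le> length vs" for i
    using that assms nth_mem[of "i - 1" vs] by simp
  then show ?thesis
    unfolding koszul_exponent_def by (intro sum.neutral) (simp add: case_prod_beta del: One_nat_def)
qed

text \<open>Five arguments occur only in the last Leibniz identity, which has degree 2. Its values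
  can be nonzero only if all arguments have degree 0, and then no Koszul sign arises.\<close>

lemma app_perm5_degree_0:
  "app (\<mu>\<^bsup>cyc [1,2]\<^esup>) [(0, a), (0, b), (0, c), (0, d), (0, e)] = app \<mu> [(0, b), (0, a), (0, c), (0, d), (0, e)]"
  "app (\<mu>\<^bsup>cyc [1,2,3]\<^esup>) [(0, a), (0, b), (0, c), (0, d), (0, e)] = app \<mu> [(0, c), (0, a), (0, b), (0, d), (0, e)]"
  "app (\<mu>\<^bsup>cyc [1,2,3,4]\<^esup>) [(0, a), (0, b), (0, c), (0, d), (0, e)] = app \<mu> [(0, d), (0, a), (0, b), (0, c), (0, e)]"
  "app (\<mu>\<^bsup>cyc [2,3]\<^esup>) [(0, a), (0, b), (0, c), (0, d), (0, e)] = app \<mu> [(0, a), (0, c), (0, b), (0, d), (0, e)]"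
  "app (\<mu>\<^bsup>cyc [1,3,2]\<^esup>) [(0, a), (0, b), (0, c), (0, d), (0, e)] = app \<mu> [(0, b), (0, c), (0, a), (0, d), (0, e)]"
  "app (\<mu>\<^bsup>cyc [2,3,4]\<^esup>) [(0, a), (0, b), (0, c), (0, d), (0, e)] = app \<mu> [(0, a), (0, d), (0, b), (0, c), (0, e)]"
  "app (\<mu>\<^bsup>cyc [1,3,4,2]\<^esup>) [(0, a), (0, b), (0, c), (0, d), (0, e)] = app \<mu> [(0, b), (0, d), (0, a), (0, c), (0, e)]"
  "app (\<mu>\<^bsup>cyc [1,3] \<circ> cyc [2,4]\<^esup>) [(0, a), (0, b), (0, c), (0, d), (0, e)] = app \<mu> [(0, c), (0, d), (0, a), (0, b), (0, e)]"
  "app (\<mu>\<^bsup>cyc [3,4]\<^esup>) [(0, a), (0, b), (0, c), (0, d), (0, e)] = app \<mu> [(0, a), (0, b), (0, d), (0, c), (0, e)]"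
  "app (\<mu>\<^bsup>cyc [2,4,3]\<^esup>) [(0, a), (0, b), (0, c), (0, d), (0, e)] = app \<mu> [(0, a), (0, c), (0, d), (0, b), (0, e)]"
  "app (\<mu>\<^bsup>cyc [1,4,3,2]\<^esup>) [(0, a), (0, b), (0, c), (0, d), (0, e)] = app \<mu> [(0, b), (0, c), (0, d), (0, a), (0, e)]"
  using koszul_exponent_degree_0[of "[(0, a), (0, b), (0, c), (0, d), (0, e)]"]
  by (simp_all add: app_perm permuted_list upt_rec_numeral upt_rec numeral_eq_Suc
      inv_transpose_eq transpose_def o_inv_distrib bij_comp sgn_pow_even ball_simps)

section \<open>Homogeneous lists and linearity in each slot\<close>

lemma homogeneous_simps [simp]:
  "homogeneous L []"
  "homogeneous L (x # vs) \<longleftrightarrow> snd x \<in> comp L (fst x) \<and> homogeneous L vs"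
  "homogeneous L (us @ vs) \<longleftrightarrow> homogeneous L us \<and> homogeneous L vs"
  by (auto simp: homogeneous_def)

lemma complex_module: "three_term_complex L \<Longrightarrow> module (scal L)"
  and complex_subspace: "three_term_complex L \<Longrightarrow> module.subspace (scal L) (comp L p)"
  and complex_trivial: "three_term_complex L \<Longrightarrow> p \<notin> {0, 1, 2} \<Longrightarrow> comp L p = {0}"
  and complex_diff: "three_term_complex L \<Longrightarrow> graded_map L L 1 (-1) (diff L)"
  and complex_diff_diff: "three_term_complex L \<Longrightarrow> map_eq L (diff L \<circ>\<^bsub>1\<^esub> diff L) (zero_map 1 (-2))"
  by (simp_all add: three_term_complex_def)

lemma comp_closed:
  assumes "three_term_complex L"
  shows "0 \<in> comp L p"
    "x \<in> comp L p \<Longrightarrow> y \<in> comp L p \<Longrightarrow> x + y \<in> comp L p"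
    "x \<in> comp L p \<Longrightarrow> y \<in> comp L p \<Longrightarrow> x - y \<in> comp L p"
    "x \<in> comp L p \<Longrightarrow> - x \<in> comp L p"
    "x \<in> comp L p \<Longrightarrow> scal L c x \<in> comp L p"
    "x \<in> comp L p \<Longrightarrow> sgn_pow k x \<in> comp L p"
  using complex_module[OF assms] complex_subspace[OF assms, of p]
  by (simp_all add: sgn_pow_def module.subspace_0 module.subspace_add module.subspace_diff
      module.subspace_neg module.subspace_scale)

lemma scal_simps:
  assumes "three_term_complex L"
  shows "scal L c (x + y) = scal L c x + scal L c y" "scal L c (x - y) = scal L c x - scal L c y"
    "scal L c (- x) = - scal L c x" "scal L c 0 = 0" "scal L 1 x = x" "scal L 0 x = 0"
    "scal L c (scal L d x) = scal L (c * d) x" "scal L (- c) x = - scal L c x"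
    "scal L (c + d) x = scal L c x + scal L d x"
  using complex_module[OF assms]
  by (simp_all add: module.scale_right_distrib module.scale_right_diff_distrib module.scale_minus_right
      module.scale_zero_right module.scale_one module.scale_zero_left module.scale_scale
      module.scale_minus_left module.scale_left_distrib)

lemma graded_mapI:
  assumes "arity \<mu> = n" "gdeg \<mu> = k"
    and "\<And>vs. length vs = n \<Longrightarrow> homogeneous L vs \<Longrightarrow> app \<mu> vs \<in> comp L' (tdeg vs + k)"
    and "\<And>us ws p x y. length us + 1 + length ws = n \<Longrightarrow> homogeneous L us \<Longrightarrow> homogeneous L ws \<Longrightarrow>
       x \<in> comp L p \<Longrightarrow> y \<in> comp L p \<Longrightarrow>
       app \<mu> (us @ (p, x + y) # ws) = app \<mu> (us @ (p, x) # ws) + app \<mu> (us @ (p, y) # ws)"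
    and "\<And>us ws p c x. length us + 1 + length ws = n \<Longrightarrow> homogeneous L us \<Longrightarrow> homogeneous L ws \<Longrightarrow>
       x \<in> comp L p \<Longrightarrow> app \<mu> (us @ (p, scal L c x) # ws) = scal L' c (app \<mu> (us @ (p, x) # ws))"
  shows "graded_map L L' n k \<mu>"
  unfolding graded_map_def using assms by blast

lemma graded_mapD:
  assumes "graded_map L L' n k \<mu>"
  shows "arity \<mu> = n" "gdeg \<mu> = k"
    "length vs = n \<Longrightarrow> homogeneous L vs \<Longrightarrow> app \<mu> vs \<in> comp L' (tdeg vs + k)"
    "length us + 1 + length ws = n \<Longrightarrow> homogeneous L us \<Longrightarrow> homogeneous L ws \<Longrightarrow>
       x \<in> comp L p \<Longrightarrow> y \<in> comp L p \<Longrightarrow>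
       app \<mu> (us @ (p, x + y) # ws) = app \<mu> (us @ (p, x) # ws) + app \<mu> (us @ (p, y) # ws)"
    "length us + 1 + length ws = n \<Longrightarrow> homogeneous L us \<Longrightarrow> homogeneous L ws \<Longrightarrow>
       x \<in> comp L p \<Longrightarrow> app \<mu> (us @ (p, scal L c x) # ws) = scal L' c (app \<mu> (us @ (p, x) # ws))"
  using assms unfolding graded_map_def by blast+

text \<open>A graded map is additive and compatible with scalars by definition; negation is the
  scalar -1, zero is the scalar 0, and differences follow from both.\<close>

lemma graded_map_slot:
  assumes L: "three_term_complex L" and L': "three_term_complex L'" and \<mu>: "graded_map L L' n k \<mu>"
    and n: "length us + 1 + length ws = n" and us: "homogeneous L us" and ws: "homogeneous L ws"
  shows
    "x \<in> comp L p \<Longrightarrow> y \<in> comp L p \<Longrightarrow>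
       app \<mu> (us @ (p, x + y) # ws) = app \<mu> (us @ (p, x) # ws) + app \<mu> (us @ (p, y) # ws)"
    "x \<in> comp L p \<Longrightarrow> y \<in> comp L p \<Longrightarrow>
       app \<mu> (us @ (p, x - y) # ws) = app \<mu> (us @ (p, x) # ws) - app \<mu> (us @ (p, y) # ws)"
    "x \<in> comp L p \<Longrightarrow> app \<mu> (us @ (p, - x) # ws) = - app \<mu> (us @ (p, x) # ws)"
    "app \<mu> (us @ (p, 0) # ws) = 0"
    "x \<in> comp L p \<Longrightarrow> app \<mu> (us @ (p, scal L c x) # ws) = scal L' c (app \<mu> (us @ (p, x) # ws))"
proof -
  note D = graded_mapD(4,5)[OF \<mu> n us ws]
  show add: "app \<mu> (us @ (p, x + y) # ws) = app \<mu> (us @ (p, x) # ws) + app \<mu> (us @ (p, y) # ws)"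
    if "x \<in> comp L p" "y \<in> comp L p" for x y
    using that by (rule D)
  show neg: "app \<mu> (us @ (p, - x) # ws) = - app \<mu> (us @ (p, x) # ws)" if "x \<in> comp L p" for x
    using D(2)[OF that, of "-1"] by (simp add: scal_simps[OF L] scal_simps[OF L'])
  show "app \<mu> (us @ (p, x - y) # ws) = app \<mu> (us @ (p, x) # ws) - app \<mu> (us @ (p, y) # ws)"
    if "x \<in> comp L p" "y \<in> comp L p" for x y
    using add[of x "- y"] neg[of y] that comp_closed(4)[OF L, of y p] by simp
  show "app \<mu> (us @ (p, 0) # ws) = 0"
    using D(2)[OF comp_closed(1)[OF L], of p 0] by (simp add: scal_simps[OF L] scal_simps[OF L'])
  show "app \<mu> (us @ (p, scal L c x) # ws) = scal L' c (app \<mu> (us @ (p, x) # ws))" if "x \<in> comp L p"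
    using that by (rule D)
qed

text \<open>Linearity on explicit lists, in the form of rewrite rules. The degree of the value
  enters as a separate equation for \<open>s\<close>, so that a literal degree can be matched first
  and the sum is left to arithmetic. The versions for two, three and four arguments serve the same
  purpose.\<close>

lemma graded_map1:
  assumes L: "three_term_complex L" and L': "three_term_complex L'" and \<mu>: "graded_map L L' 1 k \<mu>"
  shows "arity \<mu> = 1" "gdeg \<mu> = k"
    "a \<in> comp L p \<Longrightarrow> s = p + k \<Longrightarrow>
      app \<mu> [(p, a)] \<in> comp L' s"
    " x \<in> comp L p \<Longrightarrow> y \<in> comp L p \<Longrightarrow>
      app \<mu> [(p, x + y)] = app \<mu> [(p, x)] + app \<mu> [(p, y)]"
    " x \<in> comp L p \<Longrightarrow> y \<in> comp L p \<Longrightarrow>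
      app \<mu> [(p, x - y)] = app \<mu> [(p, x)] - app \<mu> [(p, y)]"
    " x \<in> comp L p \<Longrightarrow> app \<mu> [(p, - x)] = - app \<mu> [(p, x)]"
    " app \<mu> [(p, 0)] = 0"
    " x \<in> comp L p \<Longrightarrow>
      app \<mu> [(p, scal L z x)] = scal L' z (app \<mu> [(p, x)])"
  using graded_mapD(1,2)[OF \<mu>] graded_mapD(3)[OF \<mu>, of "[(p, a)]"]
    graded_map_slot[OF L L' \<mu>, where us = "[]" and ws = "[]"]
  by (simp_all add: add.assoc)

lemma graded_map2:
  assumes L: "three_term_complex L" and L': "three_term_complex L'" and \<mu>: "graded_map L L' 2 k \<mu>"
  shows "arity \<mu> = 2" "gdeg \<mu> = k"
    "a \<in> comp L p \<Longrightarrow> b \<in> comp L q \<Longrightarrow> s = p + q + k \<Longrightarrow>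
      app \<mu> [(p, a), (q, b)] \<in> comp L' s"
    "b \<in> comp L q \<Longrightarrow> x \<in> comp L p \<Longrightarrow> y \<in> comp L p \<Longrightarrow>
      app \<mu> [(p, x + y), (q, b)] = app \<mu> [(p, x), (q, b)] + app \<mu> [(p, y), (q, b)]"
    "b \<in> comp L q \<Longrightarrow> x \<in> comp L p \<Longrightarrow> y \<in> comp L p \<Longrightarrow>
      app \<mu> [(p, x - y), (q, b)] = app \<mu> [(p, x), (q, b)] - app \<mu> [(p, y), (q, b)]"
    "b \<in> comp L q \<Longrightarrow> x \<in> comp L p \<Longrightarrow> app \<mu> [(p, - x), (q, b)] = - app \<mu> [(p, x), (q, b)]"
    "b \<in> comp L q \<Longrightarrow> app \<mu> [(p, 0), (q, b)] = 0"
    "b \<in> comp L q \<Longrightarrow> x \<in> comp L p \<Longrightarrow>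
      app \<mu> [(p, scal L z x), (q, b)] = scal L' z (app \<mu> [(p, x), (q, b)])"
    "a \<in> comp L p \<Longrightarrow> x \<in> comp L q \<Longrightarrow> y \<in> comp L q \<Longrightarrow>
      app \<mu> [(p, a), (q, x + y)] = app \<mu> [(p, a), (q, x)] + app \<mu> [(p, a), (q, y)]"
    "a \<in> comp L p \<Longrightarrow> x \<in> comp L q \<Longrightarrow> y \<in> comp L q \<Longrightarrow>
      app \<mu> [(p, a), (q, x - y)] = app \<mu> [(p, a), (q, x)] - app \<mu> [(p, a), (q, y)]"
    "a \<in> comp L p \<Longrightarrow> x \<in> comp L q \<Longrightarrow> app \<mu> [(p, a), (q, - x)] = - app \<mu> [(p, a), (q, x)]"
    "a \<in> comp L p \<Longrightarrow> app \<mu> [(p, a), (q, 0)] = 0"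
    "a \<in> comp L p \<Longrightarrow> x \<in> comp L q \<Longrightarrow>
      app \<mu> [(p, a), (q, scal L z x)] = scal L' z (app \<mu> [(p, a), (q, x)])"
  using graded_mapD(1,2)[OF \<mu>] graded_mapD(3)[OF \<mu>, of "[(p, a), (q, b)]"]
    graded_map_slot[OF L L' \<mu>, where us = "[]" and ws = "[(q, b)]"]
    graded_map_slot[OF L L' \<mu>, where us = "[(p, a)]" and ws = "[]"]
  by (simp_all add: add.assoc)

lemma graded_map3:
  assumes L: "three_term_complex L" and L': "three_term_complex L'" and \<mu>: "graded_map L L' 3 k \<mu>"
  shows "arity \<mu> = 3" "gdeg \<mu> = k"
    "a \<in> comp L p \<Longrightarrow> b \<in> comp L q \<Longrightarrow> c \<in> comp L r \<Longrightarrow> s = p + q + r + k \<Longrightarrow>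
      app \<mu> [(p, a), (q, b), (r, c)] \<in> comp L' s"
    "b \<in> comp L q \<Longrightarrow> c \<in> comp L r \<Longrightarrow> x \<in> comp L p \<Longrightarrow> y \<in> comp L p \<Longrightarrow>
      app \<mu> [(p, x + y), (q, b), (r, c)] = app \<mu> [(p, x), (q, b), (r, c)] + app \<mu> [(p, y), (q, b), (r, c)]"
    "b \<in> comp L q \<Longrightarrow> c \<in> comp L r \<Longrightarrow> x \<in> comp L p \<Longrightarrow> y \<in> comp L p \<Longrightarrow>
      app \<mu> [(p, x - y), (q, b), (r, c)] = app \<mu> [(p, x), (q, b), (r, c)] - app \<mu> [(p, y), (q, b), (r, c)]"
    "b \<in> comp L q \<Longrightarrow> c \<in> comp L r \<Longrightarrow> x \<in> comp L p \<Longrightarrow> app \<mu> [(p, - x), (q, b), (r, c)] = - app \<mu> [(p, x), (q, b), (r, c)]"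
    "b \<in> comp L q \<Longrightarrow> c \<in> comp L r \<Longrightarrow> app \<mu> [(p, 0), (q, b), (r, c)] = 0"
    "b \<in> comp L q \<Longrightarrow> c \<in> comp L r \<Longrightarrow> x \<in> comp L p \<Longrightarrow>
      app \<mu> [(p, scal L z x), (q, b), (r, c)] = scal L' z (app \<mu> [(p, x), (q, b), (r, c)])"
    "a \<in> comp L p \<Longrightarrow> c \<in> comp L r \<Longrightarrow> x \<in> comp L q \<Longrightarrow> y \<in> comp L q \<Longrightarrow>
      app \<mu> [(p, a), (q, x + y), (r, c)] = app \<mu> [(p, a), (q, x), (r, c)] + app \<mu> [(p, a), (q, y), (r, c)]"
    "a \<in> comp L p \<Longrightarrow> c \<in> comp L r \<Longrightarrow> x \<in> comp L q \<Longrightarrow> y \<in> comp L q \<Longrightarrow>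
      app \<mu> [(p, a), (q, x - y), (r, c)] = app \<mu> [(p, a), (q, x), (r, c)] - app \<mu> [(p, a), (q, y), (r, c)]"
    "a \<in> comp L p \<Longrightarrow> c \<in> comp L r \<Longrightarrow> x \<in> comp L q \<Longrightarrow> app \<mu> [(p, a), (q, - x), (r, c)] = - app \<mu> [(p, a), (q, x), (r, c)]"
    "a \<in> comp L p \<Longrightarrow> c \<in> comp L r \<Longrightarrow> app \<mu> [(p, a), (q, 0), (r, c)] = 0"
    "a \<in> comp L p \<Longrightarrow> c \<in> comp L r \<Longrightarrow> x \<in> comp L q \<Longrightarrow>
      app \<mu> [(p, a), (q, scal L z x), (r, c)] = scal L' z (app \<mu> [(p, a), (q, x), (r, c)])"
    "a \<in> comp L p \<Longrightarrow> b \<in> comp L q \<Longrightarrow> x \<in> comp L r \<Longrightarrow> y \<in> comp L r \<Longrightarrow>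
      app \<mu> [(p, a), (q, b), (r, x + y)] = app \<mu> [(p, a), (q, b), (r, x)] + app \<mu> [(p, a), (q, b), (r, y)]"
    "a \<in> comp L p \<Longrightarrow> b \<in> comp L q \<Longrightarrow> x \<in> comp L r \<Longrightarrow> y \<in> comp L r \<Longrightarrow>
      app \<mu> [(p, a), (q, b), (r, x - y)] = app \<mu> [(p, a), (q, b), (r, x)] - app \<mu> [(p, a), (q, b), (r, y)]"
    "a \<in> comp L p \<Longrightarrow> b \<in> comp L q \<Longrightarrow> x \<in> comp L r \<Longrightarrow> app \<mu> [(p, a), (q, b), (r, - x)] = - app \<mu> [(p, a), (q, b), (r, x)]"
    "a \<in> comp L p \<Longrightarrow> b \<in> comp L q \<Longrightarrow> app \<mu> [(p, a), (q, b), (r, 0)] = 0"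
    "a \<in> comp L p \<Longrightarrow> b \<in> comp L q \<Longrightarrow> x \<in> comp L r \<Longrightarrow>
      app \<mu> [(p, a), (q, b), (r, scal L z x)] = scal L' z (app \<mu> [(p, a), (q, b), (r, x)])"
  using graded_mapD(1,2)[OF \<mu>] graded_mapD(3)[OF \<mu>, of "[(p, a), (q, b), (r, c)]"]
    graded_map_slot[OF L L' \<mu>, where us = "[]" and ws = "[(q, b), (r, c)]"]
    graded_map_slot[OF L L' \<mu>, where us = "[(p, a)]" and ws = "[(r, c)]"]
    graded_map_slot[OF L L' \<mu>, where us = "[(p, a), (q, b)]" and ws = "[]"]
  by (simp_all add: add.assoc)

lemma graded_map4:
  assumes L: "three_term_complex L" and L': "three_term_complex L'" and \<mu>: "graded_map L L' 4 k \<mu>"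
  shows "arity \<mu> = 4" "gdeg \<mu> = k"
    "a \<in> comp L p \<Longrightarrow> b \<in> comp L q \<Longrightarrow> c \<in> comp L r \<Longrightarrow> d \<in> comp L t \<Longrightarrow> s = p + q + r + t + k \<Longrightarrow>
      app \<mu> [(p, a), (q, b), (r, c), (t, d)] \<in> comp L' s"
    "b \<in> comp L q \<Longrightarrow> c \<in> comp L r \<Longrightarrow> d \<in> comp L t \<Longrightarrow> x \<in> comp L p \<Longrightarrow> y \<in> comp L p \<Longrightarrow>
      app \<mu> [(p, x + y), (q, b), (r, c), (t, d)] = app \<mu> [(p, x), (q, b), (r, c), (t, d)] + app \<mu> [(p, y), (q, b), (r, c), (t, d)]"
    "b \<in> comp L q \<Longrightarrow> c \<in> comp L r \<Longrightarrow> d \<in> comp L t \<Longrightarrow> x \<in> comp L p \<Longrightarrow> y \<in> comp L p \<Longrightarrow>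
      app \<mu> [(p, x - y), (q, b), (r, c), (t, d)] = app \<mu> [(p, x), (q, b), (r, c), (t, d)] - app \<mu> [(p, y), (q, b), (r, c), (t, d)]"
    "b \<in> comp L q \<Longrightarrow> c \<in> comp L r \<Longrightarrow> d \<in> comp L t \<Longrightarrow> x \<in> comp L p \<Longrightarrow> app \<mu> [(p, - x), (q, b), (r, c), (t, d)] = - app \<mu> [(p, x), (q, b), (r, c), (t, d)]"
    "b \<in> comp L q \<Longrightarrow> c \<in> comp L r \<Longrightarrow> d \<in> comp L t \<Longrightarrow> app \<mu> [(p, 0), (q, b), (r, c), (t, d)] = 0"
    "b \<in> comp L q \<Longrightarrow> c \<in> comp L r \<Longrightarrow> d \<in> comp L t \<Longrightarrow> x \<in> comp L p \<Longrightarrow>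
      app \<mu> [(p, scal L z x), (q, b), (r, c), (t, d)] = scal L' z (app \<mu> [(p, x), (q, b), (r, c), (t, d)])"
    "a \<in> comp L p \<Longrightarrow> c \<in> comp L r \<Longrightarrow> d \<in> comp L t \<Longrightarrow> x \<in> comp L q \<Longrightarrow> y \<in> comp L q \<Longrightarrow>
      app \<mu> [(p, a), (q, x + y), (r, c), (t, d)] = app \<mu> [(p, a), (q, x), (r, c), (t, d)] + app \<mu> [(p, a), (q, y), (r, c), (t, d)]"
    "a \<in> comp L p \<Longrightarrow> c \<in> comp L r \<Longrightarrow> d \<in> comp L t \<Longrightarrow> x \<in> comp L q \<Longrightarrow> y \<in> comp L q \<Longrightarrow>
      app \<mu> [(p, a), (q, x - y), (r, c), (t, d)] = app \<mu> [(p, a), (q, x), (r, c), (t, d)] - app \<mu> [(p, a), (q, y), (r, c), (t, d)]"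
    "a \<in> comp L p \<Longrightarrow> c \<in> comp L r \<Longrightarrow> d \<in> comp L t \<Longrightarrow> x \<in> comp L q \<Longrightarrow> app \<mu> [(p, a), (q, - x), (r, c), (t, d)] = - app \<mu> [(p, a), (q, x), (r, c), (t, d)]"
    "a \<in> comp L p \<Longrightarrow> c \<in> comp L r \<Longrightarrow> d \<in> comp L t \<Longrightarrow> app \<mu> [(p, a), (q, 0), (r, c), (t, d)] = 0"
    "a \<in> comp L p \<Longrightarrow> c \<in> comp L r \<Longrightarrow> d \<in> comp L t \<Longrightarrow> x \<in> comp L q \<Longrightarrow>
      app \<mu> [(p, a), (q, scal L z x), (r, c), (t, d)] = scal L' z (app \<mu> [(p, a), (q, x), (r, c), (t, d)])"
    "a \<in> comp L p \<Longrightarrow> b \<in> comp L q \<Longrightarrow> d \<in> comp L t \<Longrightarrow> x \<in> comp L r \<Longrightarrow> y \<in> comp L r \<Longrightarrow>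
      app \<mu> [(p, a), (q, b), (r, x + y), (t, d)] = app \<mu> [(p, a), (q, b), (r, x), (t, d)] + app \<mu> [(p, a), (q, b), (r, y), (t, d)]"
    "a \<in> comp L p \<Longrightarrow> b \<in> comp L q \<Longrightarrow> d \<in> comp L t \<Longrightarrow> x \<in> comp L r \<Longrightarrow> y \<in> comp L r \<Longrightarrow>
      app \<mu> [(p, a), (q, b), (r, x - y), (t, d)] = app \<mu> [(p, a), (q, b), (r, x), (t, d)] - app \<mu> [(p, a), (q, b), (r, y), (t, d)]"
    "a \<in> comp L p \<Longrightarrow> b \<in> comp L q \<Longrightarrow> d \<in> comp L t \<Longrightarrow> x \<in> comp L r \<Longrightarrow> app \<mu> [(p, a), (q, b), (r, - x), (t, d)] = - app \<mu> [(p, a), (q, b), (r, x), (t, d)]"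
    "a \<in> comp L p \<Longrightarrow> b \<in> comp L q \<Longrightarrow> d \<in> comp L t \<Longrightarrow> app \<mu> [(p, a), (q, b), (r, 0), (t, d)] = 0"
    "a \<in> comp L p \<Longrightarrow> b \<in> comp L q \<Longrightarrow> d \<in> comp L t \<Longrightarrow> x \<in> comp L r \<Longrightarrow>
      app \<mu> [(p, a), (q, b), (r, scal L z x), (t, d)] = scal L' z (app \<mu> [(p, a), (q, b), (r, x), (t, d)])"
    "a \<in> comp L p \<Longrightarrow> b \<in> comp L q \<Longrightarrow> c \<in> comp L r \<Longrightarrow> x \<in> comp L t \<Longrightarrow> y \<in> comp L t \<Longrightarrow>
      app \<mu> [(p, a), (q, b), (r, c), (t, x + y)] = app \<mu> [(p, a), (q, b), (r, c), (t, x)] + app \<mu> [(p, a), (q, b), (r, c), (t, y)]"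
    "a \<in> comp L p \<Longrightarrow> b \<in> comp L q \<Longrightarrow> c \<in> comp L r \<Longrightarrow> x \<in> comp L t \<Longrightarrow> y \<in> comp L t \<Longrightarrow>
      app \<mu> [(p, a), (q, b), (r, c), (t, x - y)] = app \<mu> [(p, a), (q, b), (r, c), (t, x)] - app \<mu> [(p, a), (q, b), (r, c), (t, y)]"
    "a \<in> comp L p \<Longrightarrow> b \<in> comp L q \<Longrightarrow> c \<in> comp L r \<Longrightarrow> x \<in> comp L t \<Longrightarrow> app \<mu> [(p, a), (q, b), (r, c), (t, - x)] = - app \<mu> [(p, a), (q, b), (r, c), (t, x)]"
    "a \<in> comp L p \<Longrightarrow> b \<in> comp L q \<Longrightarrow> c \<in> comp L r \<Longrightarrow> app \<mu> [(p, a), (q, b), (r, c), (t, 0)] = 0"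
    "a \<in> comp L p \<Longrightarrow> b \<in> comp L q \<Longrightarrow> c \<in> comp L r \<Longrightarrow> x \<in> comp L t \<Longrightarrow>
      app \<mu> [(p, a), (q, b), (r, c), (t, scal L z x)] = scal L' z (app \<mu> [(p, a), (q, b), (r, c), (t, x)])"
  using graded_mapD(1,2)[OF \<mu>] graded_mapD(3)[OF \<mu>, of "[(p, a), (q, b), (r, c), (t, d)]"]
    graded_map_slot[OF L L' \<mu>, where us = "[]" and ws = "[(q, b), (r, c), (t, d)]"]
    graded_map_slot[OF L L' \<mu>, where us = "[(p, a)]" and ws = "[(r, c), (t, d)]"]
    graded_map_slot[OF L L' \<mu>, where us = "[(p, a), (q, b)]" and ws = "[(t, d)]"]
    graded_map_slot[OF L L' \<mu>, where us = "[(p, a), (q, b), (r, c)]" and ws = "[]"]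
  by (simp_all add: add.assoc)

lemma sgn_pow_simps [simp]: "sgn_pow 0 w = w" "sgn_pow (- k) w = sgn_pow k w" "sgn_pow k 0 = 0"
  by (simp_all add: sgn_pow_def)

section \<open>Closure of graded maps under the operations\<close>

lemma graded_map_add:
  assumes L': "three_term_complex L'" and \<mu>: "graded_map L L' n k \<mu>" and \<nu>: "graded_map L L' n k \<nu>"
  shows "graded_map L L' n k (\<mu> + \<nu>)"
  using graded_mapD[OF \<mu>] graded_mapD[OF \<nu>]
  by (intro graded_mapI) (auto simp: comp_closed[OF L'] scal_simps[OF L'])

lemma graded_map_diff:
  assumes L': "three_term_complex L'" and \<mu>: "graded_map L L' n k \<mu>" and \<nu>: "graded_map L L' n k \<nu>"
  shows "graded_map L L' n k (\<mu> - \<nu>)"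
  using graded_mapD[OF \<mu>] graded_mapD[OF \<nu>]
  by (intro graded_mapI) (auto simp: comp_closed[OF L'] scal_simps[OF L'])

lemma graded_map_uminus:
  assumes L': "three_term_complex L'" and \<mu>: "graded_map L L' n k \<mu>"
  shows "graded_map L L' n k (- \<mu>)"
  using graded_mapD[OF \<mu>]
  by (intro graded_mapI) (auto simp: comp_closed[OF L'] scal_simps[OF L'])

lemma graded_map_zero:
  assumes L': "three_term_complex L'"
  shows "graded_map L L' n k (zero_map n k)"
  by (intro graded_mapI) (auto simp: comp_closed[OF L'] scal_simps[OF L'])

lemma graded_map_smult:
  assumes L': "three_term_complex L'" and \<mu>: "graded_map L L' n k \<mu>"
  shows "graded_map L L' n k (smult_map L' c \<mu>)"
  using graded_mapD[OF \<mu>]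
  by (intro graded_mapI) (auto simp: comp_closed[OF L'] scal_simps[OF L'] mult.commute)

lemma graded_map_sum:
  assumes L': "three_term_complex L'" and S: "finite S"
    and \<mu>: "\<And>s. s \<in> S \<Longrightarrow> graded_map L L' n k (\<mu> s)"
  shows "graded_map L L' n k (GMap n k (\<lambda>vs. \<Sum>s\<in>S. app (\<mu> s) vs))"
proof (intro graded_mapI)
  show "app (GMap n k (\<lambda>vs. \<Sum>s\<in>S. app (\<mu> s) vs)) vs \<in> comp L' (tdeg vs + k)"
    if "length vs = n" "homogeneous L vs" for vs
    using graded_mapD(3)[OF \<mu> that]
    by (simp add: module.subspace_sum[OF complex_module[OF L'] complex_subspace[OF L']])
qed (use graded_mapD(4,5)[OF \<mu>] in
    \<open>auto simp: sum.distrib module.scale_sum_right[OF complex_module[OF L']] intro!: sum.cong\<close>)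

lemma graded_map_sgn:
  assumes L': "three_term_complex L'" and \<mu>: "graded_map L L' n k \<mu>"
  shows "graded_map L L' n k (GMap n k (\<lambda>vs. sgn_pow e (app \<mu> vs)))"
  using graded_mapD[OF \<mu>]
  by (intro graded_mapI) (auto simp: sgn_pow_def comp_closed[OF L'] scal_simps[OF L'])

lemma tdeg_permuted:
  assumes "\<sigma> permutes {1..n}" "length vs = n"
  shows "tdeg (map (\<lambda>i. vs ! (inv \<sigma> (Suc i) - 1)) [0..<n]) = tdeg vs"
proof -
  have "tdeg (map (\<lambda>i. vs ! (inv \<sigma> (Suc i) - 1)) [0..<n]) = (\<Sum>i\<in>{1..n}. fst (vs ! (inv \<sigma> i - 1)))"
    by (simp add: tdeg_def o_def interv_sum_list_conv_sum_set_nat sum.atLeast1_atMost_eq lessThan_atLeast0)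
  also have "\<dots> = (\<Sum>i\<in>{1..n}. fst (vs ! (i - 1)))"
    using sum.permute[OF permutes_inv[OF assms(1)], of "\<lambda>i. fst (vs ! (i - 1))"] by (simp add: o_def)
  also have "\<dots> = tdeg vs"
    unfolding tdeg_def sum_list_sum_nth using assms(2)
    by (simp add: sum.atLeast1_atMost_eq lessThan_atLeast0)
  finally show ?thesis .
qed

lemma koszul_exponent_cong: "map fst vs = map fst ws \<Longrightarrow> koszul_exponent \<sigma> vs = koszul_exponent \<sigma> ws"
proof -
  assume e: "map fst vs = map fst ws"
  then have l: "length vs = length ws" by (rule map_eq_imp_length_eq)
  have "fst (vs ! i) = fst (ws ! i)" if "i < length ws" for i
    using e that l by (metis nth_map)
  then show ?thesis
    unfolding koszul_exponent_def l by (intro sum.cong) auto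
qed

text \<open>Permuting a list carries the varying slot to one new position, and the other entries do
  not involve it; linearity there is linearity of the original map. The sign is the same for all
  values in the slot, because it depends on the degrees alone.\<close>

lemma graded_map_perm:
  fixes L :: "('k::comm_ring_1, 'v::ab_group_add, 'a) cplx_scheme"
    and L' :: "('k, 'w::ab_group_add, 'b) cplx_scheme" and \<mu> :: "('v, 'w) gmap"
  assumes L: "three_term_complex L" and L': "three_term_complex L'"
    and \<mu>: "graded_map L L' n k \<mu>" and \<sigma>: "\<sigma> permutes {1..n}"
  shows "graded_map L L' n k (\<mu>\<^bsup>\<sigma>\<^esup>)"
proof -
  define P where "P vs = map (\<lambda>i. vs ! (inv \<sigma> (Suc i) - 1)) [0..<n]" for vs :: "(int \<times> 'v) list"
  have app: "app (\<mu>\<^bsup>\<sigma>\<^esup>) vs = sgn_pow (koszul_exponent \<sigma> vs) (app \<mu> (P vs))" if "length vs = n" for vs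
    by (simp only: app_perm permuted_list[OF that] P_def)
  have inv: "inv \<sigma> (Suc i) \<in> {1..n}" if "i < n" for i
    using permutes_in_image[OF permutes_inv[OF \<sigma>], of "Suc i"] that by simp
  have hom: "homogeneous L (map (\<lambda>i. vs ! (inv \<sigma> (Suc i) - 1)) is)"
    if "homogeneous L vs" "length vs = n" "set is \<subseteq> {0..<n}" for vs "is"
  proof -
    have "vs ! (inv \<sigma> (Suc i) - 1) \<in> set vs" if "i \<in> set is" for i
    proof -
      have "i < n" using that \<open>set is \<subseteq> {0..<n}\<close> by auto
      from inv[OF this] show ?thesis using \<open>length vs = n\<close> by (intro nth_mem) auto
    qed
    then show ?thesis using that(1) by (auto simp: homogeneous_def)
  qed
  \<comment> \<open>The quantifier over \<open>z\<close> stands inside: one choice of surroundings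
    serves all entries of the slot, as linearity requires.\<close>
  have slot: "\<exists>us' ws'. length us' + 1 + length ws' = n \<and> homogeneous L us' \<and> homogeneous L ws' \<and>
      (\<forall>z. P (us @ (p, z) # ws) = us' @ (p, z) # ws')"
    if len: "length us + 1 + length ws = n" and us: "homogeneous L us" and ws: "homogeneous L ws" for us ws p
  proof -
    \<comment> \<open>\<open>m\<close> is the new place of the slot counted from 0, whereas
      permutations count positions from 1.\<close>
    define m where "m = \<sigma> (Suc (length us)) - 1"
    have m: "Suc m = \<sigma> (Suc (length us))" "m < n"
      using permutes_in_image[OF \<sigma>, of "Suc (length us)"] len by (auto simp: m_def)
    have invm: "inv \<sigma> (Suc m) = Suc (length us)"
      unfolding m(1) using permutes_inverses(2)[OF \<sigma>] by simp
    have ne: "inv \<sigma> (Suc i) - 1 \<noteq> length us" if "i < n" "i \<noteq> m" for i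
    proof
      assume "inv \<sigma> (Suc i) - 1 = length us"
      then have "inv \<sigma> (Suc i) = inv \<sigma> (Suc m)" using inv[OF that(1)] invm unfolding atLeastAtMost_iff by linarith
      then show False using permutes_inj[OF permutes_inv[OF \<sigma>]] that(2) by (auto dest: injD)
    qed
    \<comment> \<open>\<open>Q\<close> is used only away from \<open>m\<close>, so the entry in the
      slot is a filler; 0 keeps the list homogeneous.\<close>
    define Q where "Q is = map (\<lambda>i. (us @ (p, 0) # ws) ! (inv \<sigma> (Suc i) - 1)) is" for "is"
    have Q: "map (\<lambda>i. (us @ (p, z) # ws) ! (inv \<sigma> (Suc i) - 1)) is = Q is"
      if "set is \<subseteq> {0..<n} - {m}" for "is" z
      unfolding Q_def
    proof (intro map_cong refl)
      fix i assume "i \<in> set is"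
      then have "inv \<sigma> (Suc i) - 1 \<noteq> length us" using that by (intro ne) auto
      then show "(us @ (p, z) # ws) ! (inv \<sigma> (Suc i) - 1) = (us @ (p, 0) # ws) ! (inv \<sigma> (Suc i) - 1)"
        by (auto simp: nth_append nth_Cons')
    qed
    have "[0..<n] = [0..<m] @ m # [Suc m..<n]"
      using m(2) upt_add_eq_append[of 0 m "n - m"] by (simp add: upt_conv_Cons)
    then have "P (us @ (p, z) # ws) = Q [0..<m] @ (p, z) # Q [Suc m..<n]" for z
    proof -
      have "set [0..<m] \<subseteq> {0..<n} - {m}" "set [Suc m..<n] \<subseteq> {0..<n} - {m}" using m(2) by auto
      from this[THEN Q, of z] show ?thesis
        unfolding P_def \<open>[0..<n] = [0..<m] @ m # [Suc m..<n]\<close> using invm by simp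
    qed
    moreover have "homogeneous L (us @ (p, 0) # ws)"
      using us ws by (simp add: comp_closed[OF L])
    ultimately show ?thesis
      using m(2) len hom[of "us @ (p, 0) # ws" "[0..<m]"] hom[of "us @ (p, 0) # ws" "[Suc m..<n]"]
      by (intro exI[of _ "Q [0..<m]"] exI[of _ "Q [Suc m..<n]"]) (auto simp: Q_def)
  qed
  have kos: "koszul_exponent \<sigma> (us @ (p, x) # ws) = koszul_exponent \<sigma> (us @ (p, y) # ws)"
    for us ws p and x y :: 'v
    by (rule koszul_exponent_cong) simp
  show ?thesis
  proof (intro graded_mapI)
    show "arity (\<mu>\<^bsup>\<sigma>\<^esup>) = n" "gdeg (\<mu>\<^bsup>\<sigma>\<^esup>) = k" using graded_mapD(1,2)[OF \<mu>] by simp_all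
  next
    fix vs assume vs: "length vs = n" "homogeneous L vs"
    have "app \<mu> (P vs) \<in> comp L' (tdeg (P vs) + k)"
      using hom[OF vs(2,1)] by (intro graded_mapD(3)[OF \<mu>]) (simp_all add: P_def)
    then show "app (\<mu>\<^bsup>\<sigma>\<^esup>) vs \<in> comp L' (tdeg vs + k)"
      using tdeg_permuted[OF \<sigma> vs(1)] by (simp add: app vs(1) P_def comp_closed[OF L'])
  next
    fix us ws p x y
    assume h: "length us + 1 + length ws = n" "homogeneous L us" "homogeneous L ws" "x \<in> comp L p" "y \<in> comp L p"
    obtain us' ws' where s: "length us' + 1 + length ws' = n" "homogeneous L us'" "homogeneous L ws'"
      "P (us @ (p, z) # ws) = us' @ (p, z) # ws'" for z
      using slot[OF h(1-3)] by blast
    show "app (\<mu>\<^bsup>\<sigma>\<^esup>) (us @ (p, x + y) # ws) = app (\<mu>\<^bsup>\<sigma>\<^esup>) (us @ (p, x) # ws) + app (\<mu>\<^bsup>\<sigma>\<^esup>) (us @ (p, y) # ws)"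
      using h(1) graded_mapD(4)[OF \<mu> s(1-3) h(4,5)]
      by (simp add: app s(4) kos[of us p "x + y" ws x] kos[of us p y ws x] sgn_pow_def)
  next
    fix us ws p c x
    assume h: "length us + 1 + length ws = n" "homogeneous L us" "homogeneous L ws" "x \<in> comp L p"
    obtain us' ws' where s: "length us' + 1 + length ws' = n" "homogeneous L us'" "homogeneous L ws'"
      "P (us @ (p, z) # ws) = us' @ (p, z) # ws'" for z
      using slot[OF h(1-3)] by blast
    show "app (\<mu>\<^bsup>\<sigma>\<^esup>) (us @ (p, scal L c x) # ws) = scal L' c (app (\<mu>\<^bsup>\<sigma>\<^esup>) (us @ (p, x) # ws))"
      using h(1) graded_mapD(5)[OF \<mu> s(1-3) h(4)]
      by (simp add: app s(4) kos[of us p "scal L c x" ws x] sgn_pow_def scal_simps[OF L'])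
  qed
qed

lemma graded_map_skew_sum:
  assumes L: "three_term_complex L" and L': "three_term_complex L'" and \<mu>: "graded_map L L' n k \<mu>"
  shows "graded_map L L' n k (skew_sum \<mu>)"
proof -
  have n: "arity \<mu> = n" "gdeg \<mu> = k" using graded_mapD(1,2)[OF \<mu>] .
  have "skew_sum \<mu> = GMap n k (\<lambda>vs. \<Sum>\<sigma> | \<sigma> permutes {1..n}. app (if evenperm \<sigma> then \<mu>\<^bsup>\<sigma>\<^esup> else - (\<mu>\<^bsup>\<sigma>\<^esup>)) vs)"
    unfolding skew_sum_def n by (auto intro!: sum.cong)
  moreover have "graded_map L L' n k (if evenperm \<sigma> then \<mu>\<^bsup>\<sigma>\<^esup> else - (\<mu>\<^bsup>\<sigma>\<^esup>))" if "\<sigma> permutes {1..n}" for \<sigma>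
    using graded_map_perm[OF L L' \<mu> that] by (auto intro: graded_map_uminus[OF L'])
  ultimately show ?thesis
    by (auto intro!: graded_map_sum[OF L'] simp: finite_permutations)
qed

lemma tensor_exponent_cong:
  "map fst vs = map fst ws \<Longrightarrow> tensor_exponent \<nu>s vs = tensor_exponent \<nu>s ws"
proof (induction \<nu>s arbitrary: vs ws)
  case (Cons \<nu> \<nu>s)
  have t: "map fst (take m vs) = map fst (take m ws)" and d: "map fst (drop m vs) = map fst (drop m ws)" for m
    using Cons.prems by (simp_all flip: take_map drop_map)
  show ?case unfolding tensor_exponent.simps tdeg_def t Cons.IH[OF d] ..
qed simp

lemma homogeneous_take_drop:
  "homogeneous L vs \<Longrightarrow> homogeneous L (take m vs)" "homogeneous L vs \<Longrightarrow> homogeneous L (drop m vs)"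
  by (auto simp: homogeneous_def dest: in_set_takeD in_set_dropD)

lemma value_of_homogeneous:
  "graded_map L L' n k \<nu> \<Longrightarrow> length vs = n \<Longrightarrow> homogeneous L vs \<Longrightarrow>
    snd (value_of \<nu> vs) \<in> comp L' (fst (value_of \<nu> vs))"
  using graded_mapD(2,3)[of L L' n k \<nu>] by (simp add: value_of_def add.commute)

lemma block_values_homogeneous:
  assumes "\<And>\<nu>. \<nu> \<in> set \<nu>s \<Longrightarrow> graded_map L L' (arity \<nu>) (gdeg \<nu>) \<nu>"
    and "length vs = sum_list (map arity \<nu>s)" and "homogeneous L vs"
  shows "homogeneous L' (block_values \<nu>s vs)" "length (block_values \<nu>s vs) = length \<nu>s"
    "tdeg (block_values \<nu>s vs) = tdeg vs + sum_list (map gdeg \<nu>s)"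
proof -
  have "homogeneous L' (block_values \<nu>s vs) \<and> length (block_values \<nu>s vs) = length \<nu>s \<and>
      tdeg (block_values \<nu>s vs) = tdeg vs + sum_list (map gdeg \<nu>s)"
    using assms
  proof (induction \<nu>s arbitrary: vs)
    case (Cons \<nu> \<nu>s)
    have "graded_map L L' (arity \<nu>) (gdeg \<nu>) \<nu>" using Cons.prems(1) by simp
    from value_of_homogeneous[OF this _ homogeneous_take_drop(1)[OF Cons.prems(3)]]
    have "snd (value_of \<nu> (take (arity \<nu>) vs)) \<in> comp L' (fst (value_of \<nu> (take (arity \<nu>) vs)))"
      using Cons.prems(2) by simp
    moreover have "homogeneous L' (block_values \<nu>s (drop (arity \<nu>) vs)) \<and>
        length (block_values \<nu>s (drop (arity \<nu>) vs)) = length \<nu>s \<and>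
        tdeg (block_values \<nu>s (drop (arity \<nu>) vs)) = tdeg (drop (arity \<nu>) vs) + sum_list (map gdeg \<nu>s)"
      using Cons.prems by (intro Cons.IH homogeneous_take_drop) auto
    moreover have "tdeg (take (arity \<nu>) vs) + tdeg (drop (arity \<nu>) vs) = tdeg vs"
      by (simp flip: tdeg_simps(3))
    ultimately show ?case by (simp add: value_of_def)
  qed simp
  then show "homogeneous L' (block_values \<nu>s vs)" "length (block_values \<nu>s vs) = length \<nu>s"
    "tdeg (block_values \<nu>s vs) = tdeg vs + sum_list (map gdeg \<nu>s)" by auto
qed

text \<open>The blocks partition the arguments, so the varying argument lies in exactly one block
  and all other block values stay fixed. By induction on the blocks, the slot is either in the first
  block or is handed on to the rest.\<close>

lemma block_values_slot:
  assumes "\<And>\<nu>. \<nu> \<in> set \<nu>s \<Longrightarrow> graded_map L L' (arity \<nu>) (gdeg \<nu>) \<nu>"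
    and "length us + 1 + length ws = sum_list (map arity \<nu>s)"
    and "homogeneous L us" "homogeneous L ws"
  obtains us' \<nu> us1 ws1 ws' where "\<nu> \<in> set \<nu>s" "length us' + 1 + length ws' = length \<nu>s"
      "homogeneous L' us'" "homogeneous L' ws'" "homogeneous L us1" "homogeneous L ws1"
      "length us1 + 1 + length ws1 = arity \<nu>"
      "\<And>z. block_values \<nu>s (us @ (p, z) # ws) = us' @ value_of \<nu> (us1 @ (p, z) # ws1) # ws'"
  using assms
proof (induction \<nu>s arbitrary: us thesis)
  case (Cons \<nu> \<nu>s)
  show ?case
  proof (cases "length us < arity \<nu>")
    case True
    \<comment> \<open>\<open>m\<close> counts the arguments of the first block to the right of the
      slot.\<close>
    define m where "m = arity \<nu> - 1 - length us"
    have m: "arity \<nu> - length us = Suc m" "length us + 1 + m = arity \<nu>" using True by (auto simp: m_def)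
    have l: "length (drop m ws) = sum_list (map arity \<nu>s)" "m \<le> length ws" using Cons.prems(3) m by auto
    have h: "homogeneous L' (block_values \<nu>s (drop m ws))" "length (block_values \<nu>s (drop m ws)) = length \<nu>s"
      using Cons.prems(2) by (auto intro!: block_values_homogeneous l homogeneous_take_drop Cons.prems(5))
    show ?thesis
      by (rule Cons.prems(1)[of \<nu> "[]" "block_values \<nu>s (drop m ws)" us "take m ws"])
        (use True m l h Cons.prems(4,5) in \<open>simp_all add: homogeneous_take_drop\<close>)
  next
    case False
    define us2 where "us2 = drop (arity \<nu>) us"
    have l: "length us2 + 1 + length ws = sum_list (map arity \<nu>s)" using False Cons.prems(3) by (simp add: us2_def)
    have h: "homogeneous L us2" unfolding us2_def by (intro homogeneous_take_drop Cons.prems(4))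
    have g: "graded_map L L' (arity \<rho>) (gdeg \<rho>) \<rho>" if "\<rho> \<in> set \<nu>s" for \<rho> using Cons.prems(2) that by simp
    obtain us' \<nu>' us1 ws1 ws' where s: "\<nu>' \<in> set \<nu>s" "length us' + 1 + length ws' = length \<nu>s"
      "homogeneous L' us'" "homogeneous L' ws'" "homogeneous L us1" "homogeneous L ws1"
      "length us1 + 1 + length ws1 = arity \<nu>'"
      "\<And>z. block_values \<nu>s (us2 @ (p, z) # ws) = us' @ value_of \<nu>' (us1 @ (p, z) # ws1) # ws'"
      by (rule Cons.IH[OF _ g l h Cons.prems(5)]) blast+
    have "graded_map L L' (arity \<nu>) (gdeg \<nu>) \<nu>" using Cons.prems(2) by simp
    from value_of_homogeneous[OF this _ homogeneous_take_drop(1)[OF Cons.prems(4)]]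
    have v: "snd (value_of \<nu> (take (arity \<nu>) us)) \<in> comp L' (fst (value_of \<nu> (take (arity \<nu>) us)))"
      using False by simp
    show ?thesis
      by (rule Cons.prems(1)[of \<nu>' "value_of \<nu> (take (arity \<nu>) us) # us'" ws' us1 ws1])
        (use False v s in \<open>simp_all add: us2_def\<close>)
  qed
qed simp

text \<open>Linearity in a slot is linearity of the block that contains it, followed by linearity of
  the outer map. The sign again depends on degrees only.\<close>

lemma graded_map_tensor:
  assumes L': "three_term_complex L'" and L'': "three_term_complex L''"
    and \<mu>: "graded_map L' L'' m k \<mu>" and m: "m = length \<nu>s"
    and g: "\<And>\<nu>. \<nu> \<in> set \<nu>s \<Longrightarrow> graded_map L L' (arity \<nu>) (gdeg \<nu>) \<nu>"
    and n: "n = sum_list (map arity \<nu>s)" and l: "l = k + sum_list (map gdeg \<nu>s)"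
  shows "graded_map L L'' n l (\<mu> \<circ>\<^sub>\<otimes> \<nu>s)"
proof (rule graded_mapI)
  show "arity (\<mu> \<circ>\<^sub>\<otimes> \<nu>s) = n" "gdeg (\<mu> \<circ>\<^sub>\<otimes> \<nu>s) = l" using graded_mapD(2)[OF \<mu>] by (simp_all add: n l)
next
  fix vs assume "length vs = n" "homogeneous L vs"
  note b = block_values_homogeneous[OF g, of \<nu>s vs, OF _ this[unfolded n]]
  show "app (\<mu> \<circ>\<^sub>\<otimes> \<nu>s) vs \<in> comp L'' (tdeg vs + l)"
    using graded_mapD(3)[OF \<mu>, of "block_values \<nu>s vs"] b
    by (simp add: app_tensor comp_closed[OF L''] l m add_ac)
next
  fix us ws p x y
  assume h: "length us + 1 + length ws = n" "homogeneous L us" "homogeneous L ws" "x \<in> comp L p" "y \<in> comp L p"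
  obtain us' \<nu> us1 ws1 ws' where s: "\<nu> \<in> set \<nu>s" "length us' + 1 + length ws' = length \<nu>s"
      "homogeneous L' us'" "homogeneous L' ws'" "homogeneous L us1" "homogeneous L ws1"
      "length us1 + 1 + length ws1 = arity \<nu>"
      "\<And>z. block_values \<nu>s (us @ (p, z) # ws) = us' @ value_of \<nu> (us1 @ (p, z) # ws1) # ws'"
    by (rule block_values_slot[OF g h(1)[unfolded n] h(2,3)]) blast+
  have e: "tensor_exponent \<nu>s (us @ (p, z) # ws) = tensor_exponent \<nu>s (us @ (p, x) # ws)" for z
    by (rule tensor_exponent_cong) simp
  have v: "app \<nu> (us1 @ (p, z) # ws1) \<in> comp L' (gdeg \<nu> + (tdeg us1 + (p + tdeg ws1)))" if "z \<in> comp L p" for z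
    using graded_mapD(3)[OF g[OF s(1)], of "us1 @ (p, z) # ws1"] s that by (simp add: add_ac)
  show "app (\<mu> \<circ>\<^sub>\<otimes> \<nu>s) (us @ (p, x + y) # ws) = app (\<mu> \<circ>\<^sub>\<otimes> \<nu>s) (us @ (p, x) # ws) + app (\<mu> \<circ>\<^sub>\<otimes> \<nu>s) (us @ (p, y) # ws)"
    unfolding app_tensor e[of "x + y"] e[of y] s(8)
    using graded_mapD(4)[OF g[OF s(1)] s(7,5,6) h(4,5)] graded_mapD(4)[OF \<mu> s(2)[folded m] s(3,4) v[OF h(4)] v[OF h(5)]]
    by (simp add: value_of_def sgn_pow_def)
next
  fix us ws p c x
  assume h: "length us + 1 + length ws = n" "homogeneous L us" "homogeneous L ws" "x \<in> comp L p"
  obtain us' \<nu> us1 ws1 ws' where s: "\<nu> \<in> set \<nu>s" "length us' + 1 + length ws' = length \<nu>s"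
      "homogeneous L' us'" "homogeneous L' ws'" "homogeneous L us1" "homogeneous L ws1"
      "length us1 + 1 + length ws1 = arity \<nu>"
      "\<And>z. block_values \<nu>s (us @ (p, z) # ws) = us' @ value_of \<nu> (us1 @ (p, z) # ws1) # ws'"
    by (rule block_values_slot[OF g h(1)[unfolded n] h(2,3)]) blast+
  have e: "tensor_exponent \<nu>s (us @ (p, z) # ws) = tensor_exponent \<nu>s (us @ (p, x) # ws)" for z
    by (rule tensor_exponent_cong) simp
  have v: "app \<nu> (us1 @ (p, z) # ws1) \<in> comp L' (gdeg \<nu> + (tdeg us1 + (p + tdeg ws1)))" if "z \<in> comp L p" for z
    using graded_mapD(3)[OF g[OF s(1)], of "us1 @ (p, z) # ws1"] s that by (simp add: add_ac)
  show "app (\<mu> \<circ>\<^sub>\<otimes> \<nu>s) (us @ (p, scal L c x) # ws) = scal L'' c (app (\<mu> \<circ>\<^sub>\<otimes> \<nu>s) (us @ (p, x) # ws))"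
    unfolding app_tensor e[of "scal L c x"] s(8)
    using graded_mapD(5)[OF g[OF s(1)] s(7,5,6) h(4)] graded_mapD(5)[OF \<mu> s(2)[folded m] s(3,4) v[OF h(4)]]
    by (simp add: value_of_def sgn_pow_def scal_simps[OF L''])
qed

text \<open>With identities in the remaining slots, a partial composition is a tensor composition,
  so gradedness has to be proved by hand for the latter only.\<close>

definition id_map :: "('v, 'v) gmap"
  where "id_map = GMap 1 0 (\<lambda>vs. snd (hd vs))"

lemma id_map_simps [simp]: "arity id_map = 1" "gdeg id_map = 0" "app id_map (x # vs) = snd x"
  by (simp_all add: id_map_def)

lemma graded_map_id: "graded_map L L 1 0 id_map"
  by (auto simp: graded_map_def length_Suc_conv)

lemma block_values_id:
  "j \<le> length vs \<Longrightarrow> block_values (replicate j id_map @ \<nu>s) vs = take j vs @ block_values \<nu>s (drop j vs)"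
  by (induction j arbitrary: vs) (auto simp: value_of_def Suc_le_length_iff)

lemma tensor_exponent_id:
  "j \<le> length vs \<Longrightarrow> tensor_exponent (replicate j id_map @ \<nu>s) vs =
    sum_list (map gdeg \<nu>s) * tdeg (take j vs) + tensor_exponent \<nu>s (drop j vs)"
  by (induction j arbitrary: vs) (auto simp: Suc_le_length_iff sum_list_replicate algebra_simps)

text \<open>The signs agree because identities have degree 0: only the inserted map contributes, and
  it passes the first \<open>i - 1\<close> arguments.\<close>

lemma app_circ_eq_tensor:
  assumes "1 \<le> i" "i \<le> arity \<mu>" "length vs = arity \<mu> + arity \<nu> - 1"
  shows "app (\<mu> \<circ>\<^bsub>i\<^esub> \<nu>) vs =
    app (\<mu> \<circ>\<^sub>\<otimes> (replicate (i - 1) id_map @ \<nu> # replicate (arity \<mu> - i) id_map)) vs"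
proof -
  have l: "i - 1 \<le> length vs" "arity \<mu> - i = length (drop (i - 1 + arity \<nu>) vs)" using assms by auto
  then show ?thesis
    using block_values_id[of "arity \<mu> - i" "drop (i - 1 + arity \<nu>) vs" "[]"]
      tensor_exponent_id[of "arity \<mu> - i" "drop (i - 1 + arity \<nu>) vs" "[]"]
    by (simp add: app_circ app_tensor block_values_id tensor_exponent_id sum_list_replicate add.commute)
qed

lemma graded_map_cong:
  assumes \<mu>: "graded_map L L' n k \<mu>" and "arity \<nu> = n" "gdeg \<nu> = k"
    and e: "\<And>vs. length vs = n \<Longrightarrow> app \<nu> vs = app \<mu> vs"
  shows "graded_map L L' n k \<nu>"
  using graded_mapD[OF \<mu>] assms(2,3) by (intro graded_mapI) (simp_all add: e)

lemma graded_map_circ: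
  assumes L: "three_term_complex L" and L': "three_term_complex L'"
    and \<mu>: "graded_map L L' m k \<mu>" and \<nu>: "graded_map L L n l \<nu>"
    and i: "1 \<le> i" "i \<le> m" and N: "N = m + n - 1" and K: "K = k + l"
  shows "graded_map L L' N K (\<mu> \<circ>\<^bsub>i\<^esub> \<nu>)"
proof -
  have m: "arity \<mu> = m" "gdeg \<mu> = k" "arity \<nu> = n" "gdeg \<nu> = l"
    using graded_mapD(1,2)[OF \<mu>] graded_mapD(1,2)[OF \<nu>] by auto
  have "graded_map L L' N K (\<mu> \<circ>\<^sub>\<otimes> (replicate (i - 1) id_map @ \<nu> # replicate (m - i) id_map))"
    by (rule graded_map_tensor[OF L L' \<mu>])
      (use i m \<nu> graded_map_id[of L] in \<open>auto simp: N K sum_list_replicate\<close>)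
  then show ?thesis
    by (rule graded_map_cong) (use i m N K in \<open>simp_all add: app_circ_eq_tensor\<close>)
qed

lemma graded_map_bdry:
  assumes L: "three_term_complex L" and L': "three_term_complex L'"
    and \<mu>: "graded_map L L' n k \<mu>" and l: "l = k - 1"
  shows "graded_map L L' n l (bdry L L' \<mu>)"
proof -
  have m: "arity \<mu> = n" "gdeg \<mu> = k" using graded_mapD(1,2)[OF \<mu>] .
  have d: "graded_map L L' n l (diff L' \<circ>\<^sub>\<otimes> [\<mu>])"
    by (rule graded_map_tensor[OF L' L' complex_diff[OF L']]) (use m \<mu> in \<open>auto simp: l\<close>)
  have "graded_map L L' n l (\<mu> \<circ>\<^bsub>i\<^esub> diff L)" if "i \<in> {1..n}" for i
    by (rule graded_map_circ[OF L L' \<mu> complex_diff[OF L]]) (use that in \<open>auto simp: l\<close>)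
  from graded_map_sgn[OF L' graded_map_sum[OF L' _ this], of "{1..n}" "\<lambda>i. i" k]
  have "graded_map L L' n l (GMap n l (\<lambda>vs. sgn_pow k (\<Sum>i\<in>{1..n}. app (\<mu> \<circ>\<^bsub>i\<^esub> diff L) vs)))"
    by simp
  from graded_map_diff[OF L' d this] show ?thesis
    by (rule graded_map_cong) (simp_all add: m l bdry_def)
qed

text \<open>A map of degree \<open>k\<close> vanishes on arguments of total degree greater than \<open>2 - k\<close>.\<close>

lemma map_eqI:
  assumes L: "three_term_complex L" and L': "three_term_complex L'"
    and \<mu>: "graded_map L L' n k \<mu>" and \<nu>: "graded_map L L' n k \<nu>"
    and eq: "\<And>vs. length vs = n \<Longrightarrow> homogeneous L vs \<Longrightarrow> fst ` set vs \<subseteq> {0, 1, 2} \<Longrightarrow> tdeg vs + k \<le> 2 \<Longrightarrow>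
      app \<mu> vs = app \<nu> vs"
  shows "map_eq L \<mu> \<nu>"
proof -
  have "app \<mu> vs = app \<nu> vs" if vs: "length vs = n" "homogeneous L vs" for vs
  proof (cases "fst ` set vs \<subseteq> {0, 1, 2}")
    case False
    then obtain x where x: "x \<in> set vs" "fst x \<notin> {0, 1, 2}" by auto
    then obtain us ws where s: "vs = us @ (fst x, snd x) # ws" by (metis prod.collapse split_list)
    have "snd x = 0"
      using vs(2) complex_trivial[OF L x(2)] unfolding s by simp
    then show ?thesis
      using graded_map_slot(4)[OF L L' \<mu>, of us ws] graded_map_slot(4)[OF L L' \<nu>, of us ws] vs
      unfolding s by simp
  next
    case True
    show ?thesis
    proof (cases "tdeg vs + k \<le> 2")
      case False
      then have "comp L' (tdeg vs + k) = {0}" by (intro complex_trivial[OF L']) auto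
      then show ?thesis using graded_mapD(3)[OF \<mu> vs] graded_mapD(3)[OF \<nu> vs] by simp
    qed (use eq vs True in blast)
  qed
  then show ?thesis
    unfolding map_eq_def using graded_mapD(1,2)[OF \<mu>] graded_mapD(1,2)[OF \<nu>] by auto
qed

lemma map_eqD: "map_eq L \<mu> \<nu> \<Longrightarrow> length vs = arity \<mu> \<Longrightarrow> homogeneous L vs \<Longrightarrow> app \<mu> vs = app \<nu> vs"
  by (simp add: map_eq_def)

text \<open>The boundary equation solved for d of a value. As a rewrite rule it moves d inwards
  until it is applied to arguments only, which gives the normal form used in all later comparisons.
  The next three lemmas do the same for more arguments.\<close>

lemma diff_app1:
  assumes "map_eq L (bdry L L' \<mu>) \<rho>" and L: "three_term_complex L" and L': "three_term_complex L'"
    and \<mu>: "graded_map L L' 1 k \<mu>"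
  shows "a \<in> comp L p \<Longrightarrow> s = p + k \<Longrightarrow>
    app (diff L') [(s, app \<mu> [(p, a)])] = app \<rho> [(p, a)] + sgn_pow k (app \<mu> [(p - 1, app (diff L) [(p, a)])])"
  using map_eqD[OF assms(1), of "[(p, a)]"]
  by (simp add: graded_mapD(1,2)[OF \<mu>] graded_mapD(1,2)[OF complex_diff[OF L]]
      graded_mapD(1,2)[OF complex_diff[OF L']] bdry_def app_tensor app_circ value_of_def numeral_eq_Suc diff_eq_eq add_ac)

lemma diff_app2:
  assumes "map_eq L (bdry L L' \<mu>) \<rho>" and L: "three_term_complex L" and L': "three_term_complex L'"
    and \<mu>: "graded_map L L' 2 k \<mu>"
  shows "a \<in> comp L p \<Longrightarrow> b \<in> comp L q \<Longrightarrow> s = p + q + k \<Longrightarrow>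
    app (diff L') [(s, app \<mu> [(p, a), (q, b)])] = app \<rho> [(p, a), (q, b)] + sgn_pow k (app \<mu> [(p - 1, app (diff L) [(p, a)]), (q, b)]
      + sgn_pow (p) (app \<mu> [(p, a), (q - 1, app (diff L) [(q, b)])]))"
  using map_eqD[OF assms(1), of "[(p, a), (q, b)]"]
  by (simp add: graded_mapD(1,2)[OF \<mu>] graded_mapD(1,2)[OF complex_diff[OF L]]
      graded_mapD(1,2)[OF complex_diff[OF L']] bdry_def app_tensor app_circ value_of_def numeral_eq_Suc diff_eq_eq add_ac)

lemma diff_app3:
  assumes "map_eq L (bdry L L' \<mu>) \<rho>" and L: "three_term_complex L" and L': "three_term_complex L'"
    and \<mu>: "graded_map L L' 3 k \<mu>"
  shows "a \<in> comp L p \<Longrightarrow> b \<in> comp L q \<Longrightarrow> c \<in> comp L r \<Longrightarrow> s = p + q + r + k \<Longrightarrow>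
    app (diff L') [(s, app \<mu> [(p, a), (q, b), (r, c)])] = app \<rho> [(p, a), (q, b), (r, c)] + sgn_pow k (app \<mu> [(p - 1, app (diff L) [(p, a)]), (q, b), (r, c)]
      + sgn_pow (p) (app \<mu> [(p, a), (q - 1, app (diff L) [(q, b)]), (r, c)])
      + sgn_pow (p + q) (app \<mu> [(p, a), (q, b), (r - 1, app (diff L) [(r, c)])]))"
  using map_eqD[OF assms(1), of "[(p, a), (q, b), (r, c)]"]
  by (simp add: graded_mapD(1,2)[OF \<mu>] graded_mapD(1,2)[OF complex_diff[OF L]]
      graded_mapD(1,2)[OF complex_diff[OF L']] bdry_def app_tensor app_circ value_of_def numeral_eq_Suc diff_eq_eq add_ac)

lemma diff_app4:
  assumes "map_eq L (bdry L L' \<mu>) \<rho>" and L: "three_term_complex L" and L': "three_term_complex L'"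
    and \<mu>: "graded_map L L' 4 k \<mu>"
  shows "a \<in> comp L p \<Longrightarrow> b \<in> comp L q \<Longrightarrow> c \<in> comp L r \<Longrightarrow> d \<in> comp L t \<Longrightarrow> s = p + q + r + t + k \<Longrightarrow>
    app (diff L') [(s, app \<mu> [(p, a), (q, b), (r, c), (t, d)])] = app \<rho> [(p, a), (q, b), (r, c), (t, d)] + sgn_pow k (app \<mu> [(p - 1, app (diff L) [(p, a)]), (q, b), (r, c), (t, d)]
      + sgn_pow (p) (app \<mu> [(p, a), (q - 1, app (diff L) [(q, b)]), (r, c), (t, d)])
      + sgn_pow (p + q) (app \<mu> [(p, a), (q, b), (r - 1, app (diff L) [(r, c)]), (t, d)])
      + sgn_pow (p + q + r) (app \<mu> [(p, a), (q, b), (r, c), (t - 1, app (diff L) [(t, d)])]))"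
  using map_eqD[OF assms(1), of "[(p, a), (q, b), (r, c), (t, d)]"]
  by (simp add: graded_mapD(1,2)[OF \<mu>] graded_mapD(1,2)[OF complex_diff[OF L]]
      graded_mapD(1,2)[OF complex_diff[OF L']] bdry_def app_tensor app_circ value_of_def numeral_eq_Suc diff_eq_eq add_ac)

subsection \<open>Transport along isomorphisms with identity linear part\<close>

text \<open>An unfolded cycle would no longer match the evaluation rules for
  \<open>cyc [1,2]\<close> and its companions.\<close>

declare cycle_of_list.simps [simp del]

lemma cyc_permutes: "set cs \<subseteq> {1..n} \<Longrightarrow> cyc cs permutes {1..n}"
  using cycle_permutes permutes_subset by blast

lemma double_transposition_permutes: "4 \<le> n \<Longrightarrow> cyc [1,3] \<circ> cyc [2,4] permutes {1..n}"
  by (intro permutes_compose cyc_permutes) auto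

lemma diff_diff:
  assumes L: "three_term_complex L" and x: "x \<in> comp L p" and q: "q = p - 1"
  shows "app (diff L) [(q, app (diff L) [(p, x)])] = 0"
  using map_eqD[OF complex_diff_diff[OF L], of "[(p, x)]"] x q
  by (simp add: graded_mapD(1,2)[OF complex_diff[OF L]] app_circ value_of_def)

text \<open>Only finitely many degree patterns matter in a 3-term complex. Checking each one with
  literal degrees lets every Koszul sign evaluate; the following variants add the bound on the total
  degree.\<close>

lemma degree_cases2:
  fixes p q :: int
  assumes "fst ` set [(p, a), (q, b)] \<subseteq> {0, 1, 2}"
  shows "p = 0 \<and> q = 0 \<or>
      p = 0 \<and> q = 1 \<or>
      p = 0 \<and> q = 2 \<or>
      p = 1 \<and> q = 0 \<or>
      p = 1 \<and> q = 1 \<or>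
      p = 1 \<and> q = 2 \<or>
      p = 2 \<and> q = 0 \<or>
      p = 2 \<and> q = 1 \<or>
      p = 2 \<and> q = 2"
proof -
  have "p = 0 \<or> p = 1 \<or> p = 2" "q = 0 \<or> q = 1 \<or> q = 2" using assms(1) by auto
  then show ?thesis by presburger
qed

lemma degree_cases3_2:
  fixes p q r :: int
  assumes "fst ` set [(p, a), (q, b), (r, c)] \<subseteq> {0, 1, 2}" "p + q + r \<le> 2"
  shows "p = 0 \<and> q = 0 \<and> r = 0 \<or>
      p = 0 \<and> q = 0 \<and> r = 1 \<or>
      p = 0 \<and> q = 0 \<and> r = 2 \<or>
      p = 0 \<and> q = 1 \<and> r = 0 \<or>
      p = 0 \<and> q = 1 \<and> r = 1 \<or>
      p = 0 \<and> q = 2 \<and> r = 0 \<or>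
      p = 1 \<and> q = 0 \<and> r = 0 \<or>
      p = 1 \<and> q = 0 \<and> r = 1 \<or>
      p = 1 \<and> q = 1 \<and> r = 0 \<or>
      p = 2 \<and> q = 0 \<and> r = 0"
proof -
  have "0 \<le> p" "0 \<le> q" "0 \<le> r" using assms(1) by auto
  then show ?thesis using assms(2) by presburger
qed

lemma degree_cases3_1:
  fixes p q r :: int
  assumes "fst ` set [(p, a), (q, b), (r, c)] \<subseteq> {0, 1, 2}" "p + q + r \<le> 1"
  shows "p = 0 \<and> q = 0 \<and> r = 0 \<or>
      p = 0 \<and> q = 0 \<and> r = 1 \<or>
      p = 0 \<and> q = 1 \<and> r = 0 \<or>
      p = 1 \<and> q = 0 \<and> r = 0"
proof -
  have "0 \<le> p" "0 \<le> q" "0 \<le> r" using assms(1) by auto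
  then show ?thesis using assms(2) by presburger
qed

lemma degree_cases4_1:
  fixes p q r t :: int
  assumes "fst ` set [(p, a), (q, b), (r, c), (t, d)] \<subseteq> {0, 1, 2}" "p + q + r + t \<le> 1"
  shows "p = 0 \<and> q = 0 \<and> r = 0 \<and> t = 0 \<or>
      p = 0 \<and> q = 0 \<and> r = 0 \<and> t = 1 \<or>
      p = 0 \<and> q = 0 \<and> r = 1 \<and> t = 0 \<or>
      p = 0 \<and> q = 1 \<and> r = 0 \<and> t = 0 \<or>
      p = 1 \<and> q = 0 \<and> r = 0 \<and> t = 0"
proof -
  have "0 \<le> p" "0 \<le> q" "0 \<le> r" "0 \<le> t" using assms(1) by auto
  then show ?thesis using assms(2) by presburger
qed

lemma degree_0:
  assumes "fst ` set vs \<subseteq> {0, 1, 2}" "tdeg vs \<le> 0" "x \<in> set vs"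
  shows "fst x = 0"
proof -
  have pos: "\<And>y. y \<in> set (map fst vs) \<Longrightarrow> 0 \<le> y" using assms(1) by auto
  then have "sum_list (map fst vs) = 0"
    using assms(2) sum_list_nonneg[of "map fst vs"] by (simp add: tdeg_def)
  then show ?thesis using sum_list_nonneg_eq_0_iff[of "map fst vs", OF pos] assms(3) by auto
qed

text \<open>Serves where the boundary of a map is still to be determined, whereas
  \<open>diff_app2\<close> presupposes a boundary equation.\<close>

lemma app_bdry2:
  assumes L: "three_term_complex L" and L': "three_term_complex L'" and "arity \<mu> = 2" "gdeg \<mu> = k"
  shows "app (bdry L L' \<mu>) [(p, a), (q, b)] =
    app (diff L') [(p + q + k, app \<mu> [(p, a), (q, b)])] - sgn_pow k (app \<mu> [(p - 1, app (diff L) [(p, a)]), (q, b)]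
      + sgn_pow (p) (app \<mu> [(p, a), (q - 1, app (diff L) [(q, b)])]))"
  using assms(3,4)
  by (simp add: graded_mapD(1,2)[OF complex_diff[OF L]] graded_mapD(1,2)[OF complex_diff[OF L']]
      bdry_def app_tensor app_circ value_of_def numeral_eq_Suc add_ac)

lemma app_bdry3:
  assumes L: "three_term_complex L" and L': "three_term_complex L'" and "arity \<mu> = 3" "gdeg \<mu> = k"
  shows "app (bdry L L' \<mu>) [(p, a), (q, b), (r, c)] =
    app (diff L') [(p + q + r + k, app \<mu> [(p, a), (q, b), (r, c)])] - sgn_pow k (app \<mu> [(p - 1, app (diff L) [(p, a)]), (q, b), (r, c)]
      + sgn_pow (p) (app \<mu> [(p, a), (q - 1, app (diff L) [(q, b)]), (r, c)])
      + sgn_pow (p + q) (app \<mu> [(p, a), (q, b), (r - 1, app (diff L) [(r, c)])]))"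
  using assms(3,4)
  by (simp add: graded_mapD(1,2)[OF complex_diff[OF L]] graded_mapD(1,2)[OF complex_diff[OF L']]
      bdry_def app_tensor app_circ value_of_def numeral_eq_Suc add_ac)

lemma app_bdry4:
  assumes L: "three_term_complex L" and L': "three_term_complex L'" and "arity \<mu> = 4" "gdeg \<mu> = k"
  shows "app (bdry L L' \<mu>) [(p, a), (q, b), (r, c), (t, d)] =
    app (diff L') [(p + q + r + t + k, app \<mu> [(p, a), (q, b), (r, c), (t, d)])] - sgn_pow k (app \<mu> [(p - 1, app (diff L) [(p, a)]), (q, b), (r, c), (t, d)]
      + sgn_pow (p) (app \<mu> [(p, a), (q - 1, app (diff L) [(q, b)]), (r, c), (t, d)])
      + sgn_pow (p + q) (app \<mu> [(p, a), (q, b), (r - 1, app (diff L) [(r, c)]), (t, d)])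
      + sgn_pow (p + q + r) (app \<mu> [(p, a), (q, b), (r, c), (t - 1, app (diff L) [(t, d)])]))"
  using assms(3,4)
  by (simp add: graded_mapD(1,2)[OF complex_diff[OF L]] graded_mapD(1,2)[OF complex_diff[OF L']]
      bdry_def app_tensor app_circ value_of_def numeral_eq_Suc add_ac)

text \<open>The conditions of \<open>leibniz3_algebra\<close> with the operations as arguments
  instead of record fields, because two structures on one complex have to be compared.\<close>

definition leibniz3 :: "('k::comm_ring_1, 'v::ab_group_add, 'a) cplx_scheme \<Rightarrow>
    ('v, 'v) gmap \<Rightarrow> ('v, 'v) gmap \<Rightarrow> ('v, 'v) gmap \<Rightarrow> bool"
  where "leibniz3 L l2 l3 l4 \<longleftrightarrow>
     three_term_complex L \<and>
     graded_map L L 2 0 l2 \<and> graded_map L L 3 1 l3 \<and> graded_map L L 4 2 l4 \<and>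
     map_eq L (bdry L L l2) (zero_map 2 (-1)) \<and>
     map_eq L (bdry L L l3)
       (l2 \<circ>\<^bsub>2\<^esub> l2 - l2 \<circ>\<^bsub>1\<^esub> l2 - (l2 \<circ>\<^bsub>2\<^esub> l2)\<^bsup>cyc [1,2]\<^esup>) \<and>
     map_eq L (bdry L L l4)
       (l2 \<circ>\<^bsub>1\<^esub> l3 + l2 \<circ>\<^bsub>2\<^esub> l3 - (l2 \<circ>\<^bsub>2\<^esub> l3)\<^bsup>cyc [1,2]\<^esup> + (l2 \<circ>\<^bsub>2\<^esub> l3)\<^bsup>cyc [1,2,3]\<^esup>
        - l3 \<circ>\<^bsub>1\<^esub> l2 + l3 \<circ>\<^bsub>2\<^esub> l2 - (l3 \<circ>\<^bsub>2\<^esub> l2)\<^bsup>cyc [1,2]\<^esup>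
        - l3 \<circ>\<^bsub>3\<^esub> l2 + (l3 \<circ>\<^bsub>3\<^esub> l2)\<^bsup>cyc [2,3]\<^esup> - (l3 \<circ>\<^bsub>3\<^esub> l2)\<^bsup>cyc [1,3,2]\<^esup>) \<and>
     map_eq L (zero_map 5 2)
       (l2 \<circ>\<^bsub>1\<^esub> l4 - l2 \<circ>\<^bsub>2\<^esub> l4 + (l2 \<circ>\<^bsub>2\<^esub> l4)\<^bsup>cyc [1,2]\<^esup> - (l2 \<circ>\<^bsub>2\<^esub> l4)\<^bsup>cyc [1,2,3]\<^esup> + (l2 \<circ>\<^bsub>2\<^esub> l4)\<^bsup>cyc [1,2,3,4]\<^esup>
        + l3 \<circ>\<^bsub>1\<^esub> l3 + l3 \<circ>\<^bsub>2\<^esub> l3 - (l3 \<circ>\<^bsub>2\<^esub> l3)\<^bsup>cyc [1,2]\<^esup> + (l3 \<circ>\<^bsub>2\<^esub> l3)\<^bsup>cyc [1,2,3]\<^esup>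
        + l3 \<circ>\<^bsub>3\<^esub> l3 - (l3 \<circ>\<^bsub>3\<^esub> l3)\<^bsup>cyc [2,3]\<^esup> + (l3 \<circ>\<^bsub>3\<^esub> l3)\<^bsup>cyc [1,3,2]\<^esup>
        + (l3 \<circ>\<^bsub>3\<^esub> l3)\<^bsup>cyc [2,3,4]\<^esup> - (l3 \<circ>\<^bsub>3\<^esub> l3)\<^bsup>cyc [1,3,4,2]\<^esup> + (l3 \<circ>\<^bsub>3\<^esub> l3)\<^bsup>cyc [1,3] \<circ> cyc [2,4]\<^esup>
        + l4 \<circ>\<^bsub>1\<^esub> l2 - l4 \<circ>\<^bsub>2\<^esub> l2 + (l4 \<circ>\<^bsub>2\<^esub> l2)\<^bsup>cyc [1,2]\<^esup>
        + l4 \<circ>\<^bsub>3\<^esub> l2 - (l4 \<circ>\<^bsub>3\<^esub> l2)\<^bsup>cyc [2,3]\<^esup> + (l4 \<circ>\<^bsub>3\<^esub> l2)\<^bsup>cyc [1,3,2]\<^esup>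
        - l4 \<circ>\<^bsub>4\<^esub> l2 + (l4 \<circ>\<^bsub>4\<^esub> l2)\<^bsup>cyc [3,4]\<^esup> - (l4 \<circ>\<^bsub>4\<^esub> l2)\<^bsup>cyc [2,4,3]\<^esup> + (l4 \<circ>\<^bsub>4\<^esub> l2)\<^bsup>cyc [1,4,3,2]\<^esup>)"

text \<open>The equations of a morphism \<open>(id, g2, g3)\<close> from the \<open>l\<close>
  structure to the \<open>m\<close> structure, with identity factors absorbed into partial
  compositions. The Leibniz identities for \<open>m\<close> are left out on purpose: they are the
  conclusion of the transport.\<close>

definition strict_iso3 :: "('k::comm_ring_1, 'v::ab_group_add, 'a) cplx_scheme \<Rightarrow>
    ('v, 'v) gmap \<Rightarrow> ('v, 'v) gmap \<Rightarrow> ('v, 'v) gmap \<Rightarrow> ('v, 'v) gmap \<Rightarrow> ('v, 'v) gmap \<Rightarrow> ('v, 'v) gmap \<Rightarrow>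
    ('v, 'v) gmap \<Rightarrow> ('v, 'v) gmap \<Rightarrow> bool"
  where "strict_iso3 L l2 l3 l4 m2 m3 m4 g2 g3 \<longleftrightarrow>
     graded_map L L 2 0 m2 \<and> graded_map L L 3 1 m3 \<and> graded_map L L 4 2 m4 \<and>
     graded_map L L 2 1 g2 \<and> graded_map L L 3 2 g3 \<and>
     map_eq L (bdry L L g2) (l2 - m2) \<and>
     map_eq L (bdry L L g3)
       (l3 - g2 \<circ>\<^bsub>2\<^esub> l2 + g2 \<circ>\<^bsub>1\<^esub> l2 + (g2 \<circ>\<^bsub>2\<^esub> l2)\<^bsup>cyc [1,2]\<^esup>
        - m3 - m2 \<circ>\<^bsub>2\<^esub> g2 + m2 \<circ>\<^bsub>1\<^esub> g2 + (m2 \<circ>\<^bsub>2\<^esub> g2)\<^bsup>cyc [1,2]\<^esup>) \<and>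
     map_eq L (l4 - m4)
       (g2 \<circ>\<^bsub>1\<^esub> l3 + g2 \<circ>\<^bsub>2\<^esub> l3 - (g2 \<circ>\<^bsub>2\<^esub> l3)\<^bsup>cyc [1,2]\<^esup> + (g2 \<circ>\<^bsub>2\<^esub> l3)\<^bsup>cyc [1,2,3]\<^esup>
        - g3 \<circ>\<^bsub>1\<^esub> l2 + g3 \<circ>\<^bsub>2\<^esub> l2 - (g3 \<circ>\<^bsub>2\<^esub> l2)\<^bsup>cyc [1,2]\<^esup>
        - g3 \<circ>\<^bsub>3\<^esub> l2 + (g3 \<circ>\<^bsub>3\<^esub> l2)\<^bsup>cyc [2,3]\<^esup> - (g3 \<circ>\<^bsub>3\<^esub> l2)\<^bsup>cyc [1,3,2]\<^esup>
        + m2 \<circ>\<^bsub>1\<^esub> g3 + m2 \<circ>\<^bsub>2\<^esub> g3 - (m2 \<circ>\<^bsub>2\<^esub> g3)\<^bsup>cyc [1,2]\<^esup> + (m2 \<circ>\<^bsub>2\<^esub> g3)\<^bsup>cyc [1,2,3]\<^esup>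
        - m2 \<circ>\<^sub>\<otimes> [g2, g2] + (m2 \<circ>\<^sub>\<otimes> [g2, g2])\<^bsup>cyc [2,3]\<^esup> - (m2 \<circ>\<^sub>\<otimes> [g2, g2])\<^bsup>cyc [1,3,2]\<^esup>
        + m3 \<circ>\<^bsub>1\<^esub> g2 - m3 \<circ>\<^bsub>2\<^esub> g2 + (m3 \<circ>\<^bsub>2\<^esub> g2)\<^bsup>cyc [1,2]\<^esup>
        + m3 \<circ>\<^bsub>3\<^esub> g2 - (m3 \<circ>\<^bsub>3\<^esub> g2)\<^bsup>cyc [2,3]\<^esup> + (m3 \<circ>\<^bsub>3\<^esub> g2)\<^bsup>cyc [1,3,2]\<^esup>)"

text \<open>Simplification turns the numeral 1 inside a cycle into \<open>Suc 0\<close>; the second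
  copies of the evaluation rules match that form.\<close>

lemmas app_unfold = app_circ app_tensor value_of_def app_perm2 app_perm3 app_perm4 app_perm5_degree_0
  app_perm2[unfolded One_nat_def] app_perm3[unfolded One_nat_def] app_perm4[unfolded One_nat_def]
  app_perm5_degree_0[unfolded One_nat_def]

text \<open>The two ends of the complex: below degree 1 the target of d is zero, and in
  \<open>diff_above\<close> the source is.\<close>

lemma diff_negative:
  assumes L: "three_term_complex L"
  shows "x \<in> comp L p \<Longrightarrow> p < 1 \<Longrightarrow> app (diff L) [(p, x)] = 0"
  using graded_map1(3)[OF L L complex_diff[OF L], of x p "p - 1"] complex_trivial[OF L, of "p - 1"] by simp

lemma diff_above:
  assumes L: "three_term_complex L"
  shows "x \<in> comp L p \<Longrightarrow> 2 < p \<Longrightarrow> app (diff L) [(p, x)] = 0"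
  using graded_map1(7)[OF L L complex_diff[OF L], of p] complex_trivial[OF L, of p] by auto

locale strict_iso =
  fixes L :: "('k::comm_ring_1, 'v::ab_group_add, 'a) cplx_scheme"
    and l2 l3 l4 m2 m3 m4 g2 g3 :: "('v, 'v) gmap"
  assumes leib: "leibniz3 L l2 l3 l4" and iso: "strict_iso3 L l2 l3 l4 m2 m3 m4 g2 g3"
begin

lemma C: "three_term_complex L"
  using leib by (simp add: leibniz3_def)

lemma graded: "graded_map L L 2 0 l2" "graded_map L L 3 1 l3" "graded_map L L 4 2 l4"
  "graded_map L L 2 0 m2" "graded_map L L 3 1 m3" "graded_map L L 4 2 m4"
  "graded_map L L 2 1 g2" "graded_map L L 3 2 g3"
  using leib iso by (simp_all add: leibniz3_def strict_iso3_def)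

lemmas ops = graded_map1[OF C C complex_diff[OF C]] graded_map2[OF C C graded(1)] graded_map3[OF C C graded(2)]
  graded_map4[OF C C graded(3)] graded_map2[OF C C graded(4)] graded_map3[OF C C graded(5)]
  graded_map4[OF C C graded(6)] graded_map2[OF C C graded(7)] graded_map3[OF C C graded(8)] comp_closed[OF C]

lemma eqs:
  "map_eq L (bdry L L l2) (zero_map 2 (-1))"
  "map_eq L (bdry L L l3) (l2 \<circ>\<^bsub>2\<^esub> l2 - l2 \<circ>\<^bsub>1\<^esub> l2 - (l2 \<circ>\<^bsub>2\<^esub> l2)\<^bsup>cyc [1,2]\<^esup>)"
  "map_eq L (bdry L L g2) (l2 - m2)"
  using leib iso by (simp_all add: leibniz3_def strict_iso3_def)

lemmas eq_l4 = leib[unfolded leibniz3_def, THEN conjunct2, THEN conjunct2, THEN conjunct2, THEN conjunct2,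
    THEN conjunct2, THEN conjunct2, THEN conjunct1]
lemmas eq_J = leib[unfolded leibniz3_def, THEN conjunct2, THEN conjunct2, THEN conjunct2, THEN conjunct2,
    THEN conjunct2, THEN conjunct2, THEN conjunct2]
lemmas eq_g3 = iso[unfolded strict_iso3_def, THEN conjunct2, THEN conjunct2, THEN conjunct2, THEN conjunct2,
    THEN conjunct2, THEN conjunct2, THEN conjunct1]
lemmas eq_4 = iso[unfolded strict_iso3_def, THEN conjunct2, THEN conjunct2, THEN conjunct2, THEN conjunct2,
    THEN conjunct2, THEN conjunct2, THEN conjunct2]

lemmas diff_l2 = diff_app2[OF eqs(1) C C graded(1), simplified]
lemmas diff_l3 = diff_app3[OF eqs(2) C C graded(2), simplified app_unfold ops gmap_simps, simplified]
lemmas diff_l4 = diff_app4[OF eq_l4 C C graded(3), simplified app_unfold ops gmap_simps, simplified]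
lemmas diff_g2 = diff_app2[OF eqs(3) C C graded(7), simplified]
lemmas diff_g3 = diff_app3[OF eq_g3 C C graded(8), simplified app_unfold ops gmap_simps, simplified]

text \<open>Difference of the two sides of the four-ary equation, as a map. Certificates list its
  values as summands: \<open>app_defect4\<close> expands them while an identity is being checked,
  and \<open>defect4_zero\<close> removes them afterwards.\<close>

definition defect4 :: "('v, 'v) gmap"
  where "defect4 = l4 - m4 -
       (g2 \<circ>\<^bsub>1\<^esub> l3 + g2 \<circ>\<^bsub>2\<^esub> l3 - (g2 \<circ>\<^bsub>2\<^esub> l3)\<^bsup>cyc [1,2]\<^esup> + (g2 \<circ>\<^bsub>2\<^esub> l3)\<^bsup>cyc [1,2,3]\<^esup>
        - g3 \<circ>\<^bsub>1\<^esub> l2 + g3 \<circ>\<^bsub>2\<^esub> l2 - (g3 \<circ>\<^bsub>2\<^esub> l2)\<^bsup>cyc [1,2]\<^esup>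
        - g3 \<circ>\<^bsub>3\<^esub> l2 + (g3 \<circ>\<^bsub>3\<^esub> l2)\<^bsup>cyc [2,3]\<^esup> - (g3 \<circ>\<^bsub>3\<^esub> l2)\<^bsup>cyc [1,3,2]\<^esup>
        + m2 \<circ>\<^bsub>1\<^esub> g3 + m2 \<circ>\<^bsub>2\<^esub> g3 - (m2 \<circ>\<^bsub>2\<^esub> g3)\<^bsup>cyc [1,2]\<^esup> + (m2 \<circ>\<^bsub>2\<^esub> g3)\<^bsup>cyc [1,2,3]\<^esup>
        - m2 \<circ>\<^sub>\<otimes> [g2, g2] + (m2 \<circ>\<^sub>\<otimes> [g2, g2])\<^bsup>cyc [2,3]\<^esup> - (m2 \<circ>\<^sub>\<otimes> [g2, g2])\<^bsup>cyc [1,3,2]\<^esup>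
        + m3 \<circ>\<^bsub>1\<^esub> g2 - m3 \<circ>\<^bsub>2\<^esub> g2 + (m3 \<circ>\<^bsub>2\<^esub> g2)\<^bsup>cyc [1,2]\<^esup>
        + m3 \<circ>\<^bsub>3\<^esub> g2 - (m3 \<circ>\<^bsub>3\<^esub> g2)\<^bsup>cyc [2,3]\<^esup> + (m3 \<circ>\<^bsub>3\<^esub> g2)\<^bsup>cyc [1,3,2]\<^esup>)"

lemma defect4_zero:
  "a \<in> comp L p \<Longrightarrow> b \<in> comp L q \<Longrightarrow> c \<in> comp L r \<Longrightarrow> d \<in> comp L t \<Longrightarrow>
    app defect4 [(p, a), (q, b), (r, c), (t, d)] = 0"
  using map_eqD[OF eq_4, of "[(p, a), (q, b), (r, c), (t, d)]"] by (simp add: defect4_def ops)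

text \<open>The definition is evaluated once on a generic list of four homogeneous arguments, so
  that later proofs start from the evaluated form.\<close>

lemmas app_defect4 = arg_cong[OF defect4_def, of "\<lambda>\<mu>. app \<mu> [(p, a), (q, b), (r, c), (t, d)]" for p a q b r c t d,
  simplified app_unfold ops gmap_simps, simplified]

lemmas expand0 = app_unfold ops diff_l2 diff_l3 diff_l4 diff_g2 diff_g3 diff_negative[OF C] diff_diff[OF C] sgn_pow_def

lemmas graded_intros = graded_map_add[OF C] graded_map_diff[OF C] graded_map_zero[OF C]
  graded_map_perm[OF C C] graded_map_circ[OF C C] graded_map_bdry[OF C C] cyc_permutes double_transposition_permutes

text \<open>\<open>m2\<close> is \<open>l2\<close> minus the boundary of \<open>g2\<close>, so the
  claim is the one for \<open>l2\<close> together with d d = 0.\<close>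

lemma bdry_m2: "map_eq L (bdry L L m2) (zero_map 2 (-1))"
proof (rule map_eqI[OF C C, of 2 "-1"])
  show "graded_map L L 2 (-1) (bdry L L m2)"
    by (rule graded | rule graded_intros | simp)+
  show "graded_map L L 2 (-1) (zero_map 2 (-1))"
    by (rule graded | rule graded_intros | simp)+
next
  fix vs :: "(int \<times> 'v) list"
  assume "length vs = 2" and h: "homogeneous L vs" "fst ` set vs \<subseteq> {0, 1, 2}"
  then obtain p a q b where vs: "vs = [(p, a), (q, b)]"
    by (auto simp: length_Suc_conv numeral_eq_Suc)
  have x: "a \<in> comp L p" "b \<in> comp L q" using h vs by auto
  have "app (bdry L L m2) [(p, a), (q, b)] = - app (diff L) [(p + q, app (diff L) [(p + q + 1, app g2 [(p, a), (q, b)])])]"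
    using degree_cases2[OF h(2)[unfolded vs]] x
    by (elim disjE conjE; hypsubst; simp add: app_bdry2[OF C C graded_mapD(1,2)[OF graded(4)]] expand0 algebra_simps)
  also have "\<dots> = 0" using x by (simp add: ops diff_diff[OF C])
  finally show "app (bdry L L m2) vs = app (zero_map 2 (-1)) vs" by (simp add: vs)
qed

lemmas diff_m2 = diff_app2[OF bdry_m2 C C graded(4), simplified]

text \<open>The ternary equation determines \<open>m3\<close> up to the boundary of
  \<open>g3\<close>. Taking boundaries once more, the known equations for \<open>l2\<close>,
  \<open>l3\<close>, \<open>g2\<close> and \<open>m2\<close> leave only d d of
  \<open>g3\<close>.\<close>

lemma bdry_m3: "map_eq L (bdry L L m3)
    (m2 \<circ>\<^bsub>2\<^esub> m2 - m2 \<circ>\<^bsub>1\<^esub> m2 - (m2 \<circ>\<^bsub>2\<^esub> m2)\<^bsup>cyc [1,2]\<^esup>)" (is "map_eq L _ ?rhs")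
proof (rule map_eqI[OF C C, of 3 0])
  show "graded_map L L 3 0 (bdry L L m3)"
    by (rule graded | rule graded_intros | simp)+
  show "graded_map L L 3 0 ?rhs"
    by (rule graded | rule graded_intros | simp)+
next
  fix vs :: "(int \<times> 'v) list"
  assume "length vs = 3" and h: "homogeneous L vs" "fst ` set vs \<subseteq> {0, 1, 2}" "tdeg vs + 0 \<le> 2"
  then obtain a p b q c r where vs: "vs = [(p, a), (q, b), (r, c)]"
    by (auto simp: length_Suc_conv numeral_eq_Suc)
  have x: "a \<in> comp L p" "b \<in> comp L q" "c \<in> comp L r" using h vs by auto
  have tdeg: "p + q + r \<le> 2" using h(3) vs by simp
  have "app (bdry L L m3) [(p, a), (q, b), (r, c)] = app ?rhs [(p, a), (q, b), (r, c)]
      - app (diff L) [(p + q + r + 1, app (diff L) [(p + q + r + 2, app g3 [(p, a), (q, b), (r, c)])])]"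
    using degree_cases3_2[OF h(2)[unfolded vs] tdeg] x
    by (elim disjE conjE; hypsubst; simp add: app_bdry3[OF C C graded_mapD(1,2)[OF graded(5)]] expand0 diff_m2 algebra_simps)
  also have "app (diff L) [(p + q + r + 1, app (diff L) [(p + q + r + 2, app g3 [(p, a), (q, b), (r, c)])])] = 0"
    using x by (simp add: ops diff_diff[OF C])
  finally show "app (bdry L L m3) vs = app ?rhs vs" by (simp add: vs)
qed

lemmas diff_m3 = diff_app3[OF bdry_m3 C C graded(5), simplified app_unfold ops gmap_simps, simplified]

lemma defect4_arity: "arity defect4 = 4" "gdeg defect4 = 2"
  by (simp_all add: defect4_def graded_mapD(1,2)[OF graded(3)])

text \<open>\<open>m4\<close> is given by an equation without boundary term. Its boundary is
  therefore obtained by applying the boundary operator to that equation, that is, to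
  \<open>defect4\<close>.\<close>

lemma bdry_m4: "map_eq L (bdry L L m4)
    (m2 \<circ>\<^bsub>1\<^esub> m3 + m2 \<circ>\<^bsub>2\<^esub> m3 - (m2 \<circ>\<^bsub>2\<^esub> m3)\<^bsup>cyc [1,2]\<^esup> + (m2 \<circ>\<^bsub>2\<^esub> m3)\<^bsup>cyc [1,2,3]\<^esup>
        - m3 \<circ>\<^bsub>1\<^esub> m2 + m3 \<circ>\<^bsub>2\<^esub> m2 - (m3 \<circ>\<^bsub>2\<^esub> m2)\<^bsup>cyc [1,2]\<^esup>
        - m3 \<circ>\<^bsub>3\<^esub> m2 + (m3 \<circ>\<^bsub>3\<^esub> m2)\<^bsup>cyc [2,3]\<^esup> - (m3 \<circ>\<^bsub>3\<^esub> m2)\<^bsup>cyc [1,3,2]\<^esup>)" (is "map_eq L _ ?rhs")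
proof (rule map_eqI[OF C C, of 4 1])
  show "graded_map L L 4 1 (bdry L L m4)"
    by (rule graded | rule graded_intros | simp)+
  show "graded_map L L 4 1 ?rhs"
    by (rule graded | rule graded_intros | simp)+
next
  fix vs :: "(int \<times> 'v) list"
  assume "length vs = 4" and h: "homogeneous L vs" "fst ` set vs \<subseteq> {0, 1, 2}" "tdeg vs + 1 \<le> 2"
  then obtain a p b q c r d t where vs: "vs = [(p, a), (q, b), (r, c), (t, d)]"
    by (auto simp: length_Suc_conv numeral_eq_Suc)
  have x: "a \<in> comp L p" "b \<in> comp L q" "c \<in> comp L r" "d \<in> comp L t" using h vs by auto
  have tdeg: "p + q + r + t \<le> 1" using h(3) vs by simp
  have "app (bdry L L m4) [(p, a), (q, b), (r, c), (t, d)] = app ?rhs [(p, a), (q, b), (r, c), (t, d)]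
      - app (bdry L L defect4) [(p, a), (q, b), (r, c), (t, d)]"
    using degree_cases4_1[OF h(2)[unfolded vs] tdeg] x
    by (elim disjE conjE; hypsubst; simp add: app_bdry4[OF C C graded_mapD(1,2)[OF graded(6)]]
      app_bdry4[OF C C defect4_arity] app_defect4 expand0 diff_m2 diff_m3 algebra_simps)
  also have "app (bdry L L defect4) [(p, a), (q, b), (r, c), (t, d)] = 0"
    using x by (simp add: app_bdry4[OF C C defect4_arity] defect4_zero ops)
  finally show "app (bdry L L m4) vs = app ?rhs vs" by (simp add: vs)
qed

lemmas diff_m4 = diff_app4[OF bdry_m4 C C graded(6), simplified app_unfold ops gmap_simps, simplified]

end

section \<open>The five-ary identity for the transported operations\<close>

context strict_iso
begin

text \<open>The five-ary expression in \<open>m\<close> is the one in \<open>l\<close> up to values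
  of \<open>defect4\<close> and values d x. Here x runs through composites that contain
  \<open>g2\<close> or \<open>g3\<close> and have degree 3 on arguments of degree 0: each d x is
  zero, while its expansion supplies the cancelling terms.\<close>

lemma jacobi5_transport:
  assumes x: "a \<in> comp L 0" "b \<in> comp L 0" "c \<in> comp L 0" "d \<in> comp L 0" "e \<in> comp L 0"
  shows "app (m2 \<circ>\<^bsub>1\<^esub> m4 - m2 \<circ>\<^bsub>2\<^esub> m4 + (m2 \<circ>\<^bsub>2\<^esub> m4)\<^bsup>cyc [1,2]\<^esup> - (m2 \<circ>\<^bsub>2\<^esub> m4)\<^bsup>cyc [1,2,3]\<^esup> + (m2 \<circ>\<^bsub>2\<^esub> m4)\<^bsup>cyc [1,2,3,4]\<^esup>
        + m3 \<circ>\<^bsub>1\<^esub> m3 + m3 \<circ>\<^bsub>2\<^esub> m3 - (m3 \<circ>\<^bsub>2\<^esub> m3)\<^bsup>cyc [1,2]\<^esup> + (m3 \<circ>\<^bsub>2\<^esub> m3)\<^bsup>cyc [1,2,3]\<^esup>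
        + m3 \<circ>\<^bsub>3\<^esub> m3 - (m3 \<circ>\<^bsub>3\<^esub> m3)\<^bsup>cyc [2,3]\<^esup> + (m3 \<circ>\<^bsub>3\<^esub> m3)\<^bsup>cyc [1,3,2]\<^esup>
        + (m3 \<circ>\<^bsub>3\<^esub> m3)\<^bsup>cyc [2,3,4]\<^esup> - (m3 \<circ>\<^bsub>3\<^esub> m3)\<^bsup>cyc [1,3,4,2]\<^esup> + (m3 \<circ>\<^bsub>3\<^esub> m3)\<^bsup>cyc [1,3] \<circ> cyc [2,4]\<^esup>
        + m4 \<circ>\<^bsub>1\<^esub> m2 - m4 \<circ>\<^bsub>2\<^esub> m2 + (m4 \<circ>\<^bsub>2\<^esub> m2)\<^bsup>cyc [1,2]\<^esup>
        + m4 \<circ>\<^bsub>3\<^esub> m2 - (m4 \<circ>\<^bsub>3\<^esub> m2)\<^bsup>cyc [2,3]\<^esup> + (m4 \<circ>\<^bsub>3\<^esub> m2)\<^bsup>cyc [1,3,2]\<^esup>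
        - m4 \<circ>\<^bsub>4\<^esub> m2 + (m4 \<circ>\<^bsub>4\<^esub> m2)\<^bsup>cyc [3,4]\<^esup> - (m4 \<circ>\<^bsub>4\<^esub> m2)\<^bsup>cyc [2,4,3]\<^esup> + (m4 \<circ>\<^bsub>4\<^esub> m2)\<^bsup>cyc [1,4,3,2]\<^esup>) [(0, a), (0, b), (0, c), (0, d), (0, e)] = 0"
proof -
  have "app (m2 \<circ>\<^bsub>1\<^esub> m4 - m2 \<circ>\<^bsub>2\<^esub> m4 + (m2 \<circ>\<^bsub>2\<^esub> m4)\<^bsup>cyc [1,2]\<^esup> - (m2 \<circ>\<^bsub>2\<^esub> m4)\<^bsup>cyc [1,2,3]\<^esup> + (m2 \<circ>\<^bsub>2\<^esub> m4)\<^bsup>cyc [1,2,3,4]\<^esup>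
        + m3 \<circ>\<^bsub>1\<^esub> m3 + m3 \<circ>\<^bsub>2\<^esub> m3 - (m3 \<circ>\<^bsub>2\<^esub> m3)\<^bsup>cyc [1,2]\<^esup> + (m3 \<circ>\<^bsub>2\<^esub> m3)\<^bsup>cyc [1,2,3]\<^esup>
        + m3 \<circ>\<^bsub>3\<^esub> m3 - (m3 \<circ>\<^bsub>3\<^esub> m3)\<^bsup>cyc [2,3]\<^esup> + (m3 \<circ>\<^bsub>3\<^esub> m3)\<^bsup>cyc [1,3,2]\<^esup>
        + (m3 \<circ>\<^bsub>3\<^esub> m3)\<^bsup>cyc [2,3,4]\<^esup> - (m3 \<circ>\<^bsub>3\<^esub> m3)\<^bsup>cyc [1,3,4,2]\<^esup> + (m3 \<circ>\<^bsub>3\<^esub> m3)\<^bsup>cyc [1,3] \<circ> cyc [2,4]\<^esup>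
        + m4 \<circ>\<^bsub>1\<^esub> m2 - m4 \<circ>\<^bsub>2\<^esub> m2 + (m4 \<circ>\<^bsub>2\<^esub> m2)\<^bsup>cyc [1,2]\<^esup>
        + m4 \<circ>\<^bsub>3\<^esub> m2 - (m4 \<circ>\<^bsub>3\<^esub> m2)\<^bsup>cyc [2,3]\<^esup> + (m4 \<circ>\<^bsub>3\<^esub> m2)\<^bsup>cyc [1,3,2]\<^esup>
        - m4 \<circ>\<^bsub>4\<^esub> m2 + (m4 \<circ>\<^bsub>4\<^esub> m2)\<^bsup>cyc [3,4]\<^esup> - (m4 \<circ>\<^bsub>4\<^esub> m2)\<^bsup>cyc [2,4,3]\<^esup> + (m4 \<circ>\<^bsub>4\<^esub> m2)\<^bsup>cyc [1,4,3,2]\<^esup>) [(0, a), (0, b), (0, c), (0, d), (0, e)] =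
      app (l2 \<circ>\<^bsub>1\<^esub> l4 - l2 \<circ>\<^bsub>2\<^esub> l4 + (l2 \<circ>\<^bsub>2\<^esub> l4)\<^bsup>cyc [1,2]\<^esup> - (l2 \<circ>\<^bsub>2\<^esub> l4)\<^bsup>cyc [1,2,3]\<^esup> + (l2 \<circ>\<^bsub>2\<^esub> l4)\<^bsup>cyc [1,2,3,4]\<^esup>
        + l3 \<circ>\<^bsub>1\<^esub> l3 + l3 \<circ>\<^bsub>2\<^esub> l3 - (l3 \<circ>\<^bsub>2\<^esub> l3)\<^bsup>cyc [1,2]\<^esup> + (l3 \<circ>\<^bsub>2\<^esub> l3)\<^bsup>cyc [1,2,3]\<^esup>
        + l3 \<circ>\<^bsub>3\<^esub> l3 - (l3 \<circ>\<^bsub>3\<^esub> l3)\<^bsup>cyc [2,3]\<^esup> + (l3 \<circ>\<^bsub>3\<^esub> l3)\<^bsup>cyc [1,3,2]\<^esup>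
        + (l3 \<circ>\<^bsub>3\<^esub> l3)\<^bsup>cyc [2,3,4]\<^esup> - (l3 \<circ>\<^bsub>3\<^esub> l3)\<^bsup>cyc [1,3,4,2]\<^esup> + (l3 \<circ>\<^bsub>3\<^esub> l3)\<^bsup>cyc [1,3] \<circ> cyc [2,4]\<^esup>
        + l4 \<circ>\<^bsub>1\<^esub> l2 - l4 \<circ>\<^bsub>2\<^esub> l2 + (l4 \<circ>\<^bsub>2\<^esub> l2)\<^bsup>cyc [1,2]\<^esup>
        + l4 \<circ>\<^bsub>3\<^esub> l2 - (l4 \<circ>\<^bsub>3\<^esub> l2)\<^bsup>cyc [2,3]\<^esup> + (l4 \<circ>\<^bsub>3\<^esub> l2)\<^bsup>cyc [1,3,2]\<^esup>
        - l4 \<circ>\<^bsub>4\<^esub> l2 + (l4 \<circ>\<^bsub>4\<^esub> l2)\<^bsup>cyc [3,4]\<^esup> - (l4 \<circ>\<^bsub>4\<^esub> l2)\<^bsup>cyc [2,4,3]\<^esup> + (l4 \<circ>\<^bsub>4\<^esub> l2)\<^bsup>cyc [1,4,3,2]\<^esup>) [(0, a), (0, b), (0, c), (0, d), (0, e)]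
       + app m2 [(0, a), (2, app defect4 [(0, b), (0, c), (0, d), (0, e)])]
       - app m2 [(2, app defect4 [(0, a), (0, b), (0, c), (0, d)]), (0, e)]
       - app defect4 [(0, b), (0, app l2 [(0, a), (0, c)]), (0, d), (0, e)]
       - app defect4 [(0, a), (0, b), (0, app l2 [(0, c), (0, d)]), (0, e)]
       + app defect4 [(0, a), (0, b), (0, c), (0, app l2 [(0, d), (0, e)])]
       - app m2 [(0, b), (2, app defect4 [(0, a), (0, c), (0, d), (0, e)])]
       - app defect4 [(0, a), (0, b), (0, d), (0, app l2 [(0, c), (0, e)])]
       + app defect4 [(0, a), (0, c), (0, app l2 [(0, b), (0, d)]), (0, e)]
       + app defect4 [(0, a), (0, app l2 [(0, b), (0, c)]), (0, d), (0, e)]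
       + app m2 [(0, c), (2, app defect4 [(0, a), (0, b), (0, d), (0, e)])]
       - app defect4 [(0, app l2 [(0, a), (0, b)]), (0, c), (0, d), (0, e)]
       - app defect4 [(0, b), (0, c), (0, app l2 [(0, a), (0, d)]), (0, e)]
       - app defect4 [(0, b), (0, c), (0, d), (0, app l2 [(0, a), (0, e)])]
       - app m2 [(0, d), (2, app defect4 [(0, a), (0, b), (0, c), (0, e)])]
       + app defect4 [(0, a), (0, c), (0, d), (0, app l2 [(0, b), (0, e)])]
       + app (diff L) [(3, app m3 [(0, c), (2, app g3 [(0, a), (0, b), (0, d)]), (0, e)])]
       - app (diff L) [(3, app m4 [(0, b), (0, c), (1, app g2 [(0, a), (0, d)]), (0, e)])]
       + app (diff L) [(3, app m3 [(0, b), (0, c), (2, app g3 [(0, a), (0, d), (0, e)])])]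
       - app (diff L) [(3, app g3 [(0, c), (1, app l3 [(0, a), (0, b), (0, d)]), (0, e)])]
       - app (diff L) [(3, app m2 [(2, app g3 [(0, a), (0, b), (0, d)]), (1, app g2 [(0, c), (0, e)])])]
       + app (diff L) [(3, app m3 [(1, app g2 [(0, a), (0, c)]), (1, app g2 [(0, b), (0, d)]), (0, e)])]
       + app (diff L) [(3, app m3 [(1, app g2 [(0, a), (0, c)]), (0, d), (1, app g2 [(0, b), (0, e)])])]
       - app (diff L) [(3, app m4 [(0, b), (1, app g2 [(0, a), (0, c)]), (0, d), (0, e)])]
       + app (diff L) [(3, app m3 [(2, app g3 [(0, a), (0, b), (0, c)]), (0, d), (0, e)])]
       - app (diff L) [(3, app m3 [(0, b), (2, app g3 [(0, a), (0, c), (0, d)]), (0, e)])]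
       - app (diff L) [(3, app g2 [(0, b), (2, app l4 [(0, a), (0, c), (0, d), (0, e)])])]
       + app (diff L) [(3, app g3 [(0, b), (0, d), (1, app l3 [(0, a), (0, c), (0, e)])])]
       - app (diff L) [(3, app m2 [(1, app g2 [(0, a), (0, b)]), (2, app g3 [(0, c), (0, d), (0, e)])])]
       - app (diff L) [(3, app m3 [(1, app g2 [(0, a), (0, b)]), (1, app g2 [(0, c), (0, d)]), (0, e)])]
       - app (diff L) [(3, app m4 [(0, a), (0, b), (1, app g2 [(0, c), (0, d)]), (0, e)])]
       - app (diff L) [(3, app m3 [(0, a), (1, app g2 [(0, c), (0, d)]), (1, app g2 [(0, b), (0, e)])])]
       + app (diff L) [(3, app m2 [(2, app g3 [(0, a), (0, c), (0, d)]), (1, app g2 [(0, b), (0, e)])])]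
       + app (diff L) [(3, app m4 [(0, a), (0, c), (1, app g2 [(0, b), (0, d)]), (0, e)])]
       + app (diff L) [(3, app m2 [(2, app g3 [(0, a), (0, b), (0, c)]), (1, app g2 [(0, d), (0, e)])])]
       + app (diff L) [(3, app m4 [(0, a), (0, b), (0, c), (1, app g2 [(0, d), (0, e)])])]
       + app (diff L) [(3, app m3 [(1, app g2 [(0, a), (0, b)]), (0, c), (1, app g2 [(0, d), (0, e)])])]
       + app (diff L) [(3, app g2 [(0, a), (2, app l4 [(0, b), (0, c), (0, d), (0, e)])])]
       - app (diff L) [(3, app g3 [(0, a), (0, b), (1, app l3 [(0, c), (0, d), (0, e)])])]
       + app (diff L) [(3, app m3 [(0, a), (2, app g3 [(0, b), (0, c), (0, d)]), (0, e)])]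
       - app (diff L) [(3, app g3 [(0, a), (1, app l3 [(0, b), (0, c), (0, d)]), (0, e)])]
       + app (diff L) [(3, app m3 [(0, a), (0, b), (2, app g3 [(0, c), (0, d), (0, e)])])]
       - app (diff L) [(3, app m2 [(2, app g3 [(0, b), (0, c), (0, d)]), (1, app g2 [(0, a), (0, e)])])]
       + app (diff L) [(3, app m3 [(0, b), (1, app g2 [(0, c), (0, d)]), (1, app g2 [(0, a), (0, e)])])]
       + app (diff L) [(3, app m3 [(0, a), (1, app g2 [(0, b), (0, d)]), (1, app g2 [(0, c), (0, e)])])]
       - app (diff L) [(3, app m2 [(1, app g2 [(0, b), (0, c)]), (2, app g3 [(0, a), (0, d), (0, e)])])]
       - app (diff L) [(3, app g3 [(0, b), (0, c), (1, app l3 [(0, a), (0, d), (0, e)])])]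
       + app (diff L) [(3, app m3 [(0, a), (0, d), (2, app g3 [(0, b), (0, c), (0, e)])])]
       - app (diff L) [(3, app m3 [(0, a), (1, app g2 [(0, b), (0, c)]), (1, app g2 [(0, d), (0, e)])])]
       - app (diff L) [(3, app m3 [(1, app g2 [(0, b), (0, c)]), (1, app g2 [(0, a), (0, d)]), (0, e)])]
       - app (diff L) [(3, app g3 [(1, app l3 [(0, a), (0, b), (0, c)]), (0, d), (0, e)])]
       - app (diff L) [(3, app m3 [(0, b), (0, d), (2, app g3 [(0, a), (0, c), (0, e)])])]
       + app (diff L) [(3, app m2 [(1, app g2 [(0, a), (0, c)]), (2, app g3 [(0, b), (0, d), (0, e)])])]
       + app (diff L) [(3, app m3 [(0, b), (1, app g2 [(0, a), (0, c)]), (1, app g2 [(0, d), (0, e)])])]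
       + app (diff L) [(3, app g3 [(0, a), (0, c), (1, app l3 [(0, b), (0, d), (0, e)])])]
       + app (diff L) [(3, app g2 [(0, c), (2, app l4 [(0, a), (0, b), (0, d), (0, e)])])]
       - app (diff L) [(3, app m3 [(1, app g2 [(0, a), (0, b)]), (0, d), (1, app g2 [(0, c), (0, e)])])]
       + app (diff L) [(3, app m3 [(0, c), (1, app g2 [(0, a), (0, d)]), (1, app g2 [(0, b), (0, e)])])]
       - app (diff L) [(3, app g2 [(2, app l4 [(0, a), (0, b), (0, c), (0, d)]), (0, e)])]
       + app (diff L) [(3, app g3 [(0, b), (1, app l3 [(0, a), (0, c), (0, d)]), (0, e)])]
       - app (diff L) [(3, app m2 [(1, app g2 [(0, a), (0, d)]), (2, app g3 [(0, b), (0, c), (0, e)])])]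
       - app (diff L) [(3, app m3 [(0, b), (1, app g2 [(0, a), (0, d)]), (1, app g2 [(0, c), (0, e)])])]
       - app (diff L) [(3, app g2 [(0, d), (2, app l4 [(0, a), (0, b), (0, c), (0, e)])])]
       + app (diff L) [(3, app m2 [(1, app g2 [(0, b), (0, d)]), (2, app g3 [(0, a), (0, c), (0, e)])])]
       - app (diff L) [(3, app m3 [(1, app g2 [(0, b), (0, c)]), (0, d), (1, app g2 [(0, a), (0, e)])])]
       - app (diff L) [(3, app m4 [(0, b), (0, c), (0, d), (1, app g2 [(0, a), (0, e)])])]
       - app (diff L) [(3, app m3 [(0, c), (1, app g2 [(0, b), (0, d)]), (1, app g2 [(0, a), (0, e)])])]
       + app (diff L) [(3, app m3 [(0, c), (0, d), (2, app g3 [(0, a), (0, b), (0, e)])])]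
       - app (diff L) [(3, app g3 [(0, c), (0, d), (1, app l3 [(0, a), (0, b), (0, e)])])]
       - app (diff L) [(3, app m2 [(1, app g2 [(0, c), (0, d)]), (2, app g3 [(0, a), (0, b), (0, e)])])]
       + app (diff L) [(3, app m4 [(0, a), (0, c), (0, d), (1, app g2 [(0, b), (0, e)])])]
       - app (diff L) [(3, app m3 [(0, a), (0, c), (2, app g3 [(0, b), (0, d), (0, e)])])]
       - app (diff L) [(3, app m4 [(1, app g2 [(0, a), (0, b)]), (0, c), (0, d), (0, e)])]
       + app (diff L) [(3, app m4 [(0, a), (1, app g2 [(0, b), (0, c)]), (0, d), (0, e)])]
       - app (diff L) [(3, app m4 [(0, a), (0, b), (0, d), (1, app g2 [(0, c), (0, e)])])]
       - app (diff L) [(3, app g3 [(0, a), (0, d), (1, app l3 [(0, b), (0, c), (0, e)])])]"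
    \<comment> \<open>The boundary equations of \<open>m2\<close>, \<open>m3\<close> and
      \<open>m4\<close> enter the expansion of the d x, so the lower transported identities must
      already be available.\<close>
    by (simp add: x expand0 diff_m2 diff_m3 diff_m4 app_defect4 algebra_simps)
  also have "\<dots> = 0"
    using map_eqD[OF eq_J, of "[(0, a), (0, b), (0, c), (0, d), (0, e)]"] x by (simp add: ops diff_above[OF C] defect4_zero)
  finally show ?thesis .
qed

end

context strict_iso
begin

lemma leibniz3_transport: "leibniz3 L m2 m3 m4"
proof -
  have "map_eq L (zero_map 5 2) (m2 \<circ>\<^bsub>1\<^esub> m4 - m2 \<circ>\<^bsub>2\<^esub> m4 + (m2 \<circ>\<^bsub>2\<^esub> m4)\<^bsup>cyc [1,2]\<^esup> - (m2 \<circ>\<^bsub>2\<^esub> m4)\<^bsup>cyc [1,2,3]\<^esup> + (m2 \<circ>\<^bsub>2\<^esub> m4)\<^bsup>cyc [1,2,3,4]\<^esup>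
        + m3 \<circ>\<^bsub>1\<^esub> m3 + m3 \<circ>\<^bsub>2\<^esub> m3 - (m3 \<circ>\<^bsub>2\<^esub> m3)\<^bsup>cyc [1,2]\<^esup> + (m3 \<circ>\<^bsub>2\<^esub> m3)\<^bsup>cyc [1,2,3]\<^esup>
        + m3 \<circ>\<^bsub>3\<^esub> m3 - (m3 \<circ>\<^bsub>3\<^esub> m3)\<^bsup>cyc [2,3]\<^esup> + (m3 \<circ>\<^bsub>3\<^esub> m3)\<^bsup>cyc [1,3,2]\<^esup>
        + (m3 \<circ>\<^bsub>3\<^esub> m3)\<^bsup>cyc [2,3,4]\<^esup> - (m3 \<circ>\<^bsub>3\<^esub> m3)\<^bsup>cyc [1,3,4,2]\<^esup> + (m3 \<circ>\<^bsub>3\<^esub> m3)\<^bsup>cyc [1,3] \<circ> cyc [2,4]\<^esup>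
        + m4 \<circ>\<^bsub>1\<^esub> m2 - m4 \<circ>\<^bsub>2\<^esub> m2 + (m4 \<circ>\<^bsub>2\<^esub> m2)\<^bsup>cyc [1,2]\<^esup>
        + m4 \<circ>\<^bsub>3\<^esub> m2 - (m4 \<circ>\<^bsub>3\<^esub> m2)\<^bsup>cyc [2,3]\<^esup> + (m4 \<circ>\<^bsub>3\<^esub> m2)\<^bsup>cyc [1,3,2]\<^esup>
        - m4 \<circ>\<^bsub>4\<^esub> m2 + (m4 \<circ>\<^bsub>4\<^esub> m2)\<^bsup>cyc [3,4]\<^esup> - (m4 \<circ>\<^bsub>4\<^esub> m2)\<^bsup>cyc [2,4,3]\<^esup> + (m4 \<circ>\<^bsub>4\<^esub> m2)\<^bsup>cyc [1,4,3,2]\<^esup>)" (is "map_eq L _ ?rhs")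
  proof (rule map_eqI[OF C C, of 5 2])
    show "graded_map L L 5 2 (zero_map 5 2)"
      by (rule graded | rule graded_intros)+
    show "graded_map L L 5 2 ?rhs"
      by (rule graded | rule graded_intros | simp)+
  next
    fix vs :: "(int \<times> 'v) list"
    assume l: "length vs = 5" and h: "homogeneous L vs" "fst ` set vs \<subseteq> {0, 1, 2}" "tdeg vs + 2 \<le> 2"
    then obtain p a q b r c t d s e where vs: "vs = [(p, a), (q, b), (r, c), (t, d), (s, e)]"
      by (auto simp: length_Suc_conv numeral_eq_Suc)
    have "p = 0" "q = 0" "r = 0" "t = 0" "s = 0"
      using degree_0[OF h(2), of "(p, a)"] degree_0[OF h(2), of "(q, b)"] degree_0[OF h(2), of "(r, c)"]
        degree_0[OF h(2), of "(t, d)"] degree_0[OF h(2), of "(s, e)"] h(3) by (simp_all add: vs)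
    then show "app (zero_map 5 2) vs = app ?rhs vs"
      using jacobi5_transport[of a b c d e] h(1) by (simp add: vs)
  qed
  then show ?thesis
    unfolding leibniz3_def using C graded bdry_m2 bdry_m3 bdry_m4 by blast
qed

end

subsection \<open>Transport of morphisms along a homotopy\<close>

lemma graded_map_tensor2:
  assumes "three_term_complex L'" "three_term_complex L''" "graded_map L' L'' 2 k \<mu>"
    "graded_map L L' n1 k1 \<nu>1" "graded_map L L' n2 k2 \<nu>2"
    and "n = n1 + n2" and "l = k + k1 + k2"
  shows "graded_map L L'' n l (\<mu> \<circ>\<^sub>\<otimes> [\<nu>1, \<nu>2])"
  by (rule graded_map_tensor[OF assms(1-3)]) (use assms(4-) in \<open>auto simp: graded_map_def\<close>)

lemma graded_map_tensor3:
  assumes "three_term_complex L'" "three_term_complex L''" "graded_map L' L'' 3 k \<mu>"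
    "graded_map L L' n1 k1 \<nu>1" "graded_map L L' n2 k2 \<nu>2" "graded_map L L' n3 k3 \<nu>3"
    and "n = n1 + n2 + n3" and "l = k + k1 + k2 + k3"
  shows "graded_map L L'' n l (\<mu> \<circ>\<^sub>\<otimes> [\<nu>1, \<nu>2, \<nu>3])"
  by (rule graded_map_tensor[OF assms(1-3)]) (use assms(4-) in \<open>auto simp: graded_map_def\<close>)

lemma graded_map_tensor4:
  assumes "three_term_complex L'" "three_term_complex L''" "graded_map L' L'' 4 k \<mu>"
    "graded_map L L' n1 k1 \<nu>1" "graded_map L L' n2 k2 \<nu>2" "graded_map L L' n3 k3 \<nu>3" "graded_map L L' n4 k4 \<nu>4"
    and "n = n1 + n2 + n3 + n4" and "l = k + k1 + k2 + k3 + k4"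
  shows "graded_map L L'' n l (\<mu> \<circ>\<^sub>\<otimes> [\<nu>1, \<nu>2, \<nu>3, \<nu>4])"
  by (rule graded_map_tensor[OF assms(1-3)]) (use assms(4-) in \<open>auto simp: graded_map_def\<close>)

text \<open>Again with explicit operations, because morphisms between the original structures and
  between their skew-symmetrizations live over the same two complexes.\<close>

definition leibniz3_maps ::
    "('k::comm_ring_1, 'v::ab_group_add, 'a) cplx_scheme \<Rightarrow> ('k, 'w::ab_group_add, 'b) cplx_scheme \<Rightarrow>
     ('v, 'v) gmap \<Rightarrow> ('v, 'v) gmap \<Rightarrow> ('v, 'v) gmap \<Rightarrow>
     ('w, 'w) gmap \<Rightarrow> ('w, 'w) gmap \<Rightarrow> ('w, 'w) gmap \<Rightarrow>
     ('v, 'w) gmap \<Rightarrow> ('v, 'w) gmap \<Rightarrow> ('v, 'w) gmap \<Rightarrow> bool"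
  where "leibniz3_maps L L' l2 l3 l4 m2 m3 m4 f1 f2 f3 \<longleftrightarrow>
     graded_map L L' 1 0 f1 \<and> graded_map L L' 2 1 f2 \<and> graded_map L L' 3 2 f3 \<and>
     map_eq L (bdry L L' f1) (zero_map 1 (-1)) \<and>
     map_eq L (bdry L L' f2) (f1 \<circ>\<^bsub>1\<^esub> l2 - m2 \<circ>\<^sub>\<otimes> [f1, f1]) \<and>
     map_eq L (bdry L L' f3)
       (f1 \<circ>\<^bsub>1\<^esub> l3 - f2 \<circ>\<^bsub>2\<^esub> l2 + f2 \<circ>\<^bsub>1\<^esub> l2 + (f2 \<circ>\<^bsub>2\<^esub> l2)\<^bsup>cyc [1,2]\<^esup>
        - m3 \<circ>\<^sub>\<otimes> [f1, f1, f1] - m2 \<circ>\<^sub>\<otimes> [f1, f2] + m2 \<circ>\<^sub>\<otimes> [f2, f1]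
        + (m2 \<circ>\<^sub>\<otimes> [f1, f2])\<^bsup>cyc [1,2]\<^esup>) \<and>
     map_eq L (f1 \<circ>\<^bsub>1\<^esub> l4 - m4 \<circ>\<^sub>\<otimes> [f1, f1, f1, f1])
       (f2 \<circ>\<^bsub>1\<^esub> l3 + f2 \<circ>\<^bsub>2\<^esub> l3 - (f2 \<circ>\<^bsub>2\<^esub> l3)\<^bsup>cyc [1,2]\<^esup> + (f2 \<circ>\<^bsub>2\<^esub> l3)\<^bsup>cyc [1,2,3]\<^esup>
        - f3 \<circ>\<^bsub>1\<^esub> l2 + f3 \<circ>\<^bsub>2\<^esub> l2 - (f3 \<circ>\<^bsub>2\<^esub> l2)\<^bsup>cyc [1,2]\<^esup>
        - f3 \<circ>\<^bsub>3\<^esub> l2 + (f3 \<circ>\<^bsub>3\<^esub> l2)\<^bsup>cyc [2,3]\<^esup> - (f3 \<circ>\<^bsub>3\<^esub> l2)\<^bsup>cyc [1,3,2]\<^esup>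
        + m2 \<circ>\<^sub>\<otimes> [f3, f1] + m2 \<circ>\<^sub>\<otimes> [f1, f3] - (m2 \<circ>\<^sub>\<otimes> [f1, f3])\<^bsup>cyc [1,2]\<^esup> + (m2 \<circ>\<^sub>\<otimes> [f1, f3])\<^bsup>cyc [1,2,3]\<^esup>
        - m2 \<circ>\<^sub>\<otimes> [f2, f2] + (m2 \<circ>\<^sub>\<otimes> [f2, f2])\<^bsup>cyc [2,3]\<^esup> - (m2 \<circ>\<^sub>\<otimes> [f2, f2])\<^bsup>cyc [1,3,2]\<^esup>
        + m3 \<circ>\<^sub>\<otimes> [f2, f1, f1] - m3 \<circ>\<^sub>\<otimes> [f1, f2, f1] + (m3 \<circ>\<^sub>\<otimes> [f1, f2, f1])\<^bsup>cyc [1,2]\<^esup>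
        + m3 \<circ>\<^sub>\<otimes> [f1, f1, f2] - (m3 \<circ>\<^sub>\<otimes> [f1, f1, f2])\<^bsup>cyc [2,3]\<^esup> + (m3 \<circ>\<^sub>\<otimes> [f1, f1, f2])\<^bsup>cyc [1,3,2]\<^esup>)"

locale strict_iso_homotopy =
  gV: strict_iso L l2 l3 l4 b2 b3 b4 g2 g3 + gW: strict_iso L' n2 n3 n4 p2 p3 p4 q2 q3
  for L :: "('k::comm_ring_1, 'v::ab_group_add, 'a) cplx_scheme"
    and L' :: "('k, 'w::ab_group_add, 'b) cplx_scheme"
    and l2 l3 l4 b2 b3 b4 g2 g3 n2 n3 n4 p2 p3 p4 q2 q3 +
  fixes f1 f2 f3 h2 h3 u :: "('v, 'w) gmap"
  assumes f: "leibniz3_maps L L' l2 l3 l4 n2 n3 n4 f1 f2 f3"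
    and h2: "graded_map L L' 2 1 h2" and h3: "graded_map L L' 3 2 h3" and u: "graded_map L L' 2 2 u"
    and bdry_u: "map_eq L (bdry L L' u) (h2 + f1 \<circ>\<^bsub>1\<^esub> g2 - f2 - q2 \<circ>\<^sub>\<otimes> [f1, f1])"
    and defect3: "map_eq L (zero_map 3 2) (h3 - f3 + f1 \<circ>\<^bsub>1\<^esub> g3 - q3 \<circ>\<^sub>\<otimes> [f1, f1, f1] + (q2 \<circ>\<^sub>\<otimes> [f1, f2])\<^bsup>cyc [1,2]\<^esup> - q2 \<circ>\<^sub>\<otimes> [f1, f2] + q2 \<circ>\<^sub>\<otimes> [f2, f1]
    - p2 \<circ>\<^sub>\<otimes> [u, f1] - (p2 \<circ>\<^sub>\<otimes> [f1, u])\<^bsup>cyc [1,2]\<^esup> + p2 \<circ>\<^sub>\<otimes> [f1, u] - u \<circ>\<^bsub>1\<^esub> l2 + u \<circ>\<^bsub>2\<^esub> l2 - (u \<circ>\<^bsub>2\<^esub> l2)\<^bsup>cyc [1,2]\<^esup>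
    - h2 \<circ>\<^bsub>1\<^esub> g2 + h2 \<circ>\<^bsub>2\<^esub> g2 - (h2 \<circ>\<^bsub>2\<^esub> g2)\<^bsup>cyc [1,2]\<^esup>)"
begin

lemma fgraded: "graded_map L L' 1 0 f1" "graded_map L L' 2 1 f2" "graded_map L L' 3 2 f3"
  "graded_map L L' 2 1 h2" "graded_map L L' 3 2 h3" "graded_map L L' 2 2 u"
  using f h2 h3 u by (simp_all add: leibniz3_maps_def)

lemmas fops = graded_map1[OF gV.C gW.C fgraded(1)] graded_map2[OF gV.C gW.C fgraded(2)]
  graded_map3[OF gV.C gW.C fgraded(3)] graded_map2[OF gV.C gW.C fgraded(4)]
  graded_map3[OF gV.C gW.C fgraded(5)] graded_map2[OF gV.C gW.C fgraded(6)] gV.ops gW.ops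

lemmas feqs = f[unfolded leibniz3_maps_def, THEN conjunct2, THEN conjunct2, THEN conjunct2]
lemmas diff_f1 = diff_app1[OF feqs[THEN conjunct1] gV.C gW.C fgraded(1), simplified]
lemmas diff_f2 = diff_app2[OF feqs[THEN conjunct2, THEN conjunct1] gV.C gW.C fgraded(2),
    simplified app_unfold fops gmap_simps, simplified]
lemmas diff_f3 = diff_app3[OF feqs[THEN conjunct2, THEN conjunct2, THEN conjunct1] gV.C gW.C fgraded(3),
    simplified app_unfold fops gmap_simps, simplified]
lemmas diff_u = diff_app2[OF bdry_u gV.C gW.C fgraded(6), simplified app_unfold fops gmap_simps, simplified]

definition defect3 :: "('v, 'w) gmap"
  where "defect3 = h3 - f3 + f1 \<circ>\<^bsub>1\<^esub> g3 - q3 \<circ>\<^sub>\<otimes> [f1, f1, f1] + (q2 \<circ>\<^sub>\<otimes> [f1, f2])\<^bsup>cyc [1,2]\<^esup> - q2 \<circ>\<^sub>\<otimes> [f1, f2] + q2 \<circ>\<^sub>\<otimes> [f2, f1]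
    - p2 \<circ>\<^sub>\<otimes> [u, f1] - (p2 \<circ>\<^sub>\<otimes> [f1, u])\<^bsup>cyc [1,2]\<^esup> + p2 \<circ>\<^sub>\<otimes> [f1, u] - u \<circ>\<^bsub>1\<^esub> l2 + u \<circ>\<^bsub>2\<^esub> l2 - (u \<circ>\<^bsub>2\<^esub> l2)\<^bsup>cyc [1,2]\<^esup>
    - h2 \<circ>\<^bsub>1\<^esub> g2 + h2 \<circ>\<^bsub>2\<^esub> g2 - (h2 \<circ>\<^bsub>2\<^esub> g2)\<^bsup>cyc [1,2]\<^esup>"

lemma defect3_zero: "a \<in> comp L p \<Longrightarrow> b \<in> comp L q \<Longrightarrow> c \<in> comp L r \<Longrightarrow> app defect3 [(p, a), (q, b), (r, c)] = 0"
  using map_eqD[OF defect3, of "[(p, a), (q, b), (r, c)]"] by (simp add: defect3_def)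

lemma defect3_arity: "arity defect3 = 3" "gdeg defect3 = 2"
  by (simp_all add: defect3_def graded_mapD(1,2)[OF h3])

lemmas app_defect3 = arg_cong[OF defect3_def, of "\<lambda>\<mu>. app \<mu> [(p, a), (q, b), (r, c)]" for p a q b r c,
  simplified app_unfold fops gmap_simps, simplified]

definition morphism4 :: "('v, 'w) gmap"
  where "morphism4 = (f2 \<circ>\<^bsub>1\<^esub> l3 + f2 \<circ>\<^bsub>2\<^esub> l3 - (f2 \<circ>\<^bsub>2\<^esub> l3)\<^bsup>cyc [1,2]\<^esup> + (f2 \<circ>\<^bsub>2\<^esub> l3)\<^bsup>cyc [1,2,3]\<^esup>
        - f3 \<circ>\<^bsub>1\<^esub> l2 + f3 \<circ>\<^bsub>2\<^esub> l2 - (f3 \<circ>\<^bsub>2\<^esub> l2)\<^bsup>cyc [1,2]\<^esup>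
        - f3 \<circ>\<^bsub>3\<^esub> l2 + (f3 \<circ>\<^bsub>3\<^esub> l2)\<^bsup>cyc [2,3]\<^esup> - (f3 \<circ>\<^bsub>3\<^esub> l2)\<^bsup>cyc [1,3,2]\<^esup>
        + n2 \<circ>\<^sub>\<otimes> [f3, f1] + n2 \<circ>\<^sub>\<otimes> [f1, f3] - (n2 \<circ>\<^sub>\<otimes> [f1, f3])\<^bsup>cyc [1,2]\<^esup> + (n2 \<circ>\<^sub>\<otimes> [f1, f3])\<^bsup>cyc [1,2,3]\<^esup>
        - n2 \<circ>\<^sub>\<otimes> [f2, f2] + (n2 \<circ>\<^sub>\<otimes> [f2, f2])\<^bsup>cyc [2,3]\<^esup> - (n2 \<circ>\<^sub>\<otimes> [f2, f2])\<^bsup>cyc [1,3,2]\<^esup>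
        + n3 \<circ>\<^sub>\<otimes> [f2, f1, f1] - n3 \<circ>\<^sub>\<otimes> [f1, f2, f1] + (n3 \<circ>\<^sub>\<otimes> [f1, f2, f1])\<^bsup>cyc [1,2]\<^esup>
        + n3 \<circ>\<^sub>\<otimes> [f1, f1, f2] - (n3 \<circ>\<^sub>\<otimes> [f1, f1, f2])\<^bsup>cyc [2,3]\<^esup> + (n3 \<circ>\<^sub>\<otimes> [f1, f1, f2])\<^bsup>cyc [1,3,2]\<^esup>)
    - (f1 \<circ>\<^bsub>1\<^esub> l4 - n4 \<circ>\<^sub>\<otimes> [f1, f1, f1, f1])"

lemma morphism4_zero:
  "a \<in> comp L p \<Longrightarrow> b \<in> comp L q \<Longrightarrow> c \<in> comp L r \<Longrightarrow> d \<in> comp L t \<Longrightarrow>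
    app morphism4 [(p, a), (q, b), (r, c), (t, d)] = 0"
  using map_eqD[OF feqs[THEN conjunct2, THEN conjunct2, THEN conjunct2], of "[(p, a), (q, b), (r, c), (t, d)]"]
  by (simp add: morphism4_def fops)

lemmas app_morphism4 = arg_cong[OF morphism4_def, of "\<lambda>\<mu>. app \<mu> [(p, a), (q, b), (r, c), (t, d)]" for p a q b r c t d,
  simplified app_unfold fops gmap_simps, simplified]

lemmas fexpand = fops gV.expand0 gW.expand0 gV.diff_m2 gV.diff_m3 gV.diff_m4 gW.diff_m2 gW.diff_m3 gW.diff_m4
  diff_f1 diff_f2 diff_f3 diff_u

lemmas fgraded_intros = gV.graded gW.graded fgraded
  graded_map_add[OF gW.C] graded_map_diff[OF gW.C] graded_map_zero[OF gW.C]
  graded_map_perm[OF gV.C gW.C] graded_map_circ[OF gV.C gW.C] graded_map_tensor2[OF gW.C gW.C] graded_map_tensor3[OF gW.C gW.C]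
  graded_map_tensor4[OF gW.C gW.C]
  graded_map_bdry[OF gV.C gW.C] cyc_permutes

text \<open>Take boundaries in \<open>bdry_u\<close>: the only remainder is d d of
  \<open>u\<close>.\<close>

lemma bdry_h2: "map_eq L (bdry L L' h2)
    (f1 \<circ>\<^bsub>1\<^esub> b2 - p2 \<circ>\<^sub>\<otimes> [f1, f1])" (is "map_eq L _ ?rhs")
proof (rule map_eqI[OF gV.C gW.C, of 2 0])
  show "graded_map L L' 2 0 (bdry L L' h2)"
    by (rule fgraded_intros | simp)+
  show "graded_map L L' 2 0 ?rhs"
    by (rule fgraded_intros | simp)+
next
  fix vs :: "(int \<times> 'v) list"
  assume "length vs = 2" and h: "homogeneous L vs" "fst ` set vs \<subseteq> {0, 1, 2}" "tdeg vs + 0 \<le> 2"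
  then obtain a p b q where vs: "vs = [(p, a), (q, b)]"
    by (auto simp: length_Suc_conv numeral_eq_Suc)
  have x: "a \<in> comp L p" "b \<in> comp L q" using h vs by auto
  have "app (bdry L L' h2) [(p, a), (q, b)] = app ?rhs [(p, a), (q, b)]
      + app (diff L') [(p + q + 1, app (diff L') [(p + q + 2, app u [(p, a), (q, b)])])]"
    using degree_cases2[OF h(2)[unfolded vs]] x
    by (elim disjE conjE; hypsubst; simp add: app_bdry2[OF gV.C gW.C graded_mapD(1,2)[OF h2]] fexpand algebra_simps)
  also have "app (diff L') [(p + q + 1, app (diff L') [(p + q + 2, app u [(p, a), (q, b)])])] = 0"
    using x by (simp add: fops diff_diff[OF gW.C])
  finally show "app (bdry L L' h2) vs = app ?rhs vs" by (simp add: vs)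
qed

lemmas diff_h2 = diff_app2[OF bdry_h2 gV.C gW.C h2, simplified app_unfold fops gmap_simps, simplified]

text \<open>Take boundaries in the ternary homotopy relation; the boundary of \<open>h2\<close> is
  known by now.\<close>

lemma bdry_h3: "map_eq L (bdry L L' h3)
    (f1 \<circ>\<^bsub>1\<^esub> b3 - h2 \<circ>\<^bsub>2\<^esub> b2 + h2 \<circ>\<^bsub>1\<^esub> b2 + (h2 \<circ>\<^bsub>2\<^esub> b2)\<^bsup>cyc [1,2]\<^esup>
        - p3 \<circ>\<^sub>\<otimes> [f1, f1, f1] - p2 \<circ>\<^sub>\<otimes> [f1, h2] + p2 \<circ>\<^sub>\<otimes> [h2, f1]
        + (p2 \<circ>\<^sub>\<otimes> [f1, h2])\<^bsup>cyc [1,2]\<^esup>)" (is "map_eq L _ ?rhs")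
proof (rule map_eqI[OF gV.C gW.C, of 3 1])
  show "graded_map L L' 3 1 (bdry L L' h3)"
    by (rule fgraded_intros | simp)+
  show "graded_map L L' 3 1 ?rhs"
    by (rule fgraded_intros | simp)+
next
  fix vs :: "(int \<times> 'v) list"
  assume "length vs = 3" and h: "homogeneous L vs" "fst ` set vs \<subseteq> {0, 1, 2}" "tdeg vs + 1 \<le> 2"
  then obtain a p b q c r where vs: "vs = [(p, a), (q, b), (r, c)]"
    by (auto simp: length_Suc_conv numeral_eq_Suc)
  have x: "a \<in> comp L p" "b \<in> comp L q" "c \<in> comp L r" using h vs by auto
  have tdeg: "p + q + r \<le> 1" using h(3) vs by simp
  have "app (bdry L L' h3) [(p, a), (q, b), (r, c)] = app ?rhs [(p, a), (q, b), (r, c)] + app (bdry L L' defect3) [(p, a), (q, b), (r, c)]"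
    using degree_cases3_1[OF h(2)[unfolded vs] tdeg] x
    by (elim disjE conjE; hypsubst; simp add: app_bdry3[OF gV.C gW.C graded_mapD(1,2)[OF h3]]
      app_bdry3[OF gV.C gW.C defect3_arity] app_defect3 fexpand diff_h2 algebra_simps)
  also have "app (bdry L L' defect3) [(p, a), (q, b), (r, c)] = 0"
    using x by (simp add: app_bdry3[OF gV.C gW.C defect3_arity] defect3_zero fops)
  finally show "app (bdry L L' h3) vs = app ?rhs vs" by (simp add: vs)
qed

lemmas diff_h3 = diff_app3[OF bdry_h3 gV.C gW.C h3, simplified app_unfold fops gmap_simps, simplified]

end

context strict_iso_homotopy
begin

text \<open>The four-ary equations of \<open>f\<close>, \<open>g\<close> and \<open>q\<close> enter
  through \<open>morphism4\<close>, \<open>gV.defect4\<close> and \<open>gW.defect4\<close>, the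
  ternary homotopy relation through composites of \<open>defect3\<close> with \<open>l2\<close> and
  \<open>p2\<close>. The other summands are d of elements of degree 3.\<close>

lemma morphism4_transport:
  assumes x: "a \<in> comp L 0" "b \<in> comp L 0" "c \<in> comp L 0" "d \<in> comp L 0"
  shows "app (f1 \<circ>\<^bsub>1\<^esub> b4 - p4 \<circ>\<^sub>\<otimes> [f1, f1, f1, f1]) [(0, a), (0, b), (0, c), (0, d)] =
    app (h2 \<circ>\<^bsub>1\<^esub> b3 + h2 \<circ>\<^bsub>2\<^esub> b3 - (h2 \<circ>\<^bsub>2\<^esub> b3)\<^bsup>cyc [1,2]\<^esup> + (h2 \<circ>\<^bsub>2\<^esub> b3)\<^bsup>cyc [1,2,3]\<^esup>
        - h3 \<circ>\<^bsub>1\<^esub> b2 + h3 \<circ>\<^bsub>2\<^esub> b2 - (h3 \<circ>\<^bsub>2\<^esub> b2)\<^bsup>cyc [1,2]\<^esup>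
        - h3 \<circ>\<^bsub>3\<^esub> b2 + (h3 \<circ>\<^bsub>3\<^esub> b2)\<^bsup>cyc [2,3]\<^esup> - (h3 \<circ>\<^bsub>3\<^esub> b2)\<^bsup>cyc [1,3,2]\<^esup>
        + p2 \<circ>\<^sub>\<otimes> [h3, f1] + p2 \<circ>\<^sub>\<otimes> [f1, h3] - (p2 \<circ>\<^sub>\<otimes> [f1, h3])\<^bsup>cyc [1,2]\<^esup> + (p2 \<circ>\<^sub>\<otimes> [f1, h3])\<^bsup>cyc [1,2,3]\<^esup>
        - p2 \<circ>\<^sub>\<otimes> [h2, h2] + (p2 \<circ>\<^sub>\<otimes> [h2, h2])\<^bsup>cyc [2,3]\<^esup> - (p2 \<circ>\<^sub>\<otimes> [h2, h2])\<^bsup>cyc [1,3,2]\<^esup>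
        + p3 \<circ>\<^sub>\<otimes> [h2, f1, f1] - p3 \<circ>\<^sub>\<otimes> [f1, h2, f1] + (p3 \<circ>\<^sub>\<otimes> [f1, h2, f1])\<^bsup>cyc [1,2]\<^esup>
        + p3 \<circ>\<^sub>\<otimes> [f1, f1, h2] - (p3 \<circ>\<^sub>\<otimes> [f1, f1, h2])\<^bsup>cyc [2,3]\<^esup> + (p3 \<circ>\<^sub>\<otimes> [f1, f1, h2])\<^bsup>cyc [1,3,2]\<^esup>) [(0, a), (0, b), (0, c), (0, d)]"
proof -
  have "app (h2 \<circ>\<^bsub>1\<^esub> b3 + h2 \<circ>\<^bsub>2\<^esub> b3 - (h2 \<circ>\<^bsub>2\<^esub> b3)\<^bsup>cyc [1,2]\<^esup> + (h2 \<circ>\<^bsub>2\<^esub> b3)\<^bsup>cyc [1,2,3]\<^esup>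
        - h3 \<circ>\<^bsub>1\<^esub> b2 + h3 \<circ>\<^bsub>2\<^esub> b2 - (h3 \<circ>\<^bsub>2\<^esub> b2)\<^bsup>cyc [1,2]\<^esup>
        - h3 \<circ>\<^bsub>3\<^esub> b2 + (h3 \<circ>\<^bsub>3\<^esub> b2)\<^bsup>cyc [2,3]\<^esup> - (h3 \<circ>\<^bsub>3\<^esub> b2)\<^bsup>cyc [1,3,2]\<^esup>
        + p2 \<circ>\<^sub>\<otimes> [h3, f1] + p2 \<circ>\<^sub>\<otimes> [f1, h3] - (p2 \<circ>\<^sub>\<otimes> [f1, h3])\<^bsup>cyc [1,2]\<^esup> + (p2 \<circ>\<^sub>\<otimes> [f1, h3])\<^bsup>cyc [1,2,3]\<^esup>
        - p2 \<circ>\<^sub>\<otimes> [h2, h2] + (p2 \<circ>\<^sub>\<otimes> [h2, h2])\<^bsup>cyc [2,3]\<^esup> - (p2 \<circ>\<^sub>\<otimes> [h2, h2])\<^bsup>cyc [1,3,2]\<^esup>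
        + p3 \<circ>\<^sub>\<otimes> [h2, f1, f1] - p3 \<circ>\<^sub>\<otimes> [f1, h2, f1] + (p3 \<circ>\<^sub>\<otimes> [f1, h2, f1])\<^bsup>cyc [1,2]\<^esup>
        + p3 \<circ>\<^sub>\<otimes> [f1, f1, h2] - (p3 \<circ>\<^sub>\<otimes> [f1, f1, h2])\<^bsup>cyc [2,3]\<^esup> + (p3 \<circ>\<^sub>\<otimes> [f1, f1, h2])\<^bsup>cyc [1,3,2]\<^esup>) [(0, a), (0, b), (0, c), (0, d)]
    - app (f1 \<circ>\<^bsub>1\<^esub> b4 - p4 \<circ>\<^sub>\<otimes> [f1, f1, f1, f1]) [(0, a), (0, b), (0, c), (0, d)] =
      0
       + app defect3 [(0, a), (0, app l2 [(0, b), (0, c)]), (0, d)]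
       - app defect3 [(0, b), (0, c), (0, app l2 [(0, a), (0, d)])]
       - app defect3 [(0, b), (0, app l2 [(0, a), (0, c)]), (0, d)]
       + app p2 [(2, app defect3 [(0, a), (0, b), (0, c)]), (0, app f1 [(0, d)])]
       + app p2 [(0, app f1 [(0, a)]), (2, app defect3 [(0, b), (0, c), (0, d)])]
       + app defect3 [(0, a), (0, c), (0, app l2 [(0, b), (0, d)])]
       - app p2 [(0, app f1 [(0, b)]), (2, app defect3 [(0, a), (0, c), (0, d)])]
       + app p2 [(0, app f1 [(0, c)]), (2, app defect3 [(0, a), (0, b), (0, d)])]
       - app defect3 [(0, app l2 [(0, a), (0, b)]), (0, c), (0, d)]
       - app defect3 [(0, a), (0, b), (0, app l2 [(0, c), (0, d)])]
       + app morphism4 [(0, a), (0, b), (0, c), (0, d)]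
       + app f1 [(2, app gV.defect4 [(0, a), (0, b), (0, c), (0, d)])]
       - app gW.defect4 [(0, app f1 [(0, a)]), (0, app f1 [(0, b)]), (0, app f1 [(0, c)]), (0, app f1 [(0, d)])]
       + app (diff L') [(3, app h3 [(1, app g2 [(0, a), (0, b)]), (0, c), (0, d)])]
       - app (diff L') [(3, app p3 [(2, app u [(0, a), (0, b)]), (0, app f1 [(0, c)]), (0, app f1 [(0, d)])])]
       + app (diff L') [(3, app p2 [(1, app f1 [(1, app g2 [(0, b), (0, c)])]), (2, app u [(0, a), (0, d)])])]
       + app (diff L') [(3, app u [(0, a), (1, app l3 [(0, b), (0, c), (0, d)])])]
       + app (diff L') [(3, app u [(1, app l3 [(0, a), (0, b), (0, c)]), (0, d)])]
       + app (diff L') [(3, app u [(0, c), (1, app l3 [(0, a), (0, b), (0, d)])])]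
       + app (diff L') [(3, app h2 [(2, app g3 [(0, a), (0, b), (0, c)]), (0, d)])]
       - app (diff L') [(3, app h2 [(1, app g2 [(0, a), (0, b)]), (1, app g2 [(0, c), (0, d)])])]
       + app (diff L') [(3, app p2 [(1, app f1 [(1, app g2 [(0, a), (0, b)])]), (2, app u [(0, c), (0, d)])])]
       - app (diff L') [(3, app q2 [(0, app f1 [(0, c)]), (2, app f3 [(0, a), (0, b), (0, d)])])]
       - app (diff L') [(3, app u [(0, b), (1, app l3 [(0, a), (0, c), (0, d)])])]
       + app (diff L') [(3, app q2 [(0, app f1 [(0, b)]), (2, app f3 [(0, a), (0, c), (0, d)])])]
       + app (diff L') [(3, app q3 [(0, app f1 [(0, a)]), (0, app f1 [(0, c)]), (1, app f2 [(0, b), (0, d)])])]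
       - app (diff L') [(3, app q2 [(1, app f2 [(0, a), (0, c)]), (1, app f2 [(0, b), (0, d)])])]
       + app (diff L') [(3, app p2 [(2, app u [(0, a), (0, c)]), (1, app q2 [(0, app f1 [(0, b)]), (0, app f1 [(0, d)])])])]
       - app (diff L') [(3, app p2 [(1, app h2 [(0, a), (0, c)]), (2, app u [(0, b), (0, d)])])]
       - app (diff L') [(3, app p2 [(1, app f1 [(1, app g2 [(0, a), (0, c)])]), (2, app u [(0, b), (0, d)])])]
       + app (diff L') [(3, app h3 [(0, b), (1, app g2 [(0, a), (0, c)]), (0, d)])]
       + app (diff L') [(3, app h3 [(0, a), (0, b), (1, app g2 [(0, c), (0, d)])])]
       + app (diff L') [(3, app h2 [(0, a), (2, app g3 [(0, b), (0, c), (0, d)])])]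
       - app (diff L') [(3, app h2 [(0, b), (2, app g3 [(0, a), (0, c), (0, d)])])]
       + app (diff L') [(3, app p2 [(2, app u [(0, a), (0, c)]), (1, app f2 [(0, b), (0, d)])])]
       - app (diff L') [(3, app p2 [(2, app u [(0, b), (0, c)]), (1, app f2 [(0, a), (0, d)])])]
       + app (diff L') [(3, app p2 [(1, app h2 [(0, b), (0, c)]), (2, app u [(0, a), (0, d)])])]
       - app (diff L') [(3, app p2 [(2, app u [(0, b), (0, c)]), (1, app q2 [(0, app f1 [(0, a)]), (0, app f1 [(0, d)])])])]
       - app (diff L') [(3, app q3 [(0, app f1 [(0, b)]), (0, app f1 [(0, c)]), (1, app f2 [(0, a), (0, d)])])]
       + app (diff L') [(3, app q2 [(1, app f2 [(0, b), (0, c)]), (1, app f2 [(0, a), (0, d)])])]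
       + app (diff L') [(3, app q3 [(0, app f1 [(0, a)]), (1, app f2 [(0, b), (0, c)]), (0, app f1 [(0, d)])])]
       - app (diff L') [(3, app q2 [(2, app f3 [(0, a), (0, b), (0, c)]), (0, app f1 [(0, d)])])]
       + app (diff L') [(3, app p3 [(0, app f1 [(0, a)]), (2, app u [(0, b), (0, c)]), (0, app f1 [(0, d)])])]
       - app (diff L') [(3, app h2 [(1, app g2 [(0, b), (0, c)]), (1, app g2 [(0, a), (0, d)])])]
       - app (diff L') [(3, app h3 [(0, a), (0, c), (1, app g2 [(0, b), (0, d)])])]
       + app (diff L') [(3, app h2 [(1, app g2 [(0, a), (0, c)]), (1, app g2 [(0, b), (0, d)])])]
       - app (diff L') [(3, app h3 [(0, a), (1, app g2 [(0, b), (0, c)]), (0, d)])]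
       - app (diff L') [(3, app q2 [(0, app f1 [(0, a)]), (2, app f3 [(0, b), (0, c), (0, d)])])]
       - app (diff L') [(3, app q3 [(0, app f1 [(0, b)]), (1, app f2 [(0, a), (0, c)]), (0, app f1 [(0, d)])])]
       - app (diff L') [(3, app p3 [(0, app f1 [(0, a)]), (0, app f1 [(0, b)]), (2, app u [(0, c), (0, d)])])]
       + app (diff L') [(3, app p2 [(1, app h2 [(0, a), (0, b)]), (2, app u [(0, c), (0, d)])])]
       - app (diff L') [(3, app p2 [(2, app u [(0, a), (0, b)]), (1, app q2 [(0, app f1 [(0, c)]), (0, app f1 [(0, d)])])])]
       - app (diff L') [(3, app p3 [(0, app f1 [(0, b)]), (0, app f1 [(0, c)]), (2, app u [(0, a), (0, d)])])]
       + app (diff L') [(3, app p3 [(0, app f1 [(0, a)]), (0, app f1 [(0, c)]), (2, app u [(0, b), (0, d)])])]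
       - app (diff L') [(3, app q3 [(1, app f2 [(0, a), (0, b)]), (0, app f1 [(0, c)]), (0, app f1 [(0, d)])])]
       + app (diff L') [(3, app q2 [(1, app f2 [(0, a), (0, b)]), (1, app f2 [(0, c), (0, d)])])]
       - app (diff L') [(3, app q3 [(0, app f1 [(0, a)]), (0, app f1 [(0, b)]), (1, app f2 [(0, c), (0, d)])])]
       - app (diff L') [(3, app p2 [(2, app u [(0, a), (0, b)]), (1, app f2 [(0, c), (0, d)])])]
       + app (diff L') [(3, app h2 [(0, c), (2, app g3 [(0, a), (0, b), (0, d)])])]
       + app (diff L') [(3, app h3 [(0, b), (0, c), (1, app g2 [(0, a), (0, d)])])]
       - app (diff L') [(3, app p3 [(0, app f1 [(0, b)]), (2, app u [(0, a), (0, c)]), (0, app f1 [(0, d)])])]"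
    by (simp add: x fexpand diff_h2 diff_h3 gV.app_defect4 gW.app_defect4 app_defect3 app_morphism4 algebra_simps)
  also have "\<dots> = 0"
    using x by (simp add: fops diff_above[OF gW.C] gV.defect4_zero gW.defect4_zero defect3_zero morphism4_zero)
  finally show ?thesis by simp
qed

end

subsection \<open>Alternation of the transported four-ary bracket\<close>

text \<open>Antisymmetrization without Koszul signs, as appropriate for arguments of degree 0,
  written out so that rewriting reaches every summand. In arity four it is organized like a Laplace
  expansion along the first argument.\<close>

definition alt3 :: "('x \<Rightarrow> 'x \<Rightarrow> 'x \<Rightarrow> 'w::ab_group_add) \<Rightarrow> 'x \<Rightarrow> 'x \<Rightarrow> 'x \<Rightarrow> 'w"
  where "alt3 F a b c = F a b c - F a c b - F b a c + F b c a + F c a b - F c b a"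

definition alt4 :: "('x \<Rightarrow> 'x \<Rightarrow> 'x \<Rightarrow> 'x \<Rightarrow> 'w::ab_group_add) \<Rightarrow> 'x \<Rightarrow> 'x \<Rightarrow> 'x \<Rightarrow> 'x \<Rightarrow> 'w"
  where "alt4 F a b c d = alt3 (F a) b c d - alt3 (F b) a c d + alt3 (F c) a b d - alt3 (F d) a b c"

lemma alt4_zero:
  assumes "\<And>a b c d. a \<in> C \<Longrightarrow> b \<in> C \<Longrightarrow> c \<in> C \<Longrightarrow> d \<in> C \<Longrightarrow> F a b c d = 0"
    and "a \<in> C" "b \<in> C" "c \<in> C" "d \<in> C"
  shows "alt4 F a b c d = 0"
  by (simp add: alt4_def alt3_def assms)

text \<open>The assumptions \<open>bdry_h\<close>, \<open>l31\<close> and \<open>l32\<close> are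
  equations of a weak morphism with components id, \<open>g2\<close>, \<open>h\<close>,
  \<open>g3\<close> into a target with vanishing symmetry operations. The assumption
  \<open>g3_alt\<close> states that 2 g3 + 6 g2 g2 - 3 h l2 - 3 l2 h, all composed in the first
  slot, has zero antisymmetrization; it serves to evaluate the antisymmetrization of the transported
  bracket.\<close>

locale skew_iso = strict_iso L l2 l3 l4 m2 m3 m4 g2 g3
  for L :: "('k::comm_ring_1, 'v::ab_group_add, 'a) cplx_scheme"
    and l2 l3 l4 m2 m3 m4 g2 g3 +
  fixes l21 l31 l32 h :: "('v, 'v) gmap"
  assumes hgraded: "graded_map L L 2 2 h"
    and bdry_h: "map_eq L (bdry L L h) (g2 - g2\<^bsup>cyc [1,2]\<^esup>)"
    and l21: "map_eq L l21 (g2 + g2)"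
    and l31: "map_eq L l31 (g3 + g3\<^bsup>cyc [1,2]\<^esup> + g2 \<circ>\<^bsub>1\<^esub> l21 + m2 \<circ>\<^bsub>1\<^esub> h)"
    and l32: "map_eq L l32 (g3 + g3\<^bsup>cyc [2,3]\<^esup> - g2 \<circ>\<^bsub>2\<^esub> l21 + h \<circ>\<^bsub>1\<^esub> l2 + (h \<circ>\<^bsub>2\<^esub> l2)\<^bsup>cyc [1,2]\<^esup> - m2 \<circ>\<^bsub>2\<^esub> h)"
    and m2_eq: "map_eq L (m2 + m2) (l2 - l2\<^bsup>cyc [1,2]\<^esup>)"
    and h_skew: "map_eq L (h + h\<^bsup>cyc [1,2]\<^esup>) (zero_map 2 2)"
    and m2_skew: "map_eq L (m2 + m2\<^bsup>cyc [1,2]\<^esup>) (zero_map 2 0)"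
    and m3_skew: "map_eq L (m3 + m3\<^bsup>cyc [1,2]\<^esup>) (zero_map 3 1)" "map_eq L (m3 + m3\<^bsup>cyc [2,3]\<^esup>) (zero_map 3 1)"
    and l4_swap: "map_eq L (l4 + l4\<^bsup>cyc [1,2]\<^esup>)
       (l2 \<circ>\<^bsub>1\<^esub> l31 - l31 \<circ>\<^bsub>3\<^esub> l2 + (l2 \<circ>\<^bsub>2\<^esub> l31)\<^bsup>cyc [1,2,3]\<^esup> + l3 \<circ>\<^bsub>1\<^esub> l21)"
     "map_eq L (l4 + l4\<^bsup>cyc [2,3]\<^esup>)
       (l2 \<circ>\<^bsub>1\<^esub> l32 - l3 \<circ>\<^bsub>2\<^esub> l21 + l2 \<circ>\<^bsub>2\<^esub> l31
        - l31 \<circ>\<^bsub>1\<^esub> l2 - (l31 \<circ>\<^bsub>2\<^esub> l2)\<^bsup>cyc [1,2]\<^esup> - (l31 \<circ>\<^bsub>3\<^esub> l2)\<^bsup>cyc [1,3,2]\<^esup>)"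
     "map_eq L (l4 + l4\<^bsup>cyc [3,4]\<^esup>)
       (l21 \<circ>\<^bsub>1\<^esub> l3 - l32 \<circ>\<^bsub>1\<^esub> l2 + l32 \<circ>\<^bsub>2\<^esub> l2 - (l32 \<circ>\<^bsub>2\<^esub> l2)\<^bsup>cyc [1,2]\<^esup>
        + l3 \<circ>\<^bsub>3\<^esub> l21 + (l32 \<circ>\<^bsub>3\<^esub> l2)\<^bsup>cyc [2,3]\<^esup> - (l32 \<circ>\<^bsub>3\<^esub> l2)\<^bsup>cyc [1,3,2]\<^esup>
        + l2 \<circ>\<^bsub>2\<^esub> l32 - (l2 \<circ>\<^bsub>2\<^esub> l32)\<^bsup>cyc [1,2]\<^esup> + (l21 \<circ>\<^bsub>2\<^esub> l3)\<^bsup>cyc [1,2,3]\<^esup>)"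
    and g3_alt: "\<And>a b c. a \<in> comp L 0 \<Longrightarrow> b \<in> comp L 0 \<Longrightarrow> c \<in> comp L 0 \<Longrightarrow>
      alt3 (\<lambda>a b c. app (g3 + g3 + g2 \<circ>\<^bsub>1\<^esub> g2 + g2 \<circ>\<^bsub>1\<^esub> g2 + g2 \<circ>\<^bsub>1\<^esub> g2 + g2 \<circ>\<^bsub>1\<^esub> g2 + g2 \<circ>\<^bsub>1\<^esub> g2 + g2 \<circ>\<^bsub>1\<^esub> g2
        - h \<circ>\<^bsub>1\<^esub> l2 - h \<circ>\<^bsub>1\<^esub> l2 - h \<circ>\<^bsub>1\<^esub> l2 - l2 \<circ>\<^bsub>1\<^esub> h - l2 \<circ>\<^bsub>1\<^esub> h - l2 \<circ>\<^bsub>1\<^esub> h)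
        [(0, a), (0, b), (0, c)]) a b c = 0"
    and l21_graded: "graded_map L L 2 1 l21" and l31_graded: "graded_map L L 3 2 l31" and l32_graded: "graded_map L L 3 2 l32"
begin

lemmas hops = ops graded_map2[OF C C hgraded] graded_mapD(1,2)[OF l21_graded]
  graded_mapD(1,2)[OF l31_graded] graded_mapD(1,2)[OF l32_graded]

lemmas diff_h = diff_app2[OF bdry_h C C hgraded, simplified app_unfold hops gmap_simps, simplified]

lemma app_l21: "a \<in> comp L p \<Longrightarrow> b \<in> comp L q \<Longrightarrow>
    app l21 [(p, a), (q, b)] = app g2 [(p, a), (q, b)] + app g2 [(p, a), (q, b)]"
  using map_eqD[OF l21, of "[(p, a), (q, b)]"] by (simp add: hops)

lemma app_l31_raw: "a \<in> comp L p \<Longrightarrow> b \<in> comp L q \<Longrightarrow> c \<in> comp L r \<Longrightarrow>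
    app l31 [(p, a), (q, b), (r, c)] =
    app (g3 + g3\<^bsup>cyc [1,2]\<^esup> + g2 \<circ>\<^bsub>1\<^esub> l21 + m2 \<circ>\<^bsub>1\<^esub> h) [(p, a), (q, b), (r, c)]"
  by (rule map_eqD[OF l31]) (simp_all add: hops)

lemma app_l32_raw: "a \<in> comp L p \<Longrightarrow> b \<in> comp L q \<Longrightarrow> c \<in> comp L r \<Longrightarrow>
    app l32 [(p, a), (q, b), (r, c)] =
    app (g3 + g3\<^bsup>cyc [2,3]\<^esup> - g2 \<circ>\<^bsub>2\<^esub> l21 + h \<circ>\<^bsub>1\<^esub> l2 + (h \<circ>\<^bsub>2\<^esub> l2)\<^bsup>cyc [1,2]\<^esup> - m2 \<circ>\<^bsub>2\<^esub> h)
      [(p, a), (q, b), (r, c)]"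
  by (rule map_eqD[OF l32]) (simp_all add: hops)

lemmas app_l31 = app_l31_raw[simplified app_unfold hops gmap_simps, simplified]
lemmas app_l32 = app_l32_raw[simplified app_unfold hops gmap_simps, simplified]

text \<open>This relation and the following ones are turned into maps that vanish on homogeneous
  arguments, in the manner of \<open>defect4\<close>, so that certificates can cite their
  values.\<close>

definition defect_m2 :: "('v, 'v) gmap"
  where "defect_m2 = l2 - l2\<^bsup>cyc [1,2]\<^esup> - (m2 + m2)"

lemma defect_m2_zero: "a \<in> comp L p \<Longrightarrow> b \<in> comp L q \<Longrightarrow> app defect_m2 [(p, a), (q, b)] = 0"
  using map_eqD[OF m2_eq, of "[(p, a), (q, b)]"] by (simp add: defect_m2_def hops)

lemmas app_defect_m2 = arg_cong[OF defect_m2_def, of "\<lambda>\<mu>. app \<mu> [(p, a), (q, b)]" for p a q b,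
  simplified app_unfold hops gmap_simps, simplified]

definition defect_h :: "('v, 'v) gmap"
  where "defect_h = h + h\<^bsup>cyc [1,2]\<^esup>"

lemma defect_h_zero: "a \<in> comp L p \<Longrightarrow> b \<in> comp L q \<Longrightarrow> app defect_h [(p, a), (q, b)] = 0"
  using map_eqD[OF h_skew, of "[(p, a), (q, b)]"] by (simp add: defect_h_def hops)

lemmas app_defect_h = arg_cong[OF defect_h_def, of "\<lambda>\<mu>. app \<mu> [(p, a), (q, b)]" for p a q b,
  simplified app_unfold hops gmap_simps, simplified]

definition defect_skew2 :: "('v, 'v) gmap"
  where "defect_skew2 = m2 + m2\<^bsup>cyc [1,2]\<^esup>"

lemma defect_skew2_zero: "a \<in> comp L p \<Longrightarrow> b \<in> comp L q \<Longrightarrow> app defect_skew2 [(p, a), (q, b)] = 0"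
  using map_eqD[OF m2_skew, of "[(p, a), (q, b)]"] by (simp add: defect_skew2_def hops)

lemmas app_defect_skew2 = arg_cong[OF defect_skew2_def, of "\<lambda>\<mu>. app \<mu> [(p, a), (q, b)]" for p a q b,
  simplified app_unfold hops gmap_simps, simplified]

definition defect_skew3a :: "('v, 'v) gmap"
  where "defect_skew3a = m3 + m3\<^bsup>cyc [1,2]\<^esup>"

lemma defect_skew3a_zero: "a \<in> comp L p \<Longrightarrow> b \<in> comp L q \<Longrightarrow> c \<in> comp L r \<Longrightarrow> app defect_skew3a [(p, a), (q, b), (r, c)] = 0"
  using map_eqD[OF m3_skew(1), of "[(p, a), (q, b), (r, c)]"] by (simp add: defect_skew3a_def hops)

lemmas app_defect_skew3a = arg_cong[OF defect_skew3a_def, of "\<lambda>\<mu>. app \<mu> [(p, a), (q, b), (r, c)]" for p a q b r c,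
  simplified app_unfold hops gmap_simps, simplified]

definition defect_skew3b :: "('v, 'v) gmap"
  where "defect_skew3b = m3 + m3\<^bsup>cyc [2,3]\<^esup>"

lemma defect_skew3b_zero: "a \<in> comp L p \<Longrightarrow> b \<in> comp L q \<Longrightarrow> c \<in> comp L r \<Longrightarrow> app defect_skew3b [(p, a), (q, b), (r, c)] = 0"
  using map_eqD[OF m3_skew(2), of "[(p, a), (q, b), (r, c)]"] by (simp add: defect_skew3b_def hops)

lemmas app_defect_skew3b = arg_cong[OF defect_skew3b_def, of "\<lambda>\<mu>. app \<mu> [(p, a), (q, b), (r, c)]" for p a q b r c,
  simplified app_unfold hops gmap_simps, simplified]

lemmas defects_zero = defect_m2_zero defect_h_zero defect_skew2_zero defect_skew3a_zero defect_skew3b_zero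
lemmas app_defects = app_defect_m2 app_defect_h app_defect_skew2 app_defect_skew3a app_defect_skew3b
lemmas hexpand = hops expand0 diff_m2 diff_m3 diff_h app_l21 app_l31 app_l32 app_defects

text \<open>The four-ary equation expresses \<open>m4\<close> by \<open>l4\<close> and terms in
  \<open>g2\<close> and \<open>g3\<close>. In the symmetric sum the axiom for \<open>l4\<close>
  contributes \<open>l31\<close>, which, rewritten by \<open>g3\<close>, cancels those terms. The
  rest is accounted for by skew-symmetry of \<open>m3\<close>, by the relation between
  \<open>m2\<close> and \<open>l2\<close>, and by d of elements of degree 3.\<close>

lemma m4_swap12:
  assumes x: "a \<in> comp L 0" "b \<in> comp L 0" "c \<in> comp L 0" "d \<in> comp L 0"
  shows "app m4 [(0, a), (0, b), (0, c), (0, d)] + app m4 [(0, b), (0, a), (0, c), (0, d)] = 0"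
proof -
  have "app m4 [(0, a), (0, b), (0, c), (0, d)] + app m4 [(0, b), (0, a), (0, c), (0, d)] =
      app (l4 + l4\<^bsup>cyc [1,2]\<^esup>) [(0, a), (0, b), (0, c), (0, d)]
      - app (l2 \<circ>\<^bsub>1\<^esub> l31 - l31 \<circ>\<^bsub>3\<^esub> l2 + (l2 \<circ>\<^bsub>2\<^esub> l31)\<^bsup>cyc [1,2,3]\<^esup> + l3 \<circ>\<^bsub>1\<^esub> l21) [(0, a), (0, b), (0, c), (0, d)]
      - app defect4 [(0, a), (0, b), (0, c), (0, d)] - app defect4 [(0, b), (0, a), (0, c), (0, d)]
       - app m2 [(2, app h [(0, c), (0, app defect_m2 [(0, a), (0, b)])]), (0, d)]
       + app l2 [(2, app h [(0, c), (0, app defect_m2 [(0, a), (0, b)])]), (0, d)]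
       - app m2 [(0, c), (2, app h [(0, d), (0, app defect_m2 [(0, a), (0, b)])])]
       + app l2 [(0, c), (2, app h [(0, d), (0, app defect_m2 [(0, a), (0, b)])])]
       - app g2 [(0, c), (1, app g2 [(0, d), (0, app defect_m2 [(0, a), (0, b)])])]
       - app g3 [(0, app defect_m2 [(0, a), (0, b)]), (0, c), (0, d)]
       - app g2 [(1, app g2 [(0, c), (0, app defect_m2 [(0, a), (0, b)])]), (0, d)]
       - app defect_skew3a [(0, a), (0, b), (1, app g2 [(0, c), (0, d)])]
       - app g2 [(0, c), (1, app defect_skew3a [(0, a), (0, b), (0, d)])]
       - app g2 [(1, app defect_skew3a [(0, a), (0, b), (0, c)]), (0, d)]
       + app (diff L) [(3, app g2 [(2, app h [(0, c), (0, app l2 [(0, b), (0, a)])]), (0, d)])]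
       + app (diff L) [(3, app g2 [(2, app h [(0, c), (0, app m2 [(0, a), (0, b)])]), (0, d)])]
       + app (diff L) [(3, app g2 [(2, app h [(0, c), (0, app m2 [(0, a), (0, b)])]), (0, d)])]
       - app (diff L) [(3, app g2 [(2, app h [(0, c), (0, app l2 [(0, a), (0, b)])]), (0, d)])]
       + app (diff L) [(3, app g2 [(0, c), (2, app m2 [(2, app h [(0, a), (0, b)]), (0, d)])])]
       - app (diff L) [(3, app g2 [(0, c), (2, app h [(0, d), (0, app l2 [(0, a), (0, b)])])])]
       + app (diff L) [(3, app g2 [(0, c), (2, app g3 [(0, a), (0, b), (0, d)])])]
       + app (diff L) [(3, app g2 [(0, c), (2, app h [(0, d), (0, app l2 [(0, b), (0, a)])])])]
       + app (diff L) [(3, app g2 [(0, c), (2, app h [(0, d), (0, app m2 [(0, a), (0, b)])])])]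
       + app (diff L) [(3, app g2 [(0, c), (2, app h [(0, d), (0, app m2 [(0, a), (0, b)])])])]
       + app (diff L) [(3, app g2 [(0, c), (2, app g2 [(1, app g2 [(0, a), (0, b)]), (0, d)])])]
       + app (diff L) [(3, app g2 [(0, c), (2, app g2 [(1, app g2 [(0, a), (0, b)]), (0, d)])])]
       + app (diff L) [(3, app g2 [(2, app g2 [(1, app g2 [(0, a), (0, b)]), (0, c)]), (0, d)])]
       + app (diff L) [(3, app g2 [(2, app g2 [(1, app g2 [(0, a), (0, b)]), (0, c)]), (0, d)])]
       + app (diff L) [(3, app g3 [(1, app g2 [(0, a), (0, b)]), (0, c), (0, d)])]
       + app (diff L) [(3, app g3 [(1, app g2 [(0, a), (0, b)]), (0, c), (0, d)])]
       + app (diff L) [(3, app g2 [(2, app m2 [(2, app h [(0, a), (0, b)]), (0, c)]), (0, d)])]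
       - app (diff L) [(3, app m3 [(2, app h [(0, a), (0, b)]), (0, c), (0, d)])]
       + app (diff L) [(3, app g2 [(2, app g3 [(0, b), (0, a), (0, c)]), (0, d)])]
       + app (diff L) [(3, app g2 [(2, app g3 [(0, a), (0, b), (0, c)]), (0, d)])]
       + app (diff L) [(3, app g2 [(0, c), (2, app g3 [(0, b), (0, a), (0, d)])])]
       - app (diff L) [(3, app m2 [(2, app h [(0, a), (0, b)]), (1, app g2 [(0, c), (0, d)])])]"
    by (simp add: x hexpand app_defect4 algebra_simps)
  also have "\<dots> = 0"
    using map_eqD[OF l4_swap(1), of "[(0, a), (0, b), (0, c), (0, d)]"] x by (simp add: hops diff_above[OF C] defects_zero defect4_zero)
  finally show ?thesis .
qed

text \<open>Same mechanism; the axiom now contains both \<open>l31\<close> and \<open>l32\<close>,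
  and skew-symmetry of \<open>m2\<close> is used as well.\<close>

lemma m4_swap23:
  assumes x: "a \<in> comp L 0" "b \<in> comp L 0" "c \<in> comp L 0" "d \<in> comp L 0"
  shows "app m4 [(0, a), (0, b), (0, c), (0, d)] + app m4 [(0, a), (0, c), (0, b), (0, d)] = 0"
proof -
  have "app m4 [(0, a), (0, b), (0, c), (0, d)] + app m4 [(0, a), (0, c), (0, b), (0, d)] =
      app (l4 + l4\<^bsup>cyc [2,3]\<^esup>) [(0, a), (0, b), (0, c), (0, d)]
      - app (l2 \<circ>\<^bsub>1\<^esub> l32 - l3 \<circ>\<^bsub>2\<^esub> l21 + l2 \<circ>\<^bsub>2\<^esub> l31
        - l31 \<circ>\<^bsub>1\<^esub> l2 - (l31 \<circ>\<^bsub>2\<^esub> l2)\<^bsup>cyc [1,2]\<^esup> - (l31 \<circ>\<^bsub>3\<^esub> l2)\<^bsup>cyc [1,3,2]\<^esup>) [(0, a), (0, b), (0, c), (0, d)]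
      - app defect4 [(0, a), (0, b), (0, c), (0, d)] - app defect4 [(0, a), (0, c), (0, b), (0, d)]
       + app g3 [(0, a), (0, app defect_m2 [(0, b), (0, c)]), (0, d)]
       + app l2 [(0, a), (2, app h [(0, d), (0, app defect_m2 [(0, b), (0, c)])])]
       - app m2 [(0, a), (2, app h [(0, d), (0, app defect_m2 [(0, b), (0, c)])])]
       - app g2 [(0, a), (1, app g2 [(0, d), (0, app defect_m2 [(0, b), (0, c)])])]
       + app g2 [(1, app g2 [(0, a), (0, app defect_m2 [(0, b), (0, c)])]), (0, d)]
       + app g2 [(1, app defect_skew2 [(1, app g2 [(0, a), (0, c)]), (0, b)]), (0, d)]
       + app g2 [(1, app defect_skew2 [(1, app g2 [(0, a), (0, b)]), (0, c)]), (0, d)]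
       - app g2 [(0, a), (1, app defect_skew3a [(0, b), (0, c), (0, d)])]
       - app defect_skew3a [(0, c), (1, app g2 [(0, a), (0, b)]), (0, d)]
       - app defect_skew3a [(0, b), (1, app g2 [(0, a), (0, c)]), (0, d)]
       - app defect_skew3a [(0, b), (0, c), (1, app g2 [(0, a), (0, d)])]
       - app g2 [(1, app defect_skew3b [(0, a), (0, b), (0, c)]), (0, d)]
       + app (diff L) [(3, app g2 [(2, app g3 [(0, a), (0, c), (0, b)]), (0, d)])]
       - app (diff L) [(3, app g2 [(2, app g2 [(0, a), (1, app g2 [(0, b), (0, c)])]), (0, d)])]
       - app (diff L) [(3, app g2 [(2, app g2 [(0, a), (1, app g2 [(0, b), (0, c)])]), (0, d)])]
       - app (diff L) [(3, app g3 [(0, a), (1, app g2 [(0, b), (0, c)]), (0, d)])]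
       - app (diff L) [(3, app g3 [(0, a), (1, app g2 [(0, b), (0, c)]), (0, d)])]
       + app (diff L) [(3, app g2 [(0, a), (2, app h [(0, d), (0, app m2 [(0, b), (0, c)])])])]
       + app (diff L) [(3, app g2 [(0, a), (2, app h [(0, d), (0, app m2 [(0, b), (0, c)])])])]
       + app (diff L) [(3, app g2 [(0, a), (2, app g2 [(1, app g2 [(0, b), (0, c)]), (0, d)])])]
       + app (diff L) [(3, app g2 [(0, a), (2, app g2 [(1, app g2 [(0, b), (0, c)]), (0, d)])])]
       - app (diff L) [(3, app g2 [(0, a), (2, app h [(0, d), (0, app l2 [(0, b), (0, c)])])])]
       + app (diff L) [(3, app g2 [(0, a), (2, app h [(0, d), (0, app l2 [(0, c), (0, b)])])])]
       + app (diff L) [(3, app g2 [(2, app h [(0, b), (0, app l2 [(0, a), (0, c)])]), (0, d)])]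
       - app (diff L) [(3, app g2 [(2, app m2 [(0, a), (2, app h [(0, b), (0, c)])]), (0, d)])]
       + app (diff L) [(3, app g2 [(0, a), (2, app m2 [(2, app h [(0, b), (0, c)]), (0, d)])])]
       + app (diff L) [(3, app g2 [(2, app g3 [(0, a), (0, b), (0, c)]), (0, d)])]
       + app (diff L) [(3, app g2 [(2, app h [(0, app l2 [(0, a), (0, b)]), (0, c)]), (0, d)])]
       + app (diff L) [(3, app g2 [(0, a), (2, app g3 [(0, c), (0, b), (0, d)])])]
       + app (diff L) [(3, app g2 [(0, a), (2, app g3 [(0, b), (0, c), (0, d)])])]
       - app (diff L) [(3, app m2 [(2, app h [(0, b), (0, c)]), (1, app g2 [(0, a), (0, d)])])]
       + app (diff L) [(3, app m3 [(0, a), (2, app h [(0, b), (0, c)]), (0, d)])]"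
    by (simp add: x hexpand app_defect4 algebra_simps)
  also have "\<dots> = 0"
    using map_eqD[OF l4_swap(2), of "[(0, a), (0, b), (0, c), (0, d)]"] x by (simp add: hops diff_above[OF C] defects_zero defect4_zero)
  finally show ?thesis .
qed

text \<open>The axiom contains \<open>l32\<close> but not \<open>l31\<close>. Matching it takes
  skew-symmetry of \<open>m2\<close> and \<open>m3\<close> with values of \<open>g2\<close> and
  \<open>g3\<close> among their arguments.\<close>

lemma m4_swap34:
  assumes x: "a \<in> comp L 0" "b \<in> comp L 0" "c \<in> comp L 0" "d \<in> comp L 0"
  shows "app m4 [(0, a), (0, b), (0, c), (0, d)] + app m4 [(0, a), (0, b), (0, d), (0, c)] = 0"
proof -
  have "app m4 [(0, a), (0, b), (0, c), (0, d)] + app m4 [(0, a), (0, b), (0, d), (0, c)] =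
      app (l4 + l4\<^bsup>cyc [3,4]\<^esup>) [(0, a), (0, b), (0, c), (0, d)]
      - app (l21 \<circ>\<^bsub>1\<^esub> l3 - l32 \<circ>\<^bsub>1\<^esub> l2 + l32 \<circ>\<^bsub>2\<^esub> l2 - (l32 \<circ>\<^bsub>2\<^esub> l2)\<^bsup>cyc [1,2]\<^esup>
        + l3 \<circ>\<^bsub>3\<^esub> l21 + (l32 \<circ>\<^bsub>3\<^esub> l2)\<^bsup>cyc [2,3]\<^esup> - (l32 \<circ>\<^bsub>3\<^esub> l2)\<^bsup>cyc [1,3,2]\<^esup>
        + l2 \<circ>\<^bsub>2\<^esub> l32 - (l2 \<circ>\<^bsub>2\<^esub> l32)\<^bsup>cyc [1,2]\<^esup> + (l21 \<circ>\<^bsub>2\<^esub> l3)\<^bsup>cyc [1,2,3]\<^esup>) [(0, a), (0, b), (0, c), (0, d)]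
      - app defect4 [(0, a), (0, b), (0, c), (0, d)] - app defect4 [(0, a), (0, b), (0, d), (0, c)]
       - app g2 [(0, b), (1, app g2 [(0, a), (0, app defect_m2 [(0, c), (0, d)])])]
       + app g2 [(0, a), (1, app g2 [(0, b), (0, app defect_m2 [(0, c), (0, d)])])]
       - app g3 [(0, a), (0, b), (0, app defect_m2 [(0, c), (0, d)])]
       - app g2 [(0, b), (1, app defect_skew2 [(1, app g2 [(0, a), (0, c)]), (0, d)])]
       - app g2 [(0, b), (1, app defect_skew2 [(1, app g2 [(0, a), (0, d)]), (0, c)])]
       - app defect_skew2 [(2, app g3 [(0, a), (0, b), (0, c)]), (0, d)]
       + app g2 [(0, a), (1, app defect_skew2 [(1, app g2 [(0, b), (0, c)]), (0, d)])]
       + app g2 [(0, a), (1, app defect_skew2 [(1, app g2 [(0, b), (0, d)]), (0, c)])]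
       - app defect_skew2 [(1, app g2 [(0, a), (0, c)]), (1, app g2 [(0, b), (0, d)])]
       - app defect_skew2 [(2, app g3 [(0, a), (0, b), (0, d)]), (0, c)]
       - app defect_skew2 [(1, app g2 [(0, a), (0, d)]), (1, app g2 [(0, b), (0, c)])]
       - app defect_skew3a [(0, c), (1, app g2 [(0, a), (0, b)]), (0, d)]
       - app defect_skew3a [(0, c), (0, d), (1, app g2 [(0, a), (0, b)])]
       - app defect_skew3a [(0, d), (1, app g2 [(0, a), (0, b)]), (0, c)]
       + app g2 [(0, b), (1, app defect_skew3b [(0, a), (0, c), (0, d)])]
       - app g2 [(0, a), (1, app defect_skew3b [(0, b), (0, c), (0, d)])]
       + app defect_skew3b [(0, c), (0, d), (1, app g2 [(0, a), (0, b)])]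
       + app defect_skew3b [(0, d), (0, c), (1, app g2 [(0, a), (0, b)])]
       + app defect_skew3b [(0, a), (0, d), (1, app g2 [(0, b), (0, c)])]
       - app defect_skew3b [(0, b), (0, d), (1, app g2 [(0, a), (0, c)])]
       - app defect_skew3b [(0, b), (0, c), (1, app g2 [(0, a), (0, d)])]
       + app defect_skew3b [(0, a), (0, c), (1, app g2 [(0, b), (0, d)])]
       + app (diff L) [(3, app g3 [(0, a), (0, b), (1, app g2 [(0, c), (0, d)])])]
       + app (diff L) [(3, app g3 [(0, a), (0, b), (1, app g2 [(0, c), (0, d)])])]
       + app (diff L) [(3, app h [(1, app l3 [(0, a), (0, b), (0, c)]), (0, d)])]
       - app (diff L) [(3, app g2 [(0, b), (2, app h [(0, app l2 [(0, a), (0, c)]), (0, d)])])]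
       - app (diff L) [(3, app g2 [(0, b), (2, app g3 [(0, a), (0, d), (0, c)])])]
       - app (diff L) [(3, app g2 [(0, b), (2, app h [(0, c), (0, app l2 [(0, a), (0, d)])])])]
       - app (diff L) [(3, app g2 [(0, a), (2, app g2 [(0, b), (1, app g2 [(0, c), (0, d)])])])]
       - app (diff L) [(3, app g2 [(0, a), (2, app g2 [(0, b), (1, app g2 [(0, c), (0, d)])])])]
       + app (diff L) [(3, app g2 [(0, b), (2, app g2 [(0, a), (1, app g2 [(0, c), (0, d)])])])]
       + app (diff L) [(3, app g2 [(0, b), (2, app g2 [(0, a), (1, app g2 [(0, c), (0, d)])])])]
       + app (diff L) [(3, app g2 [(0, a), (2, app h [(0, app l2 [(0, b), (0, c)]), (0, d)])])]
       + app (diff L) [(3, app g2 [(0, a), (2, app h [(0, c), (0, app l2 [(0, b), (0, d)])])])]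
       - app (diff L) [(3, app g2 [(0, a), (2, app m2 [(0, b), (2, app h [(0, c), (0, d)])])])]
       + app (diff L) [(3, app g2 [(0, b), (2, app m2 [(0, a), (2, app h [(0, c), (0, d)])])])]
       - app (diff L) [(3, app m3 [(0, a), (0, b), (2, app h [(0, c), (0, d)])])]
       + app (diff L) [(3, app m2 [(1, app g2 [(0, a), (0, b)]), (2, app h [(0, c), (0, d)])])]
       - app (diff L) [(3, app g2 [(0, b), (2, app g3 [(0, a), (0, c), (0, d)])])]
       + app (diff L) [(3, app g2 [(0, a), (2, app g3 [(0, b), (0, c), (0, d)])])]
       + app (diff L) [(3, app g2 [(0, a), (2, app g3 [(0, b), (0, d), (0, c)])])]
       + app (diff L) [(3, app h [(0, c), (1, app l3 [(0, a), (0, b), (0, d)])])]"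
    by (simp add: x hexpand app_defect4 algebra_simps)
  also have "\<dots> = 0"
    using map_eqD[OF l4_swap(3), of "[(0, a), (0, b), (0, c), (0, d)]"] x by (simp add: hops diff_above[OF C] defects_zero defect4_zero)
  finally show ?thesis .
qed

end

section \<open>Antisymmetrization of the transported bracket\<close>

lemma alt4_perm:
  shows "alt4 (\<lambda>a b c d. F a b d c) a b c d = - alt4 F a b c d"
    "alt4 (\<lambda>a b c d. F a c b d) a b c d = - alt4 F a b c d"
    "alt4 (\<lambda>a b c d. F a c d b) a b c d = alt4 F a b c d"
    "alt4 (\<lambda>a b c d. F a d b c) a b c d = alt4 F a b c d"
    "alt4 (\<lambda>a b c d. F a d c b) a b c d = - alt4 F a b c d"
    "alt4 (\<lambda>a b c d. F b a c d) a b c d = - alt4 F a b c d"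
    "alt4 (\<lambda>a b c d. F b a d c) a b c d = alt4 F a b c d"
    "alt4 (\<lambda>a b c d. F b c a d) a b c d = alt4 F a b c d"
    "alt4 (\<lambda>a b c d. F b c d a) a b c d = - alt4 F a b c d"
    "alt4 (\<lambda>a b c d. F b d a c) a b c d = - alt4 F a b c d"
    "alt4 (\<lambda>a b c d. F b d c a) a b c d = alt4 F a b c d"
    "alt4 (\<lambda>a b c d. F c a b d) a b c d = alt4 F a b c d"
    "alt4 (\<lambda>a b c d. F c a d b) a b c d = - alt4 F a b c d"
    "alt4 (\<lambda>a b c d. F c b a d) a b c d = - alt4 F a b c d"
    "alt4 (\<lambda>a b c d. F c b d a) a b c d = alt4 F a b c d"
    "alt4 (\<lambda>a b c d. F c d a b) a b c d = alt4 F a b c d"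
    "alt4 (\<lambda>a b c d. F c d b a) a b c d = - alt4 F a b c d"
    "alt4 (\<lambda>a b c d. F d a b c) a b c d = - alt4 F a b c d"
    "alt4 (\<lambda>a b c d. F d a c b) a b c d = alt4 F a b c d"
    "alt4 (\<lambda>a b c d. F d b a c) a b c d = alt4 F a b c d"
    "alt4 (\<lambda>a b c d. F d b c a) a b c d = - alt4 F a b c d"
    "alt4 (\<lambda>a b c d. F d c a b) a b c d = - alt4 F a b c d"
    "alt4 (\<lambda>a b c d. F d c b a) a b c d = alt4 F a b c d"
  by (simp_all add: alt4_def alt3_def)

lemma alt4_add: "alt4 (\<lambda>a b c d. F a b c d + G a b c d) a b c d = alt4 F a b c d + alt4 G a b c d"
  and alt4_diff: "alt4 (\<lambda>a b c d. F a b c d - G a b c d) a b c d = alt4 F a b c d - alt4 G a b c d"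
  and alt4_0: "alt4 (\<lambda>a b c d. 0) a b c d = 0"
  by (simp_all add: alt4_def alt3_def algebra_simps)

text \<open>Numeral scalars become repeated sums, so that certificates with coefficients reduce to
  cancellation in an abelian group.\<close>

lemma scal_double:
  assumes L: "three_term_complex L"
  shows "scal L (numeral (num.Bit0 n)) x = scal L (numeral n) x + scal L (numeral n) x"
    "scal L (numeral (num.Bit1 n)) x = scal L (numeral n) x + scal L (numeral n) x + x"
    "scal L (- numeral n) x = - scal L (numeral n) x"
  by (simp_all only: numeral_Bit0 numeral_Bit1 scal_simps[OF L])

context skew_iso
begin

text \<open>The difference of the two maps is a sum of permuted copies of a few expressions.
  Antisymmetrization identifies the copies up to sign, which leaves one unknown per expression and
  turns the claim into a linear relation between unknowns. Twice this relation is an integral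
  combination of antisymmetrized pointwise identities.\<close>

lemma alt4_m4:
  assumes units: "\<And>v. scal L 2 v = 0 \<Longrightarrow> v = 0"
    and x: "a \<in> comp L 0" "b \<in> comp L 0" "c \<in> comp L 0" "d \<in> comp L 0"
  shows "alt4 (\<lambda>a b c d. app (m4 + m4) [(0, a), (0, b), (0, c), (0, d)]) a b c d =
    alt4 (\<lambda>a b c d. app (l4 + l4 + (l21 \<circ>\<^bsub>1\<^esub> l3 - l31 \<circ>\<^bsub>1\<^esub> l2 + l32 \<circ>\<^bsub>2\<^esub> l2 - l21 \<circ>\<^bsub>2\<^esub> l3 - l31 \<circ>\<^bsub>2\<^esub> l2 + l32 \<circ>\<^bsub>3\<^esub> l2)) [(0, a), (0, b), (0, c), (0, d)]) a b c d"
proof -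
  \<comment> \<open>The shapes \<open>s1\<close> to \<open>s22\<close> occur in the difference
    itself; \<open>s23\<close> to \<open>s42\<close> enter only through the auxiliary
    relations.\<close>
  define s1 where "s1 a b c d = app g2 [(1, app l3 [(0, a), (0, b), (0, c)]), (0, d)]" for a b c d
  define s2 where "s2 a b c d = app g2 [(0, a), (1, app l3 [(0, b), (0, c), (0, d)])]" for a b c d
  define s3 where "s3 a b c d = app g3 [(0, app l2 [(0, a), (0, b)]), (0, c), (0, d)]" for a b c d
  define s4 where "s4 a b c d = app g3 [(0, a), (0, app l2 [(0, b), (0, c)]), (0, d)]" for a b c d
  define s5 where "s5 a b c d = app g3 [(0, a), (0, b), (0, app l2 [(0, c), (0, d)])]" for a b c d
  define s6 where "s6 a b c d = app m2 [(2, app g3 [(0, a), (0, b), (0, c)]), (0, d)]" for a b c d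
  define s7 where "s7 a b c d = app m2 [(0, a), (2, app g3 [(0, b), (0, c), (0, d)])]" for a b c d
  define s8 where "s8 a b c d = app m2 [(1, app g2 [(0, a), (0, b)]), (1, app g2 [(0, c), (0, d)])]" for a b c d
  define s9 where "s9 a b c d = app m3 [(1, app g2 [(0, a), (0, b)]), (0, c), (0, d)]" for a b c d
  define s10 where "s10 a b c d = app m3 [(0, a), (1, app g2 [(0, b), (0, c)]), (0, d)]" for a b c d
  define s11 where "s11 a b c d = app m3 [(0, a), (0, b), (1, app g2 [(0, c), (0, d)])]" for a b c d
  define s12 where "s12 a b c d = app g2 [(1, app g2 [(0, app l2 [(0, a), (0, b)]), (0, c)]), (0, d)]" for a b c d
  define s13 where "s13 a b c d = app m2 [(2, app h [(0, app l2 [(0, a), (0, b)]), (0, c)]), (0, d)]" for a b c d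
  define s14 where "s14 a b c d = app g2 [(0, a), (1, app g2 [(0, app l2 [(0, b), (0, c)]), (0, d)])]" for a b c d
  define s15 where "s15 a b c d = app h [(0, app l2 [(0, a), (0, app l2 [(0, b), (0, c)])]), (0, d)]" for a b c d
  define s16 where "s16 a b c d = app h [(0, app l2 [(0, a), (0, b)]), (0, app l2 [(0, c), (0, d)])]" for a b c d
  define s17 where "s17 a b c d = app m2 [(0, a), (2, app h [(0, app l2 [(0, b), (0, c)]), (0, d)])]" for a b c d
  define s18 where "s18 a b c d = app g2 [(1, app g2 [(0, a), (0, app l2 [(0, b), (0, c)])]), (0, d)]" for a b c d
  define s19 where "s19 a b c d = app m2 [(2, app h [(0, a), (0, app l2 [(0, b), (0, c)])]), (0, d)]" for a b c d
  define s20 where "s20 a b c d = app g2 [(0, a), (1, app g2 [(0, b), (0, app l2 [(0, c), (0, d)])])]" for a b c d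
  define s21 where "s21 a b c d = app h [(0, a), (0, app l2 [(0, b), (0, app l2 [(0, c), (0, d)])])]" for a b c d
  define s22 where "s22 a b c d = app m2 [(0, a), (2, app h [(0, b), (0, app l2 [(0, c), (0, d)])])]" for a b c d
  define s23 where "s23 a b c d = app l2 [(2, app h [(0, a), (0, app l2 [(0, b), (0, c)])]), (0, d)]" for a b c d
  define s24 where "s24 a b c d = app l2 [(2, app h [(0, app l2 [(0, a), (0, b)]), (0, c)]), (0, d)]" for a b c d
  define s25 where "s25 a b c d = app g2 [(1, app g2 [(0, a), (0, b)]), (0, app l2 [(0, c), (0, d)])]" for a b c d
  define s26 where "s26 a b c d = app l2 [(2, app h [(0, a), (0, b)]), (0, app l2 [(0, c), (0, d)])]" for a b c d
  define s27 where "s27 a b c d = app h [(0, app l2 [(0, app l2 [(0, a), (0, b)]), (0, c)]), (0, d)]" for a b c d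
  define s28 where "s28 a b c d = app h [(0, a), (0, app l2 [(0, app l2 [(0, b), (0, c)]), (0, d)])]" for a b c d
  define s29 where "s29 a b c d = app l2 [(0, a), (2, app h [(0, app l2 [(0, b), (0, c)]), (0, d)])]" for a b c d
  define s30 where "s30 a b c d = app m2 [(0, a), (2, app g2 [(1, app g2 [(0, b), (0, c)]), (0, d)])]" for a b c d
  define s31 where "s31 a b c d = app m2 [(2, app g2 [(1, app g2 [(0, a), (0, b)]), (0, c)]), (0, d)]" for a b c d
  define s32 where "s32 a b c d = app m2 [(0, a), (2, app l2 [(2, app h [(0, b), (0, c)]), (0, d)])]" for a b c d
  define s33 where "s33 a b c d = app m2 [(2, app l2 [(2, app h [(0, a), (0, b)]), (0, c)]), (0, d)]" for a b c d
  define s34 where "s34 a b c d = app h [(0, a), (0, app m2 [(0, app l2 [(0, b), (0, c)]), (0, d)])]" for a b c d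
  define s35 where "s35 a b c d = app l3 [(1, app g2 [(0, a), (0, b)]), (0, c), (0, d)]" for a b c d
  define s36 where "s36 a b c d = app g2 [(1, app l2 [(1, app g2 [(0, a), (0, b)]), (0, c)]), (0, d)]" for a b c d
  define s37 where "s37 a b c d = app g2 [(0, a), (1, app l2 [(1, app g2 [(0, b), (0, c)]), (0, d)])]" for a b c d
  define s38 where "s38 a b c d = app g3 [(0, app m2 [(0, a), (0, b)]), (0, c), (0, d)]" for a b c d
  define s39 where "s39 a b c d = app l2 [(0, a), (2, app l2 [(2, app h [(0, b), (0, c)]), (0, d)])]" for a b c d
  define s40 where "s40 a b c d = app l2 [(2, app l2 [(2, app h [(0, a), (0, b)]), (0, c)]), (0, d)]" for a b c d
  define s41 where "s41 a b c d = app m2 [(2, app h [(0, a), (0, b)]), (0, app l2 [(0, c), (0, d)])]" for a b c d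
  define s42 where "s42 a b c d = app m2 [(2, app h [(0, a), (0, b)]), (0, app m2 [(0, c), (0, d)])]" for a b c d
  note s_def = s1_def s2_def s3_def s4_def s5_def s6_def s7_def s8_def s9_def s10_def s11_def s12_def s13_def s14_def s15_def s16_def s17_def s18_def s19_def s20_def s21_def s22_def s23_def s24_def s25_def s26_def s27_def s28_def s29_def s30_def s31_def s32_def s33_def s34_def s35_def s36_def s37_def s38_def s39_def s40_def s41_def s42_def
  define A1 where "A1 = alt4 s1 a b c d"
  define A2 where "A2 = alt4 s2 a b c d"
  define A3 where "A3 = alt4 s3 a b c d"
  define A4 where "A4 = alt4 s4 a b c d"
  define A5 where "A5 = alt4 s5 a b c d"
  define A6 where "A6 = alt4 s6 a b c d"
  define A7 where "A7 = alt4 s7 a b c d"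
  define A8 where "A8 = alt4 s8 a b c d"
  define A9 where "A9 = alt4 s9 a b c d"
  define A10 where "A10 = alt4 s10 a b c d"
  define A11 where "A11 = alt4 s11 a b c d"
  define A12 where "A12 = alt4 s12 a b c d"
  define A13 where "A13 = alt4 s13 a b c d"
  define A14 where "A14 = alt4 s14 a b c d"
  define A15 where "A15 = alt4 s15 a b c d"
  define A16 where "A16 = alt4 s16 a b c d"
  define A17 where "A17 = alt4 s17 a b c d"
  define A18 where "A18 = alt4 s18 a b c d"
  define A19 where "A19 = alt4 s19 a b c d"
  define A20 where "A20 = alt4 s20 a b c d"
  define A21 where "A21 = alt4 s21 a b c d"
  define A22 where "A22 = alt4 s22 a b c d"
  define A23 where "A23 = alt4 s23 a b c d"
  define A24 where "A24 = alt4 s24 a b c d"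
  define A25 where "A25 = alt4 s25 a b c d"
  define A26 where "A26 = alt4 s26 a b c d"
  define A27 where "A27 = alt4 s27 a b c d"
  define A28 where "A28 = alt4 s28 a b c d"
  define A29 where "A29 = alt4 s29 a b c d"
  define A30 where "A30 = alt4 s30 a b c d"
  define A31 where "A31 = alt4 s31 a b c d"
  define A32 where "A32 = alt4 s32 a b c d"
  define A33 where "A33 = alt4 s33 a b c d"
  define A34 where "A34 = alt4 s34 a b c d"
  define A35 where "A35 = alt4 s35 a b c d"
  define A36 where "A36 = alt4 s36 a b c d"
  define A37 where "A37 = alt4 s37 a b c d"
  define A38 where "A38 = alt4 s38 a b c d"
  define A39 where "A39 = alt4 s39 a b c d"
  define A40 where "A40 = alt4 s40 a b c d"
  define A41 where "A41 = alt4 s41 a b c d"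
  define A42 where "A42 = alt4 s42 a b c d"
  note A_def = A1_def A2_def A3_def A4_def A5_def A6_def A7_def A8_def A9_def A10_def A11_def A12_def A13_def A14_def A15_def A16_def A17_def A18_def A19_def A20_def A21_def A22_def A23_def A24_def A25_def A26_def A27_def A28_def A29_def A30_def A31_def A32_def A33_def A34_def A35_def A36_def A37_def A38_def A39_def A40_def A41_def A42_def
  \<comment> \<open>The combination from \<open>g3_alt\<close>. It is used twice, with a bracket as
    one of its arguments and as an argument of \<open>m2\<close>.\<close>
  define K where "K a b c = app (g3 + g3 + g2 \<circ>\<^bsub>1\<^esub> g2 + g2 \<circ>\<^bsub>1\<^esub> g2 + g2 \<circ>\<^bsub>1\<^esub> g2 + g2 \<circ>\<^bsub>1\<^esub> g2 + g2 \<circ>\<^bsub>1\<^esub> g2 + g2 \<circ>\<^bsub>1\<^esub> g2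
        - h \<circ>\<^bsub>1\<^esub> l2 - h \<circ>\<^bsub>1\<^esub> l2 - h \<circ>\<^bsub>1\<^esub> l2 - l2 \<circ>\<^bsub>1\<^esub> h - l2 \<circ>\<^bsub>1\<^esub> h - l2 \<circ>\<^bsub>1\<^esub> h)
        [(0, a), (0, b), (0, c)]" for a b c
  have K: "K a b c \<in> comp L 2" if "a \<in> comp L 0" "b \<in> comp L 0" "c \<in> comp L 0" for a b c
    unfolding K_def using that by (simp add: app_unfold hops sgn_pow_def)
  have K0: "alt3 K a b c = 0" if "a \<in> comp L 0" "b \<in> comp L 0" "c \<in> comp L 0" for a b c
    unfolding K_def by (rule g3_alt[OF that])
  \<comment> \<open>Each \<open>p\<close> is a pointwise identity and the \<open>r\<close> of the
    same number its antisymmetrization. The sign in \<open>r1\<close> arises because a cyclic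
    permutation of four arguments is odd.\<close>
  have p1: "s7 a b c d + s6 b c d a = 0" (is "?e = 0")
    if x: "a \<in> comp L 0" "b \<in> comp L 0" "c \<in> comp L 0" "d \<in> comp L 0" for a b c d
  proof -
    have "?e = app defect_skew2 [(0, a), (2, app g3 [(0, b), (0, c), (0, d)])]"
      by (simp add: s_def x hexpand algebra_simps)
    also have "\<dots> = 0" using x by (simp add: hops diff_above[OF C] defects_zero)
    finally show ?thesis .
  qed
  have r1: "A7 - A6 = 0" (is "?e = 0")
  proof -
    have "?e = alt4 (\<lambda>a b c d. s7 a b c d + s6 b c d a) a b c d"
      by (simp add: A_def alt4_def alt3_def algebra_simps)
    also have "\<dots> = 0" by (rule alt4_zero[OF p1 x])
    finally show ?thesis .
  qed
  have p2: "s19 a b c d + s13 b c a d = 0" (is "?e = 0")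
    if x: "a \<in> comp L 0" "b \<in> comp L 0" "c \<in> comp L 0" "d \<in> comp L 0" for a b c d
  proof -
    have "?e = app m2 [(2, app defect_h [(0, a), (0, app l2 [(0, b), (0, c)])]), (0, d)]"
      by (simp add: s_def x hexpand algebra_simps)
    also have "\<dots> = 0" using x by (simp add: hops diff_above[OF C] defects_zero)
    finally show ?thesis .
  qed
  have r2: "A19 + A13 = 0" (is "?e = 0")
  proof -
    have "?e = alt4 (\<lambda>a b c d. s19 a b c d + s13 b c a d) a b c d"
      by (simp add: A_def alt4_def alt3_def algebra_simps)
    also have "\<dots> = 0" by (rule alt4_zero[OF p2 x])
    finally show ?thesis .
  qed
  have p3: "s23 a b c d + s24 b c a d = 0" (is "?e = 0")
    if x: "a \<in> comp L 0" "b \<in> comp L 0" "c \<in> comp L 0" "d \<in> comp L 0" for a b c d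
  proof -
    have "?e = app l2 [(2, app defect_h [(0, a), (0, app l2 [(0, b), (0, c)])]), (0, d)]"
      by (simp add: s_def x hexpand algebra_simps)
    also have "\<dots> = 0" using x by (simp add: hops diff_above[OF C] defects_zero)
    finally show ?thesis .
  qed
  have r3: "A23 + A24 = 0" (is "?e = 0")
  proof -
    have "?e = alt4 (\<lambda>a b c d. s23 a b c d + s24 b c a d) a b c d"
      by (simp add: A_def alt4_def alt3_def algebra_simps)
    also have "\<dots> = 0" by (rule alt4_zero[OF p3 x])
    finally show ?thesis .
  qed
  \<comment> \<open>The bracket \<open>l2\<close> is inserted into the three slots of
    \<open>K\<close> with alternating signs.\<close>
  have p4: "K a b (app l2 [(0, c), (0, d)]) - K a (app l2 [(0, b), (0, c)]) d + K (app l2 [(0, a), (0, b)]) c d = s5 a b c d + s5 a b c d + s25 a b c d + s25 a b c d + s25 a b c d + s25 a b c d + s25 a b c d + s25 a b c d - s16 a b c d - s16 a b c d - s16 a b c d - s26 a b c d - s26 a b c d - s26 a b c d - s4 a b c d - s4 a b c d - s18 a b c d - s18 a b c d - s18 a b c d - s18 a b c d - s18 a b c d - s18 a b c d + s15 a b c d + s15 a b c d + s15 a b c d + s23 a b c d + s23 a b c d + s23 a b c d + s3 a b c d + s3 a b c d + s12 a b c d + s12 a b c d + s12 a b c d + s12 a b c d + s12 a b c d + s12 a b c d - s27 a b c d - s27 a b c d - s27 a b c d - s24 a b c d - s24 a b c d - s24 a b c d"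
    if x: "a \<in> comp L 0" "b \<in> comp L 0" "c \<in> comp L 0" "d \<in> comp L 0" for a b c d
    by (simp add: s_def K_def x hexpand algebra_simps)
  have r4: "A5 + A5 + A25 + A25 + A25 + A25 + A25 + A25 - A16 - A16 - A16 - A26 - A26 - A26 - A4 - A4 - A18 - A18 - A18 - A18 - A18 - A18 + A15 + A15 + A15 + A23 + A23 + A23 + A3 + A3 + A12 + A12 + A12 + A12 + A12 + A12 - A27 - A27 - A27 - A24 - A24 - A24 = 0" (is "?e = 0")
  proof -
    have "?e = alt4 (\<lambda>a b c d. s5 a b c d + s5 a b c d + s25 a b c d + s25 a b c d + s25 a b c d + s25 a b c d + s25 a b c d + s25 a b c d - s16 a b c d - s16 a b c d - s16 a b c d - s26 a b c d - s26 a b c d - s26 a b c d - s4 a b c d - s4 a b c d - s18 a b c d - s18 a b c d - s18 a b c d - s18 a b c d - s18 a b c d - s18 a b c d + s15 a b c d + s15 a b c d + s15 a b c d + s23 a b c d + s23 a b c d + s23 a b c d + s3 a b c d + s3 a b c d + s12 a b c d + s12 a b c d + s12 a b c d + s12 a b c d + s12 a b c d + s12 a b c d - s27 a b c d - s27 a b c d - s27 a b c d - s24 a b c d - s24 a b c d - s24 a b c d) a b c d"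
      by (simp add: A_def alt4_add alt4_diff alt4_0)
    also have "\<dots> = alt4 (\<lambda>a b c d. K a b (app l2 [(0, c), (0, d)]) - K a (app l2 [(0, b), (0, c)]) d + K (app l2 [(0, a), (0, b)]) c d) a b c d"
      using x by (simp only: alt4_def alt3_def p4)
    \<comment> \<open>Grouping by the ordered pair inside the bracket: in each of the twelve groups
      the bracket behaves as a third argument, and the group is a full antisymmetrization of
      \<open>K\<close>.\<close>
    also have "\<dots> = alt3 K a b (app l2 [(0, c), (0, d)]) - alt3 K a b (app l2 [(0, d), (0, c)]) - alt3 K a c (app l2 [(0, b), (0, d)]) + alt3 K a c (app l2 [(0, d), (0, b)]) + alt3 K a d (app l2 [(0, b), (0, c)]) - alt3 K a d (app l2 [(0, c), (0, b)]) + alt3 K b c (app l2 [(0, a), (0, d)]) - alt3 K b c (app l2 [(0, d), (0, a)]) - alt3 K b d (app l2 [(0, a), (0, c)]) + alt3 K b d (app l2 [(0, c), (0, a)]) + alt3 K c d (app l2 [(0, a), (0, b)]) - alt3 K c d (app l2 [(0, b), (0, a)])"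
      by (simp add: alt4_def alt3_def x K hops algebra_simps)
    also have "\<dots> = 0" using x by (simp add: K0 hops)
    finally show ?thesis .
  qed
  have p5: "s10 a b c d + s9 b c a d = 0" (is "?e = 0")
    if x: "a \<in> comp L 0" "b \<in> comp L 0" "c \<in> comp L 0" "d \<in> comp L 0" for a b c d
  proof -
    have "?e = app defect_skew3a [(0, a), (1, app g2 [(0, b), (0, c)]), (0, d)]"
      by (simp add: s_def x hexpand algebra_simps)
    also have "\<dots> = 0" using x by (simp add: hops diff_above[OF C] defects_zero)
    finally show ?thesis .
  qed
  have r5: "A10 + A9 = 0" (is "?e = 0")
  proof -
    have "?e = alt4 (\<lambda>a b c d. s10 a b c d + s9 b c a d) a b c d"
      by (simp add: A_def alt4_def alt3_def algebra_simps)
    also have "\<dots> = 0" by (rule alt4_zero[OF p5 x])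
    finally show ?thesis .
  qed
  \<comment> \<open>Zero because the argument of d has degree 3; expanding d through
    \<open>h\<close> and then through \<open>l3\<close> gives the five terms.\<close>
  have p6: "s2 a b c d - s1 b c d a + s21 a b c d - s28 a b c d - s21 a c b d = 0" (is "?e = 0")
    if x: "a \<in> comp L 0" "b \<in> comp L 0" "c \<in> comp L 0" "d \<in> comp L 0" for a b c d
  proof -
    have "?e = app (diff L) [(3, app h [(0, a), (1, app l3 [(0, b), (0, c), (0, d)])])]"
      by (simp add: s_def x hexpand algebra_simps)
    also have "\<dots> = 0" using x by (simp add: hops diff_above[OF C] defects_zero)
    finally show ?thesis .
  qed
  have r6: "A2 + A1 + A21 + A21 - A28 = 0" (is "?e = 0")
  proof -
    have "?e = alt4 (\<lambda>a b c d. s2 a b c d - s1 b c d a + s21 a b c d - s28 a b c d - s21 a c b d) a b c d"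
      by (simp add: A_def alt4_def alt3_def algebra_simps)
    also have "\<dots> = 0" by (rule alt4_zero[OF p6 x])
    finally show ?thesis .
  qed
  have p7: "s29 a b c d - s17 a b c d - s14 a b c d + s20 a d b c = 0" (is "?e = 0")
    if x: "a \<in> comp L 0" "b \<in> comp L 0" "c \<in> comp L 0" "d \<in> comp L 0" for a b c d
  proof -
    have "?e = app (diff L) [(3, app g2 [(0, a), (2, app h [(0, app l2 [(0, b), (0, c)]), (0, d)])])]"
      by (simp add: s_def x hexpand algebra_simps)
    also have "\<dots> = 0" using x by (simp add: hops diff_above[OF C] defects_zero)
    finally show ?thesis .
  qed
  have r7: "A29 - A17 - A14 + A20 = 0" (is "?e = 0")
  proof -
    have "?e = alt4 (\<lambda>a b c d. s29 a b c d - s17 a b c d - s14 a b c d + s20 a d b c) a b c d"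
      by (simp add: A_def alt4_def alt3_def algebra_simps)
    also have "\<dots> = 0" by (rule alt4_zero[OF p7 x])
    finally show ?thesis .
  qed
  have p8: "s30 a b c d + s31 b c d a = 0" (is "?e = 0")
    if x: "a \<in> comp L 0" "b \<in> comp L 0" "c \<in> comp L 0" "d \<in> comp L 0" for a b c d
  proof -
    have "?e = app defect_skew2 [(0, a), (2, app g2 [(1, app g2 [(0, b), (0, c)]), (0, d)])]"
      by (simp add: s_def x hexpand algebra_simps)
    also have "\<dots> = 0" using x by (simp add: hops diff_above[OF C] defects_zero)
    finally show ?thesis .
  qed
  have r8: "A30 - A31 = 0" (is "?e = 0")
  proof -
    have "?e = alt4 (\<lambda>a b c d. s30 a b c d + s31 b c d a) a b c d"
      by (simp add: A_def alt4_def alt3_def algebra_simps)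
    also have "\<dots> = 0" by (rule alt4_zero[OF p8 x])
    finally show ?thesis .
  qed
  \<comment> \<open>With \<open>K\<close> inside \<open>m2\<close>, antisymmetrizing the four
    arguments produces the antisymmetrization of \<open>K\<close> in the second slot.\<close>
  have p9: "app m2 [(0, a), (2, K b c d)] = s7 a b c d + s7 a b c d + s30 a b c d + s30 a b c d + s30 a b c d + s30 a b c d + s30 a b c d + s30 a b c d - s17 a b c d - s17 a b c d - s17 a b c d - s32 a b c d - s32 a b c d - s32 a b c d"
    if x: "a \<in> comp L 0" "b \<in> comp L 0" "c \<in> comp L 0" "d \<in> comp L 0" for a b c d
    by (simp add: s_def K_def x hexpand algebra_simps)
  have r9: "A7 + A7 + A30 + A30 + A30 + A30 + A30 + A30 - A17 - A17 - A17 - A32 - A32 - A32 = 0" (is "?e = 0")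
  proof -
    have "?e = alt4 (\<lambda>a b c d. s7 a b c d + s7 a b c d + s30 a b c d + s30 a b c d + s30 a b c d + s30 a b c d + s30 a b c d + s30 a b c d - s17 a b c d - s17 a b c d - s17 a b c d - s32 a b c d - s32 a b c d - s32 a b c d) a b c d"
      by (simp add: A_def alt4_add alt4_diff alt4_0)
    also have "\<dots> = alt4 (\<lambda>a b c d. app m2 [(0, a), (2, K b c d)]) a b c d"
      using x by (simp only: alt4_def alt3_def p9)
    also have "\<dots> = app m2 [(0, a), (2, alt3 K b c d)] - app m2 [(0, b), (2, alt3 K a c d)] + app m2 [(0, c), (2, alt3 K a b d)] - app m2 [(0, d), (2, alt3 K a b c)]"
      by (simp add: alt4_def alt3_def x K hops algebra_simps)
    also have "\<dots> = 0" using x by (simp add: K0 hops)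
    finally show ?thesis .
  qed
  have p10: "s29 a b c d - s24 b c d a - s17 a b c d - s17 a b c d = 0" (is "?e = 0")
    if x: "a \<in> comp L 0" "b \<in> comp L 0" "c \<in> comp L 0" "d \<in> comp L 0" for a b c d
  proof -
    have "?e = app defect_m2 [(0, a), (2, app h [(0, app l2 [(0, b), (0, c)]), (0, d)])]"
      by (simp add: s_def x hexpand algebra_simps)
    also have "\<dots> = 0" using x by (simp add: hops diff_above[OF C] defects_zero)
    finally show ?thesis .
  qed
  have r10: "A29 + A24 - A17 - A17 = 0" (is "?e = 0")
  proof -
    have "?e = alt4 (\<lambda>a b c d. s29 a b c d - s24 b c d a - s17 a b c d - s17 a b c d) a b c d"
      by (simp add: A_def alt4_def alt3_def algebra_simps)
    also have "\<dots> = 0" by (rule alt4_zero[OF p10 x])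
    finally show ?thesis .
  qed
  have p11: "s32 a b c d + s33 b c d a = 0" (is "?e = 0")
    if x: "a \<in> comp L 0" "b \<in> comp L 0" "c \<in> comp L 0" "d \<in> comp L 0" for a b c d
  proof -
    have "?e = app defect_skew2 [(0, a), (2, app l2 [(2, app h [(0, b), (0, c)]), (0, d)])]"
      by (simp add: s_def x hexpand algebra_simps)
    also have "\<dots> = 0" using x by (simp add: hops diff_above[OF C] defects_zero)
    finally show ?thesis .
  qed
  have r11: "A32 - A33 = 0" (is "?e = 0")
  proof -
    have "?e = alt4 (\<lambda>a b c d. s32 a b c d + s33 b c d a) a b c d"
      by (simp add: A_def alt4_def alt3_def algebra_simps)
    also have "\<dots> = 0" by (rule alt4_zero[OF p11 x])
    finally show ?thesis .
  qed
  have p12: "s14 a b c d - s12 b c d a + s28 a b c d - s34 a b c d = 0" (is "?e = 0")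
    if x: "a \<in> comp L 0" "b \<in> comp L 0" "c \<in> comp L 0" "d \<in> comp L 0" for a b c d
  proof -
    have "?e = app (diff L) [(3, app h [(0, a), (1, app g2 [(0, app l2 [(0, b), (0, c)]), (0, d)])])]"
      by (simp add: s_def x hexpand algebra_simps)
    also have "\<dots> = 0" using x by (simp add: hops diff_above[OF C] defects_zero)
    finally show ?thesis .
  qed
  have r12: "A14 + A12 + A28 - A34 = 0" (is "?e = 0")
  proof -
    have "?e = alt4 (\<lambda>a b c d. s14 a b c d - s12 b c d a + s28 a b c d - s34 a b c d) a b c d"
      by (simp add: A_def alt4_def alt3_def algebra_simps)
    also have "\<dots> = 0" by (rule alt4_zero[OF p12 x])
    finally show ?thesis .
  qed
  have p13: "s23 a b c d - s19 a b c d - s18 a b c d + s12 b c a d = 0" (is "?e = 0")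
    if x: "a \<in> comp L 0" "b \<in> comp L 0" "c \<in> comp L 0" "d \<in> comp L 0" for a b c d
  proof -
    have "?e = app (diff L) [(3, app g2 [(2, app h [(0, a), (0, app l2 [(0, b), (0, c)])]), (0, d)])]"
      by (simp add: s_def x hexpand algebra_simps)
    also have "\<dots> = 0" using x by (simp add: hops diff_above[OF C] defects_zero)
    finally show ?thesis .
  qed
  have r13: "A23 - A19 - A18 + A12 = 0" (is "?e = 0")
  proof -
    have "?e = alt4 (\<lambda>a b c d. s23 a b c d - s19 a b c d - s18 a b c d + s12 b c a d) a b c d"
      by (simp add: A_def alt4_def alt3_def algebra_simps)
    also have "\<dots> = 0" by (rule alt4_zero[OF p13 x])
    finally show ?thesis .
  qed
  have p14: "s11 a b c d + s10 a c d b = 0" (is "?e = 0")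
    if x: "a \<in> comp L 0" "b \<in> comp L 0" "c \<in> comp L 0" "d \<in> comp L 0" for a b c d
  proof -
    have "?e = app defect_skew3b [(0, a), (0, b), (1, app g2 [(0, c), (0, d)])]"
      by (simp add: s_def x hexpand algebra_simps)
    also have "\<dots> = 0" using x by (simp add: hops diff_above[OF C] defects_zero)
    finally show ?thesis .
  qed
  have r14: "A11 + A10 = 0" (is "?e = 0")
  proof -
    have "?e = alt4 (\<lambda>a b c d. s11 a b c d + s10 a c d b) a b c d"
      by (simp add: A_def alt4_def alt3_def algebra_simps)
    also have "\<dots> = 0" by (rule alt4_zero[OF p14 x])
    finally show ?thesis .
  qed
  have p15: "s22 a b c d + s17 a c d b = 0" (is "?e = 0")
    if x: "a \<in> comp L 0" "b \<in> comp L 0" "c \<in> comp L 0" "d \<in> comp L 0" for a b c d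
  proof -
    have "?e = app m2 [(0, a), (2, app defect_h [(0, b), (0, app l2 [(0, c), (0, d)])])]"
      by (simp add: s_def x hexpand algebra_simps)
    also have "\<dots> = 0" using x by (simp add: hops diff_above[OF C] defects_zero)
    finally show ?thesis .
  qed
  have r15: "A22 + A17 = 0" (is "?e = 0")
  proof -
    have "?e = alt4 (\<lambda>a b c d. s22 a b c d + s17 a c d b) a b c d"
      by (simp add: A_def alt4_def alt3_def algebra_simps)
    also have "\<dots> = 0" by (rule alt4_zero[OF p15 x])
    finally show ?thesis .
  qed
  have p16: "s16 a b c d + s16 c d a b = 0" (is "?e = 0")
    if x: "a \<in> comp L 0" "b \<in> comp L 0" "c \<in> comp L 0" "d \<in> comp L 0" for a b c d
  proof -
    have "?e = app defect_h [(0, app l2 [(0, a), (0, b)]), (0, app l2 [(0, c), (0, d)])]"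
      by (simp add: s_def x hexpand algebra_simps)
    also have "\<dots> = 0" using x by (simp add: hops diff_above[OF C] defects_zero)
    finally show ?thesis .
  qed
  \<comment> \<open>Exchanging the two pairs is an even permutation, so skew-symmetry of
    \<open>h\<close> yields the vanishing of twice \<open>A16\<close>.\<close>
  have r16: "A16 + A16 = 0" (is "?e = 0")
  proof -
    have "?e = alt4 (\<lambda>a b c d. s16 a b c d + s16 c d a b) a b c d"
      by (simp add: A_def alt4_def alt3_def algebra_simps)
    also have "\<dots> = 0" by (rule alt4_zero[OF p16 x])
    finally show ?thesis .
  qed
  have p17: "s22 a b c d + s19 b c d a = 0" (is "?e = 0")
    if x: "a \<in> comp L 0" "b \<in> comp L 0" "c \<in> comp L 0" "d \<in> comp L 0" for a b c d
  proof -
    have "?e = app defect_skew2 [(0, a), (2, app h [(0, b), (0, app l2 [(0, c), (0, d)])])]"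
      by (simp add: s_def x hexpand algebra_simps)
    also have "\<dots> = 0" using x by (simp add: hops diff_above[OF C] defects_zero)
    finally show ?thesis .
  qed
  have r17: "A22 - A19 = 0" (is "?e = 0")
  proof -
    have "?e = alt4 (\<lambda>a b c d. s22 a b c d + s19 b c d a) a b c d"
      by (simp add: A_def alt4_def alt3_def algebra_simps)
    also have "\<dots> = 0" by (rule alt4_zero[OF p17 x])
    finally show ?thesis .
  qed
  have p18: "s21 a b c d + s15 b c d a = 0" (is "?e = 0")
    if x: "a \<in> comp L 0" "b \<in> comp L 0" "c \<in> comp L 0" "d \<in> comp L 0" for a b c d
  proof -
    have "?e = app defect_h [(0, a), (0, app l2 [(0, b), (0, app l2 [(0, c), (0, d)])])]"
      by (simp add: s_def x hexpand algebra_simps)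
    also have "\<dots> = 0" using x by (simp add: hops diff_above[OF C] defects_zero)
    finally show ?thesis .
  qed
  have r18: "A21 - A15 = 0" (is "?e = 0")
  proof -
    have "?e = alt4 (\<lambda>a b c d. s21 a b c d + s15 b c d a) a b c d"
      by (simp add: A_def alt4_def alt3_def algebra_simps)
    also have "\<dots> = 0" by (rule alt4_zero[OF p18 x])
    finally show ?thesis .
  qed
  have p19: "s28 a b c d - s21 a d b c - s34 a b c d - s34 a b c d = 0" (is "?e = 0")
    if x: "a \<in> comp L 0" "b \<in> comp L 0" "c \<in> comp L 0" "d \<in> comp L 0" for a b c d
  proof -
    have "?e = app h [(0, a), (0, app defect_m2 [(0, app l2 [(0, b), (0, c)]), (0, d)])]"
      by (simp add: s_def x hexpand algebra_simps)
    also have "\<dots> = 0" using x by (simp add: hops diff_above[OF C] defects_zero)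
    finally show ?thesis .
  qed
  have r19: "A28 - A21 - A34 - A34 = 0" (is "?e = 0")
  proof -
    have "?e = alt4 (\<lambda>a b c d. s28 a b c d - s21 a d b c - s34 a b c d - s34 a b c d) a b c d"
      by (simp add: A_def alt4_def alt3_def algebra_simps)
    also have "\<dots> = 0" by (rule alt4_zero[OF p19 x])
    finally show ?thesis .
  qed
  \<comment> \<open>The boundary equation of \<open>g3\<close> is applied to an argument of degree
    1; this links the terms in \<open>l3\<close>, \<open>m3\<close> and \<open>m2\<close> with each
    other.\<close>
  have p20: "s35 a b c d - s25 a b c d + s36 a b c d + s37 c a b d - s9 a b c d + s8 a b c d + s31 a b c d + s30 c a b d + s3 a b c d - s38 a b c d = 0" (is "?e = 0")
    if x: "a \<in> comp L 0" "b \<in> comp L 0" "c \<in> comp L 0" "d \<in> comp L 0" for a b c d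
  proof -
    have "?e = app (diff L) [(3, app g3 [(1, app g2 [(0, a), (0, b)]), (0, c), (0, d)])]"
      by (simp add: s_def x hexpand algebra_simps)
    also have "\<dots> = 0" using x by (simp add: hops diff_above[OF C] defects_zero)
    finally show ?thesis .
  qed
  have r20: "A35 - A25 + A36 + A37 - A9 + A8 + A31 + A30 + A3 - A38 = 0" (is "?e = 0")
  proof -
    have "?e = alt4 (\<lambda>a b c d. s35 a b c d - s25 a b c d + s36 a b c d + s37 c a b d - s9 a b c d + s8 a b c d + s31 a b c d + s30 c a b d + s3 a b c d - s38 a b c d) a b c d"
      by (simp add: A_def alt4_def alt3_def algebra_simps)
    also have "\<dots> = 0" by (rule alt4_zero[OF p20 x])
    finally show ?thesis .
  qed
  have p21: "s39 a b c d - s32 a b c d - s37 a b c d + s37 a c b d = 0" (is "?e = 0")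
    if x: "a \<in> comp L 0" "b \<in> comp L 0" "c \<in> comp L 0" "d \<in> comp L 0" for a b c d
  proof -
    have "?e = app (diff L) [(3, app g2 [(0, a), (2, app l2 [(2, app h [(0, b), (0, c)]), (0, d)])])]"
      by (simp add: s_def x hexpand algebra_simps)
    also have "\<dots> = 0" using x by (simp add: hops diff_above[OF C] defects_zero)
    finally show ?thesis .
  qed
  have r21: "A39 - A32 - A37 - A37 = 0" (is "?e = 0")
  proof -
    have "?e = alt4 (\<lambda>a b c d. s39 a b c d - s32 a b c d - s37 a b c d + s37 a c b d) a b c d"
      by (simp add: A_def alt4_def alt3_def algebra_simps)
    also have "\<dots> = 0" by (rule alt4_zero[OF p21 x])
    finally show ?thesis .
  qed
  have p22: "s26 a b c d - s40 a b c d - s39 c a b d - s35 a b c d + s35 b a c d = 0" (is "?e = 0")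
    if x: "a \<in> comp L 0" "b \<in> comp L 0" "c \<in> comp L 0" "d \<in> comp L 0" for a b c d
  proof -
    have "?e = app (diff L) [(3, app l3 [(2, app h [(0, a), (0, b)]), (0, c), (0, d)])]"
      by (simp add: s_def x hexpand algebra_simps)
    also have "\<dots> = 0" using x by (simp add: hops diff_above[OF C] defects_zero)
    finally show ?thesis .
  qed
  have r22: "A26 - A40 - A39 - A35 - A35 = 0" (is "?e = 0")
  proof -
    have "?e = alt4 (\<lambda>a b c d. s26 a b c d - s40 a b c d - s39 c a b d - s35 a b c d + s35 b a c d) a b c d"
      by (simp add: A_def alt4_def alt3_def algebra_simps)
    also have "\<dots> = 0" by (rule alt4_zero[OF p22 x])
    finally show ?thesis .
  qed
  have p23: "s40 a b c d - s33 a b c d - s36 a b c d + s36 b a c d = 0" (is "?e = 0")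
    if x: "a \<in> comp L 0" "b \<in> comp L 0" "c \<in> comp L 0" "d \<in> comp L 0" for a b c d
  proof -
    have "?e = app (diff L) [(3, app g2 [(2, app l2 [(2, app h [(0, a), (0, b)]), (0, c)]), (0, d)])]"
      by (simp add: s_def x hexpand algebra_simps)
    also have "\<dots> = 0" using x by (simp add: hops diff_above[OF C] defects_zero)
    finally show ?thesis .
  qed
  have r23: "A40 - A33 - A36 - A36 = 0" (is "?e = 0")
  proof -
    have "?e = alt4 (\<lambda>a b c d. s40 a b c d - s33 a b c d - s36 a b c d + s36 b a c d) a b c d"
      by (simp add: A_def alt4_def alt3_def algebra_simps)
    also have "\<dots> = 0" by (rule alt4_zero[OF p23 x])
    finally show ?thesis .
  qed
  have p24: "s3 a b c d - s3 b a c d - s38 a b c d - s38 a b c d = 0" (is "?e = 0")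
    if x: "a \<in> comp L 0" "b \<in> comp L 0" "c \<in> comp L 0" "d \<in> comp L 0" for a b c d
  proof -
    have "?e = app g3 [(0, app defect_m2 [(0, a), (0, b)]), (0, c), (0, d)]"
      by (simp add: s_def x hexpand algebra_simps)
    also have "\<dots> = 0" using x by (simp add: hops diff_above[OF C] defects_zero)
    finally show ?thesis .
  qed
  have r24: "A3 + A3 - A38 - A38 = 0" (is "?e = 0")
  proof -
    have "?e = alt4 (\<lambda>a b c d. s3 a b c d - s3 b a c d - s38 a b c d - s38 a b c d) a b c d"
      by (simp add: A_def alt4_def alt3_def algebra_simps)
    also have "\<dots> = 0" by (rule alt4_zero[OF p24 x])
    finally show ?thesis .
  qed
  have p25: "s28 a b c d + s27 b c d a = 0" (is "?e = 0")
    if x: "a \<in> comp L 0" "b \<in> comp L 0" "c \<in> comp L 0" "d \<in> comp L 0" for a b c d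
  proof -
    have "?e = app defect_h [(0, a), (0, app l2 [(0, app l2 [(0, b), (0, c)]), (0, d)])]"
      by (simp add: s_def x hexpand algebra_simps)
    also have "\<dots> = 0" using x by (simp add: hops diff_above[OF C] defects_zero)
    finally show ?thesis .
  qed
  have r25: "A28 - A27 = 0" (is "?e = 0")
  proof -
    have "?e = alt4 (\<lambda>a b c d. s28 a b c d + s27 b c d a) a b c d"
      by (simp add: A_def alt4_def alt3_def algebra_simps)
    also have "\<dots> = 0" by (rule alt4_zero[OF p25 x])
    finally show ?thesis .
  qed
  have p26: "s8 a b c d - s8 b a c d + s41 a b c d - s42 a b c d = 0" (is "?e = 0")
    if x: "a \<in> comp L 0" "b \<in> comp L 0" "c \<in> comp L 0" "d \<in> comp L 0" for a b c d
  proof -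
    have "?e = app (diff L) [(3, app m2 [(2, app h [(0, a), (0, b)]), (1, app g2 [(0, c), (0, d)])])]"
      by (simp add: s_def x hexpand algebra_simps)
    also have "\<dots> = 0" using x by (simp add: hops diff_above[OF C] defects_zero)
    finally show ?thesis .
  qed
  have r26: "A8 + A8 + A41 - A42 = 0" (is "?e = 0")
  proof -
    have "?e = alt4 (\<lambda>a b c d. s8 a b c d - s8 b a c d + s41 a b c d - s42 a b c d) a b c d"
      by (simp add: A_def alt4_def alt3_def algebra_simps)
    also have "\<dots> = 0" by (rule alt4_zero[OF p26 x])
    finally show ?thesis .
  qed
  have p27: "s41 a b c d - s41 a b d c - s42 a b c d - s42 a b c d = 0" (is "?e = 0")
    if x: "a \<in> comp L 0" "b \<in> comp L 0" "c \<in> comp L 0" "d \<in> comp L 0" for a b c d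
  proof -
    have "?e = app m2 [(2, app h [(0, a), (0, b)]), (0, app defect_m2 [(0, c), (0, d)])]"
      by (simp add: s_def x hexpand algebra_simps)
    also have "\<dots> = 0" using x by (simp add: hops diff_above[OF C] defects_zero)
    finally show ?thesis .
  qed
  have r27: "A41 + A41 - A42 - A42 = 0" (is "?e = 0")
  proof -
    have "?e = alt4 (\<lambda>a b c d. s41 a b c d - s41 a b d c - s42 a b c d - s42 a b c d) a b c d"
      by (simp add: A_def alt4_def alt3_def algebra_simps)
    also have "\<dots> = 0" by (rule alt4_zero[OF p27 x])
    finally show ?thesis .
  qed
  \<comment> \<open>The multipliers solve the linear system over the integers. The leading factor 2
    clears the denominators of the solution and is cancelled by \<open>units\<close>.\<close>
  have "scal L 2 (A1 + A1 + A1 + A1 + A2 + A2 + A2 + A2 - A3 - A3 - A3 - A3 + A4 + A4 + A4 + A4 - A5 - A5 - A5 - A5 + A6 + A6 + A7 + A7 + A7 + A7 + A7 + A7 - A8 - A8 - A8 - A8 - A8 - A8 + A9 + A9 - A10 - A10 - A10 - A10 + A11 + A11 + A11 + A11 + A11 + A11 - A12 - A12 - A13 - A14 - A14 + A15 + A16 + A16 - A17 - A18 - A18 - A19 - A20 - A20 - A21 - A22) = scal L (-4) (A7 - A6) + scal L (-2) (A19 + A13) + scal L (-16) (A23 + A24) + scal L (-4) (A5 + A5 + A25 + A25 + A25 + A25 + A25 + A25 - A16 - A16 - A16 - A26 - A26 - A26 - A4 - A4 - A18 - A18 - A18 - A18 - A18 - A18 + A15 + A15 + A15 + A23 + A23 +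 A23 + A3 + A3 + A12 + A12 + A12 + A12 + A12 + A12 - A27 - A27 - A27 - A24 - A24 - A24) + scal L (-20) (A10 + A9) + scal L (8) (A2 + A1 + A21 + A21 - A28) + scal L (-4) (A29 - A17 - A14 + A20) + scal L (-24) (A30 - A31) + scal L (8) (A7 + A7 + A30 + A30 + A30 + A30 + A30 + A30 - A17 - A17 - A17 - A32 - A32 - A32) + scal L (4) (A29 + A24 - A17 - A17) + scal L (12) (A32 - A33) + scal L (-8) (A14 + A12 + A28 - A34) + scal L (28) (A23 - A19 - A18 + A12) + scal L (12) (A11 + A10) + scal L (26) (A22 + A17) + scal L (-4) (A16 + A16) + scal L (-28) (A22 - A19) + scal L (-14) (A21 - A15) + scal L (4) (A28 - A21 - A34 - A34) + scal L (-24) (A35 - A25 + A36 + A37 - A9 + A8 + A31 + A30 + A3 - A38) + scal L (-12) (A39 - A32 - A37 - A37) + scal L (-12) (A26 - A40 - A39 - A35 - A35) + scal L (-12) (A40 - A33 - A36 - A36) + scal L (12) (A3 + A3 - A38 - A38) + scal L (12) (A28 - A27) + scal L (6) (A8 + A8 + A41 - A42) + scal L (-3) (A41 + A41 - A42 - A42)"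
    by (simp add: scal_simps[OF C] scal_double[OF C] algebra_simps)
  also have "\<dots> = 0"
    unfolding r1 r2 r3 r4 r5 r6 r7 r8 r9 r10 r11 r12 r13 r14 r15 r16 r17 r18 r19 r20 r21 r22 r23 r24 r25 r26 r27 by (simp add: scal_simps[OF C])
  finally have t: "A1 + A1 + A1 + A1 + A2 + A2 + A2 + A2 - A3 - A3 - A3 - A3 + A4 + A4 + A4 + A4 - A5 - A5 - A5 - A5 + A6 + A6 + A7 + A7 + A7 + A7 + A7 + A7 - A8 - A8 - A8 - A8 - A8 - A8 + A9 + A9 - A10 - A10 - A10 - A10 + A11 + A11 + A11 + A11 + A11 + A11 - A12 - A12 - A13 - A14 - A14 + A15 + A16 + A16 - A17 - A18 - A18 - A19 - A20 - A20 - A21 - A22 = 0" by (rule units)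
  \<comment> \<open>Pointwise form of the difference: \<open>defect4\<close> eliminates
    \<open>m4\<close>, and \<open>l31\<close>, \<open>l32\<close> are expressed by \<open>g3\<close>
    and \<open>h\<close>.\<close>
  have e: "app (m4 + m4) [(0, a), (0, b), (0, c), (0, d)] = app (l4 + l4 + (l21 \<circ>\<^bsub>1\<^esub> l3 - l31 \<circ>\<^bsub>1\<^esub> l2 + l32 \<circ>\<^bsub>2\<^esub> l2 - l21 \<circ>\<^bsub>2\<^esub> l3 - l31 \<circ>\<^bsub>2\<^esub> l2 + l32 \<circ>\<^bsub>3\<^esub> l2)) [(0, a), (0, b), (0, c), (0, d)] - (s1 a b c d + s1 a b c d + s1 a b c d + s1 a b c d - s2 b a c d - s2 b a c d + s2 c a b d + s2 c a b d - s3 a b c d - s3 a b c d - s3 a b c d + s4 a b c d + s4 a b c d - s4 b a c d - s4 b a c d - s5 a b c d + s5 a c b d + s5 a c b d - s5 b c a d - s5 b c a d + s6 a b c d + s6 a b c d + s7 a b c d + s7 a b c d - s7 b a c d - s7 b a c d + s7 c a b d + s7 c a b d - s8 a b c d - s8 a b c d + s8 a c b d + s8 a c b d - s8 b c a d - s8 b c a d + s9 a b c d + s9 a b c d - s10 a b c d - s10 a b c d + s10 b a c d + s10 b a c d + s11 a b c d + s11 a b c d - s11 a c b d - s11 a c b d + s11 b c a d + s11 b c a d - s4 c a b d - s12 a b c d - s12 a b c d - s13 a b c d + s5 a d b c - s14 a b c d - s14 a b c d + s15 a b c d + s16 b c a d - s17 a b c d - s3 b c a d - s18 a b c d - s18 a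 b c d - s19 a b c d + s4 a c d b - s20 a b c d - s20 a b c d + s16 a b c d + s21 b a c d - s22 a b c d)"
    if x: "a \<in> comp L 0" "b \<in> comp L 0" "c \<in> comp L 0" "d \<in> comp L 0" for a b c d
  proof -
    have "app (m4 + m4) [(0, a), (0, b), (0, c), (0, d)] = app (l4 + l4 + (l21 \<circ>\<^bsub>1\<^esub> l3 - l31 \<circ>\<^bsub>1\<^esub> l2 + l32 \<circ>\<^bsub>2\<^esub> l2 - l21 \<circ>\<^bsub>2\<^esub> l3 - l31 \<circ>\<^bsub>2\<^esub> l2 + l32 \<circ>\<^bsub>3\<^esub> l2)) [(0, a), (0, b), (0, c), (0, d)] - (s1 a b c d + s1 a b c d + s1 a b c d + s1 a b c d - s2 b a c d - s2 b a c d + s2 c a b d + s2 c a b d - s3 a b c d - s3 a b c d - s3 a b c d + s4 a b c d + s4 a b c d - s4 b a c d - s4 b a c d - s5 a b c d + s5 a c b d + s5 a c b d - s5 b c a d - s5 b c a d + s6 a b c d + s6 a b c d + s7 a b c d + s7 a b c d - s7 b a c d - s7 b a c d + s7 c a b d + s7 c a b d - s8 a b c d - s8 a b c d + s8 a c b d + s8 a c b d - s8 b c a d - s8 b c a d + s9 a b c d + s9 a b c d - s10 a b c d - s10 a b c d + s10 b a c d + s10 b a c d + s11 a b c d + s11 a b c d - s11 a c b d - s11 a c b d + s11 b c a d + s11 b c a d - s4 c a b d - s12 a b c d - s12 a b c d - s13 a b c d + s5 a d b c - s14 a b c d - s14 a b c d + s15 a b c d + s16 b c a d - s17 a b c d -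 s3 b c a d - s18 a b c d - s18 a b c d - s19 a b c d + s4 a c d b - s20 a b c d - s20 a b c d + s16 a b c d + s21 b a c d - s22 a b c d) - app defect4 [(0, a), (0, b), (0, c), (0, d)] - app defect4 [(0, a), (0, b), (0, c), (0, d)]"
      by (simp add: s_def x hexpand app_defect4 algebra_simps)
    then show ?thesis using that by (simp add: defect4_zero)
  qed
  have "alt4 (\<lambda>a b c d. app (m4 + m4) [(0, a), (0, b), (0, c), (0, d)]) a b c d =
    alt4 (\<lambda>a b c d. app (l4 + l4 + (l21 \<circ>\<^bsub>1\<^esub> l3 - l31 \<circ>\<^bsub>1\<^esub> l2 + l32 \<circ>\<^bsub>2\<^esub> l2 - l21 \<circ>\<^bsub>2\<^esub> l3 - l31 \<circ>\<^bsub>2\<^esub> l2 + l32 \<circ>\<^bsub>3\<^esub> l2)) [(0, a), (0, b), (0, c), (0, d)] - (s1 a b c d + s1 a b c d + s1 a b c d + s1 a b c d - s2 b a c d - s2 b a c d + s2 c a b d + s2 c a b d - s3 a b c d - s3 a b c d - s3 a b c d + s4 a b c d + s4 a b c d - s4 b a c d - s4 b a c d - s5 a b c d + s5 a c b d + s5 a c b d - s5 b c a d - s5 b c a d + s6 a b c d + s6 a b c d + s7 a b c d + s7 a b c d - s7 b a c d - s7 b a c d + s7 c a b d + s7 c a b d - s8 a b c d - s8 a b c d + s8 a c b d + s8 a c b d - s8 b c a d - s8 b c a d + s9 a b c d + s9 a b c d - s10 a b c d - s10 a b c d + s10 b a c d + s10 b a c d + s11 a b c d + s11 a b c d - s11 a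 c b d - s11 a c b d + s11 b c a d + s11 b c a d - s4 c a b d - s12 a b c d - s12 a b c d - s13 a b c d + s5 a d b c - s14 a b c d - s14 a b c d + s15 a b c d + s16 b c a d - s17 a b c d - s3 b c a d - s18 a b c d - s18 a b c d - s19 a b c d + s4 a c d b - s20 a b c d - s20 a b c d + s16 a b c d + s21 b a c d - s22 a b c d)) a b c d"
    using x by (simp only: alt4_def alt3_def e)
  also have "\<dots> = alt4 (\<lambda>a b c d. app (l4 + l4 + (l21 \<circ>\<^bsub>1\<^esub> l3 - l31 \<circ>\<^bsub>1\<^esub> l2 + l32 \<circ>\<^bsub>2\<^esub> l2 - l21 \<circ>\<^bsub>2\<^esub> l3 - l31 \<circ>\<^bsub>2\<^esub> l2 + l32 \<circ>\<^bsub>3\<^esub> l2)) [(0, a), (0, b), (0, c), (0, d)]) a b c d - (A1 + A1 + A1 + A1 + A2 + A2 + A2 + A2 - A3 - A3 - A3 - A3 + A4 + A4 + A4 + A4 - A5 - A5 - A5 - A5 + A6 + A6 + A7 + A7 + A7 + A7 + A7 + A7 - A8 - A8 - A8 - A8 - A8 - A8 + A9 + A9 - A10 - A10 - A10 - A10 + A11 + A11 + A11 + A11 + A11 + A11 - A12 - A12 - A13 - A14 - A14 + A15 + A16 + A16 - A17 - A18 - A18 - A19 - A20 - A20 - A21 - A22)"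
    by (simp only: A_def alt4_add alt4_diff alt4_0 alt4_perm(2)[of s5] alt4_perm(2)[of s8] alt4_perm(2)[of s11] alt4_perm(3)[of s4] alt4_perm(4)[of s5] alt4_perm(6)[of s2] alt4_perm(6)[of s4] alt4_perm(6)[of s7] alt4_perm(6)[of s10] alt4_perm(6)[of s21] alt4_perm(8)[of s3] alt4_perm(8)[of s5] alt4_perm(8)[of s8] alt4_perm(8)[of s11] alt4_perm(8)[of s16] alt4_perm(12)[of s2] alt4_perm(12)[of s4] alt4_perm(12)[of s7]) (simp add: algebra_simps)
  finally show ?thesis using t by simp
qed

end

subsection \<open>Skew-symmetrization of a weak Lie 3-algebra\<close>

lemma app_perm3_transposition13:
  "app (\<mu>\<^bsup>cyc [1,3]\<^esup>) [x, y, z] = sgn_pow (fst x * fst y + fst x * fst z + fst y * fst z) (app \<mu> [z, y, x])"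
  by (simp add: perm_eval cycle_of_list.simps add.assoc)

text \<open>Enumerates the permutations of an explicit set by choosing the image of one element
  after another.\<close>

lemma permutes_insert_sum:
  assumes "finite S" "a \<notin> S"
  shows "(\<Sum>p | p permutes insert a S. f p) =
    (\<Sum>b\<in>insert a S. \<Sum>q | q permutes S. f (transpose a b \<circ> q))"
  by (rule sum_over_permutations_insert[OF assms])

lemmas permutation_eval = permutes_insert_sum permutation_compose permutation_swap_id evenperm_comp evenperm_swap
  o_inv_distrib bij_comp inv_transpose_eq transpose_def

lemma skew_sum2:
  assumes "arity \<mu> = 2"
  shows "app (skew_sum \<mu>) [x, y] = app \<mu> [x, y] - sgn_pow (fst x * fst y) (app \<mu> [y, x])"
proof -
  \<comment> \<open>The set in explicit form lets \<open>permutes_insert_sum\<close> unfold the sum;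
    the same device serves for three and four arguments.\<close>
  have "{1..2::nat} = {1, 2}" by auto
  then show ?thesis
    by (simp add: skew_sum_def assms permutation_eval app_perm permuted_list koszul_exponent_list
        upt_rec_numeral upt_rec numeral_eq_Suc)
qed

lemma skew_sum3:
  assumes "arity \<mu> = 3"
  shows "app (skew_sum \<mu>) [x, y, z] = app \<mu> [x, y, z] - sgn_pow (fst y * fst z) (app \<mu> [x, z, y])
    - sgn_pow (fst x * fst y) (app \<mu> [y, x, z])
    + sgn_pow (fst x * fst y + fst x * fst z) (app \<mu> [y, z, x])
    + sgn_pow (fst x * fst z + fst y * fst z) (app \<mu> [z, x, y])
    - sgn_pow (fst x * fst y + fst x * fst z + fst y * fst z) (app \<mu> [z, y, x])"
proof -
  have "{1..3::nat} = {1, 2, 3}" by auto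
  then show ?thesis
    by (simp add: skew_sum_def assms permutation_eval app_perm permuted_list koszul_exponent_list
        upt_rec_numeral upt_rec numeral_eq_Suc algebra_simps)
qed

text \<open>The four-ary maps concerned have degree 2, so only arguments of degree 0 matter.\<close>

lemma skew_sum4_degree_0:
  assumes "arity \<mu> = 4"
  shows "app (skew_sum \<mu>) [(0, a), (0, b), (0, c), (0, d)] =
    alt4 (\<lambda>a b c d. app \<mu> [(0, a), (0, b), (0, c), (0, d)]) a b c d"
proof -
  have "{1..4::nat} = {1, 2, 3, 4}" by auto
  then show ?thesis
    by (simp add: skew_sum_def assms permutation_eval app_perm permuted_list koszul_exponent_degree_0
        upt_rec_numeral upt_rec numeral_eq_Suc alt4_def alt3_def algebra_simps)
qed

lemma map_eq2I:
  assumes "arity \<mu> = 2" "arity \<nu> = 2" "gdeg \<mu> = gdeg \<nu>"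
    and e: "\<And>p a q b. a \<in> comp L p \<Longrightarrow> b \<in> comp L q \<Longrightarrow> app \<mu> [(p, a), (q, b)] = app \<nu> [(p, a), (q, b)]"
  shows "map_eq L \<mu> \<nu>"
  unfolding map_eq_def
proof (intro conjI allI impI)
  fix vs assume l: "length vs = arity \<mu>" and h: "homogeneous L vs"
  then obtain p a q b where vs: "vs = [(p, a), (q, b)]"
    using assms(1) by (auto simp: length_Suc_conv numeral_eq_Suc)
  show "app \<mu> vs = app \<nu> vs" unfolding vs by (rule e) (use h vs in auto)
qed (simp_all only: assms)

text \<open>The definite description is legitimate because an inverse in a commutative ring is
  unique.\<close>

lemma unit_inv_mult: "c dvd 1 \<Longrightarrow> c * unit_inv c = 1"
  unfolding unit_inv_def
proof (rule theI')
  assume "c dvd 1"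
  then obtain b where b: "c * b = 1" by (metis dvdE)
  show "\<exists>!b. c * b = 1"
  proof (rule ex1I[of _ b])
    show "b' = b" if "c * b' = 1" for b'
      using b that by (metis mult.left_commute mult.right_neutral)
  qed (rule b)
qed

lemma scal_cancel:
  assumes L: "three_term_complex L" and c: "c dvd 1" and e: "scal L c x = scal L c y"
  shows "x = y"
proof -
  have "scal L (unit_inv c * c) x = scal L (unit_inv c * c) y"
    using arg_cong[OF e, of "scal L (unit_inv c)"] by (simp add: scal_simps[OF L])
  then show ?thesis using unit_inv_mult[OF c] by (simp add: scal_simps[OF L] mult.commute)
qed

lemma bdry_smult_map:
  fixes \<mu> :: "('v::ab_group_add, 'w::ab_group_add) gmap"
  assumes L: "three_term_complex L" and L': "three_term_complex L'"
    and \<mu>: "graded_map L L' n k \<mu>" and vs: "length vs = n" "homogeneous L vs"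
  shows "app (bdry L L' (smult_map L' c \<mu>)) vs = scal L' c (app (bdry L L' \<mu>) vs)"
proof -
  have d: "app (diff L') [(p, scal L' c x)] = scal L' c (app (diff L') [(p, x)])" if "x \<in> comp L' p" for p x
    using that by (simp add: graded_map1[OF L' L' complex_diff[OF L']])
  have s: "sgn_pow i (scal L' c x) = scal L' c (sgn_pow i x)" for i x
    by (simp add: sgn_pow_def scal_simps[OF L'])
  show ?thesis
    using graded_mapD[OF \<mu>] vs
    by (simp add: bdry_def app_tensor app_circ value_of_def d s add.commute scal_simps[OF L']
        module.scale_sum_right[OF complex_module[OF L'], symmetric])
qed

text \<open>Explicit operations allow the source and the target of a morphism to be two instances of
  this context at once.\<close>

locale weak_lie3_ops =
  fixes L :: "('k::comm_ring_1, 'v::ab_group_add, 'a) cplx_scheme"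
    and l2 l3 l4 l21 l211 l31 l32 :: "('v, 'v) gmap"
  assumes two: "(2::'k) dvd 1" and three: "(3::'k) dvd 1"
    and leib: "leibniz3 L l2 l3 l4"
    and wgraded: "graded_map L L 2 1 l21" "graded_map L L 2 2 l211" "graded_map L L 3 2 l31" "graded_map L L 3 2 l32"
    and bdry_l21: "map_eq L (bdry L L l21) (l2 + l2\<^bsup>cyc [1,2]\<^esup>)"
    and bdry_l211: "map_eq L (bdry L L l211) (l21 - l21\<^bsup>cyc [1,2]\<^esup>)"
    and bdry_l31: "map_eq L (bdry L L l31) (l3 + l3\<^bsup>cyc [1,2]\<^esup> + l2 \<circ>\<^bsub>1\<^esub> l21)"
    and bdry_l32: "map_eq L (bdry L L l32) (l3 + l3\<^bsup>cyc [2,3]\<^esup> - l2 \<circ>\<^bsub>2\<^esub> l21 + l21 \<circ>\<^bsub>1\<^esub> l2 + (l21 \<circ>\<^bsub>2\<^esub> l2)\<^bsup>cyc [1,2]\<^esup>)"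
    and l211_skew: "map_eq L (l211 + l211\<^bsup>cyc [1,2]\<^esup>) (zero_map 2 2)"
    and l31_swap: "map_eq L (l31 - l31\<^bsup>cyc [1,2]\<^esup>) (l2 \<circ>\<^bsub>1\<^esub> l211)"
    and l31_l32: "map_eq L (l31 - l32\<^bsup>cyc [1,2]\<^esup> + l31\<^bsup>cyc [1,3,2]\<^esup> - l32 + l31\<^bsup>cyc [2,3]\<^esup> - l32\<^bsup>cyc [1,2,3]\<^esup>)
      (l21 \<circ>\<^bsub>2\<^esub> l21 + l21 \<circ>\<^bsub>1\<^esub> l21 + (l21 \<circ>\<^bsub>2\<^esub> l21)\<^bsup>cyc [1,2]\<^esup> + (l211 \<circ>\<^bsub>2\<^esub> l2)\<^bsup>cyc [1,3,2]\<^esup>)"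
    and l32_swap: "map_eq L (l32 - l32\<^bsup>cyc [2,3]\<^esup>) (- l2 \<circ>\<^bsub>2\<^esub> l211 + l211 \<circ>\<^bsub>1\<^esub> l2 + (l211 \<circ>\<^bsub>2\<^esub> l2)\<^bsup>cyc [1,2]\<^esup>)"
    and l4_swap: "map_eq L (l4 + l4\<^bsup>cyc [1,2]\<^esup>)
       (l2 \<circ>\<^bsub>1\<^esub> l31 - l31 \<circ>\<^bsub>3\<^esub> l2 + (l2 \<circ>\<^bsub>2\<^esub> l31)\<^bsup>cyc [1,2,3]\<^esup> + l3 \<circ>\<^bsub>1\<^esub> l21)"
     "map_eq L (l4 + l4\<^bsup>cyc [2,3]\<^esup>)
       (l2 \<circ>\<^bsub>1\<^esub> l32 - l3 \<circ>\<^bsub>2\<^esub> l21 + l2 \<circ>\<^bsub>2\<^esub> l31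
        - l31 \<circ>\<^bsub>1\<^esub> l2 - (l31 \<circ>\<^bsub>2\<^esub> l2)\<^bsup>cyc [1,2]\<^esup> - (l31 \<circ>\<^bsub>3\<^esub> l2)\<^bsup>cyc [1,3,2]\<^esup>)"
     "map_eq L (l4 + l4\<^bsup>cyc [3,4]\<^esup>)
       (l21 \<circ>\<^bsub>1\<^esub> l3 - l32 \<circ>\<^bsub>1\<^esub> l2 + l32 \<circ>\<^bsub>2\<^esub> l2 - (l32 \<circ>\<^bsub>2\<^esub> l2)\<^bsup>cyc [1,2]\<^esup>
        + l3 \<circ>\<^bsub>3\<^esub> l21 + (l32 \<circ>\<^bsub>3\<^esub> l2)\<^bsup>cyc [2,3]\<^esup> - (l32 \<circ>\<^bsub>3\<^esub> l2)\<^bsup>cyc [1,3,2]\<^esup>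
        + l2 \<circ>\<^bsub>2\<^esub> l32 - (l2 \<circ>\<^bsub>2\<^esub> l32)\<^bsup>cyc [1,2]\<^esup> + (l21 \<circ>\<^bsub>2\<^esub> l3)\<^bsup>cyc [1,2,3]\<^esup>)"
begin

lemma C: "three_term_complex L"
  using leib by (simp add: leibniz3_def)

lemma lgraded: "graded_map L L 2 0 l2" "graded_map L L 3 1 l3" "graded_map L L 4 2 l4"
  using leib by (simp_all add: leibniz3_def)

text \<open>Half of \<open>l21\<close> has the symmetric part of \<open>l2\<close> as boundary,
  which is exactly the difference between \<open>l2\<close> and its skew part \<open>m2\<close>.
  Likewise \<open>h\<close> bounds the failure of \<open>g2\<close> to be symmetric.\<close>

definition g2 :: "('v, 'v) gmap" where "g2 = smult_map L (unit_inv 2) l21"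
definition h :: "('v, 'v) gmap" where "h = smult_map L (unit_inv 2) l211"
definition m2 :: "('v, 'v) gmap" where "m2 = smult_map L (unit_inv 2) (skew_sum l2)"
definition m3 :: "('v, 'v) gmap"
  where "m3 = smult_map L (unit_inv 6) (skew_sum l3)
    - smult_map L (unit_inv 24) (skew_sum (l21 \<circ>\<^bsub>1\<^esub> l2 + l21 \<circ>\<^bsub>2\<^esub> l2))"
text \<open>
  The coefficients solve the linear system expressing that \<open>g3 = 1/24 G3\<close> satisfies \<open>bdry_g3\<close>, \<open>l31_eq\<close> and
  \<open>l32_eq\<close> below.
\<close>
definition G3 :: "('v, 'v) gmap"
  where "G3 = smult_map L 14 l31 - smult_map L 2 (l31\<^bsup>cyc [2,3]\<^esup>) + smult_map L 6 (l31\<^bsup>cyc [1,3,2]\<^esup>)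
    + smult_map L 6 l32 - smult_map L 10 (l32\<^bsup>cyc [1,2]\<^esup>) - smult_map L 2 (l32\<^bsup>cyc [1,2,3]\<^esup>)
    - smult_map L 8 (l21 \<circ>\<^bsub>1\<^esub> l21) - smult_map L 4 ((l21 \<circ>\<^bsub>1\<^esub> l21)\<^bsup>cyc [2,3]\<^esup>)
    - (l211 \<circ>\<^bsub>1\<^esub> l2) - (l211 \<circ>\<^bsub>1\<^esub> l2)\<^bsup>cyc [1,2,3]\<^esup> + (l211 \<circ>\<^bsub>1\<^esub> l2)\<^bsup>cyc [1,3,2]\<^esup> - (l211 \<circ>\<^bsub>1\<^esub> l2)\<^bsup>cyc [1,3]\<^esup> + (l211 \<circ>\<^bsub>1\<^esub> l2)\<^bsup>cyc [1,2]\<^esup> - smult_map L 5 ((l211 \<circ>\<^bsub>1\<^esub> l2)\<^bsup>cyc [2,3]\<^esup>)"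
definition g3 :: "('v, 'v) gmap" where "g3 = smult_map L (unit_inv 24) G3"

lemmas wgraded_intros = lgraded wgraded graded_map_add[OF C] graded_map_diff[OF C] graded_map_uminus[OF C] graded_map_zero[OF C]
  graded_map_smult[OF C] graded_map_perm[OF C C] graded_map_circ[OF C C] graded_map_bdry[OF C C]
  graded_map_skew_sum[OF C C] graded_map_tensor2[OF C C] cyc_permutes

lemma bar_graded: "graded_map L L 2 1 g2" "graded_map L L 2 2 h" "graded_map L L 2 0 m2" "graded_map L L 3 1 m3"
  "graded_map L L 3 2 G3" "graded_map L L 3 2 g3"
proof -
  show "graded_map L L 2 1 g2" unfolding g2_def by (rule wgraded_intros | simp)+
  show "graded_map L L 2 2 h" unfolding h_def by (rule wgraded_intros | simp)+
  show "graded_map L L 2 0 m2" unfolding m2_def by (rule wgraded_intros | simp)+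
  show "graded_map L L 3 1 m3" unfolding m3_def by (rule wgraded_intros | simp)+
  show G: "graded_map L L 3 2 G3" unfolding G3_def by (rule wgraded_intros | simp)+
  show "graded_map L L 3 2 g3" unfolding g3_def by (rule wgraded_intros G | simp)+
qed

lemma units: "(6::'k) dvd 1" "(24::'k) dvd 1" "(48::'k) dvd 1"
  using mult_dvd_mono[OF two three] mult_dvd_mono[OF two mult_dvd_mono[OF two mult_dvd_mono[OF two three]]]
    mult_dvd_mono[OF two mult_dvd_mono[OF two mult_dvd_mono[OF two mult_dvd_mono[OF two three]]]] by simp_all

lemmas wops = graded_map1[OF C C complex_diff[OF C]] graded_map2[OF C C lgraded(1)] graded_map3[OF C C lgraded(2)]
  graded_map4[OF C C lgraded(3)] graded_map2[OF C C wgraded(1)] graded_map2[OF C C wgraded(2)]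
  graded_map3[OF C C wgraded(3)] graded_map3[OF C C wgraded(4)] graded_map2[OF C C bar_graded(1)]
  graded_map2[OF C C bar_graded(2)] graded_map2[OF C C bar_graded(3)] graded_map3[OF C C bar_graded(4)]
  graded_map3[OF C C bar_graded(5)] graded_map3[OF C C bar_graded(6)] comp_closed[OF C]

text \<open>Rules for clearing denominators: 24 for the ternary formulas, 48 for the four-ary
  one.\<close>

lemma unit_inv_scal: "scal L 2 (scal L (unit_inv 2) x) = x" "scal L 24 (scal L (unit_inv 24) x) = x"
  "scal L 24 (scal L (unit_inv 6) x) = scal L 4 x" "scal L 48 (scal L (unit_inv 48) x) = x"
  "scal L 48 (scal L (unit_inv 24) x) = scal L 2 x"
proof -
  have "24 * unit_inv (6::'k) = 4" "48 * unit_inv (24::'k) = 2"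
    using arg_cong[OF unit_inv_mult[OF units(1)], of "times 4"] arg_cong[OF unit_inv_mult[OF units(2)], of "times 2"]
    by (simp_all add: mult.assoc[symmetric])
  then show "scal L 24 (scal L (unit_inv 6) x) = scal L 4 x" "scal L 48 (scal L (unit_inv 24) x) = scal L 2 x"
    by (simp_all add: scal_simps[OF C])
qed (simp_all add: scal_simps[OF C] unit_inv_mult two units)

lemma half: "scal L (unit_inv 2) x + scal L (unit_inv 2) x = x"
proof -
  have "unit_inv 2 + unit_inv 2 = (1::'k)" using unit_inv_mult[OF two] unfolding mult_2 .
  then show ?thesis by (simp only: scal_simps(9)[OF C, symmetric] scal_simps(5)[OF C])
qed

text \<open>Eliminates \<open>l21\<close>, and in the next lemma \<open>l211\<close>, so that later
  expansions contain no factor 1/2.\<close>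

lemma app_l21: "app l21 vs = app g2 vs + app g2 vs"
  by (simp add: g2_def half)

lemma app_l211: "app l211 vs = app h vs + app h vs"
  by (simp add: h_def half)

lemma app_m2_double: "app m2 [x, y] + app m2 [x, y] = app l2 [x, y] - sgn_pow (fst x * fst y) (app l2 [y, x])"
  by (simp add: m2_def half skew_sum2 wops)

lemma m2_eq: "map_eq L (m2 + m2) (l2 - l2\<^bsup>cyc [1,2]\<^esup>)"
  by (rule map_eq2I) (simp_all add: wops app_unfold app_m2_double)

lemma m2_skew: "map_eq L (m2 + m2\<^bsup>cyc [1,2]\<^esup>) (zero_map 2 0)"
  by (rule map_eq2I)
    (simp_all add: wops app_unfold m2_def skew_sum2 sgn_pow_def mult.commute scal_simps[OF C])

lemma h_skew: "map_eq L (h + h\<^bsup>cyc [1,2]\<^esup>) (zero_map 2 2)"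
proof (rule map_eq2I)
  fix p a q b assume x: "a \<in> comp L p" "b \<in> comp L q"
  have "app (h + h\<^bsup>cyc [1,2]\<^esup>) [(p, a), (q, b)] = scal L (unit_inv 2) (app (l211 + l211\<^bsup>cyc [1,2]\<^esup>) [(p, a), (q, b)])"
    by (simp add: h_def app_unfold sgn_pow_def scal_simps[OF C])
  also have "app (l211 + l211\<^bsup>cyc [1,2]\<^esup>) [(p, a), (q, b)] = 0"
    using map_eqD[OF l211_skew, of "[(p, a), (q, b)]"] x by (simp add: wops)
  finally show "app (h + h\<^bsup>cyc [1,2]\<^esup>) [(p, a), (q, b)] = app (zero_map 2 2) [(p, a), (q, b)]"
    by (simp add: scal_simps[OF C])
qed (simp_all add: wops)

lemma g2_eq: "map_eq L l21 (g2 + g2)"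
  unfolding map_eq_def by (simp add: wops app_l21)

lemmas bdry_smult = bdry_smult_map[OF C C]

text \<open>Half of a sum is the first summand minus half of the difference, applied to
  \<open>l2\<close> and its transpose.\<close>

lemma bdry_g2: "map_eq L (bdry L L g2) (l2 - m2)"
proof (rule map_eq2I)
  fix p a q b assume x: "a \<in> comp L p" "b \<in> comp L q"
  have "app (bdry L L g2) [(p, a), (q, b)] = scal L (unit_inv 2) (app (l2 + l2\<^bsup>cyc [1,2]\<^esup>) [(p, a), (q, b)])"
    unfolding g2_def using bdry_smult[OF wgraded(1), of "[(p, a), (q, b)]"] map_eqD[OF bdry_l21, of "[(p, a), (q, b)]"] x
    by (simp add: wops)
  also have "\<dots> = app (l2 - m2) [(p, a), (q, b)]"
    using half[of "app l2 [(p, a), (q, b)]"]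
    by (simp add: app_unfold m2_def skew_sum2 wops scal_simps[OF C] algebra_simps)
  finally show "app (bdry L L g2) [(p, a), (q, b)] = app (l2 - m2) [(p, a), (q, b)]" .
qed (simp_all add: wops)

lemma bdry_h: "map_eq L (bdry L L h) (g2 - g2\<^bsup>cyc [1,2]\<^esup>)"
proof (rule map_eq2I)
  fix p a q b assume x: "a \<in> comp L p" "b \<in> comp L q"
  have "app (bdry L L h) [(p, a), (q, b)] = scal L (unit_inv 2) (app (l21 - l21\<^bsup>cyc [1,2]\<^esup>) [(p, a), (q, b)])"
    unfolding h_def using bdry_smult[OF wgraded(2), of "[(p, a), (q, b)]"] map_eqD[OF bdry_l211, of "[(p, a), (q, b)]"] x
    by (simp add: wops)
  also have "\<dots> = app (g2 - g2\<^bsup>cyc [1,2]\<^esup>) [(p, a), (q, b)]"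
    by (simp add: app_unfold g2_def sgn_pow_def scal_simps[OF C])
  finally show "app (bdry L L h) [(p, a), (q, b)] = app (g2 - g2\<^bsup>cyc [1,2]\<^esup>) [(p, a), (q, b)]" .
qed (simp_all add: wops)

lemmas diff_l2 = diff_app2[OF leib[unfolded leibniz3_def, THEN conjunct2, THEN conjunct2, THEN conjunct2, THEN conjunct2, THEN conjunct1]
    C C lgraded(1), simplified]
lemmas diff_l3 = diff_app3[OF leib[unfolded leibniz3_def, THEN conjunct2, THEN conjunct2, THEN conjunct2, THEN conjunct2, THEN conjunct2, THEN conjunct1]
    C C lgraded(2), simplified app_unfold wops gmap_simps, simplified]
lemmas diff_g2 = diff_app2[OF bdry_g2 C C bar_graded(1), simplified]
lemmas diff_h = diff_app2[OF bdry_h C C bar_graded(2), simplified app_unfold wops gmap_simps, simplified]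
lemmas diff_l31 = diff_app3[OF bdry_l31 C C wgraded(3), simplified app_unfold wops gmap_simps, simplified]
lemmas diff_l32 = diff_app3[OF bdry_l32 C C wgraded(4), simplified app_unfold wops gmap_simps, simplified]

definition defect_m2 :: "('v, 'v) gmap"
  where "defect_m2 = l2 - l2\<^bsup>cyc [1,2]\<^esup> - (m2 + m2)"

lemma defect_m2_zero: "a \<in> comp L p \<Longrightarrow> b \<in> comp L q \<Longrightarrow> app defect_m2 [(p, a), (q, b)] = 0"
  using map_eqD[OF m2_eq, of "[(p, a), (q, b)]"] by (simp add: defect_m2_def wops)

lemmas app_defect_m2 = arg_cong[OF defect_m2_def, of "\<lambda>\<mu>. app \<mu> [(p, a), (q, b)]" for p a q b,
  simplified app_unfold wops gmap_simps, simplified]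

definition defect_h :: "('v, 'v) gmap"
  where "defect_h = h + h\<^bsup>cyc [1,2]\<^esup>"

lemma defect_h_zero: "a \<in> comp L p \<Longrightarrow> b \<in> comp L q \<Longrightarrow> app defect_h [(p, a), (q, b)] = 0"
  using map_eqD[OF h_skew, of "[(p, a), (q, b)]"] by (simp add: defect_h_def wops)

lemmas app_defect_h = arg_cong[OF defect_h_def, of "\<lambda>\<mu>. app \<mu> [(p, a), (q, b)]" for p a q b,
  simplified app_unfold wops gmap_simps, simplified]

definition defect_31 :: "('v, 'v) gmap"
  where "defect_31 = l31 - l31\<^bsup>cyc [1,2]\<^esup> - l2 \<circ>\<^bsub>1\<^esub> l211"

lemma defect_31_zero: "a \<in> comp L p \<Longrightarrow> b \<in> comp L q \<Longrightarrow> c \<in> comp L r \<Longrightarrow> app defect_31 [(p, a), (q, b), (r, c)] = 0"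
  using map_eqD[OF l31_swap, of "[(p, a), (q, b), (r, c)]"] by (simp add: defect_31_def wops)

lemmas app_defect_31 = arg_cong[OF defect_31_def, of "\<lambda>\<mu>. app \<mu> [(p, a), (q, b), (r, c)]" for p a q b r c,
  simplified app_unfold wops gmap_simps, simplified]

definition defect_3132 :: "('v, 'v) gmap"
  where "defect_3132 = l31 - l32\<^bsup>cyc [1,2]\<^esup> + l31\<^bsup>cyc [1,3,2]\<^esup> - l32 + l31\<^bsup>cyc [2,3]\<^esup> - l32\<^bsup>cyc [1,2,3]\<^esup> - (l21 \<circ>\<^bsub>2\<^esub> l21 + l21 \<circ>\<^bsub>1\<^esub> l21 + (l21 \<circ>\<^bsub>2\<^esub> l21)\<^bsup>cyc [1,2]\<^esup> + (l211 \<circ>\<^bsub>2\<^esub> l2)\<^bsup>cyc [1,3,2]\<^esup>)"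

lemma defect_3132_zero: "a \<in> comp L p \<Longrightarrow> b \<in> comp L q \<Longrightarrow> c \<in> comp L r \<Longrightarrow> app defect_3132 [(p, a), (q, b), (r, c)] = 0"
  using map_eqD[OF l31_l32, of "[(p, a), (q, b), (r, c)]"] by (simp add: defect_3132_def wops)

lemmas app_defect_3132 = arg_cong[OF defect_3132_def, of "\<lambda>\<mu>. app \<mu> [(p, a), (q, b), (r, c)]" for p a q b r c,
  simplified app_unfold wops gmap_simps, simplified]

definition defect_32 :: "('v, 'v) gmap"
  where "defect_32 = l32 - l32\<^bsup>cyc [2,3]\<^esup> - (- l2 \<circ>\<^bsub>2\<^esub> l211 + l211 \<circ>\<^bsub>1\<^esub> l2 + (l211 \<circ>\<^bsub>2\<^esub> l2)\<^bsup>cyc [1,2]\<^esup>)"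

lemma defect_32_zero: "a \<in> comp L p \<Longrightarrow> b \<in> comp L q \<Longrightarrow> c \<in> comp L r \<Longrightarrow> app defect_32 [(p, a), (q, b), (r, c)] = 0"
  using map_eqD[OF l32_swap, of "[(p, a), (q, b), (r, c)]"] by (simp add: defect_32_def wops)

lemmas app_defect_32 = arg_cong[OF defect_32_def, of "\<lambda>\<mu>. app \<mu> [(p, a), (q, b), (r, c)]" for p a q b r c,
  simplified app_unfold wops gmap_simps, simplified]

lemmas app_G3 = arg_cong[OF G3_def, of "\<lambda>\<mu>. app \<mu> [(p, a), (q, b), (r, c)]" for p a q b r c,
  simplified app_unfold app_perm3_transposition13 app_perm3_transposition13[unfolded One_nat_def] wops gmap_simps, simplified]

lemma g3_scal: "scal L 24 (app g3 vs) = app G3 vs"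
  by (simp add: g3_def unit_inv_scal)

lemmas wdefects_zero = defect_m2_zero defect_h_zero defect_31_zero defect_3132_zero defect_32_zero
lemmas wdefects = app_defect_m2 app_defect_h app_defect_31 app_defect_3132 app_defect_32
lemmas wexpand = app_unfold wops app_l21 app_l211 diff_l2 diff_l3 diff_g2 diff_h diff_l31 diff_l32 wdefects
  diff_negative[OF C] diff_diff[OF C] sgn_pow_def scal_double[OF C] scal_simps(1-6)[OF C]

text \<open>After multiplication by 24 this is an integral identity. The axioms between
  \<open>l31\<close> and \<open>l32\<close>, the relations for \<open>m2\<close> and
  \<open>h\<close>, and three values d x are added with multiplicities that solve a linear system.
  The same scheme proves \<open>l32_eq\<close>.\<close>

lemma l31_eq: "map_eq L l31 (g3 + g3\<^bsup>cyc [1,2]\<^esup> + g2 \<circ>\<^bsub>1\<^esub> l21 + m2 \<circ>\<^bsub>1\<^esub> h)" (is "map_eq L _ ?rhs")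
proof (rule map_eqI[OF C C, of 3 2])
  show "graded_map L L 3 2 l31" by (rule wgraded)
  show "graded_map L L 3 2 ?rhs"
    by (rule bar_graded wgraded_intros | simp)+
next
  fix vs :: "(int \<times> 'v) list"
  assume l: "length vs = 3" and h: "homogeneous L vs" "fst ` set vs \<subseteq> {0, 1, 2}" "tdeg vs + 2 \<le> 2"
  then obtain p a q b r c where vs: "vs = [(p, a), (q, b), (r, c)]"
    by (auto simp: length_Suc_conv numeral_eq_Suc)
  have z: "p = 0" "q = 0" "r = 0"
    using degree_0[OF h(2), of "(p, a)"] degree_0[OF h(2), of "(q, b)"] degree_0[OF h(2), of "(r, c)"] h(3)
    by (simp_all add: vs)
  have x: "a \<in> comp L 0" "b \<in> comp L 0" "c \<in> comp L 0" using h(1) by (simp_all add: vs z)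
  have "scal L 24 (app l31 [(0, a), (0, b), (0, c)]) = app (G3 + G3\<^bsup>cyc [1,2]\<^esup>) [(0, a), (0, b), (0, c)] + scal L 24 (app (g2 \<circ>\<^bsub>1\<^esub> l21) [(0, a), (0, b), (0, c)]) + scal L 24 (app (m2 \<circ>\<^bsub>1\<^esub> h) [(0, a), (0, b), (0, c)])
       + scal L 10 (app defect_31 [(0, a), (0, b), (0, c)])
       + scal L 2 (app defect_32 [(0, c), (0, a), (0, b)])
       - scal L 16 (app (diff L) [(3, app h [(0, a), (1, app g2 [(0, b), (0, c)])])])
       - scal L 4 (app defect_h [(0, a), (0, app l2 [(0, c), (0, b)])])
       + scal L 16 (app defect_h [(0, a), (0, app l2 [(0, b), (0, c)])])
       + scal L 8 (app defect_h [(0, b), (0, app l2 [(0, a), (0, c)])])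
       + scal L 4 (app defect_m2 [(2, app h [(0, a), (0, b)]), (0, c)])
       - scal L 4 (app defect_3132 [(0, b), (0, a), (0, c)])
       + scal L 8 (app defect_h [(0, b), (0, app l2 [(0, c), (0, a)])])
       - scal L 16 (app (diff L) [(3, app h [(0, b), (1, app g2 [(0, a), (0, c)])])])
       + scal L 8 (app h [(0, b), (0, app defect_m2 [(0, a), (0, c)])])
       - scal L 8 (app h [(0, app defect_m2 [(0, b), (0, c)]), (0, a)])
       - scal L 16 (app defect_h [(0, a), (0, app m2 [(0, b), (0, c)])])
       + scal L 16 (app (diff L) [(3, app g2 [(2, app h [(0, a), (0, b)]), (0, c)])])"
    by (simp add: x wexpand app_G3 algebra_simps)
  also have "\<dots> = app (G3 + G3\<^bsup>cyc [1,2]\<^esup>) [(0, a), (0, b), (0, c)] + scal L 24 (app (g2 \<circ>\<^bsub>1\<^esub> l21) [(0, a), (0, b), (0, c)]) + scal L 24 (app (m2 \<circ>\<^bsub>1\<^esub> h) [(0, a), (0, b), (0, c)])"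
    using x by (simp add: wops diff_above[OF C] wdefects_zero scal_simps[OF C])
  \<comment> \<open>Reading \<open>G3\<close> as 24 times \<open>g3\<close> puts the whole right
    side under a common factor 24, which is then cancelled.\<close>
  also have "\<dots> = scal L 24 (app ?rhs [(0, a), (0, b), (0, c)])"
    by (simp add: g3_scal[symmetric] scal_simps[OF C] app_unfold(4-))
  finally show "app l31 vs = app ?rhs vs"
    unfolding vs z by (rule scal_cancel[OF C units(2)])
qed

lemma l32_eq: "map_eq L l32 (g3 + g3\<^bsup>cyc [2,3]\<^esup> - g2 \<circ>\<^bsub>2\<^esub> l21 + h \<circ>\<^bsub>1\<^esub> l2 + (h \<circ>\<^bsub>2\<^esub> l2)\<^bsup>cyc [1,2]\<^esup> - m2 \<circ>\<^bsub>2\<^esub> h)" (is "map_eq L _ ?rhs")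
proof (rule map_eqI[OF C C, of 3 2])
  show "graded_map L L 3 2 l32" by (rule wgraded)
  show "graded_map L L 3 2 ?rhs"
    by (rule bar_graded wgraded_intros | simp)+
next
  fix vs :: "(int \<times> 'v) list"
  assume l: "length vs = 3" and h: "homogeneous L vs" "fst ` set vs \<subseteq> {0, 1, 2}" "tdeg vs + 2 \<le> 2"
  then obtain p a q b r c where vs: "vs = [(p, a), (q, b), (r, c)]"
    by (auto simp: length_Suc_conv numeral_eq_Suc)
  have z: "p = 0" "q = 0" "r = 0"
    using degree_0[OF h(2), of "(p, a)"] degree_0[OF h(2), of "(q, b)"] degree_0[OF h(2), of "(r, c)"] h(3)
    by (simp_all add: vs)
  have x: "a \<in> comp L 0" "b \<in> comp L 0" "c \<in> comp L 0" using h(1) by (simp_all add: vs z)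
  have "scal L 24 (app l32 [(0, a), (0, b), (0, c)]) = app (G3 + G3\<^bsup>cyc [2,3]\<^esup>) [(0, a), (0, b), (0, c)] - scal L 24 (app (g2 \<circ>\<^bsub>2\<^esub> l21) [(0, a), (0, b), (0, c)]) + scal L 24 (app (h \<circ>\<^bsub>1\<^esub> l2) [(0, a), (0, b), (0, c)]) + scal L 24 (app ((h \<circ>\<^bsub>2\<^esub> l2)\<^bsup>cyc [1,2]\<^esup>) [(0, a), (0, b), (0, c)]) - scal L 24 (app (m2 \<circ>\<^bsub>2\<^esub> h) [(0, a), (0, b), (0, c)])
       + scal L 6 (app defect_31 [(0, b), (0, c), (0, a)])
       - scal L 12 (app defect_3132 [(0, a), (0, b), (0, c)])
       - scal L 48 (app (diff L) [(3, app h [(0, b), (1, app g2 [(0, a), (0, c)])])])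
       + scal L 24 (app h [(0, b), (0, app defect_m2 [(0, a), (0, c)])])
       + scal L 6 (app defect_32 [(0, a), (0, b), (0, c)])
       - scal L 12 (app defect_m2 [(0, a), (2, app h [(0, b), (0, c)])])
       + scal L 12 (app defect_h [(0, b), (0, app l2 [(0, a), (0, c)])])"
    by (simp add: x wexpand app_G3 algebra_simps)
  also have "\<dots> = app (G3 + G3\<^bsup>cyc [2,3]\<^esup>) [(0, a), (0, b), (0, c)] - scal L 24 (app (g2 \<circ>\<^bsub>2\<^esub> l21) [(0, a), (0, b), (0, c)]) + scal L 24 (app (h \<circ>\<^bsub>1\<^esub> l2) [(0, a), (0, b), (0, c)]) + scal L 24 (app ((h \<circ>\<^bsub>2\<^esub> l2)\<^bsup>cyc [1,2]\<^esup>) [(0, a), (0, b), (0, c)]) - scal L 24 (app (m2 \<circ>\<^bsub>2\<^esub> h) [(0, a), (0, b), (0, c)])"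
    using x by (simp add: wops diff_above[OF C] wdefects_zero scal_simps[OF C])
  also have "\<dots> = scal L 24 (app ?rhs [(0, a), (0, b), (0, c)])"
    by (simp add: g3_scal[symmetric] scal_simps[OF C] app_unfold(4-))
  finally show "app l32 vs = app ?rhs vs"
    unfolding vs z by (rule scal_cancel[OF C units(2)])
qed

end

section \<open>Boundary and antisymmetrization of \<open>g3\<close>\<close>

lemma alt3_zero:
  assumes "\<And>a b c. a \<in> C \<Longrightarrow> b \<in> C \<Longrightarrow> c \<in> C \<Longrightarrow> F a b c = 0"
    and "a \<in> C" "b \<in> C" "c \<in> C"
  shows "alt3 F a b c = 0"
  by (simp add: alt3_def assms)

lemma alt3_add: "alt3 (\<lambda>a b c. F a b c + G a b c) a b c = alt3 F a b c + alt3 G a b c"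
  and alt3_diff: "alt3 (\<lambda>a b c. F a b c - G a b c) a b c = alt3 F a b c - alt3 G a b c"
  and alt3_0: "alt3 (\<lambda>a b c. 0) a b c = 0"
  by (simp_all add: alt3_def algebra_simps)

lemma alt3_scal: "three_term_complex L \<Longrightarrow> alt3 (\<lambda>a b c. scal L z (F a b c)) a b c = scal L z (alt3 F a b c)"
  by (simp add: alt3_def scal_simps)

lemma alt3_perm:
  shows "alt3 (\<lambda>a b c. F a c b) a b c = - alt3 F a b c"
    "alt3 (\<lambda>a b c. F b a c) a b c = - alt3 F a b c"
    "alt3 (\<lambda>a b c. F b c a) a b c = alt3 F a b c"
    "alt3 (\<lambda>a b c. F c a b) a b c = alt3 F a b c"
    "alt3 (\<lambda>a b c. F c b a) a b c = - alt3 F a b c"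
  by (simp_all add: alt3_def)

context weak_lie3_ops
begin

lemma m3_scal: "scal L 24 (app m3 vs) = (scal L 4 (app (skew_sum l3) vs) - app (skew_sum (l21 \<circ>\<^bsub>1\<^esub> l2 + l21 \<circ>\<^bsub>2\<^esub> l2)) vs)"
  by (simp only: m3_def gmap_simps scal_simps(2)[OF C] unit_inv_scal)

text \<open>Linearity of d over the summands of \<open>G3\<close>, kept apart from the expansion of
  these summands by the boundary equations.\<close>

lemma diff_G3_000:
  assumes x: "a \<in> comp L 0" "b \<in> comp L 0" "c \<in> comp L 0"
  shows "app (diff L) [(2, app G3 [(0, a), (0, b), (0, c)])] =
    scal L 14 (app (diff L) [(2, app l31 [(0, a), (0, b), (0, c)])]) - scal L 2 (app (diff L) [(2, app l31 [(0, a), (0, c), (0, b)])]) + scal L 6 (app (diff L) [(2, app l31 [(0, b), (0, c), (0, a)])]) + scal L 6 (app (diff L) [(2, app l32 [(0, a), (0, b), (0, c)])]) - scal L 10 (app (diff L) [(2, app l32 [(0, b), (0, a), (0, c)])]) - scal L 2 (app (diff L) [(2, app l32 [(0, c), (0, a), (0, b)])]) - scal L 8 (app (diff L) [(2, app l21 [(1, app l21 [(0, a), (0, b)]), (0, c)])]) - scal L 4 (app (diff L) [(2, app l21 [(1, app l21 [(0, a), (0, c)]), (0, b)])]) - app (diff L) [(2, app l211 [(0, app l2 [(0, a), (0, b)]), (0, c)])] - app (diff L) [(2, app l211 [(0, app l2 [(0, c), (0, a)]), (0, b)])] + app (diff L) [(2, app l211 [(0, app l2 [(0, b), (0, c)]),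 (0, a)])] - app (diff L) [(2, app l211 [(0, app l2 [(0, c), (0, b)]), (0, a)])] + app (diff L) [(2, app l211 [(0, app l2 [(0, b), (0, a)]), (0, c)])] - scal L 5 (app (diff L) [(2, app l211 [(0, app l2 [(0, a), (0, c)]), (0, b)])])"
  using x by (simp add: app_G3 wops sgn_pow_def)

text \<open>In this case and the two following ones the value of \<open>G3\<close> has degree 3 and
  vanishes; the expansion of its d is nevertheless what produces the boundary equation.\<close>

lemma diff_G3_001:
  assumes x: "a \<in> comp L 0" "b \<in> comp L 0" "c \<in> comp L 1"
  shows "app (diff L) [(3, app G3 [(0, a), (0, b), (1, c)])] =
    scal L 14 (app (diff L) [(3, app l31 [(0, a), (0, b), (1, c)])]) - scal L 2 (app (diff L) [(3, app l31 [(0, a), (1, c), (0, b)])]) + scal L 6 (app (diff L) [(3, app l31 [(0, b), (1, c), (0, a)])]) + scal L 6 (app (diff L) [(3, app l32 [(0, a), (0, b), (1, c)])]) - scal L 10 (app (diff L) [(3, app l32 [(0, b), (0, a), (1, c)])]) - scal L 2 (app (diff L) [(3, app l32 [(1, c), (0, a), (0, b)])]) - scal L 8 (app (diff L) [(3, app l21 [(1, app l21 [(0, a), (0, b)]), (1, c)])]) - scal L 4 (app (diff L) [(3, app l21 [(2, app l21 [(0, a), (1, c)]), (0, b)])]) - app (diff L) [(3, app l211 [(0, app l2 [(0, a), (0, b)]), (1, c)])] - app (diff L) [(3, app l211 [(1, app l2 [(1, c), (0, a)]), (0, b)])] + app (diff L) [(3, app l211 [(1, app l2 [(0, b), (1,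 c)]), (0, a)])] - app (diff L) [(3, app l211 [(1, app l2 [(1, c), (0, b)]), (0, a)])] + app (diff L) [(3, app l211 [(0, app l2 [(0, b), (0, a)]), (1, c)])] - scal L 5 (app (diff L) [(3, app l211 [(1, app l2 [(0, a), (1, c)]), (0, b)])])"
  using x by (simp add: app_G3 wops sgn_pow_def)

lemma diff_G3_010:
  assumes x: "a \<in> comp L 0" "b \<in> comp L 1" "c \<in> comp L 0"
  shows "app (diff L) [(3, app G3 [(0, a), (1, b), (0, c)])] =
    scal L 14 (app (diff L) [(3, app l31 [(0, a), (1, b), (0, c)])]) - scal L 2 (app (diff L) [(3, app l31 [(0, a), (0, c), (1, b)])]) + scal L 6 (app (diff L) [(3, app l31 [(1, b), (0, c), (0, a)])]) + scal L 6 (app (diff L) [(3, app l32 [(0, a), (1, b), (0, c)])]) - scal L 10 (app (diff L) [(3, app l32 [(1, b), (0, a), (0, c)])]) - scal L 2 (app (diff L) [(3, app l32 [(0, c), (0, a), (1, b)])]) - scal L 8 (app (diff L) [(3, app l21 [(2, app l21 [(0, a), (1, b)]), (0, c)])]) - scal L 4 (app (diff L) [(3, app l21 [(1, app l21 [(0, a), (0, c)]), (1, b)])]) - app (diff L) [(3, app l211 [(1, app l2 [(0, a), (1, b)]), (0, c)])] - app (diff L) [(3, app l211 [(0, app l2 [(0, c), (0, a)]), (1, b)])] + app (diff L) [(3, app l211 [(1, app l2 [(1, b), (0, c)]), (0, a)])] - app (diff L) [(3, app l211 [(1, app l2 [(0, c), (1, b)]), (0, a)])] + app (diff L) [(3,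 app l211 [(1, app l2 [(1, b), (0, a)]), (0, c)])] - scal L 5 (app (diff L) [(3, app l211 [(0, app l2 [(0, a), (0, c)]), (1, b)])])"
  using x by (simp add: app_G3 wops sgn_pow_def)

lemma diff_G3_100:
  assumes x: "a \<in> comp L 1" "b \<in> comp L 0" "c \<in> comp L 0"
  shows "app (diff L) [(3, app G3 [(1, a), (0, b), (0, c)])] =
    scal L 14 (app (diff L) [(3, app l31 [(1, a), (0, b), (0, c)])]) - scal L 2 (app (diff L) [(3, app l31 [(1, a), (0, c), (0, b)])]) + scal L 6 (app (diff L) [(3, app l31 [(0, b), (0, c), (1, a)])]) + scal L 6 (app (diff L) [(3, app l32 [(1, a), (0, b), (0, c)])]) - scal L 10 (app (diff L) [(3, app l32 [(0, b), (1, a), (0, c)])]) - scal L 2 (app (diff L) [(3, app l32 [(0, c), (1, a), (0, b)])]) - scal L 8 (app (diff L) [(3, app l21 [(2, app l21 [(1, a), (0, b)]), (0, c)])]) - scal L 4 (app (diff L) [(3, app l21 [(2, app l21 [(1, a), (0, c)]), (0, b)])]) - app (diff L) [(3, app l211 [(1, app l2 [(1, a), (0, b)]), (0, c)])] - app (diff L) [(3, app l211 [(1, app l2 [(0, c), (1, a)]), (0, b)])] + app (diff L) [(3, app l211 [(0, app l2 [(0, b), (0, c)]), (1, a)])] - app (diff L) [(3, app l211 [(0, app l2 [(0, c), (0, b)]), (1, a)])] + app (diff L) [(3, app l211 [(1, app l2 [(0, b), (1, a)]), (0, c)])] - scal L 5 (app (diff L) [(3, app l211 [(1, app l2 [(1,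 a), (0, c)]), (0, b)])])"
  using x by (simp add: app_G3 wops sgn_pow_def)

text \<open>The ternary boundary equation has degree 1, so the total degree of the arguments is at
  most 1: either all have degree 0, or exactly one has degree 1. These four patterns are treated one
  by one. The summands added to the claim all come from the relation between \<open>m2\<close> and
  \<open>l2\<close>.\<close>

lemma bdry_G3_000:
  assumes x: "a \<in> comp L 0" "b \<in> comp L 0" "c \<in> comp L 0"
  shows "app (bdry L L G3) [(0, a), (0, b), (0, c)] = scal L 24 (app (l3 - g2 \<circ>\<^bsub>2\<^esub> l2 + g2 \<circ>\<^bsub>1\<^esub> l2 + (g2 \<circ>\<^bsub>2\<^esub> l2)\<^bsup>cyc [1,2]\<^esup> - m2 \<circ>\<^bsub>2\<^esub> g2 + m2 \<circ>\<^bsub>1\<^esub> g2 + (m2 \<circ>\<^bsub>2\<^esub> g2)\<^bsup>cyc [1,2]\<^esup>) [(0, a), (0, b), (0, c)])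
    - (scal L 4 (app (skew_sum l3) [(0, a), (0, b), (0, c)]) - app (skew_sum (l21 \<circ>\<^bsub>1\<^esub> l2 + l21 \<circ>\<^bsub>2\<^esub> l2)) [(0, a), (0, b), (0, c)])"
proof -
  have "app (bdry L L G3) [(0, a), (0, b), (0, c)] = scal L 24 (app (l3 - g2 \<circ>\<^bsub>2\<^esub> l2 + g2 \<circ>\<^bsub>1\<^esub> l2 + (g2 \<circ>\<^bsub>2\<^esub> l2)\<^bsup>cyc [1,2]\<^esup> - m2 \<circ>\<^bsub>2\<^esub> g2 + m2 \<circ>\<^bsub>1\<^esub> g2 + (m2 \<circ>\<^bsub>2\<^esub> g2)\<^bsup>cyc [1,2]\<^esup>) [(0, a), (0, b), (0, c)])
    - (scal L 4 (app (skew_sum l3) [(0, a), (0, b), (0, c)]) - app (skew_sum (l21 \<circ>\<^bsub>1\<^esub> l2 + l21 \<circ>\<^bsub>2\<^esub> l2)) [(0, a), (0, b), (0, c)])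
       - scal L 12 (app defect_m2 [(0, a), (1, app g2 [(0, b), (0, c)])])
       + scal L 12 (app defect_m2 [(0, b), (1, app g2 [(0, a), (0, c)])])
       - scal L 4 (app defect_m2 [(1, app g2 [(0, a), (0, b)]), (0, c)])
       + scal L 16 (app g2 [(0, app defect_m2 [(0, a), (0, b)]), (0, c)])
       - scal L 8 (app defect_m2 [(1, app g2 [(0, a), (0, c)]), (0, b)])
       + scal L 8 (app g2 [(0, app defect_m2 [(0, a), (0, c)]), (0, b)])"
    by (simp add: x app_bdry3[OF C C graded_mapD(1,2)[OF bar_graded(5)]] skew_sum3 diff_G3_000 wexpand algebra_simps)
  then show ?thesis
    using x by (simp add: wops wdefects_zero scal_simps[OF C])
qed

lemma bdry_G3_001:
  assumes x: "a \<in> comp L 0" "b \<in> comp L 0" "c \<in> comp L 1"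
  shows "app (bdry L L G3) [(0, a), (0, b), (1, c)] = scal L 24 (app (l3 - g2 \<circ>\<^bsub>2\<^esub> l2 + g2 \<circ>\<^bsub>1\<^esub> l2 + (g2 \<circ>\<^bsub>2\<^esub> l2)\<^bsup>cyc [1,2]\<^esup> - m2 \<circ>\<^bsub>2\<^esub> g2 + m2 \<circ>\<^bsub>1\<^esub> g2 + (m2 \<circ>\<^bsub>2\<^esub> g2)\<^bsup>cyc [1,2]\<^esup>) [(0, a), (0, b), (1, c)])
    - (scal L 4 (app (skew_sum l3) [(0, a), (0, b), (1, c)]) - app (skew_sum (l21 \<circ>\<^bsub>1\<^esub> l2 + l21 \<circ>\<^bsub>2\<^esub> l2)) [(0, a), (0, b), (1, c)])"
proof -
  \<comment> \<open>Isolates d of \<open>G3\<close>, so that it is split by linearity before any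
    boundary equation is applied.\<close>
  have s: "app (bdry L L G3) [(0, a), (0, b), (1, c)] = app (diff L) [(3, app G3 [(0, a), (0, b), (1, c)])] - app G3 [(0, a), (0, b), (0, app (diff L) [(1, c)])]"
    using x by (simp add: app_bdry3[OF C C graded_mapD(1,2)[OF bar_graded(5)]] wops diff_negative[OF C] sgn_pow_def)
  have "app (bdry L L G3) [(0, a), (0, b), (1, c)] = scal L 24 (app (l3 - g2 \<circ>\<^bsub>2\<^esub> l2 + g2 \<circ>\<^bsub>1\<^esub> l2 + (g2 \<circ>\<^bsub>2\<^esub> l2)\<^bsup>cyc [1,2]\<^esup> - m2 \<circ>\<^bsub>2\<^esub> g2 + m2 \<circ>\<^bsub>1\<^esub> g2 + (m2 \<circ>\<^bsub>2\<^esub> g2)\<^bsup>cyc [1,2]\<^esup>) [(0, a), (0, b), (1, c)])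
    - (scal L 4 (app (skew_sum l3) [(0, a), (0, b), (1, c)]) - app (skew_sum (l21 \<circ>\<^bsub>1\<^esub> l2 + l21 \<circ>\<^bsub>2\<^esub> l2)) [(0, a), (0, b), (1, c)])
       + scal L 12 (app defect_m2 [(0, b), (2, app g2 [(0, a), (1, c)])])
       - scal L 4 (app defect_m2 [(1, app g2 [(0, a), (0, b)]), (1, c)])
       + scal L 16 (app g2 [(0, app defect_m2 [(0, a), (0, b)]), (1, c)])
       - scal L 8 (app defect_m2 [(2, app g2 [(0, a), (1, c)]), (0, b)])
       + scal L 8 (app g2 [(1, app defect_m2 [(0, a), (1, c)]), (0, b)])
       - scal L 12 (app defect_m2 [(0, a), (2, app g2 [(0, b), (1, c)])])"
    unfolding s diff_G3_001[OF x] by (simp add: x skew_sum3 app_G3 wexpand algebra_simps)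
  then show ?thesis
    using x by (simp add: wops wdefects_zero scal_simps[OF C])
qed

lemma bdry_G3_010:
  assumes x: "a \<in> comp L 0" "b \<in> comp L 1" "c \<in> comp L 0"
  shows "app (bdry L L G3) [(0, a), (1, b), (0, c)] = scal L 24 (app (l3 - g2 \<circ>\<^bsub>2\<^esub> l2 + g2 \<circ>\<^bsub>1\<^esub> l2 + (g2 \<circ>\<^bsub>2\<^esub> l2)\<^bsup>cyc [1,2]\<^esup> - m2 \<circ>\<^bsub>2\<^esub> g2 + m2 \<circ>\<^bsub>1\<^esub> g2 + (m2 \<circ>\<^bsub>2\<^esub> g2)\<^bsup>cyc [1,2]\<^esup>) [(0, a), (1, b), (0, c)])
    - (scal L 4 (app (skew_sum l3) [(0, a), (1, b), (0, c)]) - app (skew_sum (l21 \<circ>\<^bsub>1\<^esub> l2 + l21 \<circ>\<^bsub>2\<^esub> l2)) [(0, a), (1, b), (0, c)])"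
proof -
  have s: "app (bdry L L G3) [(0, a), (1, b), (0, c)] = app (diff L) [(3, app G3 [(0, a), (1, b), (0, c)])] - app G3 [(0, a), (0, app (diff L) [(1, b)]), (0, c)]"
    using x by (simp add: app_bdry3[OF C C graded_mapD(1,2)[OF bar_graded(5)]] wops diff_negative[OF C] sgn_pow_def)
  have "app (bdry L L G3) [(0, a), (1, b), (0, c)] = scal L 24 (app (l3 - g2 \<circ>\<^bsub>2\<^esub> l2 + g2 \<circ>\<^bsub>1\<^esub> l2 + (g2 \<circ>\<^bsub>2\<^esub> l2)\<^bsup>cyc [1,2]\<^esup> - m2 \<circ>\<^bsub>2\<^esub> g2 + m2 \<circ>\<^bsub>1\<^esub> g2 + (m2 \<circ>\<^bsub>2\<^esub> g2)\<^bsup>cyc [1,2]\<^esup>) [(0, a), (1, b), (0, c)])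
    - (scal L 4 (app (skew_sum l3) [(0, a), (1, b), (0, c)]) - app (skew_sum (l21 \<circ>\<^bsub>1\<^esub> l2 + l21 \<circ>\<^bsub>2\<^esub> l2)) [(0, a), (1, b), (0, c)])
       - scal L 12 (app defect_m2 [(1, b), (1, app g2 [(0, a), (0, c)])])
       + scal L 8 (app g2 [(0, app defect_m2 [(0, a), (0, c)]), (1, b)])
       - scal L 4 (app defect_m2 [(2, app g2 [(0, a), (1, b)]), (0, c)])
       + scal L 16 (app g2 [(1, app defect_m2 [(0, a), (1, b)]), (0, c)])
       - scal L 8 (app defect_m2 [(1, app g2 [(0, a), (0, c)]), (1, b)])
       - scal L 12 (app defect_m2 [(0, a), (2, app g2 [(1, b), (0, c)])])"
    unfolding s diff_G3_010[OF x] by (simp add: x skew_sum3 app_G3 wexpand algebra_simps)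
  then show ?thesis
    using x by (simp add: wops wdefects_zero scal_simps[OF C])
qed

lemma bdry_G3_100:
  assumes x: "a \<in> comp L 1" "b \<in> comp L 0" "c \<in> comp L 0"
  shows "app (bdry L L G3) [(1, a), (0, b), (0, c)] = scal L 24 (app (l3 - g2 \<circ>\<^bsub>2\<^esub> l2 + g2 \<circ>\<^bsub>1\<^esub> l2 + (g2 \<circ>\<^bsub>2\<^esub> l2)\<^bsup>cyc [1,2]\<^esup> - m2 \<circ>\<^bsub>2\<^esub> g2 + m2 \<circ>\<^bsub>1\<^esub> g2 + (m2 \<circ>\<^bsub>2\<^esub> g2)\<^bsup>cyc [1,2]\<^esup>) [(1, a), (0, b), (0, c)])
    - (scal L 4 (app (skew_sum l3) [(1, a), (0, b), (0, c)]) - app (skew_sum (l21 \<circ>\<^bsub>1\<^esub> l2 + l21 \<circ>\<^bsub>2\<^esub> l2)) [(1, a), (0, b), (0, c)])"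
proof -
  have s: "app (bdry L L G3) [(1, a), (0, b), (0, c)] = app (diff L) [(3, app G3 [(1, a), (0, b), (0, c)])] - app G3 [(0, app (diff L) [(1, a)]), (0, b), (0, c)]"
    using x by (simp add: app_bdry3[OF C C graded_mapD(1,2)[OF bar_graded(5)]] wops diff_negative[OF C] sgn_pow_def)
  have "app (bdry L L G3) [(1, a), (0, b), (0, c)] = scal L 24 (app (l3 - g2 \<circ>\<^bsub>2\<^esub> l2 + g2 \<circ>\<^bsub>1\<^esub> l2 + (g2 \<circ>\<^bsub>2\<^esub> l2)\<^bsup>cyc [1,2]\<^esup> - m2 \<circ>\<^bsub>2\<^esub> g2 + m2 \<circ>\<^bsub>1\<^esub> g2 + (m2 \<circ>\<^bsub>2\<^esub> g2)\<^bsup>cyc [1,2]\<^esup>) [(1, a), (0, b), (0, c)])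
    - (scal L 4 (app (skew_sum l3) [(1, a), (0, b), (0, c)]) - app (skew_sum (l21 \<circ>\<^bsub>1\<^esub> l2 + l21 \<circ>\<^bsub>2\<^esub> l2)) [(1, a), (0, b), (0, c)])
       - scal L 8 (app defect_m2 [(2, app g2 [(1, a), (0, c)]), (0, b)])
       - scal L 4 (app defect_m2 [(2, app g2 [(1, a), (0, b)]), (0, c)])
       + scal L 16 (app g2 [(1, app defect_m2 [(1, a), (0, b)]), (0, c)])
       + scal L 8 (app g2 [(1, app defect_m2 [(1, a), (0, c)]), (0, b)])
       + scal L 12 (app defect_m2 [(1, a), (1, app g2 [(0, b), (0, c)])])
       + scal L 12 (app defect_m2 [(0, b), (2, app g2 [(1, a), (0, c)])])"
    unfolding s diff_G3_100[OF x] by (simp add: x skew_sum3 app_G3 wexpand algebra_simps)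
  then show ?thesis
    using x by (simp add: wops wdefects_zero scal_simps[OF C])
qed

lemma bdry_g3: "map_eq L (bdry L L g3) (l3 - g2 \<circ>\<^bsub>2\<^esub> l2 + g2 \<circ>\<^bsub>1\<^esub> l2 + (g2 \<circ>\<^bsub>2\<^esub> l2)\<^bsup>cyc [1,2]\<^esup> - m3 - m2 \<circ>\<^bsub>2\<^esub> g2 + m2 \<circ>\<^bsub>1\<^esub> g2 + (m2 \<circ>\<^bsub>2\<^esub> g2)\<^bsup>cyc [1,2]\<^esup>)" (is "map_eq L _ ?rhs")
proof (rule map_eqI[OF C C, of 3 1])
  show "graded_map L L 3 1 (bdry L L g3)" by (rule bar_graded wgraded_intros | simp)+
  show "graded_map L L 3 1 ?rhs" by (rule bar_graded wgraded_intros | simp)+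
next
  fix vs :: "(int \<times> 'v) list"
  assume l: "length vs = 3" and h: "homogeneous L vs" "fst ` set vs \<subseteq> {0, 1, 2}" "tdeg vs + 1 \<le> 2"
  then obtain p a q b r c where vs: "vs = [(p, a), (q, b), (r, c)]"
    by (auto simp: length_Suc_conv numeral_eq_Suc)
  have tdeg: "p + q + r \<le> 1" using h(3) vs by simp
  have x: "a \<in> comp L p" "b \<in> comp L q" "c \<in> comp L r" using h(1) vs by auto
  have e: "app (bdry L L G3) vs = scal L 24 (app (l3 - g2 \<circ>\<^bsub>2\<^esub> l2 + g2 \<circ>\<^bsub>1\<^esub> l2 + (g2 \<circ>\<^bsub>2\<^esub> l2)\<^bsup>cyc [1,2]\<^esup> - m2 \<circ>\<^bsub>2\<^esub> g2 + m2 \<circ>\<^bsub>1\<^esub> g2 + (m2 \<circ>\<^bsub>2\<^esub> g2)\<^bsup>cyc [1,2]\<^esup>) vs) - (scal L 4 (app (skew_sum l3) vs) - app (skew_sum (l21 \<circ>\<^bsub>1\<^esub> l2 + l21 \<circ>\<^bsub>2\<^esub> l2)) vs)"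
    using degree_cases3_1[OF h(2)[unfolded vs] tdeg] x unfolding vs
    by (elim disjE conjE; hypsubst; intro bdry_G3_000 bdry_G3_001 bdry_G3_010 bdry_G3_100)
  have "scal L 24 (app (bdry L L g3) vs) = app (bdry L L G3) vs"
    unfolding g3_def using bdry_smult[OF bar_graded(5) l h(1)] by (simp add: unit_inv_scal)
  also have "\<dots> = scal L 24 (app ?rhs vs)"
    unfolding e by (simp add: m3_scal scal_simps(1-3)[OF C] algebra_simps del: app_circ)
  finally show "app (bdry L L g3) vs = app ?rhs vs"
    by (rule scal_cancel[OF C units(2)])
qed

lemma twelve: "(12::'k) dvd 1"
  using mult_dvd_mono[OF two units(1)] by simp

text \<open>Antisymmetrization leaves one unknown for each kind of term, and the relations
  \<open>r1\<close>, \<open>r2\<close>, \<open>r3\<close> force the resulting sum to vanish. The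
  factor is 12 because 12 times \<open>g3 + g3\<close> equals \<open>G3\<close>.\<close>

lemma g3_alt:
  assumes x: "a \<in> comp L 0" "b \<in> comp L 0" "c \<in> comp L 0"
  shows "alt3 (\<lambda>a b c. app (g3 + g3 + g2 \<circ>\<^bsub>1\<^esub> g2 + g2 \<circ>\<^bsub>1\<^esub> g2 + g2 \<circ>\<^bsub>1\<^esub> g2 + g2 \<circ>\<^bsub>1\<^esub> g2 + g2 \<circ>\<^bsub>1\<^esub> g2 + g2 \<circ>\<^bsub>1\<^esub> g2
        - h \<circ>\<^bsub>1\<^esub> l2 - h \<circ>\<^bsub>1\<^esub> l2 - h \<circ>\<^bsub>1\<^esub> l2 - l2 \<circ>\<^bsub>1\<^esub> h - l2 \<circ>\<^bsub>1\<^esub> h - l2 \<circ>\<^bsub>1\<^esub> h)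
        [(0, a), (0, b), (0, c)]) a b c = 0"
proof -
  define s1 where "s1 a b c = app l32 [(0, a), (0, b), (0, c)]" for a b c
  define s2 where "s2 a b c = app l31 [(0, a), (0, b), (0, c)]" for a b c
  define s3 where "s3 a b c = app g2 [(0, a), (1, app g2 [(0, b), (0, c)])]" for a b c
  define s4 where "s4 a b c = app h [(0, a), (0, app l2 [(0, b), (0, c)])]" for a b c
  define s5 where "s5 a b c = app g2 [(1, app g2 [(0, a), (0, b)]), (0, c)]" for a b c
  define s6 where "s6 a b c = app l2 [(2, app h [(0, a), (0, b)]), (0, c)]" for a b c
  define s7 where "s7 a b c = app h [(0, app l2 [(0, a), (0, b)]), (0, c)]" for a b c
  note s_def = s1_def s2_def s3_def s4_def s5_def s6_def s7_def
  define A1 where "A1 = alt3 s1 a b c"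
  define A2 where "A2 = alt3 s2 a b c"
  define A3 where "A3 = alt3 s3 a b c"
  define A4 where "A4 = alt3 s4 a b c"
  define A5 where "A5 = alt3 s5 a b c"
  define A6 where "A6 = alt3 s6 a b c"
  define A7 where "A7 = alt3 s7 a b c"
  note A_def = A1_def A2_def A3_def A4_def A5_def A6_def A7_def
  \<comment> \<open>The two \<open>s3\<close> terms differ by a transposition and cancel under
    antisymmetrization, so \<open>r1\<close> contains no \<open>A3\<close>.\<close>
  have p1: "s2 a b c - s1 b a c + s2 b c a - s1 a b c + s2 a c b - s1 c a b - scal L 4 (s3 a b c) - scal L 4 (s5 a b c) - scal L 4 (s3 b a c) - scal L 2 (s4 b c a) = 0" (is "?e = 0")
    if x: "a \<in> comp L 0" "b \<in> comp L 0" "c \<in> comp L 0" for a b c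
  proof -
    have "?e = app defect_3132 [(0, a), (0, b), (0, c)]"
      by (simp add: s_def x wexpand algebra_simps)
    then show ?thesis using x by (simp add: wops diff_above[OF C] wdefects_zero)
  qed
  have r1: "A2 - A1 - scal L 4 (A5) - scal L 2 (A4) = 0" (is "?e = 0")
  proof -
    have "?e = alt3 (\<lambda>a b c. s2 a b c - s1 b a c + s2 b c a - s1 a b c + s2 a c b - s1 c a b - scal L 4 (s3 a b c) - scal L 4 (s5 a b c) - scal L 4 (s3 b a c) - scal L 2 (s4 b c a)) a b c"
      by (simp add: A_def alt3_def scal_simps[OF C] scal_double[OF C] algebra_simps)
    also have "\<dots> = 0" by (rule alt3_zero[OF p1 x])
    finally show ?thesis .
  qed
  have p2: "s2 a b c - s2 b a c - scal L 2 (s6 a b c) = 0" (is "?e = 0")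
    if x: "a \<in> comp L 0" "b \<in> comp L 0" "c \<in> comp L 0" for a b c
  proof -
    have "?e = app defect_31 [(0, a), (0, b), (0, c)]"
      by (simp add: s_def x wexpand algebra_simps)
    then show ?thesis using x by (simp add: wops diff_above[OF C] wdefects_zero)
  qed
  have r2: "scal L 2 (A2) - scal L 2 (A6) = 0" (is "?e = 0")
  proof -
    have "?e = alt3 (\<lambda>a b c. s2 a b c - s2 b a c - scal L 2 (s6 a b c)) a b c"
      by (simp add: A_def alt3_def scal_simps[OF C] scal_double[OF C] algebra_simps)
    also have "\<dots> = 0" by (rule alt3_zero[OF p2 x])
    finally show ?thesis .
  qed
  have p3: "s4 a b c + s7 b c a = 0" (is "?e = 0")
    if x: "a \<in> comp L 0" "b \<in> comp L 0" "c \<in> comp L 0" for a b c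
  proof -
    have "?e = app defect_h [(0, a), (0, app l2 [(0, b), (0, c)])]"
      by (simp add: s_def x wexpand algebra_simps)
    then show ?thesis using x by (simp add: wops diff_above[OF C] wdefects_zero)
  qed
  have r3: "A4 + A7 = 0" (is "?e = 0")
  proof -
    have "?e = alt3 (\<lambda>a b c. s4 a b c + s7 b c a) a b c"
      by (simp add: A_def alt3_def scal_simps[OF C] scal_double[OF C] algebra_simps)
    also have "\<dots> = 0" by (rule alt3_zero[OF p3 x])
    finally show ?thesis .
  qed
  \<comment> \<open>The multipliers -14, 18 and -28 are read off from the coefficients of
    \<open>A1\<close>, \<open>A6\<close> and \<open>A7\<close>; the remaining coefficients then
    agree.\<close>
  have "scal L 22 (A2) + scal L 14 (A1) + scal L 56 (A5) - scal L 28 (A7) - scal L 36 (A6) = 0 - scal L 14 (A2 - A1 - scal L 4 (A5) - scal L 2 (A4)) + scal L 18 (scal L 2 (A2) - scal L 2 (A6)) - scal L 28 (A4 + A7)"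
    by (simp add: scal_simps[OF C] scal_double[OF C] algebra_simps)
  also have "\<dots> = 0"
    unfolding r1 r2 r3 by (simp add: scal_simps[OF C])
  finally have t: "scal L 22 (A2) + scal L 14 (A1) + scal L 56 (A5) - scal L 28 (A7) - scal L 36 (A6) = 0" .
  have e: "scal L 12 (app (g3 + g3 + g2 \<circ>\<^bsub>1\<^esub> g2 + g2 \<circ>\<^bsub>1\<^esub> g2 + g2 \<circ>\<^bsub>1\<^esub> g2 + g2 \<circ>\<^bsub>1\<^esub> g2 + g2 \<circ>\<^bsub>1\<^esub> g2 + g2 \<circ>\<^bsub>1\<^esub> g2
        - h \<circ>\<^bsub>1\<^esub> l2 - h \<circ>\<^bsub>1\<^esub> l2 - h \<circ>\<^bsub>1\<^esub> l2 - l2 \<circ>\<^bsub>1\<^esub> h - l2 \<circ>\<^bsub>1\<^esub> h - l2 \<circ>\<^bsub>1\<^esub> h) [(0, a), (0, b), (0, c)]) = scal L 14 (s2 a b c) - scal L 2 (s2 a c b) + scal L 6 (s2 b c a) + scal L 6 (s1 a b c) - scal L 10 (s1 b a c) - scal L 2 (s1 c a b) + scal L 40 (s5 a b c) - scal L 16 (s5 a c b) - scal L 38 (s7 a b c) - scal L 2 (s7 c a b) + scal L 2 (s7 b c a) - scal L 2 (s7 c b a) + scal L 2 (s7 b a c) - scal L 10 (s7 a c b) - scal L 36 (s6 a b c)"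
    if x: "a \<in> comp L 0" "b \<in> comp L 0" "c \<in> comp L 0" for a b c
  proof -
    have "scal L 12 (app g3 [(0, a), (0, b), (0, c)] + app g3 [(0, a), (0, b), (0, c)]) = app G3 [(0, a), (0, b), (0, c)]"
      unfolding g3_scal[symmetric] by (simp add: scal_simps(1)[OF C] scal_simps(9)[OF C, symmetric])
    moreover have "app (g3 + g3 + g2 \<circ>\<^bsub>1\<^esub> g2 + g2 \<circ>\<^bsub>1\<^esub> g2 + g2 \<circ>\<^bsub>1\<^esub> g2 + g2 \<circ>\<^bsub>1\<^esub> g2 + g2 \<circ>\<^bsub>1\<^esub> g2 + g2 \<circ>\<^bsub>1\<^esub> g2
        - h \<circ>\<^bsub>1\<^esub> l2 - h \<circ>\<^bsub>1\<^esub> l2 - h \<circ>\<^bsub>1\<^esub> l2 - l2 \<circ>\<^bsub>1\<^esub> h - l2 \<circ>\<^bsub>1\<^esub> h - l2 \<circ>\<^bsub>1\<^esub> h) [(0, a), (0, b), (0, c)] = (app g3 [(0, a), (0, b), (0, c)] + app g3 [(0, a), (0, b), (0, c)]) + app (g2 \<circ>\<^bsub>1\<^esub> g2 + g2 \<circ>\<^bsub>1\<^esub> g2 + g2 \<circ>\<^bsub>1\<^esub> g2 + g2 \<circ>\<^bsub>1\<^esub> g2 + g2 \<circ>\<^bsub>1\<^esub> g2 + g2 \<circ>\<^bsub>1\<^esub> g2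
        - h \<circ>\<^bsub>1\<^esub> l2 - h \<circ>\<^bsub>1\<^esub> l2 - h \<circ>\<^bsub>1\<^esub> l2 - l2 \<circ>\<^bsub>1\<^esub> h - l2 \<circ>\<^bsub>1\<^esub> h - l2 \<circ>\<^bsub>1\<^esub> h) [(0, a), (0, b), (0, c)]"
      by (simp add: algebra_simps)
    ultimately have "scal L 12 (app (g3 + g3 + g2 \<circ>\<^bsub>1\<^esub> g2 + g2 \<circ>\<^bsub>1\<^esub> g2 + g2 \<circ>\<^bsub>1\<^esub> g2 + g2 \<circ>\<^bsub>1\<^esub> g2 + g2 \<circ>\<^bsub>1\<^esub> g2 + g2 \<circ>\<^bsub>1\<^esub> g2
        - h \<circ>\<^bsub>1\<^esub> l2 - h \<circ>\<^bsub>1\<^esub> l2 - h \<circ>\<^bsub>1\<^esub> l2 - l2 \<circ>\<^bsub>1\<^esub> h - l2 \<circ>\<^bsub>1\<^esub> h - l2 \<circ>\<^bsub>1\<^esub> h) [(0, a), (0, b), (0, c)]) = app G3 [(0, a), (0, b), (0, c)] + scal L 12 (app (g2 \<circ>\<^bsub>1\<^esub> g2 + g2 \<circ>\<^bsub>1\<^esub> g2 + g2 \<circ>\<^bsub>1\<^esub> g2 + g2 \<circ>\<^bsub>1\<^esub> g2 + g2 \<circ>\<^bsub>1\<^esub> g2 + g2 \<circ>\<^bsub>1\<^esub> g2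
        - h \<circ>\<^bsub>1\<^esub> l2 - h \<circ>\<^bsub>1\<^esub> l2 - h \<circ>\<^bsub>1\<^esub> l2 - l2 \<circ>\<^bsub>1\<^esub> h - l2 \<circ>\<^bsub>1\<^esub> h - l2 \<circ>\<^bsub>1\<^esub> h) [(0, a), (0, b), (0, c)])"
      by (simp only: scal_simps(1)[OF C])
    then show ?thesis by (simp add: s_def x app_G3 wexpand algebra_simps)
  qed
  have "scal L 12 (alt3 (\<lambda>a b c. app (g3 + g3 + g2 \<circ>\<^bsub>1\<^esub> g2 + g2 \<circ>\<^bsub>1\<^esub> g2 + g2 \<circ>\<^bsub>1\<^esub> g2 + g2 \<circ>\<^bsub>1\<^esub> g2 + g2 \<circ>\<^bsub>1\<^esub> g2 + g2 \<circ>\<^bsub>1\<^esub> g2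
        - h \<circ>\<^bsub>1\<^esub> l2 - h \<circ>\<^bsub>1\<^esub> l2 - h \<circ>\<^bsub>1\<^esub> l2 - l2 \<circ>\<^bsub>1\<^esub> h - l2 \<circ>\<^bsub>1\<^esub> h - l2 \<circ>\<^bsub>1\<^esub> h) [(0, a), (0, b), (0, c)]) a b c) =
      alt3 (\<lambda>a b c. scal L 12 (app (g3 + g3 + g2 \<circ>\<^bsub>1\<^esub> g2 + g2 \<circ>\<^bsub>1\<^esub> g2 + g2 \<circ>\<^bsub>1\<^esub> g2 + g2 \<circ>\<^bsub>1\<^esub> g2 + g2 \<circ>\<^bsub>1\<^esub> g2 + g2 \<circ>\<^bsub>1\<^esub> g2
        - h \<circ>\<^bsub>1\<^esub> l2 - h \<circ>\<^bsub>1\<^esub> l2 - h \<circ>\<^bsub>1\<^esub> l2 - l2 \<circ>\<^bsub>1\<^esub> h - l2 \<circ>\<^bsub>1\<^esub> h - l2 \<circ>\<^bsub>1\<^esub> h) [(0, a), (0, b), (0, c)])) a b c"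
    by (simp only: alt3_def scal_simps[OF C])
  also have "\<dots> = alt3 (\<lambda>a b c. scal L 14 (s2 a b c) - scal L 2 (s2 a c b) + scal L 6 (s2 b c a) + scal L 6 (s1 a b c) - scal L 10 (s1 b a c) - scal L 2 (s1 c a b) + scal L 40 (s5 a b c) - scal L 16 (s5 a c b) - scal L 38 (s7 a b c) - scal L 2 (s7 c a b) + scal L 2 (s7 b c a) - scal L 2 (s7 c b a) + scal L 2 (s7 b a c) - scal L 10 (s7 a c b) - scal L 36 (s6 a b c)) a b c"
    using x by (simp only: alt3_def e)
  also have "\<dots> = scal L 22 (A2) + scal L 14 (A1) + scal L 56 (A5) - scal L 28 (A7) - scal L 36 (A6)"
    by (simp only: A_def alt3_add alt3_diff alt3_0 alt3_scal[OF C] alt3_perm(1)[of s2] alt3_perm(1)[of s5] alt3_perm(1)[of s7] alt3_perm(2)[of s1] alt3_perm(2)[of s2] alt3_perm(2)[of s3] alt3_perm(2)[of s7] alt3_perm(3)[of s2] alt3_perm(3)[of s4] alt3_perm(3)[of s7] alt3_perm(4)[of s1] alt3_perm(4)[of s7] alt3_perm(5)[of s7]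
        scal_simps(3)[OF C]) (simp add: scal_simps(1-6)[OF C] scal_double[OF C] algebra_simps)
  finally show ?thesis
    using scal_cancel[OF C twelve, of _ 0] t by (simp add: scal_simps[OF C])
qed

end

text \<open>Reindexing of the sum over the symmetric group by a translation. By \<open>comm\<close>
  at most one entry has nonzero degree, hence all Koszul signs are trivial and permutations simply
  compose.\<close>

lemma app_skew_sum_permuted:
  fixes \<mu> :: "('v, 'w::ab_group_add) gmap" and vs :: "(int \<times> 'v) list"
  assumes n: "arity \<mu> = n" "length vs = n" and \<sigma>: "\<sigma> permutes {1..n}"
    and comm: "\<And>i j. i < n \<Longrightarrow> j < n \<Longrightarrow> i \<noteq> j \<Longrightarrow> fst (vs ! i) * fst (vs ! j) = 0"
  shows "app ((skew_sum \<mu>)\<^bsup>\<sigma>\<^esup>) vs = (if evenperm \<sigma> then app (skew_sum \<mu>) vs else - app (skew_sum \<mu>) vs)"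
proof -
  define act where "act \<tau> = map (\<lambda>i. vs ! (inv \<tau> i - 1)) [1..<Suc n]" for \<tau>
  have act_nth: "act \<tau> ! i = vs ! (inv \<tau> (Suc i) - 1)" if "i < n" for \<tau> i
    using that by (simp add: act_def del: upt_Suc)
  have inv_range: "inv \<tau> i \<in> {1..n}" if "\<tau> permutes {1..n}" "i \<in> {1..n}" for \<tau> i
    using permutes_in_image[OF permutes_inv[OF that(1)], of i] that(2) by simp
  have koszul: "koszul_exponent \<tau> ws = 0"
    if l: "length ws = n" and z: "\<And>i j. i < n \<Longrightarrow> j < n \<Longrightarrow> i \<noteq> j \<Longrightarrow> fst (ws ! i) * fst (ws ! j) = 0"
    for \<tau> and ws :: "(int \<times> 'v) list"
  proof -
    have "fst (ws ! (i - 1)) * fst (ws ! (j - 1)) = 0" if "1 \<le> i" "i < j" "j \<le> length ws" for i j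
      by (rule z) (use that l in auto)
    then show ?thesis
      unfolding koszul_exponent_def by (intro sum.neutral) (simp add: case_prod_beta del: mult_eq_0_iff One_nat_def)
  qed
  have koszul_vs: "koszul_exponent \<tau> vs = 0" for \<tau>
    by (rule koszul[OF n(2)]) (rule comm)
  have commuting: "fst (act \<tau> ! i) * fst (act \<tau> ! j) = 0"
    if \<tau>: "\<tau> permutes {1..n}" and ij: "i < n" "j < n" "i \<noteq> j" for \<tau> i j
  proof -
    have r: "inv \<tau> (Suc i) \<in> {1..n}" "inv \<tau> (Suc j) \<in> {1..n}"
      using inv_range[OF \<tau>, of "Suc i"] inv_range[OF \<tau>, of "Suc j"] ij by simp_all
    have "inv \<tau> (Suc i) \<noteq> inv \<tau> (Suc j)"
      using ij(3) permutes_inv[OF \<tau>, THEN permutes_inj] by (simp add: inj_eq)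
    then have "inv \<tau> (Suc i) - 1 \<noteq> inv \<tau> (Suc j) - 1" "inv \<tau> (Suc i) - 1 < n" "inv \<tau> (Suc j) - 1 < n"
      using r by auto
    then show ?thesis unfolding act_nth[OF ij(1)] act_nth[OF ij(2)] by (intro comm)
  qed
  have act_act: "map (\<lambda>i. act \<sigma> ! (inv \<tau> i - 1)) [1..<Suc n] = act (\<tau> \<circ> \<sigma>)" if \<tau>: "\<tau> permutes {1..n}" for \<tau>
  proof -
    have "inv (\<tau> \<circ> \<sigma>) = inv \<sigma> \<circ> inv \<tau>"
      by (rule o_inv_distrib[OF permutes_bij[OF \<tau>] permutes_bij[OF \<sigma>]])
    moreover have "act \<sigma> ! (inv \<tau> i - 1) = vs ! (inv \<sigma> (inv \<tau> i) - 1)" if "i \<in> {1..n}" for i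
    proof -
      have "1 \<le> inv \<tau> i" "inv \<tau> i \<le> n" using inv_range[OF \<tau> that] by auto
      then show ?thesis using act_nth[of "inv \<tau> i - 1" \<sigma>] by simp
    qed
    ultimately show ?thesis unfolding act_def[of "\<tau> \<circ> \<sigma>"] by (intro map_cong) (auto simp: o_def)
  qed
  define S where "S \<tau> = (if evenperm \<tau> then app \<mu> (act \<tau>) else - app \<mu> (act \<tau>))" for \<tau>
  have "app ((skew_sum \<mu>)\<^bsup>\<sigma>\<^esup>) vs = app (skew_sum \<mu>) (act \<sigma>)"
    unfolding app_perm koszul_vs by (simp add: n act_def)
  also have "\<dots> = (\<Sum>\<tau> | \<tau> permutes {1..n}. if evenperm \<tau> then app \<mu> (act (\<tau> \<circ> \<sigma>)) else - app \<mu> (act (\<tau> \<circ> \<sigma>)))"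
  proof -
    have "app (\<mu>\<^bsup>\<tau>\<^esup>) (act \<sigma>) = app \<mu> (act (\<tau> \<circ> \<sigma>))" if "\<tau> permutes {1..n}" for \<tau>
    proof -
      have l: "length (act \<sigma>) = n" by (simp add: act_def)
      have "koszul_exponent \<tau> (act \<sigma>) = 0" by (rule koszul[OF l]) (rule commuting[OF \<sigma>])
      then show ?thesis unfolding app_perm l using act_act[OF that] by simp
    qed
    then show ?thesis unfolding skew_sum_def n gmap.sel by (intro sum.cong) simp_all
  qed
  \<comment> \<open>The parity of \<tau> is recovered from those of
    \<open>\<tau> \<circ> \<sigma>\<close> and \<sigma>; this prepares the right translation by
    \<sigma>.\<close>
  also have "\<dots> = (\<Sum>\<tau> | \<tau> permutes {1..n}. if evenperm \<sigma> then S (\<tau> \<circ> \<sigma>) else - S (\<tau> \<circ> \<sigma>))"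
  proof (rule sum.cong[OF refl])
    fix \<tau> assume "\<tau> \<in> {\<tau>. \<tau> permutes {1..n}}"
    then have "evenperm (\<tau> \<circ> \<sigma>) = (evenperm \<tau> = evenperm \<sigma>)"
      using \<sigma> by (intro evenperm_comp) (auto simp: permutation_permutes)
    then show "(if evenperm \<tau> then app \<mu> (act (\<tau> \<circ> \<sigma>)) else - app \<mu> (act (\<tau> \<circ> \<sigma>))) =
        (if evenperm \<sigma> then S (\<tau> \<circ> \<sigma>) else - S (\<tau> \<circ> \<sigma>))"
      by (simp add: S_def)
  qed
  also have "\<dots> = (\<Sum>\<tau> | \<tau> permutes {1..n}. if evenperm \<sigma> then S \<tau> else - S \<tau>)"
    by (rule sum_permutations_compose_right[OF \<sigma>, symmetric])
  also have "\<dots> = (if evenperm \<sigma> then app (skew_sum \<mu>) vs else - app (skew_sum \<mu>) vs)"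
  proof -
    have "app (\<mu>\<^bsup>\<tau>\<^esup>) vs = app \<mu> (act \<tau>)" for \<tau>
      unfolding app_perm koszul_vs by (simp add: n act_def)
    then have "app (skew_sum \<mu>) vs = (\<Sum>\<tau> | \<tau> permutes {1..n}. S \<tau>)"
      unfolding skew_sum_def n gmap.sel by (intro sum.cong) (simp_all add: S_def)
    then show ?thesis by (simp add: sum_negf)
  qed
  finally show ?thesis .
qed

text \<open>A map of degree at least 1 is determined in total degree at most 1. There at most one
  argument has positive degree, so the case without Koszul signs suffices.\<close>

lemma skew_symmetric_skew_sum:
  fixes L :: "('k::comm_ring_1, 'v::ab_group_add, 'a) cplx_scheme"
    and L' :: "('k, 'w::ab_group_add, 'b) cplx_scheme" and \<mu> :: "('v, 'w) gmap"
  assumes L: "three_term_complex L" and L': "three_term_complex L'" and \<mu>: "graded_map L L' n k \<mu>" and "1 \<le> k"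
  shows "skew_symmetric L (skew_sum \<mu>)"
  unfolding skew_symmetric_def
proof (intro allI impI)
  fix \<sigma> assume \<sigma>: "\<sigma> permutes {1..arity (skew_sum \<mu>)}"
  note g = graded_map_skew_sum[OF L L' \<mu>]
  have \<sigma>n: "\<sigma> permutes {1..n}" using \<sigma> graded_mapD(1)[OF g] by simp
  show "map_eq L ((skew_sum \<mu>)\<^bsup>\<sigma>\<^esup>) (if evenperm \<sigma> then skew_sum \<mu> else - skew_sum \<mu>)" (is "map_eq L ?lhs ?rhs")
  proof (rule map_eqI[OF L L', of n k])
    show "graded_map L L' n k ?lhs" by (rule graded_map_perm[OF L L' g \<sigma>n])
    show "graded_map L L' n k ?rhs"
      using g graded_map_uminus[OF L' g] by simp
  next
    fix vs :: "(int \<times> 'v) list"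
    assume l: "length vs = n" and d: "fst ` set vs \<subseteq> {0, 1, 2}" "tdeg vs + k \<le> 2"
    \<comment> \<open>All degrees are nonnegative, so the two entries together contribute at most 1
      and one of them has degree 0.\<close>
    have "fst (vs ! i) * fst (vs ! j) = 0" if ij: "i < n" "j < n" "i < j" for i j
    proof -
      have m: "fst (vs ! i') \<in> {0, 1, 2}" if "i' < n" for i'
        using d(1) that nth_mem[of i' vs] unfolding l by blast
      have "vs = take i vs @ vs ! i # drop (Suc i) vs" using ij l by (simp add: id_take_nth_drop[symmetric])
      moreover have "drop (Suc i) vs = take (j - Suc i) (drop (Suc i) vs) @ vs ! j # drop (Suc j) vs"
        using id_take_nth_drop[of "j - Suc i" "drop (Suc i) vs"] ij l by simp
      ultimately have "tdeg vs = tdeg (take i vs) + fst (vs ! i) + tdeg (take (j - Suc i) (drop (Suc i) vs))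
          + fst (vs ! j) + tdeg (drop (Suc j) vs)"
        by (metis add.assoc tdeg_simps(2,3))
      moreover have "0 \<le> tdeg us" if "set us \<subseteq> set vs" for us
      proof -
        have "0 \<le> fst x" if "x \<in> set vs" for x using d(1) that by fastforce
        then show ?thesis unfolding tdeg_def using that by (intro sum_list_nonneg) auto
      qed
      ultimately have "fst (vs ! i) + fst (vs ! j) \<le> 1"
        using d(2) \<open>1 \<le> k\<close> set_take_subset[of i vs] set_drop_subset[of "Suc j" vs]
          set_take_subset[of "j - Suc i" "drop (Suc i) vs"] set_drop_subset[of "Suc i" vs]
        by (smt (verit) order_trans)
      then show ?thesis using m[OF ij(1)] m[OF ij(2)] by auto
    qed
    then have "fst (vs ! i) * fst (vs ! j) = 0" if "i < n" "j < n" "i \<noteq> j" for i j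
      using that by (metis linorder_neqE_nat mult.commute)
    from app_skew_sum_permuted[OF graded_mapD(1)[OF \<mu>] l \<sigma>n this]
    show "app ?lhs vs = app ?rhs vs"
      by simp
  qed
qed

lemma skew_symmetricD:
  assumes "skew_symmetric L \<mu>" "\<sigma> permutes {1..arity \<mu>}" "length vs = arity \<mu>" "homogeneous L vs"
  shows "app (\<mu>\<^bsup>\<sigma>\<^esup>) vs = (if evenperm \<sigma> then app \<mu> vs else - app \<mu> vs)"
proof -
  have "map_eq L (\<mu>\<^bsup>\<sigma>\<^esup>) (if evenperm \<sigma> then \<mu> else - \<mu>)"
    using assms(1,2) unfolding skew_symmetric_def by blast
  from map_eqD[OF this _ assms(4)] show ?thesis using assms(3) by simp
qed

lemma skew_symmetricI:
  assumes "\<And>\<sigma> vs. \<sigma> permutes {1..arity \<mu>} \<Longrightarrow> length vs = arity \<mu> \<Longrightarrow> homogeneous L vs \<Longrightarrow>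
    app (\<mu>\<^bsup>\<sigma>\<^esup>) vs = (if evenperm \<sigma> then app \<mu> vs else - app \<mu> vs)"
  shows "skew_symmetric L \<mu>"
  unfolding skew_symmetric_def map_eq_def by (simp add: assms)

lemma skew_symmetric_smult:
  fixes L :: "('k::comm_ring_1, 'v::ab_group_add, 'a) cplx_scheme"
    and L' :: "('k, 'w::ab_group_add, 'b) cplx_scheme" and \<mu> :: "('v, 'w) gmap"
  assumes L': "three_term_complex L'" and \<mu>: "skew_symmetric L \<mu>"
  shows "skew_symmetric L (smult_map L' c \<mu>)"
proof (rule skew_symmetricI)
  fix \<sigma> vs assume a: "\<sigma> permutes {1..arity (smult_map L' c \<mu>)}" "length vs = arity (smult_map L' c \<mu>)" "homogeneous L vs"
  have "app ((smult_map L' c \<mu>)\<^bsup>\<sigma>\<^esup>) vs = scal L' c (app (\<mu>\<^bsup>\<sigma>\<^esup>) vs)"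
    by (simp add: app_perm sgn_pow_def scal_simps[OF L'])
  also have "app (\<mu>\<^bsup>\<sigma>\<^esup>) vs = (if evenperm \<sigma> then app \<mu> vs else - app \<mu> vs)"
    using a by (intro skew_symmetricD[OF \<mu>]) simp_all
  finally show "app ((smult_map L' c \<mu>)\<^bsup>\<sigma>\<^esup>) vs = (if evenperm \<sigma> then app (smult_map L' c \<mu>) vs else - app (smult_map L' c \<mu>) vs)"
    by (simp add: scal_simps[OF L'])
qed

lemma skew_symmetric_add:
  fixes \<mu> \<nu> :: "('v, 'w::ab_group_add) gmap"
  assumes \<mu>: "skew_symmetric L \<mu>" and \<nu>: "skew_symmetric L \<nu>" and a: "arity \<nu> = arity \<mu>"
  shows "skew_symmetric L (\<mu> + \<nu>)" "skew_symmetric L (\<mu> - \<nu>)"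
proof -
  note e = skew_symmetricD[OF \<mu>] skew_symmetricD[OF \<nu>, unfolded a]
  have p: "app ((\<mu> + \<nu>)\<^bsup>\<sigma>\<^esup>) vs = app (\<mu>\<^bsup>\<sigma>\<^esup>) vs + app (\<nu>\<^bsup>\<sigma>\<^esup>) vs"
    "app ((\<mu> - \<nu>)\<^bsup>\<sigma>\<^esup>) vs = app (\<mu>\<^bsup>\<sigma>\<^esup>) vs - app (\<nu>\<^bsup>\<sigma>\<^esup>) vs" for \<sigma> vs
    by (simp_all add: app_perm sgn_pow_def)
  show "skew_symmetric L (\<mu> + \<nu>)" "skew_symmetric L (\<mu> - \<nu>)"
    by (auto intro!: skew_symmetricI simp: p e)
qed

lemma skew_symmetric_transposition:
  assumes "skew_symmetric L \<mu>" "cyc [i, j] permutes {1..arity \<mu>}" "i \<noteq> j"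
  shows "map_eq L (\<mu> + \<mu>\<^bsup>cyc [i,j]\<^esup>) (zero_map (arity \<mu>) (gdeg \<mu>))"
proof -
  have "cyc [i, j] = transpose i j" by (simp add: cycle_of_list.simps)
  then have "\<not> evenperm (cyc [i, j])" using evenperm_swap[of i j] assms(3) by simp
  then show ?thesis
    using skew_symmetricD[OF assms(1,2)] by (simp add: map_eq_def)
qed

lemma skew_symmetric1: "arity \<mu> = 1 \<Longrightarrow> skew_symmetric L \<mu>"
proof -
  assume a: "arity \<mu> = 1"
  have "app (\<mu>\<^bsup>id\<^esup>) [x] = app \<mu> [x]" for x
    by (simp add: app_perm koszul_exponent_list)
  then show ?thesis
    using a by (intro skew_symmetricI) (auto simp: length_Suc_conv permutes_sing)
qed

text \<open>Meant for the binary bracket: it has degree 0, so two arguments of odd degree may occur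
  together and the general argument above does not reach it. The transposition is the only
  permutation besides id.\<close>

lemma skew_symmetric2:
  assumes a: "arity \<mu> = 2" and e: "map_eq L (\<mu> + \<mu>\<^bsup>cyc [1,2]\<^esup>) (zero_map 2 (gdeg \<mu>))"
  shows "skew_symmetric L \<mu>"
proof (rule skew_symmetricI)
  fix \<sigma> vs assume \<sigma>: "\<sigma> permutes {1..arity \<mu>}" and l: "length vs = arity \<mu>" and h: "homogeneous L vs"
  have "{1..arity \<mu>} = {1, 2}" using a by auto
  then consider "\<sigma> = id" | "\<sigma> = cyc [1, 2]"
    using \<sigma> by (auto simp: permutes_doubleton_iff cycle_of_list.simps)
  then show "app (\<mu>\<^bsup>\<sigma>\<^esup>) vs = (if evenperm \<sigma> then app \<mu> vs else - app \<mu> vs)"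
  proof cases
    case 1
    obtain x y where vs: "vs = [x, y]" using l a by (auto simp: length_Suc_conv numeral_2_eq_2)
    have "app (\<mu>\<^bsup>id\<^esup>) [x, y] = app \<mu> [x, y]"
      by (simp add: app_perm koszul_exponent_list permuted_list upt_rec)
    then show ?thesis using 1 vs by simp
  next
    case 2
    have "\<not> evenperm (cyc [1, 2::nat])" by (simp add: cycle_of_list.simps evenperm_swap)
    then show ?thesis
      using 2 map_eqD[OF e _ h] l a by (simp add: eq_neg_iff_add_eq_0 add.commute)
  qed
qed

lemma alt3_alternating:
  assumes "\<And>a b c. a \<in> C \<Longrightarrow> b \<in> C \<Longrightarrow> c \<in> C \<Longrightarrow> F a b c + F b a c = 0"
    and "\<And>a b c. a \<in> C \<Longrightarrow> b \<in> C \<Longrightarrow> c \<in> C \<Longrightarrow> F a b c + F a c b = 0"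
    and x: "a \<in> C" "b \<in> C" "c \<in> C"
  shows "alt3 F a b c = F a b c + F a b c + F a b c + F a b c + F a b c + F a b c"
proof -
  have s: "F b a c = - F a b c" "F a c b = - F a b c" "F b c a = - F b a c" "F c a b = - F a c b" "F c b a = - F b c a"
    using assms by (metis add.commute eq_neg_iff_add_eq_0)+
  then show ?thesis by (simp add: alt3_def)
qed

text \<open>Successive adjacent exchanges bring every summand back to the same value with the sign
  that antisymmetrization attaches to it, so all 24 summands coincide.\<close>

lemma alt4_alternating:
  assumes s12: "\<And>a b c d. a \<in> C \<Longrightarrow> b \<in> C \<Longrightarrow> c \<in> C \<Longrightarrow> d \<in> C \<Longrightarrow> F a b c d + F b a c d = 0"
    and s23: "\<And>a b c d. a \<in> C \<Longrightarrow> b \<in> C \<Longrightarrow> c \<in> C \<Longrightarrow> d \<in> C \<Longrightarrow> F a b c d + F a c b d = 0"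
    and s34: "\<And>a b c d. a \<in> C \<Longrightarrow> b \<in> C \<Longrightarrow> c \<in> C \<Longrightarrow> d \<in> C \<Longrightarrow> F a b c d + F a b d c = 0"
    and x: "a \<in> C" "b \<in> C" "c \<in> C" "d \<in> C"
    and L: "three_term_complex L"
  shows "alt4 F a b c d = scal L 24 (F a b c d)"
proof -
  have s: "F b a c d = - F a b c d" "F c a b d = - F a c b d" "F a c b d = - F a b c d"
    "F d a b c = - F a d b c" "F a d b c = - F a b d c" "F a b d c = - F a b c d"
    using s12[OF x(2,1,3,4)] s12[OF x(3,1,2,4)] s23[OF x(1,3,2,4)] s12[OF x(4,1,2,3)] s23[OF x(1,4,2,3)] s34[OF x(1,2,4,3)]
    by (simp_all add: eq_neg_iff_add_eq_0)
  have "alt3 (F x) y z w = F x y z w + F x y z w + F x y z w + F x y z w + F x y z w + F x y z w"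
    if "x \<in> C" "y \<in> C" "z \<in> C" "w \<in> C" for x y z w
    by (rule alt3_alternating[of C]) (use s23 s34 that in auto)
  then show ?thesis
    by (simp add: alt4_def x s scal_double[OF L] scal_simps(5)[OF L])
qed

section \<open>Identification of the four-ary bracket\<close>

context weak_lie3_ops
begin

lemma bar_skew: "skew_symmetric L m2" "skew_symmetric L m3"
proof -
  show "skew_symmetric L m2"
    using m2_skew by (intro skew_symmetric2) (simp_all add: wops)
  show "skew_symmetric L m3"
    unfolding m3_def
    by (rule skew_symmetric_add skew_symmetric_smult C
        skew_symmetric_skew_sum[OF C C, of 3 1] wgraded_intros | simp add: wops)+
qed

definition m4 :: "('v, 'v) gmap"
  where "m4 = smult_map L (unit_inv 24) (skew_sum l4) + smult_map L (unit_inv 48) (skew_sum (l21 \<circ>\<^bsub>1\<^esub> l3 - l31 \<circ>\<^bsub>1\<^esub> l2 + l32 \<circ>\<^bsub>2\<^esub> l2 - l21 \<circ>\<^bsub>2\<^esub> l3 - l31 \<circ>\<^bsub>2\<^esub> l2 + l32 \<circ>\<^bsub>3\<^esub> l2))"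

lemma m4_graded: "graded_map L L 4 2 m4"
  unfolding m4_def by (rule wgraded_intros | simp)+

lemma m4_skew: "skew_symmetric L m4"
  unfolding m4_def
  by (rule skew_symmetric_add skew_symmetric_smult C
      skew_symmetric_skew_sum[OF C C, of 4 2] wgraded_intros | simp add: wops)+

text \<open>
  The four-ary operation \<open>l4 - R\<close> makes the last equation of \<open>strict_iso3\<close> hold trivially, hence is alternating;
  comparing antisymmetrizations identifies it with \<open>m4\<close>.
\<close>
lemma strict_iso_bar: "strict_iso L l2 l3 l4 m2 m3 m4 g2 g3"
proof -
  define R where "R = (g2 \<circ>\<^bsub>1\<^esub> l3 + g2 \<circ>\<^bsub>2\<^esub> l3 - (g2 \<circ>\<^bsub>2\<^esub> l3)\<^bsup>cyc [1,2]\<^esup> + (g2 \<circ>\<^bsub>2\<^esub> l3)\<^bsup>cyc [1,2,3]\<^esup>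
        - g3 \<circ>\<^bsub>1\<^esub> l2 + g3 \<circ>\<^bsub>2\<^esub> l2 - (g3 \<circ>\<^bsub>2\<^esub> l2)\<^bsup>cyc [1,2]\<^esup>
        - g3 \<circ>\<^bsub>3\<^esub> l2 + (g3 \<circ>\<^bsub>3\<^esub> l2)\<^bsup>cyc [2,3]\<^esup> - (g3 \<circ>\<^bsub>3\<^esub> l2)\<^bsup>cyc [1,3,2]\<^esup>
        + m2 \<circ>\<^bsub>1\<^esub> g3 + m2 \<circ>\<^bsub>2\<^esub> g3 - (m2 \<circ>\<^bsub>2\<^esub> g3)\<^bsup>cyc [1,2]\<^esup> + (m2 \<circ>\<^bsub>2\<^esub> g3)\<^bsup>cyc [1,2,3]\<^esup>
        - m2 \<circ>\<^sub>\<otimes> [g2, g2] + (m2 \<circ>\<^sub>\<otimes> [g2, g2])\<^bsup>cyc [2,3]\<^esup> - (m2 \<circ>\<^sub>\<otimes> [g2, g2])\<^bsup>cyc [1,3,2]\<^esup>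
        + m3 \<circ>\<^bsub>1\<^esub> g2 - m3 \<circ>\<^bsub>2\<^esub> g2 + (m3 \<circ>\<^bsub>2\<^esub> g2)\<^bsup>cyc [1,2]\<^esup>
        + m3 \<circ>\<^bsub>3\<^esub> g2 - (m3 \<circ>\<^bsub>3\<^esub> g2)\<^bsup>cyc [2,3]\<^esup> + (m3 \<circ>\<^bsub>3\<^esub> g2)\<^bsup>cyc [1,3,2]\<^esup>)"
  have R: "graded_map L L 4 2 R"
    unfolding R_def by (rule bar_graded wgraded_intros | simp)+
  have r: "map_eq L (l4 - (l4 - R)) R"
    by (simp add: map_eq_def graded_mapD(1,2)[OF R] graded_mapD(1,2)[OF lgraded(3)])
  have iso: "strict_iso L l2 l3 l4 m2 m3 (l4 - R) g2 g3"
    unfolding strict_iso_def strict_iso3_def R_def[symmetric]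
    by (intro conjI leib bar_graded bdry_g2 bdry_g3 graded_map_diff[OF C lgraded(3) R] r)
  have m3: "map_eq L (m3 + m3\<^bsup>cyc [1,2]\<^esup>) (zero_map 3 1)" "map_eq L (m3 + m3\<^bsup>cyc [2,3]\<^esup>) (zero_map 3 1)"
    using skew_symmetric_transposition[OF bar_skew(2), of 1 2] skew_symmetric_transposition[OF bar_skew(2), of 2 3]
    by (simp_all add: wops cyc_permutes[unfolded One_nat_def])
  interpret iso: skew_iso L l2 l3 l4 m2 m3 "l4 - R" g2 g3 l21 l31 l32 h
    by (intro skew_iso.intro skew_iso_axioms.intro iso bar_graded bdry_h g2_eq l31_eq l32_eq m2_eq h_skew m2_skew m3
        l4_swap g3_alt wgraded)
  have e: "app m4 [(0, a), (0, b), (0, c), (0, d)] = app (l4 - R) [(0, a), (0, b), (0, c), (0, d)]"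
    if x: "a \<in> comp L 0" "b \<in> comp L 0" "c \<in> comp L 0" "d \<in> comp L 0" for a b c d
  proof -
    have two_cancel: "v = 0" if "scal L 2 v = 0" for v
      using scal_cancel[OF C two, of v 0] that by (simp add: scal_simps[OF C])
    \<comment> \<open>The factor 48 turns the coefficients 1/24 and 1/48 of \<open>m4\<close> into 2
      and 1, the combination evaluated in \<open>alt4_m4\<close>.\<close>
    have "scal L 48 (app m4 [(0, a), (0, b), (0, c), (0, d)]) = scal L 2 (app (skew_sum l4) [(0, a), (0, b), (0, c), (0, d)]) + app (skew_sum (l21 \<circ>\<^bsub>1\<^esub> l3 - l31 \<circ>\<^bsub>1\<^esub> l2 + l32 \<circ>\<^bsub>2\<^esub> l2 - l21 \<circ>\<^bsub>2\<^esub> l3 - l31 \<circ>\<^bsub>2\<^esub> l2 + l32 \<circ>\<^bsub>3\<^esub> l2)) [(0, a), (0, b), (0, c), (0, d)]"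
      by (simp only: m4_def gmap_simps scal_simps(1)[OF C] unit_inv_scal)
    also have "\<dots> = alt4 (\<lambda>a b c d. app (l4 + l4 + (l21 \<circ>\<^bsub>1\<^esub> l3 - l31 \<circ>\<^bsub>1\<^esub> l2 + l32 \<circ>\<^bsub>2\<^esub> l2 - l21 \<circ>\<^bsub>2\<^esub> l3 - l31 \<circ>\<^bsub>2\<^esub> l2 + l32 \<circ>\<^bsub>3\<^esub> l2)) [(0, a), (0, b), (0, c), (0, d)]) a b c d"
      by (simp add: skew_sum4_degree_0 wops alt4_add scal_double[OF C] scal_simps(5)[OF C] del: app_circ)
    also have "\<dots> = alt4 (\<lambda>a b c d. app (l4 - R + (l4 - R)) [(0, a), (0, b), (0, c), (0, d)]) a b c d"
      by (rule iso.alt4_m4[OF two_cancel x, symmetric])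
    also have "\<dots> = scal L 24 (app (l4 - R + (l4 - R)) [(0, a), (0, b), (0, c), (0, d)])"
    proof (rule alt4_alternating[OF _ _ _ x C])
      fix a b c d assume x: "a \<in> comp L 0" "b \<in> comp L 0" "c \<in> comp L 0" "d \<in> comp L 0"
      show "app (l4 - R + (l4 - R)) [(0, a), (0, b), (0, c), (0, d)] + app (l4 - R + (l4 - R)) [(0, b), (0, a), (0, c), (0, d)] = 0"
        using iso.m4_swap12[OF x] by (simp only: gmap_simps(3)) (simp only: ac_simps add_0_right)
      show "app (l4 - R + (l4 - R)) [(0, a), (0, b), (0, c), (0, d)] + app (l4 - R + (l4 - R)) [(0, a), (0, c), (0, b), (0, d)] = 0"
        using iso.m4_swap23[OF x] by (simp only: gmap_simps(3)) (simp only: ac_simps add_0_right)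
      show "app (l4 - R + (l4 - R)) [(0, a), (0, b), (0, c), (0, d)] + app (l4 - R + (l4 - R)) [(0, a), (0, b), (0, d), (0, c)] = 0"
        using iso.m4_swap34[OF x] by (simp only: gmap_simps(3)) (simp only: ac_simps add_0_right)
    qed
    also have "\<dots> = scal L 48 (app (l4 - R) [(0, a), (0, b), (0, c), (0, d)])"
      using scal_simps(9)[OF C, of 24 24] by (simp add: scal_simps(1)[OF C])
    finally show ?thesis by (rule scal_cancel[OF C units(3)])
  qed
  have "map_eq L (l4 - m4) R"
  proof (rule map_eqI[OF C C, of 4 2])
    show "graded_map L L 4 2 (l4 - m4)" by (rule graded_map_diff[OF C lgraded(3) m4_graded])
    show "graded_map L L 4 2 R" by (rule R)
    fix vs :: "(int \<times> 'v) list"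
    assume l: "length vs = 4" and h: "homogeneous L vs" "fst ` set vs \<subseteq> {0, 1, 2}" "tdeg vs + 2 \<le> 2"
    then obtain p a q b r c t d where vs: "vs = [(p, a), (q, b), (r, c), (t, d)]"
      by (auto simp: length_Suc_conv numeral_eq_Suc)
    have z: "p = 0" "q = 0" "r = 0" "t = 0"
      using degree_0[OF h(2), of "(p, a)"] degree_0[OF h(2), of "(q, b)"] degree_0[OF h(2), of "(r, c)"]
        degree_0[OF h(2), of "(t, d)"] h(3) by (simp_all add: vs)
    show "app (l4 - m4) vs = app R vs"
      using e[of a b c d] h(1) by (simp add: vs z)
  qed
  then show ?thesis
    using iso m4_graded unfolding strict_iso_def strict_iso3_def R_def[symmetric] by simp
qed

lemma leibniz3_bar: "leibniz3 L m2 m3 m4"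
  by (rule strict_iso.leibniz3_transport[OF strict_iso_bar])

end

subsection \<open>Skew-symmetrization of a weak morphism\<close>

locale weak_lie3_maps =
  V: weak_lie3_ops L l2 l3 l4 l21 l211 l31 l32 + W: weak_lie3_ops L' n2 n3 n4 n21 n211 n31 n32
  for L :: "('k::comm_ring_1, 'v::ab_group_add, 'a) cplx_scheme"
    and L' :: "('k, 'w::ab_group_add, 'b) cplx_scheme"
    and l2 l3 l4 l21 l211 l31 l32 n2 n3 n4 n21 n211 n31 n32 +
  fixes f1 f2 f3 f21 :: "('v, 'w) gmap"
  assumes f: "leibniz3_maps L L' l2 l3 l4 n2 n3 n4 f1 f2 f3"
    and f21: "graded_map L L' 2 2 f21"
    and bdry_f21: "map_eq L (bdry L L' f21) (- f2 - f2\<^bsup>cyc [1,2]\<^esup> + f1 \<circ>\<^bsub>1\<^esub> l21 - n21 \<circ>\<^sub>\<otimes> [f1, f1])"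
    and f211: "map_eq L (f1 \<circ>\<^bsub>1\<^esub> l211 - n211 \<circ>\<^sub>\<otimes> [f1, f1]) (f21 - f21\<^bsup>cyc [1,2]\<^esup>)"
    and f31: "map_eq L (f1 \<circ>\<^bsub>1\<^esub> l31 - n31 \<circ>\<^sub>\<otimes> [f1, f1, f1])
      (f3 + f3\<^bsup>cyc [1,2]\<^esup> + f2 \<circ>\<^bsub>1\<^esub> l21 + n2 \<circ>\<^sub>\<otimes> [f21, f1])"
    and f32: "map_eq L (f1 \<circ>\<^bsub>1\<^esub> l32 - n32 \<circ>\<^sub>\<otimes> [f1, f1, f1])
      (f3 + f3\<^bsup>cyc [2,3]\<^esup> - f2 \<circ>\<^bsub>2\<^esub> l21 + f21 \<circ>\<^bsub>1\<^esub> l2 + (f21 \<circ>\<^bsub>2\<^esub> l2)\<^bsup>cyc [1,2]\<^esup> - n2 \<circ>\<^sub>\<otimes> [f1, f21] - n21 \<circ>\<^sub>\<otimes> [f2, f1] - (n21 \<circ>\<^sub>\<otimes> [f1, f2])\<^bsup>cyc [1,2]\<^esup>)"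
begin

definition h2 :: "('v, 'w) gmap" where "h2 = smult_map L' (unit_inv 2) (skew_sum f2)"
definition h3 :: "('v, 'w) gmap"
  where "h3 = smult_map L' (unit_inv 6) (skew_sum f3)
    - smult_map L' (unit_inv 24) (skew_sum (f21 \<circ>\<^bsub>1\<^esub> l2 + f21 \<circ>\<^bsub>2\<^esub> l2 - n21 \<circ>\<^sub>\<otimes> [f2, f1] - n21 \<circ>\<^sub>\<otimes> [f1, f2]))"
definition u :: "('v, 'w) gmap" where "u = smult_map L' (unit_inv 2) f21"

lemma fgraded: "graded_map L L' 1 0 f1" "graded_map L L' 2 1 f2" "graded_map L L' 3 2 f3"
  using f by (simp_all add: leibniz3_maps_def)

lemmas fgraded_intros = V.bar_graded W.bar_graded V.lgraded W.lgraded V.wgraded W.wgraded fgraded f21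
  graded_map_add[OF W.C] graded_map_diff[OF W.C] graded_map_uminus[OF W.C] graded_map_zero[OF W.C] graded_map_smult[OF W.C]
  graded_map_perm[OF V.C W.C] graded_map_circ[OF V.C W.C] graded_map_tensor2[OF W.C W.C] graded_map_tensor3[OF W.C W.C]
  graded_map_bdry[OF V.C W.C] graded_map_skew_sum[OF V.C W.C] cyc_permutes

lemma hgraded: "graded_map L L' 2 1 h2" "graded_map L L' 3 2 h3" "graded_map L L' 2 2 u"
proof -
  show "graded_map L L' 2 1 h2" unfolding h2_def by (rule fgraded_intros | simp)+
  show "graded_map L L' 3 2 h3" unfolding h3_def by (rule fgraded_intros | simp)+
  show "graded_map L L' 2 2 u" unfolding u_def by (rule fgraded_intros | simp)+
qed

lemmas fops = graded_map1[OF V.C W.C fgraded(1)] graded_map2[OF V.C W.C fgraded(2)]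
  graded_map3[OF V.C W.C fgraded(3)] graded_map2[OF V.C W.C f21] graded_map2[OF V.C W.C hgraded(1)]
  graded_map3[OF V.C W.C hgraded(2)] graded_map2[OF V.C W.C hgraded(3)] V.wops W.wops

lemma app_f21: "app f21 vs = app u vs + app u vs"
  by (simp add: u_def W.half)

lemma h2_eq: "map_eq L (h2 + h2) (f2 - f2\<^bsup>cyc [1,2]\<^esup>)"
  by (rule map_eq2I) (simp_all add: fops app_unfold h2_def W.half skew_sum2)

text \<open>Half of the boundary equation for \<open>f21\<close>: the symmetric part of
  \<open>f2\<close> is \<open>f2 - h2\<close>, and half of \<open>l21\<close> and \<open>n21\<close>
  are the binary components of the two isomorphisms.\<close>

lemma bdry_u: "map_eq L (bdry L L' u) (h2 + f1 \<circ>\<^bsub>1\<^esub> V.g2 - f2 - W.g2 \<circ>\<^sub>\<otimes> [f1, f1])"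
proof (rule map_eq2I)
  fix p a q b assume x: "a \<in> comp L p" "b \<in> comp L q"
  have "app (bdry L L' u) [(p, a), (q, b)] = scal L' (unit_inv 2) (app (- f2 - f2\<^bsup>cyc [1,2]\<^esup> + f1 \<circ>\<^bsub>1\<^esub> l21 - n21 \<circ>\<^sub>\<otimes> [f1, f1]) [(p, a), (q, b)])"
    unfolding u_def using bdry_smult_map[OF V.C W.C f21, of "[(p, a), (q, b)]"] map_eqD[OF bdry_f21, of "[(p, a), (q, b)]"] x
    by (simp add: fops)
  also have "\<dots> = app (h2 + f1 \<circ>\<^bsub>1\<^esub> V.g2 - f2 - W.g2 \<circ>\<^sub>\<otimes> [f1, f1]) [(p, a), (q, b)]"
    using W.half[of "app f2 [(p, a), (q, b)]"] x
    by (simp add: app_unfold h2_def V.g2_def W.g2_def skew_sum2 fops scal_simps[OF W.C] algebra_simps)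
  finally show "app (bdry L L' u) [(p, a), (q, b)] = app (h2 + f1 \<circ>\<^bsub>1\<^esub> V.g2 - f2 - W.g2 \<circ>\<^sub>\<otimes> [f1, f1]) [(p, a), (q, b)]" .
qed (simp_all add: fops)

lemmas feqs = f[unfolded leibniz3_maps_def, THEN conjunct2, THEN conjunct2, THEN conjunct2]
lemmas diff_f1 = diff_app1[OF feqs[THEN conjunct1] V.C W.C fgraded(1), simplified]
lemmas diff_f2 = diff_app2[OF feqs[THEN conjunct2, THEN conjunct1] V.C W.C fgraded(2),
    simplified app_unfold fops gmap_simps, simplified]
lemmas diff_u = diff_app2[OF bdry_u V.C W.C hgraded(3), simplified app_unfold fops gmap_simps, simplified]

definition defect_h2 :: "('v, 'w) gmap"
  where "defect_h2 = f2 - f2\<^bsup>cyc [1,2]\<^esup> - (h2 + h2)"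

lemma defect_h2_zero: "a \<in> comp L p \<Longrightarrow> b \<in> comp L q \<Longrightarrow> app defect_h2 [(p, a), (q, b)] = 0"
  using map_eqD[OF h2_eq, of "[(p, a), (q, b)]"] by (simp add: defect_h2_def fops)

lemmas app_defect_h2 = arg_cong[OF defect_h2_def, of "\<lambda>\<mu>. app \<mu> [(p, a), (q, b)]" for p a q b,
  simplified app_unfold fops gmap_simps, simplified]

definition defect_f211 :: "('v, 'w) gmap"
  where "defect_f211 = f1 \<circ>\<^bsub>1\<^esub> l211 - n211 \<circ>\<^sub>\<otimes> [f1, f1] - (f21 - f21\<^bsup>cyc [1,2]\<^esup>)"

lemma defect_f211_zero: "a \<in> comp L p \<Longrightarrow> b \<in> comp L q \<Longrightarrow> app defect_f211 [(p, a), (q, b)] = 0"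
  using map_eqD[OF f211, of "[(p, a), (q, b)]"] by (simp add: defect_f211_def fops)

lemmas app_defect_f211 = arg_cong[OF defect_f211_def, of "\<lambda>\<mu>. app \<mu> [(p, a), (q, b)]" for p a q b,
  simplified app_unfold fops gmap_simps, simplified]

definition defect_f31 :: "('v, 'w) gmap"
  where "defect_f31 = f1 \<circ>\<^bsub>1\<^esub> l31 - n31 \<circ>\<^sub>\<otimes> [f1, f1, f1] - (f3 + f3\<^bsup>cyc [1,2]\<^esup> + f2 \<circ>\<^bsub>1\<^esub> l21 + n2 \<circ>\<^sub>\<otimes> [f21, f1])"

lemma defect_f31_zero: "a \<in> comp L p \<Longrightarrow> b \<in> comp L q \<Longrightarrow> c \<in> comp L r \<Longrightarrow> app defect_f31 [(p, a), (q, b), (r, c)] = 0"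
  using map_eqD[OF f31, of "[(p, a), (q, b), (r, c)]"] by (simp add: defect_f31_def fops)

lemmas app_defect_f31 = arg_cong[OF defect_f31_def, of "\<lambda>\<mu>. app \<mu> [(p, a), (q, b), (r, c)]" for p a q b r c,
  simplified app_unfold fops gmap_simps, simplified]

definition defect_f32 :: "('v, 'w) gmap"
  where "defect_f32 = f1 \<circ>\<^bsub>1\<^esub> l32 - n32 \<circ>\<^sub>\<otimes> [f1, f1, f1] - (f3 + f3\<^bsup>cyc [2,3]\<^esup> - f2 \<circ>\<^bsub>2\<^esub> l21 + f21 \<circ>\<^bsub>1\<^esub> l2 + (f21 \<circ>\<^bsub>2\<^esub> l2)\<^bsup>cyc [1,2]\<^esup> - n2 \<circ>\<^sub>\<otimes> [f1, f21] - n21 \<circ>\<^sub>\<otimes> [f2, f1] - (n21 \<circ>\<^sub>\<otimes> [f1, f2])\<^bsup>cyc [1,2]\<^esup>)"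

lemma defect_f32_zero: "a \<in> comp L p \<Longrightarrow> b \<in> comp L q \<Longrightarrow> c \<in> comp L r \<Longrightarrow> app defect_f32 [(p, a), (q, b), (r, c)] = 0"
  using map_eqD[OF f32, of "[(p, a), (q, b), (r, c)]"] by (simp add: defect_f32_def fops)

lemmas app_defect_f32 = arg_cong[OF defect_f32_def, of "\<lambda>\<mu>. app \<mu> [(p, a), (q, b), (r, c)]" for p a q b r c,
  simplified app_unfold fops gmap_simps, simplified]

lemmas fdefects_zero = defect_h2_zero defect_f211_zero defect_f31_zero defect_f32_zero V.wdefects_zero W.wdefects_zero
lemmas fexpand = fops app_f21 V.wexpand W.wexpand app_defect_h2 app_defect_f211 app_defect_f31 app_defect_f32
  diff_f1 diff_f2 diff_u

lemma h3_scal: "scal L' 24 (app h3 vs) = scal L' 4 (app (skew_sum f3) vs) - app (skew_sum (f21 \<circ>\<^bsub>1\<^esub> l2 + f21 \<circ>\<^bsub>2\<^esub> l2 - n21 \<circ>\<^sub>\<otimes> [f2, f1] - n21 \<circ>\<^sub>\<otimes> [f1, f2])) vs"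
  by (simp only: h3_def gmap_simps scal_simps(2)[OF W.C] W.unit_inv_scal)

lemma app_f1_G3:
  assumes x: "a \<in> comp L 0" "b \<in> comp L 0" "c \<in> comp L 0"
  shows "app f1 [(2, app V.G3 [(0, a), (0, b), (0, c)])] =
    scal L' 14 (app f1 [(2, app l31 [(0, a), (0, b), (0, c)])]) - scal L' 2 (app f1 [(2, app l31 [(0, a), (0, c), (0, b)])]) + scal L' 6 (app f1 [(2, app l31 [(0, b), (0, c), (0, a)])]) + scal L' 6 (app f1 [(2, app l32 [(0, a), (0, b), (0, c)])]) - scal L' 10 (app f1 [(2, app l32 [(0, b), (0, a), (0, c)])]) - scal L' 2 (app f1 [(2, app l32 [(0, c), (0, a), (0, b)])]) - scal L' 8 (app f1 [(2, app l21 [(1, app l21 [(0, a), (0, b)]), (0, c)])]) - scal L' 4 (app f1 [(2, app l21 [(1, app l21 [(0, a), (0, c)]), (0, b)])]) - app f1 [(2, app l211 [(0, app l2 [(0, a), (0, b)]), (0, c)])] - app f1 [(2, app l211 [(0, app l2 [(0, c), (0, a)]), (0, b)])] + app f1 [(2, app l211 [(0, app l2 [(0, b), (0, c)]), (0, a)])] - app f1 [(2, app l211 [(0, app l2 [(0, c), (0, b)]), (0, a)])] + app f1 [(2, app l211 [(0, app l2 [(0, b), (0, a)]), (0, c)])] - scal L' 5 (app f1 [(2, app l211 [(0, app l2 [(0, a), (0, c)]), (0, b)])])"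
  using x by (simp add: V.app_G3 fops)

text \<open>Here the stated formula for the ternary component is matched with the homotopy relation.
  Multiplied by 24, the relation is an integral combination of the weak-morphism equations, the
  relations for the brackets and for \<open>h\<close> on both sides, and d of elements of degree
  3.\<close>

lemma homotopy_defect_0:
  assumes x: "a \<in> comp L 0" "b \<in> comp L 0" "c \<in> comp L 0"
  shows "app (h3 - f3 + f1 \<circ>\<^bsub>1\<^esub> V.g3 - W.g3 \<circ>\<^sub>\<otimes> [f1, f1, f1] + (W.g2 \<circ>\<^sub>\<otimes> [f1, f2])\<^bsup>cyc [1,2]\<^esup> - W.g2 \<circ>\<^sub>\<otimes> [f1, f2] + W.g2 \<circ>\<^sub>\<otimes> [f2, f1]
    - W.m2 \<circ>\<^sub>\<otimes> [u, f1] - (W.m2 \<circ>\<^sub>\<otimes> [f1, u])\<^bsup>cyc [1,2]\<^esup> + W.m2 \<circ>\<^sub>\<otimes> [f1, u] - u \<circ>\<^bsub>1\<^esub> l2 + u \<circ>\<^bsub>2\<^esub> l2 - (u \<circ>\<^bsub>2\<^esub> l2)\<^bsup>cyc [1,2]\<^esup>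
    - h2 \<circ>\<^bsub>1\<^esub> V.g2 + h2 \<circ>\<^bsub>2\<^esub> V.g2 - (h2 \<circ>\<^bsub>2\<^esub> V.g2)\<^bsup>cyc [1,2]\<^esup>) [(0, a), (0, b), (0, c)] = 0"
proof -
  let ?X = "[(0, a), (0, b), (0, c)]" and ?Y = "[(0, app f1 [(0, a)]), (0, app f1 [(0, b)]), (0, app f1 [(0, c)])]"
  let ?H = "f21 \<circ>\<^bsub>1\<^esub> l2 + f21 \<circ>\<^bsub>2\<^esub> l2 - n21 \<circ>\<^sub>\<otimes> [f2, f1] - n21 \<circ>\<^sub>\<otimes> [f1, f2]"
  let ?R = "(W.g2 \<circ>\<^sub>\<otimes> [f1, f2])\<^bsup>cyc [1,2]\<^esup> - W.g2 \<circ>\<^sub>\<otimes> [f1, f2] + W.g2 \<circ>\<^sub>\<otimes> [f2, f1]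
    - W.m2 \<circ>\<^sub>\<otimes> [u, f1] - (W.m2 \<circ>\<^sub>\<otimes> [f1, u])\<^bsup>cyc [1,2]\<^esup> + W.m2 \<circ>\<^sub>\<otimes> [f1, u] - u \<circ>\<^bsub>1\<^esub> l2 + u \<circ>\<^bsub>2\<^esub> l2 - (u \<circ>\<^bsub>2\<^esub> l2)\<^bsup>cyc [1,2]\<^esup>
    - h2 \<circ>\<^bsub>1\<^esub> V.g2 + h2 \<circ>\<^bsub>2\<^esub> V.g2 - (h2 \<circ>\<^bsub>2\<^esub> V.g2)\<^bsup>cyc [1,2]\<^esup>"
  let ?E = "h3 - f3 + f1 \<circ>\<^bsub>1\<^esub> V.g3 - W.g3 \<circ>\<^sub>\<otimes> [f1, f1, f1] + (W.g2 \<circ>\<^sub>\<otimes> [f1, f2])\<^bsup>cyc [1,2]\<^esup> - W.g2 \<circ>\<^sub>\<otimes> [f1, f2] + W.g2 \<circ>\<^sub>\<otimes> [f2, f1]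
    - W.m2 \<circ>\<^sub>\<otimes> [u, f1] - (W.m2 \<circ>\<^sub>\<otimes> [f1, u])\<^bsup>cyc [1,2]\<^esup> + W.m2 \<circ>\<^sub>\<otimes> [f1, u] - u \<circ>\<^bsub>1\<^esub> l2 + u \<circ>\<^bsub>2\<^esub> l2 - (u \<circ>\<^bsub>2\<^esub> l2)\<^bsup>cyc [1,2]\<^esup>
    - h2 \<circ>\<^bsub>1\<^esub> V.g2 + h2 \<circ>\<^bsub>2\<^esub> V.g2 - (h2 \<circ>\<^bsub>2\<^esub> V.g2)\<^bsup>cyc [1,2]\<^esup>"
  \<comment> \<open>Opaque names for all values that occur, so that the final comparison is linear
    in 109 unknowns and does not expand any operation.\<close>
  define t1 where "t1 = app f3 [(0, a), (0, b), (0, c)]"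
  define t2 where "t2 = app f3 [(0, a), (0, c), (0, b)]"
  define t3 where "t3 = app f3 [(0, b), (0, a), (0, c)]"
  define t4 where "t4 = app f3 [(0, c), (0, a), (0, b)]"
  define t5 where "t5 = app f3 [(0, b), (0, c), (0, a)]"
  define t6 where "t6 = app f3 [(0, c), (0, b), (0, a)]"
  define t7 where "t7 = app u [(0, app l2 [(0, a), (0, b)]), (0, c)]"
  define t8 where "t8 = app u [(0, a), (0, app l2 [(0, b), (0, c)])]"
  define t9 where "t9 = app W.g2 [(1, app f2 [(0, a), (0, b)]), (0, app f1 [(0, c)])]"
  define t10 where "t10 = app W.g2 [(0, app f1 [(0, a)]), (1, app f2 [(0, b), (0, c)])]"
  define t11 where "t11 = app u [(0, app l2 [(0, a), (0, c)]), (0, b)]"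
  define t12 where "t12 = app u [(0, a), (0, app l2 [(0, c), (0, b)])]"
  define t13 where "t13 = app W.g2 [(1, app f2 [(0, a), (0, c)]), (0, app f1 [(0, b)])]"
  define t14 where "t14 = app W.g2 [(0, app f1 [(0, a)]), (1, app f2 [(0, c), (0, b)])]"
  define t15 where "t15 = app u [(0, app l2 [(0, b), (0, a)]), (0, c)]"
  define t16 where "t16 = app u [(0, b), (0, app l2 [(0, a), (0, c)])]"
  define t17 where "t17 = app W.g2 [(1, app f2 [(0, b), (0, a)]), (0, app f1 [(0, c)])]"
  define t18 where "t18 = app W.g2 [(0, app f1 [(0, b)]), (1, app f2 [(0, a), (0, c)])]"
  define t19 where "t19 = app u [(0, app l2 [(0, c), (0, a)]), (0, b)]"
  define t20 where "t20 = app u [(0, c), (0, app l2 [(0, a), (0, b)])]"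
  define t21 where "t21 = app W.g2 [(1, app f2 [(0, c), (0, a)]), (0, app f1 [(0, b)])]"
  define t22 where "t22 = app W.g2 [(0, app f1 [(0, c)]), (1, app f2 [(0, a), (0, b)])]"
  define t23 where "t23 = app u [(0, app l2 [(0, b), (0, c)]), (0, a)]"
  define t24 where "t24 = app u [(0, b), (0, app l2 [(0, c), (0, a)])]"
  define t25 where "t25 = app W.g2 [(1, app f2 [(0, b), (0, c)]), (0, app f1 [(0, a)])]"
  define t26 where "t26 = app W.g2 [(0, app f1 [(0, b)]), (1, app f2 [(0, c), (0, a)])]"
  define t27 where "t27 = app u [(0, app l2 [(0, c), (0, b)]), (0, a)]"
  define t28 where "t28 = app u [(0, c), (0, app l2 [(0, b), (0, a)])]"
  define t29 where "t29 = app W.g2 [(1, app f2 [(0, c), (0, b)]), (0, app f1 [(0, a)])]"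
  define t30 where "t30 = app W.g2 [(0, app f1 [(0, c)]), (1, app f2 [(0, b), (0, a)])]"
  define t31 where "t31 = app f1 [(2, app l31 [(0, a), (0, b), (0, c)])]"
  define t32 where "t32 = app f1 [(2, app l31 [(0, a), (0, c), (0, b)])]"
  define t33 where "t33 = app f1 [(2, app l31 [(0, b), (0, c), (0, a)])]"
  define t34 where "t34 = app f1 [(2, app l32 [(0, a), (0, b), (0, c)])]"
  define t35 where "t35 = app f1 [(2, app l32 [(0, b), (0, a), (0, c)])]"
  define t36 where "t36 = app f1 [(2, app l32 [(0, c), (0, a), (0, b)])]"
  define t37 where "t37 = app f1 [(2, app V.g2 [(1, app V.g2 [(0, a), (0, b)]), (0, c)])]"
  define t38 where "t38 = app f1 [(2, app V.g2 [(1, app V.g2 [(0, a), (0, c)]), (0, b)])]"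
  define t39 where "t39 = app f1 [(2, app V.h [(0, app l2 [(0, a), (0, b)]), (0, c)])]"
  define t40 where "t40 = app f1 [(2, app V.h [(0, app l2 [(0, c), (0, a)]), (0, b)])]"
  define t41 where "t41 = app f1 [(2, app V.h [(0, app l2 [(0, b), (0, c)]), (0, a)])]"
  define t42 where "t42 = app f1 [(2, app V.h [(0, app l2 [(0, c), (0, b)]), (0, a)])]"
  define t43 where "t43 = app f1 [(2, app V.h [(0, app l2 [(0, b), (0, a)]), (0, c)])]"
  define t44 where "t44 = app f1 [(2, app V.h [(0, app l2 [(0, a), (0, c)]), (0, b)])]"
  define t45 where "t45 = app n31 [(0, app f1 [(0, a)]), (0, app f1 [(0, b)]), (0, app f1 [(0, c)])]"
  define t46 where "t46 = app n31 [(0, app f1 [(0, a)]), (0, app f1 [(0, c)]), (0, app f1 [(0, b)])]"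
  define t47 where "t47 = app n31 [(0, app f1 [(0, b)]), (0, app f1 [(0, c)]), (0, app f1 [(0, a)])]"
  define t48 where "t48 = app n32 [(0, app f1 [(0, a)]), (0, app f1 [(0, b)]), (0, app f1 [(0, c)])]"
  define t49 where "t49 = app n32 [(0, app f1 [(0, b)]), (0, app f1 [(0, a)]), (0, app f1 [(0, c)])]"
  define t50 where "t50 = app n32 [(0, app f1 [(0, c)]), (0, app f1 [(0, a)]), (0, app f1 [(0, b)])]"
  define t51 where "t51 = app W.g2 [(1, app W.g2 [(0, app f1 [(0, a)]), (0, app f1 [(0, b)])]), (0, app f1 [(0, c)])]"
  define t52 where "t52 = app W.g2 [(1, app W.g2 [(0, app f1 [(0, a)]), (0, app f1 [(0, c)])]), (0, app f1 [(0, b)])]"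
  define t53 where "t53 = app W.h [(0, app n2 [(0, app f1 [(0, a)]), (0, app f1 [(0, b)])]), (0, app f1 [(0, c)])]"
  define t54 where "t54 = app W.h [(0, app n2 [(0, app f1 [(0, c)]), (0, app f1 [(0, a)])]), (0, app f1 [(0, b)])]"
  define t55 where "t55 = app W.h [(0, app n2 [(0, app f1 [(0, b)]), (0, app f1 [(0, c)])]), (0, app f1 [(0, a)])]"
  define t56 where "t56 = app W.h [(0, app n2 [(0, app f1 [(0, c)]), (0, app f1 [(0, b)])]), (0, app f1 [(0, a)])]"
  define t57 where "t57 = app W.h [(0, app n2 [(0, app f1 [(0, b)]), (0, app f1 [(0, a)])]), (0, app f1 [(0, c)])]"
  define t58 where "t58 = app W.h [(0, app n2 [(0, app f1 [(0, a)]), (0, app f1 [(0, c)])]), (0, app f1 [(0, b)])]"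
  define t59 where "t59 = app W.m2 [(2, app u [(0, a), (0, b)]), (0, app f1 [(0, c)])]"
  define t60 where "t60 = app W.m2 [(0, app f1 [(0, b)]), (2, app u [(0, a), (0, c)])]"
  define t61 where "t61 = app W.m2 [(0, app f1 [(0, a)]), (2, app u [(0, b), (0, c)])]"
  define t62 where "t62 = app h2 [(1, app V.g2 [(0, a), (0, b)]), (0, c)]"
  define t63 where "t63 = app h2 [(0, a), (1, app V.g2 [(0, b), (0, c)])]"
  define t64 where "t64 = app h2 [(0, b), (1, app V.g2 [(0, a), (0, c)])]"
  define t65 where "t65 = app f2 [(1, app V.g2 [(0, a), (0, b)]), (0, c)]"
  define t66 where "t66 = app W.g2 [(1, app f1 [(1, app V.g2 [(0, a), (0, b)])]), (0, app f1 [(0, c)])]"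
  define t67 where "t67 = app u [(0, app V.m2 [(0, a), (0, b)]), (0, c)]"
  define t68 where "t68 = app W.h [(0, app f1 [(0, a)]), (0, app n2 [(0, app f1 [(0, c)]), (0, app f1 [(0, b)])])]"
  define t69 where "t69 = app n2 [(0, app f1 [(0, a)]), (2, app u [(0, b), (0, c)])]"
  define t70 where "t70 = app n2 [(2, app u [(0, b), (0, c)]), (0, app f1 [(0, a)])]"
  define t71 where "t71 = app u [(0, app V.m2 [(0, b), (0, c)]), (0, a)]"
  define t72 where "t72 = app u [(0, c), (0, app V.m2 [(0, a), (0, b)])]"
  define t73 where "t73 = app W.h [(0, app f1 [(0, b)]), (0, app n2 [(0, app f1 [(0, a)]), (0, app f1 [(0, c)])])]"
  define t74 where "t74 = app f1 [(2, app V.h [(0, b), (0, app l2 [(0, c), (0, a)])])]"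
  define t75 where "t75 = app W.h [(0, app f1 [(0, b)]), (0, app f1 [(0, app l2 [(0, c), (0, a)])])]"
  define t76 where "t76 = app W.h [(0, app f1 [(0, b)]), (0, app n2 [(0, app f1 [(0, c)]), (0, app f1 [(0, a)])])]"
  define t77 where "t77 = app f2 [(1, app V.g2 [(0, a), (0, c)]), (0, b)]"
  define t78 where "t78 = app n2 [(2, app u [(0, a), (0, c)]), (0, app f1 [(0, b)])]"
  define t79 where "t79 = app f2 [(0, c), (1, app V.g2 [(0, a), (0, b)])]"
  define t80 where "t80 = app f1 [(2, app V.h [(0, c), (0, app l2 [(0, a), (0, b)])])]"
  define t81 where "t81 = app f2 [(0, a), (1, app V.g2 [(0, b), (0, c)])]"
  define t82 where "t82 = app h2 [(1, app V.g2 [(0, a), (0, c)]), (0, b)]"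
  define t83 where "t83 = app W.g2 [(1, app f1 [(1, app V.g2 [(0, a), (0, c)])]), (0, app f1 [(0, b)])]"
  define t84 where "t84 = app u [(0, app V.m2 [(0, a), (0, c)]), (0, b)]"
  define t85 where "t85 = app W.h [(0, app f1 [(0, b)]), (0, app f1 [(0, app l2 [(0, a), (0, c)])])]"
  define t86 where "t86 = app W.h [(0, app f1 [(0, app l2 [(0, a), (0, c)])]), (0, app f1 [(0, b)])]"
  define t87 where "t87 = app f1 [(2, app V.h [(0, app V.m2 [(0, b), (0, c)]), (0, a)])]"
  define t88 where "t88 = app n2 [(0, app f1 [(0, c)]), (2, app u [(0, a), (0, b)])]"
  define t89 where "t89 = app f2 [(1, app V.g2 [(0, b), (0, c)]), (0, a)]"
  define t90 where "t90 = app W.h [(0, app f1 [(0, c)]), (0, app n2 [(0, app f1 [(0, a)]), (0, app f1 [(0, b)])])]"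
  define t91 where "t91 = app W.h [(0, app f1 [(0, a)]), (0, app n2 [(0, app f1 [(0, b)]), (0, app f1 [(0, c)])])]"
  define t92 where "t92 = app n2 [(2, app u [(0, a), (0, b)]), (0, app f1 [(0, c)])]"
  define t93 where "t93 = app W.g2 [(1, app h2 [(0, a), (0, b)]), (0, app f1 [(0, c)])]"
  define t94 where "t94 = app f1 [(2, app V.h [(0, c), (0, app l2 [(0, b), (0, a)])])]"
  define t95 where "t95 = app W.m2 [(2, app u [(0, a), (0, c)]), (0, app f1 [(0, b)])]"
  define t96 where "t96 = app W.g2 [(1, app h2 [(0, a), (0, c)]), (0, app f1 [(0, b)])]"
  define t97 where "t97 = app W.h [(0, app f1 [(0, app V.m2 [(0, b), (0, c)])]), (0, app f1 [(0, a)])]"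
  define t98 where "t98 = app u [(0, a), (0, app V.m2 [(0, b), (0, c)])]"
  define t99 where "t99 = app W.h [(0, app f1 [(0, c)]), (0, app f1 [(0, app l2 [(0, b), (0, a)])])]"
  define t100 where "t100 = app W.h [(0, app f1 [(0, c)]), (0, app n2 [(0, app f1 [(0, b)]), (0, app f1 [(0, a)])])]"
  define t101 where "t101 = app f2 [(0, b), (1, app V.g2 [(0, a), (0, c)])]"
  define t102 where "t102 = app n2 [(0, app f1 [(0, b)]), (2, app u [(0, a), (0, c)])]"
  define t103 where "t103 = app W.h [(0, app f1 [(0, c)]), (0, app f1 [(0, app l2 [(0, a), (0, b)])])]"
  define t104 where "t104 = app W.h [(0, app f1 [(0, c)]), (0, app f1 [(0, app V.m2 [(0, a), (0, b)])])]"
  define t105 where "t105 = app W.h [(0, app f1 [(0, a)]), (0, app f1 [(0, app l2 [(0, b), (0, c)])])]"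
  define t106 where "t106 = app W.h [(0, app f1 [(0, a)]), (0, app f1 [(0, app l2 [(0, c), (0, b)])])]"
  define t107 where "t107 = app W.h [(0, app f1 [(0, app l2 [(0, c), (0, b)])]), (0, app f1 [(0, a)])]"
  define t108 where "t108 = app W.h [(0, app f1 [(0, app l2 [(0, b), (0, c)])]), (0, app f1 [(0, a)])]"
  define t109 where "t109 = app f1 [(2, app V.h [(0, c), (0, app V.m2 [(0, a), (0, b)])])]"
  note expand = t1_def t2_def t3_def t4_def t5_def t6_def t7_def t8_def t9_def t10_def t11_def t12_def t13_def t14_def t15_def t16_def t17_def t18_def t19_def t20_def t21_def t22_def t23_def t24_def t25_def t26_def t27_def t28_def t29_def t30_def t31_def t32_def t33_def t34_def t35_def t36_def t37_def t38_def t39_def t40_def t41_def t42_def t43_def t44_def t45_def t46_def t47_def t48_def t49_def t50_def t51_def t52_def t53_def t54_def t55_def t56_def t57_def t58_def t59_def t60_def t61_def t62_def t63_def t64_def t65_def t66_def t67_def t68_def t69_def t70_def t71_def t72_def t73_def t74_def t75_def t76_def t77_def t78_def t79_def t80_def t81_def t82_def t83_def t84_def t85_def t86_def t87_def t88_def t89_def t90_def t91_def t92_def t93_def t94_def t95_def t96_def t97_def t98_def t99_def t100_def t101_def t102_def t103_def t104_def t105_def t106_def t107_def t108_def t109_def fexpand algebra_simps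
  \<comment> \<open>\<open>e1\<close> to \<open>e6\<close> express the pieces of the left side in
    these unknowns, \<open>r1\<close> to \<open>r51\<close> the vanishing values that are going to
    be added.\<close>
  have e1: "app (skew_sum f3) ?X = t1 + t4 + t5 - t2 - t3 - t6"
    by (simp add: skew_sum3 x expand)
  have e2: "app (skew_sum ?H) ?X = t7 + t7 + t8 + t8 + t13 + t13 + t14 + t14 + t17 + t17 + t18 + t18 + t19 + t19 + t20 + t20 + t23 + t23 + t24 + t24 + t29 + t29 + t30 + t30 - (t9 + t9) - (t10 + t10) - (t11 + t11) - (t12 + t12) - (t15 + t15) - (t16 + t16) - (t21 + t21) - (t22 + t22) - (t25 + t25) - (t26 + t26) - (t27 + t27) - (t28 + t28)"
    by (simp add: skew_sum3 x expand)
  have e3: "app f3 ?X = t1"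
    by (simp add: x expand)
  have e4: "app f1 [(2, app V.G3 ?X)] = scal L' 14 t31 + scal L' 6 t33 + scal L' 6 t34 + t41 + t41 + t43 + t43 - (t32 + t32) - scal L' 10 t35 - (t36 + t36) - scal L' 32 t37 - scal L' 16 t38 - (t39 + t39) - (t40 + t40) - (t42 + t42) - scal L' 10 t44"
    by (simp add: app_f1_G3[OF x] x expand)
  have e5: "app W.G3 ?Y = scal L' 14 t45 + scal L' 6 t47 + scal L' 6 t48 + t55 + t55 + t57 + t57 - (t46 + t46) - scal L' 10 t49 - (t50 + t50) - scal L' 32 t51 - scal L' 16 t52 - (t53 + t53) - (t54 + t54) - (t56 + t56) - scal L' 10 t58"
    by (simp add: W.app_G3 x expand)
  have e6: "app ?R ?X = t8 + t9 + t18 + t61 + t63 - t7 - t10 - t16 - t59 - t60 - t62 - t64"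
    by (simp add: x expand)
  have r1: "app (diff L') [(3, app u [(1, app V.g2 [(0, a), (0, b)]), (0, c)])] = t7 + t37 + t62 - t65 - t66 - t67"
    by (simp add: x expand)
  have r2: "app W.defect_h [(0, app f1 [(0, a)]), (0, app n2 [(0, app f1 [(0, c)]), (0, app f1 [(0, b)])])] = t56 + t68"
    by (simp add: x expand)
  have r3: "app W.defect_m2 [(0, app f1 [(0, a)]), (2, app u [(0, b), (0, c)])] = t69 - (t61 + t61) - t70"
    by (simp add: x expand)
  have r4: "app u [(0, app V.defect_m2 [(0, b), (0, c)]), (0, a)] = t23 - t27 - (t71 + t71)"
    by (simp add: x expand)
  have r5: "app u [(0, c), (0, app V.defect_m2 [(0, a), (0, b)])] = t20 - t28 - (t72 + t72)"
    by (simp add: x expand)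
  have r6: "app W.defect_h [(0, app f1 [(0, b)]), (0, app n2 [(0, app f1 [(0, a)]), (0, app f1 [(0, c)])])] = t58 + t73"
    by (simp add: x expand)
  have r7: "app defect_f211 [(0, b), (0, app l2 [(0, c), (0, a)])] = t19 + t19 + t74 + t74 - (t24 + t24) - (t75 + t75)"
    by (simp add: x expand)
  have r8: "app (diff L') [(3, app W.h [(0, app f1 [(0, b)]), (1, app f2 [(0, c), (0, a)])])] = t26 + t75 - t21 - t76"
    by (simp add: x expand)
  have r9: "app defect_f31 [(0, a), (0, c), (0, b)] = t32 - t2 - t4 - t46 - (t77 + t77) - (t78 + t78)"
    by (simp add: x expand)
  have r10: "app defect_h2 [(1, app V.g2 [(0, a), (0, b)]), (0, c)] = t65 - (t62 + t62) - t79"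
    by (simp add: x expand)
  have r11: "app f1 [(2, app V.defect_h [(0, c), (0, app l2 [(0, a), (0, b)])])] = t39 + t80"
    by (simp add: x expand)
  have r12: "app defect_f32 [(0, a), (0, b), (0, c)] = t9 + t9 + t18 + t18 + t34 + t69 + t69 + t81 + t81 - t1 - t2 - (t7 + t7) - (t16 + t16) - t48"
    by (simp add: x expand)
  have r13: "app (diff L') [(3, app u [(1, app V.g2 [(0, a), (0, c)]), (0, b)])] = t11 + t38 + t82 - t77 - t83 - t84"
    by (simp add: x expand)
  have r14: "app u [(0, app V.defect_m2 [(0, a), (0, c)]), (0, b)] = t11 - t19 - (t84 + t84)"
    by (simp add: x expand)
  have r15: "app (diff L') [(3, app W.h [(0, app f1 [(0, b)]), (1, app f2 [(0, a), (0, c)])])] = t18 + t85 - t13 - t73"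
    by (simp add: x expand)
  have r16: "app W.defect_h [(0, app f1 [(0, b)]), (0, app f1 [(0, app l2 [(0, a), (0, c)])])] = t85 + t86"
    by (simp add: x expand)
  have r17: "app f1 [(2, app V.h [(0, app V.defect_m2 [(0, b), (0, c)]), (0, a)])] = t41 - t42 - (t87 + t87)"
    by (simp add: x expand)
  have r18: "app W.defect_h [(0, app f1 [(0, b)]), (0, app n2 [(0, app f1 [(0, c)]), (0, app f1 [(0, a)])])] = t54 + t76"
    by (simp add: x expand)
  have r19: "app defect_f32 [(0, c), (0, a), (0, b)] = t14 + t14 + t21 + t21 + t36 + t79 + t79 + t88 + t88 - t4 - t6 - (t12 + t12) - (t19 + t19) - t50"
    by (simp add: x expand)
  have r20: "app defect_f31 [(0, b), (0, c), (0, a)] = t33 - t5 - t6 - t47 - (t70 + t70) - (t89 + t89)"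
    by (simp add: x expand)
  have r21: "app defect_h2 [(0, a), (1, app V.g2 [(0, b), (0, c)])] = t81 - (t63 + t63) - t89"
    by (simp add: x expand)
  have r22: "app W.defect_h [(0, app f1 [(0, c)]), (0, app n2 [(0, app f1 [(0, a)]), (0, app f1 [(0, b)])])] = t53 + t90"
    by (simp add: x expand)
  have r23: "app W.defect_h [(0, app f1 [(0, a)]), (0, app n2 [(0, app f1 [(0, b)]), (0, app f1 [(0, c)])])] = t55 + t91"
    by (simp add: x expand)
  have r24: "app W.defect_m2 [(2, app u [(0, a), (0, b)]), (0, app f1 [(0, c)])] = t92 - (t59 + t59) - t88"
    by (simp add: x expand)
  have r25: "app defect_f211 [(0, app l2 [(0, a), (0, c)]), (0, b)] = t16 + t16 + t44 + t44 - (t11 + t11) - (t86 + t86)"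
    by (simp add: x expand)
  have r26: "app (diff L') [(3, app W.g2 [(2, app u [(0, a), (0, b)]), (0, app f1 [(0, c)])])] = t9 + t51 + t92 - t59 - t66 - t93"
    by (simp add: x expand)
  have r27: "app f1 [(2, app V.defect_h [(0, c), (0, app l2 [(0, b), (0, a)])])] = t43 + t94"
    by (simp add: x expand)
  have r28: "app defect_f31 [(0, a), (0, b), (0, c)] = t31 - t1 - t3 - t45 - (t65 + t65) - (t92 + t92)"
    by (simp add: x expand)
  have r29: "app (diff L') [(3, app W.g2 [(2, app u [(0, a), (0, c)]), (0, app f1 [(0, b)])])] = t13 + t52 + t78 - t83 - t95 - t96"
    by (simp add: x expand)
  have r30: "app defect_f211 [(0, app V.m2 [(0, b), (0, c)]), (0, a)] = t87 + t87 + t98 + t98 - (t71 + t71) - (t97 + t97)"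
    by (simp add: x expand)
  have r31: "app (diff L') [(3, app W.h [(0, app f1 [(0, c)]), (1, app f2 [(0, b), (0, a)])])] = t30 + t99 - t17 - t100"
    by (simp add: x expand)
  have r32: "app W.defect_h [(0, app f1 [(0, c)]), (0, app n2 [(0, app f1 [(0, b)]), (0, app f1 [(0, a)])])] = t57 + t100"
    by (simp add: x expand)
  have r33: "app defect_h2 [(1, app V.g2 [(0, a), (0, c)]), (0, b)] = t77 - (t82 + t82) - t101"
    by (simp add: x expand)
  have r34: "app defect_h2 [(0, b), (1, app V.g2 [(0, a), (0, c)])] = t101 - (t64 + t64) - t77"
    by (simp add: x expand)
  have r35: "app defect_f32 [(0, b), (0, a), (0, c)] = t10 + t10 + t17 + t17 + t35 + t101 + t101 + t102 + t102 - t3 - t5 - (t8 + t8) - (t15 + t15) - t49"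
    by (simp add: x expand)
  have r36: "app W.defect_m2 [(0, app f1 [(0, b)]), (2, app u [(0, a), (0, c)])] = t102 - (t60 + t60) - t78"
    by (simp add: x expand)
  have r37: "app u [(0, app V.defect_m2 [(0, a), (0, b)]), (0, c)] = t7 - t15 - (t67 + t67)"
    by (simp add: x expand)
  have r38: "app W.g2 [(1, app defect_h2 [(0, a), (0, b)]), (0, app f1 [(0, c)])] = t9 - t17 - (t93 + t93)"
    by (simp add: x expand)
  have r39: "app W.defect_m2 [(2, app u [(0, a), (0, c)]), (0, app f1 [(0, b)])] = t78 - (t95 + t95) - t102"
    by (simp add: x expand)
  have r40: "app W.g2 [(1, app defect_h2 [(0, a), (0, c)]), (0, app f1 [(0, b)])] = t13 - t21 - (t96 + t96)"
    by (simp add: x expand)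
  have r41: "app u [(0, a), (0, app V.defect_m2 [(0, b), (0, c)])] = t8 - t12 - (t98 + t98)"
    by (simp add: x expand)
  have r42: "app (diff L') [(3, app W.h [(0, app f1 [(0, c)]), (1, app f2 [(0, a), (0, b)])])] = t22 + t103 - t9 - t90"
    by (simp add: x expand)
  have r43: "app W.h [(0, app f1 [(0, c)]), (0, app f1 [(0, app V.defect_m2 [(0, a), (0, b)])])] = t103 - t99 - (t104 + t104)"
    by (simp add: x expand)
  have r44: "app (diff L') [(3, app W.h [(0, app f1 [(0, a)]), (1, app f2 [(0, b), (0, c)])])] = t10 + t105 - t25 - t91"
    by (simp add: x expand)
  have r45: "app (diff L') [(3, app W.h [(0, app f1 [(0, a)]), (1, app f2 [(0, c), (0, b)])])] = t14 + t106 - t29 - t68"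
    by (simp add: x expand)
  have r46: "app W.defect_h [(0, app f1 [(0, a)]), (0, app f1 [(0, app l2 [(0, c), (0, b)])])] = t106 + t107"
    by (simp add: x expand)
  have r47: "app W.h [(0, app f1 [(0, app V.defect_m2 [(0, b), (0, c)])]), (0, app f1 [(0, a)])] = t108 - (t97 + t97) - t107"
    by (simp add: x expand)
  have r48: "app W.defect_h [(0, app f1 [(0, a)]), (0, app f1 [(0, app l2 [(0, b), (0, c)])])] = t105 + t108"
    by (simp add: x expand)
  have r49: "app f1 [(2, app V.defect_h [(0, b), (0, app l2 [(0, c), (0, a)])])] = t40 + t74"
    by (simp add: x expand)
  have r50: "app defect_f211 [(0, c), (0, app V.m2 [(0, a), (0, b)])] = t67 + t67 + t109 + t109 - (t72 + t72) - (t104 + t104)"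
    by (simp add: x expand)
  have r51: "app f1 [(2, app V.h [(0, c), (0, app V.defect_m2 [(0, a), (0, b)])])] = t80 - t94 - (t109 + t109)"
    by (simp add: x expand)
  \<comment> \<open>The multiplicities solve the linear system formed by the preceding expansions.
    Each added value is zero by a hypothesis or because its d is taken in degree 3.\<close>
  have "scal L' 4 (app (skew_sum f3) ?X) - app (skew_sum ?H) ?X - scal L' 24 (app f3 ?X)
      + app f1 [(2, app V.G3 ?X)] - app W.G3 ?Y + scal L' 24 (app ?R ?X) = 0
      - scal L' 32 (app (diff L') [(3, app u [(1, app V.g2 [(0, a), (0, b)]), (0, c)])])
      + scal L' 2 (app W.defect_h [(0, app f1 [(0, a)]), (0, app n2 [(0, app f1 [(0, c)]), (0, app f1 [(0, b)])])])
      - scal L' 12 (app W.defect_m2 [(0, app f1 [(0, a)]), (2, app u [(0, b), (0, c)])])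
      - scal L' 2 (app u [(0, app V.defect_m2 [(0, b), (0, c)]), (0, a)])
      - scal L' 2 (app u [(0, c), (0, app V.defect_m2 [(0, a), (0, b)])])
      + scal L' 10 (app W.defect_h [(0, app f1 [(0, b)]), (0, app n2 [(0, app f1 [(0, a)]), (0, app f1 [(0, c)])])])
      + app defect_f211 [(0, b), (0, app l2 [(0, c), (0, a)])]
      + scal L' 2 (app (diff L') [(3, app W.h [(0, app f1 [(0, b)]), (1, app f2 [(0, c), (0, a)])])])
      - scal L' 2 (app defect_f31 [(0, a), (0, c), (0, b)])
      - scal L' 4 (app defect_h2 [(1, app V.g2 [(0, a), (0, b)]), (0, c)])
      - scal L' 2 (app f1 [(2, app V.defect_h [(0, c), (0, app l2 [(0, a), (0, b)])])])
      + scal L' 6 (app defect_f32 [(0, a), (0, b), (0, c)])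
      - scal L' 16 (app (diff L') [(3, app u [(1, app V.g2 [(0, a), (0, c)]), (0, b)])])
      + scal L' 8 (app u [(0, app V.defect_m2 [(0, a), (0, c)]), (0, b)])
      + scal L' 10 (app (diff L') [(3, app W.h [(0, app f1 [(0, b)]), (1, app f2 [(0, a), (0, c)])])])
      - scal L' 10 (app W.defect_h [(0, app f1 [(0, b)]), (0, app f1 [(0, app l2 [(0, a), (0, c)])])])
      + scal L' 2 (app f1 [(2, app V.h [(0, app V.defect_m2 [(0, b), (0, c)]), (0, a)])])
      + scal L' 2 (app W.defect_h [(0, app f1 [(0, b)]), (0, app n2 [(0, app f1 [(0, c)]), (0, app f1 [(0, a)])])])
      - scal L' 2 (app defect_f32 [(0, c), (0, a), (0, b)])
      + scal L' 6 (app defect_f31 [(0, b), (0, c), (0, a)])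
      - scal L' 12 (app defect_h2 [(0, a), (1, app V.g2 [(0, b), (0, c)])])
      + scal L' 2 (app W.defect_h [(0, app f1 [(0, c)]), (0, app n2 [(0, app f1 [(0, a)]), (0, app f1 [(0, b)])])])
      - scal L' 2 (app W.defect_h [(0, app f1 [(0, a)]), (0, app n2 [(0, app f1 [(0, b)]), (0, app f1 [(0, c)])])])
      - scal L' 4 (app W.defect_m2 [(2, app u [(0, a), (0, b)]), (0, app f1 [(0, c)])])
      - scal L' 5 (app defect_f211 [(0, app l2 [(0, a), (0, c)]), (0, b)])
      + scal L' 32 (app (diff L') [(3, app W.g2 [(2, app u [(0, a), (0, b)]), (0, app f1 [(0, c)])])])
      + scal L' 2 (app f1 [(2, app V.defect_h [(0, c), (0, app l2 [(0, b), (0, a)])])])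
      + scal L' 14 (app defect_f31 [(0, a), (0, b), (0, c)])
      + scal L' 16 (app (diff L') [(3, app W.g2 [(2, app u [(0, a), (0, c)]), (0, app f1 [(0, b)])])])
      + scal L' 2 (app defect_f211 [(0, app V.m2 [(0, b), (0, c)]), (0, a)])
      - scal L' 2 (app (diff L') [(3, app W.h [(0, app f1 [(0, c)]), (1, app f2 [(0, b), (0, a)])])])
      - scal L' 2 (app W.defect_h [(0, app f1 [(0, c)]), (0, app n2 [(0, app f1 [(0, b)]), (0, app f1 [(0, a)])])])
      - scal L' 8 (app defect_h2 [(1, app V.g2 [(0, a), (0, c)]), (0, b)])
      + scal L' 12 (app defect_h2 [(0, b), (1, app V.g2 [(0, a), (0, c)])])
      - scal L' 10 (app defect_f32 [(0, b), (0, a), (0, c)])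
      + scal L' 12 (app W.defect_m2 [(0, app f1 [(0, b)]), (2, app u [(0, a), (0, c)])])
      + scal L' 18 (app u [(0, app V.defect_m2 [(0, a), (0, b)]), (0, c)])
      - scal L' 16 (app W.g2 [(1, app defect_h2 [(0, a), (0, b)]), (0, app f1 [(0, c)])])
      - scal L' 8 (app W.defect_m2 [(2, app u [(0, a), (0, c)]), (0, app f1 [(0, b)])])
      - scal L' 8 (app W.g2 [(1, app defect_h2 [(0, a), (0, c)]), (0, app f1 [(0, b)])])
      + scal L' 2 (app u [(0, a), (0, app V.defect_m2 [(0, b), (0, c)])])
      + scal L' 2 (app (diff L') [(3, app W.h [(0, app f1 [(0, c)]), (1, app f2 [(0, a), (0, b)])])])
      - scal L' 2 (app W.h [(0, app f1 [(0, c)]), (0, app f1 [(0, app V.defect_m2 [(0, a), (0, b)])])])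
      - scal L' 2 (app (diff L') [(3, app W.h [(0, app f1 [(0, a)]), (1, app f2 [(0, b), (0, c)])])])
      + scal L' 2 (app (diff L') [(3, app W.h [(0, app f1 [(0, a)]), (1, app f2 [(0, c), (0, b)])])])
      - scal L' 2 (app W.defect_h [(0, app f1 [(0, a)]), (0, app f1 [(0, app l2 [(0, c), (0, b)])])])
      - scal L' 2 (app W.h [(0, app f1 [(0, app V.defect_m2 [(0, b), (0, c)])]), (0, app f1 [(0, a)])])
      + scal L' 2 (app W.defect_h [(0, app f1 [(0, a)]), (0, app f1 [(0, app l2 [(0, b), (0, c)])])])
      - scal L' 2 (app f1 [(2, app V.defect_h [(0, b), (0, app l2 [(0, c), (0, a)])])])
      + scal L' 2 (app defect_f211 [(0, c), (0, app V.m2 [(0, a), (0, b)])])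
      + scal L' 2 (app f1 [(2, app V.h [(0, c), (0, app V.defect_m2 [(0, a), (0, b)])])])"
    unfolding e1 e2 e3 e4 e5 e6 r1 r2 r3 r4 r5 r6 r7 r8 r9 r10 r11 r12 r13 r14 r15 r16 r17 r18 r19 r20 r21 r22 r23 r24 r25 r26 r27 r28 r29 r30 r31 r32 r33 r34 r35 r36 r37 r38 r39 r40 r41 r42 r43 r44 r45 r46 r47 r48 r49 r50 r51
    by (simp add: scal_double[OF W.C] scal_simps(1-6)[OF W.C] algebra_simps)
  also have "\<dots> = 0"
    using x by (simp add: fops diff_above[OF W.C] fdefects_zero scal_simps[OF W.C])
  finally have z: "scal L' 4 (app (skew_sum f3) ?X) - app (skew_sum ?H) ?X - scal L' 24 (app f3 ?X)
      + app f1 [(2, app V.G3 ?X)] - app W.G3 ?Y + scal L' 24 (app ?R ?X) = 0" .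
  \<comment> \<open>The factor 24 clears the denominators of \<open>h3\<close>, \<open>V.g3\<close>
    and \<open>W.g3\<close>, which reduces the claim to \<open>z\<close>.\<close>
  have "scal L' 24 (app ?E ?X) =
      scal L' 24 (app h3 ?X) - scal L' 24 (app f3 ?X) + scal L' 24 (app (f1 \<circ>\<^bsub>1\<^esub> V.g3) ?X)
      - scal L' 24 (app (W.g3 \<circ>\<^sub>\<otimes> [f1, f1, f1]) ?X) + scal L' 24 (app ?R ?X)"
    by (simp only: gmap_simps scal_simps(1,2)[OF W.C] algebra_simps)
  also have "app (f1 \<circ>\<^bsub>1\<^esub> V.g3) ?X = app f1 [(2, app V.g3 ?X)]"
    by (simp add: app_circ value_of_def fops)
  also have "scal L' 24 (app f1 [(2, app V.g3 ?X)]) = app f1 [(2, app V.G3 ?X)]"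
    using x by (simp add: V.g3_scal[symmetric] fops)
  also have "app (W.g3 \<circ>\<^sub>\<otimes> [f1, f1, f1]) ?X = app W.g3 ?Y"
    by (simp add: app_tensor value_of_def fops)
  also have "scal L' 24 (app W.g3 ?Y) = app W.G3 ?Y"
    by (rule W.g3_scal)
  finally have "scal L' 24 (app ?E ?X) = scal L' 24 0"
    unfolding h3_scal z by (simp add: scal_simps[OF W.C])
  then show ?thesis by (rule scal_cancel[OF W.C W.units(2)])
qed

lemma homotopy_defect: "map_eq L (zero_map 3 2) (h3 - f3 + f1 \<circ>\<^bsub>1\<^esub> V.g3 - W.g3 \<circ>\<^sub>\<otimes> [f1, f1, f1] + (W.g2 \<circ>\<^sub>\<otimes> [f1, f2])\<^bsup>cyc [1,2]\<^esup> - W.g2 \<circ>\<^sub>\<otimes> [f1, f2] + W.g2 \<circ>\<^sub>\<otimes> [f2, f1]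
    - W.m2 \<circ>\<^sub>\<otimes> [u, f1] - (W.m2 \<circ>\<^sub>\<otimes> [f1, u])\<^bsup>cyc [1,2]\<^esup> + W.m2 \<circ>\<^sub>\<otimes> [f1, u] - u \<circ>\<^bsub>1\<^esub> l2 + u \<circ>\<^bsub>2\<^esub> l2 - (u \<circ>\<^bsub>2\<^esub> l2)\<^bsup>cyc [1,2]\<^esup>
    - h2 \<circ>\<^bsub>1\<^esub> V.g2 + h2 \<circ>\<^bsub>2\<^esub> V.g2 - (h2 \<circ>\<^bsub>2\<^esub> V.g2)\<^bsup>cyc [1,2]\<^esup>)" (is "map_eq L _ ?rhs")
proof (rule map_eqI[OF V.C W.C, of 3 2])
  show "graded_map L L' 3 2 (zero_map 3 2)" by (rule graded_map_zero[OF W.C])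
  show "graded_map L L' 3 2 ?rhs"
    by (rule hgraded fgraded_intros | simp)+
next
  fix vs :: "(int \<times> 'v) list"
  assume l: "length vs = 3" and h: "homogeneous L vs" "fst ` set vs \<subseteq> {0, 1, 2}" "tdeg vs + 2 \<le> 2"
  then obtain p a q b r c where vs: "vs = [(p, a), (q, b), (r, c)]"
    by (auto simp: length_Suc_conv numeral_eq_Suc)
  have z: "p = 0" "q = 0" "r = 0"
    using degree_0[OF h(2), of "(p, a)"] degree_0[OF h(2), of "(q, b)"] degree_0[OF h(2), of "(r, c)"] h(3)
    by (simp_all add: vs)
  show "app (zero_map 3 2) vs = app ?rhs vs"
    unfolding vs z by (subst homotopy_defect_0) (use h(1) in \<open>simp_all add: vs z zero_map_def\<close>)
qed

text \<open>The skew-symmetrized components close the square formed by \<open>f\<close> and the two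
  isomorphisms, with homotopy \<open>u\<close>. The four-ary equation has degree 2, so the transport
  in degree 0 is enough.\<close>

lemma leibniz3_maps_bar: "leibniz3_maps L L' V.m2 V.m3 V.m4 W.m2 W.m3 W.m4 f1 h2 h3"
proof -
  interpret hom: strict_iso_homotopy L L' l2 l3 l4 V.m2 V.m3 V.m4 V.g2 V.g3 n2 n3 n4 W.m2 W.m3 W.m4 W.g2 W.g3 f1 f2 f3 h2 h3 u
    by (intro strict_iso_homotopy.intro strict_iso_homotopy_axioms.intro V.strict_iso_bar W.strict_iso_bar f hgraded
        bdry_u homotopy_defect)
  have "map_eq L (f1 \<circ>\<^bsub>1\<^esub> V.m4 - W.m4 \<circ>\<^sub>\<otimes> [f1, f1, f1, f1])
      (h2 \<circ>\<^bsub>1\<^esub> V.m3 + h2 \<circ>\<^bsub>2\<^esub> V.m3 - (h2 \<circ>\<^bsub>2\<^esub> V.m3)\<^bsup>cyc [1,2]\<^esup> + (h2 \<circ>\<^bsub>2\<^esub> V.m3)\<^bsup>cyc [1,2,3]\<^esup>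
        - h3 \<circ>\<^bsub>1\<^esub> V.m2 + h3 \<circ>\<^bsub>2\<^esub> V.m2 - (h3 \<circ>\<^bsub>2\<^esub> V.m2)\<^bsup>cyc [1,2]\<^esup>
        - h3 \<circ>\<^bsub>3\<^esub> V.m2 + (h3 \<circ>\<^bsub>3\<^esub> V.m2)\<^bsup>cyc [2,3]\<^esup> - (h3 \<circ>\<^bsub>3\<^esub> V.m2)\<^bsup>cyc [1,3,2]\<^esup>
        + W.m2 \<circ>\<^sub>\<otimes> [h3, f1] + W.m2 \<circ>\<^sub>\<otimes> [f1, h3] - (W.m2 \<circ>\<^sub>\<otimes> [f1, h3])\<^bsup>cyc [1,2]\<^esup> + (W.m2 \<circ>\<^sub>\<otimes> [f1, h3])\<^bsup>cyc [1,2,3]\<^esup>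
        - W.m2 \<circ>\<^sub>\<otimes> [h2, h2] + (W.m2 \<circ>\<^sub>\<otimes> [h2, h2])\<^bsup>cyc [2,3]\<^esup> - (W.m2 \<circ>\<^sub>\<otimes> [h2, h2])\<^bsup>cyc [1,3,2]\<^esup>
        + W.m3 \<circ>\<^sub>\<otimes> [h2, f1, f1] - W.m3 \<circ>\<^sub>\<otimes> [f1, h2, f1] + (W.m3 \<circ>\<^sub>\<otimes> [f1, h2, f1])\<^bsup>cyc [1,2]\<^esup>
        + W.m3 \<circ>\<^sub>\<otimes> [f1, f1, h2] - (W.m3 \<circ>\<^sub>\<otimes> [f1, f1, h2])\<^bsup>cyc [2,3]\<^esup> + (W.m3 \<circ>\<^sub>\<otimes> [f1, f1, h2])\<^bsup>cyc [1,3,2]\<^esup>)" (is "map_eq L ?lhs ?rhs")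
  proof (rule map_eqI[OF V.C W.C, of 4 2])
    show "graded_map L L' 4 2 ?lhs"
      by (rule hom.fgraded_intros | simp)+
    show "graded_map L L' 4 2 ?rhs"
      by (rule hom.fgraded_intros | simp)+
  next
    fix vs :: "(int \<times> 'v) list"
    assume l: "length vs = 4" and h: "homogeneous L vs" "fst ` set vs \<subseteq> {0, 1, 2}" "tdeg vs + 2 \<le> 2"
    then obtain p a q b r c t d where vs: "vs = [(p, a), (q, b), (r, c), (t, d)]"
      by (auto simp: length_Suc_conv numeral_eq_Suc)
    have z: "p = 0" "q = 0" "r = 0" "t = 0"
      using degree_0[OF h(2), of "(p, a)"] degree_0[OF h(2), of "(q, b)"] degree_0[OF h(2), of "(r, c)"]
        degree_0[OF h(2), of "(t, d)"] h(3) by (simp_all add: vs)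
    show "app ?lhs vs =
        app ?rhs vs"
      unfolding vs z by (rule hom.morphism4_transport) (use h(1) in \<open>simp_all add: vs z\<close>)
  qed
  then show ?thesis
    unfolding leibniz3_maps_def using fgraded(1) hgraded feqs[THEN conjunct1] hom.bdry_h2 hom.bdry_h3 by blast
qed

lemma bar_maps_skew: "skew_symmetric L f1" "skew_symmetric L h2" "skew_symmetric L h3"
proof -
  show "skew_symmetric L f1" by (rule skew_symmetric1) (simp add: fops)
  show "skew_symmetric L h2" unfolding h2_def
    by (rule skew_symmetric_smult W.C skew_symmetric_skew_sum[OF V.C W.C, of 2 1] fgraded_intros | simp)+
  show "skew_symmetric L h3" unfolding h3_def
    by (rule skew_symmetric_add skew_symmetric_smult W.C skew_symmetric_skew_sum[OF V.C W.C, of 3 2] fgraded_intros | simp add: fops)+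
qed

end

section \<open>From explicit operations back to records\<close>

lemma leibniz3_algebra_iff: "leibniz3_algebra L \<longleftrightarrow> leibniz3 L (lam2 L) (lam3 L) (lam4 L)"
  unfolding leibniz3_algebra_def leibniz3_def Let_def ..

lemma leibniz3_morphism_iff:
  "leibniz3_morphism L L' f1 f2 f3 \<longleftrightarrow> leibniz3_algebra L \<and> leibniz3_algebra L' \<and>
    leibniz3_maps L L' (lam2 L) (lam3 L) (lam4 L) (lam2 L') (lam3 L') (lam4 L') f1 f2 f3"
  unfolding leibniz3_morphism_def leibniz3_maps_def Let_def ..

lemma weak_lie3_algebra_ops:
  assumes "(2::'k::comm_ring_1) dvd 1" "(3::'k) dvd 1"
    and L: "weak_lie3_algebra (L :: ('k, 'v::ab_group_add, 'a) weak_lie3_scheme)"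
  shows "weak_lie3_ops L (lam2 L) (lam3 L) (lam4 L) (lam21 L) (lam211 L) (lam31 L) (lam32 L)"
proof -
  note L' = L[unfolded weak_lie3_algebra_def Let_def leibniz3_algebra_iff]
  show ?thesis
    unfolding weak_lie3_ops_def by (simp only: L' assms(1,2) simp_thms)
qed

text \<open>The skew-symmetrization is a record of another type over the same complex. The
  predicates depend on the complex only through scalars, components and differential, hence carry
  over.\<close>

context
  fixes K :: "('k::comm_ring_1, 'v::ab_group_add, 'a) cplx_scheme" and L :: "('k, 'v, 'b) cplx_scheme"
  assumes same: "scal K = scal L" "comp K = comp L" "diff K = diff L"
begin

lemma skew_symmetric_cong: "skew_symmetric K \<mu> \<longleftrightarrow> skew_symmetric L \<mu>"
  by (simp only: skew_symmetric_def map_eq_def homogeneous_def same)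

lemma leibniz3_cong: "leibniz3 K l2 l3 l4 \<longleftrightarrow> leibniz3 L l2 l3 l4"
  by (simp only: leibniz3_def three_term_complex_def graded_map_def map_eq_def homogeneous_def bdry_def same)

lemma leibniz3_maps_cong:
  fixes K' :: "('k, 'w::ab_group_add, 'c) cplx_scheme" and L' :: "('k, 'w, 'd) cplx_scheme"
  assumes "scal K' = scal L'" "comp K' = comp L'" "diff K' = diff L'"
  shows "leibniz3_maps K K' l2 l3 l4 m2 m3 m4 f1 f2 f3 \<longleftrightarrow> leibniz3_maps L L' l2 l3 l4 m2 m3 m4 f1 f2 f3"
  by (simp only: leibniz3_maps_def graded_map_def map_eq_def homogeneous_def bdry_def same assms)

end

lemma skew_symmetrization_simps:
  "scal (skew_symmetrization L) = scal L" "comp (skew_symmetrization L) = comp L" "diff (skew_symmetrization L) = diff L"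
  by (simp_all add: skew_symmetrization_def Let_def)

lemma lam_skew_symmetrization:
  assumes "weak_lie3_ops L (lam2 L) (lam3 L) (lam4 L) (lam21 L) (lam211 L) (lam31 L) (lam32 L)"
  shows "lam2 (skew_symmetrization L) = weak_lie3_ops.m2 L (lam2 L)"
    "lam3 (skew_symmetrization L) = weak_lie3_ops.m3 L (lam2 L) (lam3 L) (lam21 L)"
    "lam4 (skew_symmetrization L) = weak_lie3_ops.m4 L (lam2 L) (lam3 L) (lam4 L) (lam21 L) (lam31 L) (lam32 L)"
  by (simp_all only: skew_symmetrization_def Let_def leibniz3.simps
      weak_lie3_ops.m2_def[OF assms] weak_lie3_ops.m3_def[OF assms] weak_lie3_ops.m4_def[OF assms])

lemma lie3_algebra_skew_symmetrization:
  assumes "weak_lie3_ops L (lam2 L) (lam3 L) (lam4 L) (lam21 L) (lam211 L) (lam31 L) (lam32 L)"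
  shows "lie3_algebra (skew_symmetrization L)"
  unfolding lie3_algebra_def leibniz3_algebra_iff lam_skew_symmetrization[OF assms]
    leibniz3_cong[OF skew_symmetrization_simps] skew_symmetric_cong[OF skew_symmetrization_simps]
  using weak_lie3_ops.leibniz3_bar[OF assms] weak_lie3_ops.bar_skew[OF assms] weak_lie3_ops.m4_skew[OF assms]
  by blast

theorem lemma4p3:
  fixes L :: "('k::comm_ring_1, 'v::ab_group_add) weak_lie3"
    and L' :: "('k, 'w::ab_group_add) weak_lie3"
    and f1 f2 f21 f3 :: "('v, 'w) gmap"
  assumes two_unit: "(2::'k) dvd 1" and three_unit: "(3::'k) dvd 1"
    and f: "weak_lie3_morphism L L' f1 f2 f21 f3"
  shows "lie3_morphism (skew_symmetrization L) (skew_symmetrization L')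
    f1
    (smult_map L' (unit_inv 2) (skew_sum f2))
    (smult_map L' (unit_inv 6) (skew_sum f3)
     - smult_map L' (unit_inv 24) (skew_sum
         (f21 \<circ>\<^bsub>1\<^esub> lam2 L + f21 \<circ>\<^bsub>2\<^esub> lam2 L
          - lam21 L' \<circ>\<^sub>\<otimes> [f2, f1] - lam21 L' \<circ>\<^sub>\<otimes> [f1, f2])))"
proof -
  note f' = f[unfolded weak_lie3_morphism_def Let_def]
  have V: "weak_lie3_ops L (lam2 L) (lam3 L) (lam4 L) (lam21 L) (lam211 L) (lam31 L) (lam32 L)"
    and W: "weak_lie3_ops L' (lam2 L') (lam3 L') (lam4 L') (lam21 L') (lam211 L') (lam31 L') (lam32 L')"
    using f' by (blast intro: weak_lie3_algebra_ops[OF two_unit three_unit])+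
  have maps: "leibniz3_maps L L' (lam2 L) (lam3 L) (lam4 L) (lam2 L') (lam3 L') (lam4 L') f1 f2 f3"
    using f' unfolding leibniz3_morphism_iff by blast
  have "weak_lie3_maps_axioms L L' (lam2 L) (lam3 L) (lam4 L) (lam21 L) (lam211 L) (lam31 L) (lam32 L)
      (lam2 L') (lam3 L') (lam4 L') (lam21 L') (lam211 L') (lam31 L') (lam32 L') f1 f2 f3 f21"
    unfolding weak_lie3_maps_axioms_def by (simp only: f' maps simp_thms)
  with V W interpret weak_lie3_maps L L' "lam2 L" "lam3 L" "lam4 L" "lam21 L" "lam211 L" "lam31 L" "lam32 L"
      "lam2 L'" "lam3 L'" "lam4 L'" "lam21 L'" "lam211 L'" "lam31 L'" "lam32 L'" f1 f2 f3 f21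
    by (rule weak_lie3_maps.intro)
  have L: "lie3_algebra (skew_symmetrization L)" "lie3_algebra (skew_symmetrization L')"
    by (intro lie3_algebra_skew_symmetrization V W)+
  then have "leibniz3_algebra (skew_symmetrization L)" "leibniz3_algebra (skew_symmetrization L')"
    unfolding lie3_algebra_def by blast+
  \<comment> \<open>The congruence rules replace the skew-symmetrizations by the original complexes,
    over which the morphism equations and the skew-symmetry have been proved.\<close>
  with L show ?thesis
    unfolding lie3_morphism_def leibniz3_morphism_iff lam_skew_symmetrization[OF V] lam_skew_symmetrization[OF W]
      leibniz3_maps_cong[OF skew_symmetrization_simps skew_symmetrization_simps]
      skew_symmetric_cong[OF skew_symmetrization_simps] h2_def[symmetric] h3_def[symmetric]
    using leibniz3_maps_bar bar_maps_skew by blast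
qed

end
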